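(* Let $d\ge 1$ and let $\mathcal{L}_1,\mathcal{L}_2\in \mathrm{Mat}_d(\mathbb{Z})$ be irreducible and coprime. Then there are constants $D>0$ and $\sigma>0$ such that, for every finite subset $A$ of $\mathbb{Z}^d$, $$|\mathcal{L}_1 A+\mathcal{L}_2 A|\geq \left(|\det(\mathcal{L}_1)|^{1/d}+|\det(\mathcal{L}_2)|^{1/d}\right)^d|A|-D|A|^{1-\sigma}.$$ Moreover, the constants $D,\sigma$ can be chosen depending only on $d$, $|\det\mathcal{L}_1|$ and $|\det\mathcal{L}_2|$.
   Context: For a matrix $\mathcal{L}$ and a set $A$, $\mathcal{L}A=\{\mathcal{L}a: a\in A\}$, and $X+Y=\{x+y:x\in X,y\in Y\}$. Matrices $\mathcal{L}_1,\ldots,\mathcal{L}_k\in\mathrm{Mat}_d(\mathbb{Z})$ are called irreducible if there are no non-trivial subspaces $U,V$ of $\mathbb{Q}^d$ of the same dimension such that $\mathcal{L}_iU\subseteq V$ for all $i$ (non-trivial meaning neither $\{0\}$ nor $\mathbb{Q}^d$). They are called coprime if there are no $\mathcal{P},\mathcal{Q}\in \mathrm{GL}_d(\mathbb{Q})$ with $0<|\det(\mathcal{P})\det(\mathcal{Q})|<1$ such that $\mathcal{P}\mathcal{L}_i\mathcal{Q}\in\mathrm{Mat}_d(\mathbb{Z})$ for all $i$. *)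

theory Defs
  imports "HOL-Analysis.Analysis"
begin

definition rat_mat :: "int^'n^'n \<Rightarrow> rat^'n^'n" where
  "rat_mat L = (\<chi> i j. of_int (L $ i $ j))"

definition irreducible_pair :: "int^'n^'n \<Rightarrow> int^'n^'n \<Rightarrow> bool" where
  "irreducible_pair L1 L2 \<longleftrightarrow>
     \<not> (\<exists>U V :: (rat^'n) set.
          vec.subspace U \<and> vec.subspace V \<and>
          U \<noteq> {0} \<and> U \<noteq> UNIV \<and> V \<noteq> {0} \<and> V \<noteq> UNIV \<and>
          vec.dim U = vec.dim V \<and>
          (\<lambda>u. rat_mat L1 *v u) ` U \<subseteq> V \<and> (\<lambda>u. rat_mat L2 *v u) ` U \<subseteq> V)"

definition int_matrix :: "rat^'n^'n \<Rightarrow> bool" where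
  "int_matrix M \<longleftrightarrow> (\<forall>i j. M $ i $ j \<in> \<int>)"

definition coprime_pair :: "int^'n^'n \<Rightarrow> int^'n^'n \<Rightarrow> bool" where
  "coprime_pair L1 L2 \<longleftrightarrow>
     \<not> (\<exists>P Q :: rat^'n^'n.
          det P \<noteq> 0 \<and> det Q \<noteq> 0 \<and>
          0 < \<bar>det P * det Q\<bar> \<and> \<bar>det P * det Q\<bar> < 1 \<and>
          int_matrix (P ** rat_mat L1 ** Q) \<and> int_matrix (P ** rat_mat L2 ** Q))"

definition lin_sumset :: "int^'n^'n \<Rightarrow> int^'n^'n \<Rightarrow> (int^'n) set \<Rightarrow> (int^'n) set" where
  "lin_sumset L1 L2 A = {L1 *v a + L2 *v b | a b. a \<in> A \<and> b \<in> A}"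

end

theory Submission
  imports Defs "HOL-Library.Set_Algebras"
begin


text \<open>
  Write \<open>f\<close>, \<open>g\<close> for the two maps, \<open>s A\<close> for the size of the sumset of \<open>f A\<close> and \<open>g A\<close>,
  \<open>a\<close>, \<open>b\<close> for the absolute determinants and \<open>K\<close> for the leading constant.
  Coprimality says that for suitable (tight) lattices \<open>G\<close> the sublattices
  \<open>T\<^sub>1 = {x \<in> G. f x \<in> g G}\<close> and \<open>T\<^sub>2 = {x \<in> G. g x \<in> f G}\<close> have index \<open>b\<close> and \<open>a\<close>, and that their
  intersection is tight again. Splitting \<open>A\<close> along cosets of \<open>T\<^sub>1\<close> and \<open>T\<^sub>2\<close> splits the sumset into
  disjoint cells, so \<open>s\<close> is superadditive and one can induct on \<open>card A\<close>.
  If \<open>A\<close> violates the bound, nothing may be gained in any cell over boundedly many levels; shift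
  invariance of the occupied cosets then shows that \<open>A\<close> meets all cosets of the finer lattices, and a
  density increment shows that it is equidistributed among them. On the other hand irreducibility forces
  \<open>A\<close> to spread out in all rational directions, and a discrete Brunn-Minkowski inequality gives
  \<open>s A \<ge> K * card A\<close> up to a power saving and an error quadratic in the deviation from
  equidistribution. To absorb that error the induction hypothesis carries a gain linear in the deviation.
\<close>

text \<open>For the weight \<open>l\<close> = \<alpha> / (\<alpha> + \<beta>), where \<alpha>,
  \<beta> are the d-th roots of \<open>a\<close>, \<open>b\<close>, weighted AM-GM turns
  Brunn-Minkowski into a bound by K |V|^l |U|^(1-l), with sizes measured against their expected
  values. This is compared cell by cell, and a geometric mean lies below the arithmetic mean only by
  the square of the difference. The carried gain can be handed down because the second-level
  deviations of a set are the first-level deviations of its children. The loss |A|^(1-\<sigma>) is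
  concave: splitting \<open>A\<close> into boundedly many classes multiplies the total loss by a
  factor that tends to 1 with \<sigma>, so a minimal counterexample shows almost no excess in any
  cell. The set may sit in a coset of a small tight lattice, so all levels start from a minimal
  tight lattice around \<open>A\<close> and not from the full one. If one determinant vanishes, one
  of the two index computations breaks down and the leading constant is the other determinant; a
  one-sided argument that splits by columns only covers this case.\<close>

section \<open>Discrete Prekopa-Leindler and Brunn-Minkowski inequalities\<close>

lemma finite_obtain_max:
  fixes h :: "'i \<Rightarrow> 'b::linorder"
  assumes "finite S" "S \<noteq> {}"
  obtains x where "x \<in> S" "\<And>y. y \<in> S \<Longrightarrow> h y \<le> h x"
proof -
  have "Max (h ` S) \<in> h ` S" using assms by (intro Max_in) auto
  then obtain x where x: "x \<in> S" "Max (h ` S) = h x" by auto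
  have "h y \<le> h x" if "y \<in> S" for y unfolding x(2)[symmetric] using assms(1) that by simp
  then show thesis using x(1) that by blast
qed

text \<open>The translate of \<open>X\<close> by the least element of \<open>Y\<close> and the
  translate of \<open>Y\<close> by the greatest element of \<open>X\<close> lie in the sumset and
  can share only one corner, since the first ends where the second begins.\<close>

lemma card_int_set_plus_ge:
  fixes X Y :: "int set"
  assumes "finite X" "finite Y" "X \<noteq> {}" "Y \<noteq> {}"
  shows "card X + card Y \<le> card (X + Y) + 1"
proof -
  let ?P = "(\<lambda>x. x + Min Y) ` X" and ?Q = "(\<lambda>y. Max X + y) ` Y"
  have cP: "card ?P = card X" and cQ: "card ?Q = card Y"
    by (auto intro!: card_image simp: inj_on_def)
  have sub: "?P \<union> ?Q \<subseteq> X + Y"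
    using assms by (auto simp: set_plus_def intro: Min_in Max_in)
  have "?P \<inter> ?Q \<subseteq> {Max X + Min Y}"
  proof
    fix z assume "z \<in> ?P \<inter> ?Q"
    then obtain x y where "x \<in> X" "y \<in> Y" "z = x + Min Y" "z = Max X + y" by auto
    moreover from this have "x \<le> Max X" "Min Y \<le> y" using assms by auto
    ultimately show "z \<in> {Max X + Min Y}" by auto
  qed
  then have "card (?P \<inter> ?Q) \<le> 1" by (metis card_mono card.empty card_insert_disjoint empty_iff finite.emptyI finite.insertI One_nat_def)
  moreover have "card ?P + card ?Q = card (?P \<union> ?Q) + card (?P \<inter> ?Q)"
    using assms by (intro card_Un_Int) auto
  moreover have "card (?P \<union> ?Q) \<le> card (X + Y)"
    using sub assms by (intro card_mono finite_set_plus) auto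
  ultimately show ?thesis using cP cQ by linarith
qed

lemma has_integral_threshold:
  fixes c :: real
  assumes "0 \<le> c"
  shows "((\<lambda>t. if t \<le> c then 1 else 0) has_integral (min c 1)) {0..1::real}"
proof -
  have "((\<lambda>t. 1::real) has_integral (min c 1)) {0..min c 1}"
    using has_integral_const_real[of "1::real" 0 "min c 1"] assms by simp
  moreover have "{0..min c 1} = {0..1} \<inter> {t. t \<le> c}" by auto
  ultimately show ?thesis
    using has_integral_restrict_Int[of "{t. t \<le> c}" "\<lambda>t. 1::real" "min c 1" "{0..1}"]
    by (simp add: Int_commute)
qed

lemma has_integral_card_threshold:
  fixes h :: "'i \<Rightarrow> real"
  assumes "finite I" "\<And>i. i \<in> I \<Longrightarrow> 0 \<le> h i"
  shows "((\<lambda>t. real (card {i \<in> I. t \<le> h i})) has_integral (\<Sum>i\<in>I. min (h i) 1)) {0..1::real}"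
proof -
  have eq: "real (card {i \<in> I. t \<le> h i}) = (\<Sum>i\<in>I. if t \<le> h i then 1 else 0)" for t
    using assms(1) by (simp add: sum.If_cases Int_def)
  show ?thesis
    unfolding eq by (rule has_integral_sum) (use assms has_integral_threshold in auto)
qed

text \<open>A weight in [0,1] is the integral over t of the indicator of its level sets, so the
  inequality between level sets integrates to one between sums. Values of \<open>h\<close> may
  exceed 1; they are cut off at 1, and the cut-off sum is at most the true one.\<close>

lemma layer_cake_sum_le:
  fixes p q h :: "'i \<Rightarrow> real"
  assumes fin: "finite I" "finite J" "finite W"
    and p: "\<And>i. i \<in> I \<Longrightarrow> 0 \<le> p i \<and> p i \<le> 1" and q: "\<And>i. i \<in> J \<Longrightarrow> 0 \<le> q i \<and> q i \<le> 1"
    and h: "\<And>i. i \<in> W \<Longrightarrow> 0 \<le> h i"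
    and lev: "\<And>t. 0 < t \<Longrightarrow> t \<le> 1 \<Longrightarrow>
      card {i \<in> I. t \<le> p i} + card {i \<in> J. t \<le> q i} \<le> card {i \<in> W. t \<le> h i} + 1"
  shows "sum p I + sum q J \<le> sum h W + 1"
proof -
  have 1: "((\<lambda>t. real (card {i \<in> I. t \<le> p i}) + real (card {i \<in> J. t \<le> q i}))
      has_integral ((\<Sum>i\<in>I. min (p i) 1) + (\<Sum>i\<in>J. min (q i) 1))) {0..1}"
    using p q fin by (intro has_integral_add has_integral_card_threshold) auto
  have 2: "((\<lambda>t. real (card {i \<in> W. t \<le> h i}) + 1)
      has_integral ((\<Sum>i\<in>W. min (h i) 1) + 1)) {0..1}"
    using h fin has_integral_const_real[of "1::real" 0 1]
    by (intro has_integral_add has_integral_card_threshold) auto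
  have "(\<Sum>i\<in>I. min (p i) 1) + (\<Sum>i\<in>J. min (q i) 1) \<le> (\<Sum>i\<in>W. min (h i) 1) + 1"
  \<comment> \<open>At t = 0 the assumption \<open>lev\<close> says nothing. The integrand is
    replaced by 0 at this single point, which leaves its integral unchanged.\<close>
  proof (rule has_integral_spike_finite[of "{0}", OF _ _ 1, THEN has_integral_le, OF _ _ 2])
    show "finite {0::real}" by simp
    show "(if x = 0 then 0 else real (card {i \<in> I. x \<le> p i}) + real (card {i \<in> J. x \<le> q i}))
       = real (card {i \<in> I. x \<le> p i}) + real (card {i \<in> J. x \<le> q i})" if "x \<in> {0..1} - {0}" for x
      using that by auto
    show "(if x = 0 then 0 else real (card {i \<in> I. x \<le> p i}) + real (card {i \<in> J. x \<le> q i}))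
        \<le> real (card {i \<in> W. x \<le> h i}) + 1" if "x \<in> {0..1}" for x
      using lev[of x] that by (auto simp flip: of_nat_add of_nat_Suc)
  qed
  moreover have "(\<Sum>i\<in>I. min (p i) 1) = sum p I" "(\<Sum>i\<in>J. min (q i) 1) = sum q J"
    using p q by (auto intro!: sum.cong)
  moreover have "(\<Sum>i\<in>W. min (h i) 1) \<le> sum h W" by (intro sum_mono) auto
  ultimately show ?thesis by linarith
qed

text \<open>The least value of (S + T) / (S^l T^(1-l)) over positive S and T, attained for S : T = l
  : (1-l). Its d-th power becomes the Brunn-Minkowski constant in dimension d.\<close>

definition bm_const :: "real \<Rightarrow> real" where
  "bm_const l = l powr (-l) * (1 - l) powr (-(1 - l))"

lemma bm_const_pos: "0 < l \<Longrightarrow> l < 1 \<Longrightarrow> 0 < bm_const l"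
  by (simp add: bm_const_def)

text \<open>Dividing \<open>p\<close> and \<open>q\<close> by their maxima makes all level sets up
  to height 1 nonempty, so the one-dimensional sumset bound holds at each height. Integrating over
  the heights and applying weighted AM-GM produces \<open>bm_const\<close>. The discreteness error 1
  turns into \<open>c\<close>, which is at most a value of \<open>h\<close> and hence at most
  \<open>B\<close>.\<close>

lemma prekopa_leindler_int:
  fixes p q h :: "int \<Rightarrow> real"
  assumes l: "0 < l" "l < 1"
    and fin: "finite I" "finite J" "finite W" and ne: "I \<noteq> {}" "J \<noteq> {}"
    and p: "\<And>i. i \<in> I \<Longrightarrow> 0 < p i" and q: "\<And>i. i \<in> J \<Longrightarrow> 0 < q i"
    and h: "\<And>w. w \<in> W \<Longrightarrow> 0 \<le> h w" and B: "\<And>w. w \<in> W \<Longrightarrow> h w \<le> B"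
    and W: "I + J \<subseteq> W"
    and le: "\<And>i j. i \<in> I \<Longrightarrow> j \<in> J \<Longrightarrow> p i powr l * q j powr (1 - l) \<le> h (i + j)"
  shows "bm_const l * (sum p I) powr l * (sum q J) powr (1 - l) \<le> sum h W + B"
proof -
  define P where "P = Max (p ` I)"
  define Q where "Q = Max (q ` J)"
  obtain i0 where i0: "i0 \<in> I" "P = p i0"
    using Max_in[OF finite_imageI[OF fin(1)], of p] ne(1) unfolding P_def by auto
  obtain j0 where j0: "j0 \<in> J" "Q = q j0"
    using Max_in[OF finite_imageI[OF fin(2)], of q] ne(2) unfolding Q_def by auto
  have "p i \<le> P" if "i \<in> I" for i unfolding P_def using fin(1) that by simp
  then have P: "0 < P" "\<And>i. i \<in> I \<Longrightarrow> p i \<le> P" using p i0 by simp_all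
  have "q i \<le> Q" if "i \<in> J" for i unfolding Q_def using fin(2) that by simp
  then have Q: "0 < Q" "\<And>i. i \<in> J \<Longrightarrow> q i \<le> Q" using q j0 by simp_all
  define c where "c = P powr l * Q powr (1 - l)"
  have c: "0 < c" using P Q by (simp add: c_def)
  have inW: "i + j \<in> W" if "i \<in> I" "j \<in> J" for i j using W that by (auto simp: set_plus_def)
  have cB: "c \<le> B" using le[OF i0(1) j0(1)] B[OF inW[OF i0(1) j0(1)]] i0 j0 by (simp add: c_def)
  have key: "(\<Sum>i\<in>I. p i / P) + (\<Sum>j\<in>J. q j / Q) \<le> (\<Sum>w\<in>W. h w / c) + 1"
  proof (rule layer_cake_sum_le)
    fix t :: real assume t: "0 < t" "t \<le> 1"
    let ?I = "{i \<in> I. t \<le> p i / P}" and ?J = "{j \<in> J. t \<le> q j / Q}"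
    have neI: "?I \<noteq> {}" "?J \<noteq> {}" using i0 j0 P Q t by auto
    have sub: "?I + ?J \<subseteq> {w \<in> W. t \<le> h w / c}"
    proof
      fix z assume "z \<in> ?I + ?J"
      then obtain i j where ij: "i \<in> I" "t \<le> p i / P" "j \<in> J" "t \<le> q j / Q" "z = i + j"
        by (auto simp: set_plus_def)
      have "t = t powr l * t powr (1 - l)" using t by (simp flip: powr_add)
      also have "\<dots> \<le> (p i / P) powr l * (q j / Q) powr (1 - l)"
        using ij t l by (intro mult_mono powr_mono2) auto
      also have "\<dots> = (p i powr l * q j powr (1 - l)) / c"
        using P Q p[OF ij(1)] q[OF ij(3)] by (simp add: c_def powr_divide)
      also have "\<dots> \<le> h z / c" using le[OF ij(1,3)] c ij(5) by (simp add: divide_right_mono)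
      finally show "z \<in> {w \<in> W. t \<le> h w / c}" using inW ij by auto
    qed
    have "card ?I + card ?J \<le> card (?I + ?J) + 1"
      using fin neI by (intro card_int_set_plus_ge) auto
    also have "card (?I + ?J) \<le> card {w \<in> W. t \<le> h w / c}"
      using sub fin by (intro card_mono) auto
    finally show "card ?I + card ?J \<le> card {w \<in> W. t \<le> h w / c} + 1" by simp
  qed (use fin p q h P Q c in \<open>auto simp: less_imp_le\<close>)
  define S where "S = (\<Sum>i\<in>I. p i / P)"
  define T where "T = (\<Sum>j\<in>J. q j / Q)"
  have S: "S = sum p I / P" and T: "T = sum q J / Q" by (simp_all add: S_def T_def sum_divide_distrib)
  have Ipos: "0 < sum p I" "0 < sum q J" using fin ne p q by (auto intro: sum_pos)
  then have ST: "0 < S" "0 < T" using P Q by (simp_all add: S T)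
  have "(S / l) powr l * (T / (1 - l)) powr (1 - l) \<le> l * (S / l) + (1 - l) * (T / (1 - l))"
    using ST l by (intro Youngs_inequality_0) auto
  also have "\<dots> = S + T" using l by simp
  also have "\<dots> \<le> sum h W / c + 1" using key by (simp add: S_def T_def sum_divide_distrib)
  finally have "c * ((S / l) powr l * (T / (1 - l)) powr (1 - l)) \<le> c * (sum h W / c + 1)"
    using c by (intro mult_left_mono) auto
  also have "\<dots> = sum h W + c" using c by (simp add: field_simps)
  finally have "c * ((S / l) powr l * (T / (1 - l)) powr (1 - l)) \<le> sum h W + B" using cB by linarith
  moreover have "c * ((S / l) powr l * (T / (1 - l)) powr (1 - l))
      = bm_const l * (sum p I) powr l * (sum q J) powr (1 - l)"
  proof -
    define m where "m = 1 - l"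
    have m: "0 < m" using l by (simp add: m_def)
    show ?thesis unfolding bm_const_def c_def S T m_def[symmetric]
      using l m P(1) Q(1) Ipos by (simp add: powr_divide powr_mult powr_minus field_simps)
  qed
  ultimately show ?thesis by simp
qed

definition line :: "int^'n \<Rightarrow> int^'n \<Rightarrow> (int^'n) set" where
  "line v z = {z + n *s v | n. True}"

text \<open>The size of the projection of \<open>Z\<close> along \<open>v\<close>. Such projections
  are the boundary terms that separate the discrete Brunn-Minkowski inequality from the continuous
  one.\<close>

definition lines :: "int^'n \<Rightarrow> (int^'n) set \<Rightarrow> nat" where
  "lines v Z = card (line v ` Z)"

text \<open>The subgroup generated by \<open>u 0\<close> up to \<open>u (k-1)\<close>. Peeling off
  the last generator allows independence to be stated one vector at a time, and slicing to go by the
  last coefficient.\<close>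

primrec lat :: "(nat \<Rightarrow> int^'n) \<Rightarrow> nat \<Rightarrow> (int^'n) set" where
  "lat u 0 = {0}"
| "lat u (Suc k) = {y + n *s u k | y n. y \<in> lat u k}"

lemma lat_zero: "0 \<in> lat u k"
proof (induction k)
  case (Suc k)
  then show ?case by (auto intro!: exI[of _ 0])
qed auto

lemma lat_diff: "x \<in> lat u k \<Longrightarrow> y \<in> lat u k \<Longrightarrow> x - y \<in> lat u k"
proof (induction k arbitrary: x y)
  case (Suc k)
  then obtain x' m y' n where "x = x' + m *s u k" "x' \<in> lat u k" "y = y' + n *s u k" "y' \<in> lat u k"
    by auto
  then show ?case using Suc.IH[of x' y']
    by (auto intro!: exI[of _ "x' - y'"] exI[of _ "m - n"] simp: vector_sub_rdistrib)
qed auto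

lemma lat_add: "x \<in> lat u k \<Longrightarrow> y \<in> lat u k \<Longrightarrow> x + y \<in> lat u k"
  using lat_diff[of x u k "0 - y"] lat_diff[OF lat_zero, of y u k] by simp

lemma lat_generator: fixes u :: "nat \<Rightarrow> int^'n" shows "i < k \<Longrightarrow> n *s u i \<in> lat u k"
proof (induction k)
  case (Suc k)
  show ?case
  proof (cases "i = k")
    case True
    then show ?thesis using lat_zero[of u k] by (auto intro!: exI[of _ "0::int^'n"] exI[of _ n])
  next
    case False
    then have "n *s u i \<in> lat u k" using Suc by simp
    then show ?thesis by simp (metis add.right_neutral vector_smult_lzero)
  qed
qed simp

lemma line_eq_iff: "line v z = line v z' \<longleftrightarrow> (\<exists>n. z' = z + n *s v)"
proof
  assume "line v z = line v z'"
  moreover have "z' \<in> line v z'" by (auto simp: line_def intro!: exI[of _ 0])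
  ultimately show "\<exists>n. z' = z + n *s v" by (auto simp: line_def)
next
  assume "\<exists>n. z' = z + n *s v"
  then obtain n where n: "z' = z + n *s v" by blast
  have "z + m *s v = z' + (m - n) *s v" "z' + m *s v = z + (m + n) *s v" for m
    by (simp_all add: n vector_sub_rdistrib vector_sadd_rdistrib)
  then show "line v z = line v z'" unfolding line_def by blast
qed

lemma lines_mono: "Z \<subseteq> Z' \<Longrightarrow> finite Z' \<Longrightarrow> lines v Z \<le> lines v Z'"
  unfolding lines_def by (intro card_mono) auto

lemma lines_le_card: "finite Z \<Longrightarrow> lines v Z \<le> card Z"
  unfolding lines_def by (rule card_image_le)

lemma sum_card_fibres: "finite Z \<Longrightarrow> (\<Sum>w\<in>c ` Z. card {z \<in> Z. c z = w}) = card Z"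
  using sum.group[of Z "c ` Z" c "\<lambda>_. 1::nat"] by simp

lemma sum_lines_fibres:
  assumes "finite Z" and "\<And>z z'. z \<in> Z \<Longrightarrow> z' \<in> Z \<Longrightarrow> line v z = line v z' \<Longrightarrow> c z = c z'"
  shows "(\<Sum>w\<in>c ` Z. lines v {z \<in> Z. c z = w}) \<le> lines v Z"
proof -
  have "(\<Sum>w\<in>c ` Z. lines v {z \<in> Z. c z = w}) = card (\<Union>w\<in>c ` Z. line v ` {z \<in> Z. c z = w})"
    unfolding lines_def
  proof (rule card_UN_disjoint[symmetric])
    show "\<forall>i\<in>c ` Z. \<forall>j\<in>c ` Z. i \<noteq> j \<longrightarrow>
        line v ` {z \<in> Z. c z = i} \<inter> line v ` {z \<in> Z. c z = j} = {}"
    proof (intro ballI impI equals0I)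
      fix i j L assume ij: "i \<noteq> j" "L \<in> line v ` {z \<in> Z. c z = i} \<inter> line v ` {z \<in> Z. c z = j}"
      then obtain z z' where "z \<in> Z" "z' \<in> Z" "c z = i" "c z' = j" "line v z = line v z'" by auto
      then show False using assms(2)[of z z'] ij(1) by simp
    qed
  qed (use assms(1) in auto)
  also have "\<dots> \<le> lines v Z" unfolding lines_def using assms(1) by (intro card_mono) auto
  finally show ?thesis .
qed

text \<open>Induction on the rank: slice by the coefficient of the last generator, apply the
  statement of smaller rank to pairs of slices, and feed the results into the one-dimensional
  inequality. The new error is the largest slice, and a slice injects into the set of lines in
  direction \<open>u k\<close>.\<close>

lemma brunn_minkowski_lat:
  fixes u :: "nat \<Rightarrow> int^'n"
  assumes l: "0 < l" "l < 1"
    and indep: "\<And>i n. i < k \<Longrightarrow> n *s u i \<in> lat u i \<Longrightarrow> n = 0"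
    and fin: "finite X" "finite Y" and ne: "X \<noteq> {}" "Y \<noteq> {}"
    and cos: "\<And>x x'. x \<in> X \<Longrightarrow> x' \<in> X \<Longrightarrow> x - x' \<in> lat u k"
      "\<And>x x'. x \<in> Y \<Longrightarrow> x' \<in> Y \<Longrightarrow> x - x' \<in> lat u k"
  shows "bm_const l ^ k * real (card X) powr l * real (card Y) powr (1 - l)
    \<le> real (card (X + Y)) + fact (Suc k) * (\<Sum>i<k. real (lines (u i) (X + Y)))"
  using indep fin ne cos
proof (induction k arbitrary: X Y)
  case 0
  then obtain x y where "x \<in> X" "y \<in> Y" by auto
  then have "X = {x}" "Y = {y}" using 0(6,7) by auto
  then show ?case by (simp add: set_plus_def)
next
  case (Suc k)
  note cosX = Suc.prems(6) and cosY = Suc.prems(7) and fin = Suc.prems(2,3)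
  define Z where "Z = X + Y"
  have finZ: "finite Z" using fin by (simp add: Z_def finite_set_plus)
  obtain x0 y0 where x0: "x0 \<in> X" and y0: "y0 \<in> Y" using Suc.prems by auto
  \<comment> \<open>The coefficient of \<open>u k\<close>. By \<open>indep\<close> it is unique on
    \<open>lat u (Suc k)\<close>, the only place where it is evaluated.\<close>
  define c where "c z = (SOME n. z - n *s u k \<in> lat u k)" for z
  have cI: "z - c z *s u k \<in> lat u k" if "z \<in> lat u (Suc k)" for z
  proof -
    obtain y n where "z = y + n *s u k" "y \<in> lat u k" using \<open>z \<in> lat u (Suc k)\<close> by auto
    then have "z - n *s u k \<in> lat u k" by simp
    then show ?thesis unfolding c_def by (rule someI[of "\<lambda>n. z - n *s u k \<in> lat u k"])
  qed
  have cU: "c z = n" if "z - n *s u k \<in> lat u k" for z n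
  proof -
    have "z - c z *s u k \<in> lat u k" unfolding c_def using that by (rule someI[of "\<lambda>n. z - n *s u k \<in> lat u k"])
    from lat_diff[OF this that] have "(n - c z) *s u k \<in> lat u k" by (simp add: vector_sub_rdistrib)
    then have "n - c z = 0" using Suc.prems(1) by (meson lessI)
    then show ?thesis by simp
  qed
  define p where "p n = {x \<in> X. c (x - x0) = n}" for n
  define q where "q n = {y \<in> Y. c (y - y0) = n}" for n
  define r where "r n = {z \<in> Z. c (z - (x0 + y0)) = n}" for n
  define I where "I = (\<lambda>x. c (x - x0)) ` X"
  define J where "J = (\<lambda>y. c (y - y0)) ` Y"
  define W where "W = (\<lambda>z. c (z - (x0 + y0))) ` Z"
  have X1: "x - x0 - c (x - x0) *s u k \<in> lat u k" if "x \<in> X" for x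
    using cI cosX[OF that x0] by simp
  have Y1: "y - y0 - c (y - y0) *s u k \<in> lat u k" if "y \<in> Y" for y
    using cI cosY[OF that y0] by simp
  have cadd: "c (x + y - (x0 + y0)) = c (x - x0) + c (y - y0)" if "x \<in> X" "y \<in> Y" for x y
    by (rule cU) (use lat_add[OF X1[OF that(1)] Y1[OF that(2)]] in \<open>simp add: vector_sadd_rdistrib algebra_simps\<close>)
  have Z1: "z - (x0 + y0) - c (z - (x0 + y0)) *s u k \<in> lat u k" if "z \<in> Z" for z
  proof -
    obtain x y where xy: "x \<in> X" "y \<in> Y" "z = x + y" using \<open>z \<in> Z\<close> by (auto simp: Z_def set_plus_def)
    then have "c (z - (x0 + y0)) = c (x - x0) + c (y - y0)" using cadd by simp
    then show ?thesis using lat_add[OF X1[OF xy(1)] Y1[OF xy(2)]] xy(3)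
      by (simp add: vector_sadd_rdistrib algebra_simps)
  qed
  have pq: "p i + q j \<subseteq> r (i + j)" for i j
    using cadd by (auto simp: p_def q_def r_def Z_def set_plus_def)
  have fib: "z - z' \<in> lat u k" if "z - w - n *s u k \<in> lat u k" "z' - w - n *s u k \<in> lat u k" for z z' w n
    using lat_diff[OF that] by simp
  define F :: real where "F = fact (Suc k)"
  \<comment> \<open>The weight of a slice includes the error terms of its own lines, because these
    stand on the right side of the induction hypothesis for a pair of slices.\<close>
  define h where "h w = real (card (r w)) + F * (\<Sum>i<k. real (lines (u i) (r w)))" for w
  have F1: "1 \<le> F" unfolding F_def by (simp only: fact_ge_1)
  have "bm_const l * (\<Sum>n\<in>I. bm_const l ^ k * real (card (p n))) powr l
      * (\<Sum>n\<in>J. bm_const l ^ k * real (card (q n))) powr (1 - l)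
     \<le> sum h W + (1 + k * F) * real (lines (u k) Z)"
  proof (rule prekopa_leindler_int[OF l])
    show "finite I" "finite J" "finite W" using fin finZ by (simp_all add: I_def J_def W_def)
    show "I \<noteq> {}" "J \<noteq> {}" using Suc.prems by (auto simp: I_def J_def)
    show "0 < bm_const l ^ k * real (card (p i))" if "i \<in> I" for i
      using that fin bm_const_pos[OF l] by (auto simp: I_def p_def card_gt_0_iff intro!: mult_pos_pos)
    show "0 < bm_const l ^ k * real (card (q i))" if "i \<in> J" for i
      using that fin bm_const_pos[OF l] by (auto simp: J_def q_def card_gt_0_iff intro!: mult_pos_pos)
    show "0 \<le> h w" for w using F1 by (auto simp: h_def intro!: add_nonneg_nonneg mult_nonneg_nonneg sum_nonneg)
    show "h w \<le> (1 + k * F) * real (lines (u k) Z)" for w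
    proof -
      have fr: "finite (r w)" using finZ by (simp add: r_def)
      \<comment> \<open>Two points of one slice on a common line differ by a multiple of
        \<open>u k\<close> that lies in \<open>lat u k\<close>, hence by 0.\<close>
      have "inj_on (line (u k)) (r w)"
      proof (rule inj_onI)
        fix z z' assume z: "z \<in> r w" "z' \<in> r w" "line (u k) z = line (u k) z'"
        then obtain n where n: "z' = z + n *s u k" by (auto simp: line_eq_iff)
        have "z - z' \<in> lat u k" using fib[of z "x0 + y0" w z'] Z1[of z] Z1[of z'] z by (auto simp: r_def)
        then have "(-n) *s u k \<in> lat u k" by (simp add: n vector_smult_lneg)
        then have "n = 0" using Suc.prems(1)[of k "-n"] by simp
        then show "z = z'" using n by simp
      qed
      then have "card (r w) = lines (u k) (r w)" by (simp add: lines_def card_image)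
      also have "\<dots> \<le> lines (u k) Z" using finZ by (intro lines_mono) (auto simp: r_def)
      finally have le: "card (r w) \<le> lines (u k) Z" .
      have "(\<Sum>i<k. real (lines (u i) (r w))) \<le> (\<Sum>i<k. real (card (r w)))"
        by (intro sum_mono) (simp add: lines_le_card[OF fr])
      then have "F * (\<Sum>i<k. real (lines (u i) (r w))) \<le> F * (k * real (card (r w)))"
        using F1 by (intro mult_left_mono) auto
      then have "h w \<le> (1 + k * F) * real (card (r w))" by (simp add: h_def algebra_simps)
      also have "\<dots> \<le> (1 + k * F) * real (lines (u k) Z)"
        using le F1 by (intro mult_left_mono) auto
      finally show ?thesis .
    qed
    show "I + J \<subseteq> W"
    proof
      fix z assume "z \<in> I + J"
      then obtain x y where xy: "x \<in> X" "y \<in> Y" "z = c (x - x0) + c (y - y0)"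
        by (auto simp: I_def J_def set_plus_def)
      then have "z = c (x + y - (x0 + y0))" "x + y \<in> Z" using cadd by (auto simp: Z_def set_plus_def)
      then show "z \<in> W" by (auto simp: W_def)
    qed
    show "(bm_const l ^ k * real (card (p i))) powr l * (bm_const l ^ k * real (card (q j))) powr (1 - l) \<le> h (i + j)"
      if "i \<in> I" "j \<in> J" for i j
    proof -
      have fr: "finite (r (i + j))" using finZ by (simp add: r_def)
      have "(bm_const l ^ k * real (card (p i))) powr l * (bm_const l ^ k * real (card (q j))) powr (1 - l)
        = (bm_const l ^ k) powr l * (bm_const l ^ k) powr (1 - l) * (real (card (p i)) powr l * real (card (q j)) powr (1 - l))"
        using bm_const_pos[OF l] by (simp add: powr_mult)
      also have "(bm_const l ^ k) powr l * (bm_const l ^ k) powr (1 - l) = bm_const l ^ k"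
        using bm_const_pos[OF l] by (simp flip: powr_add)
      also have "bm_const l ^ k * (real (card (p i)) powr l * real (card (q j)) powr (1 - l))
        \<le> real (card (p i + q j)) + fact (Suc k) * (\<Sum>t<k. real (lines (u t) (p i + q j)))"
      proof (subst mult.assoc[symmetric], rule Suc.IH)
        show "n = 0" if "i < k" "n *s u i \<in> lat u i" for i n using Suc.prems(1) that by (meson less_SucI)
        show "finite (p i)" "finite (q j)" using fin by (simp_all add: p_def q_def)
        show "p i \<noteq> {}" "q j \<noteq> {}" using that by (auto simp: I_def J_def p_def q_def)
        show "x - x' \<in> lat u k" if "x \<in> p i" "x' \<in> p i" for x x'
          using fib[of x x0 i x'] X1[of x] X1[of x'] that by (auto simp: p_def)
        show "x - x' \<in> lat u k" if "x \<in> q j" "x' \<in> q j" for x x'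
          using fib[of x y0 j x'] Y1[of x] Y1[of x'] that by (auto simp: q_def)
      qed
      also have "\<dots> \<le> h (i + j)"
        unfolding h_def F_def using pq fr
        by (intro add_mono mult_left_mono sum_mono) (auto intro!: card_mono lines_mono)
      finally show ?thesis .
    qed
  qed
  moreover have "(\<Sum>n\<in>I. bm_const l ^ k * real (card (p n))) = bm_const l ^ k * card X"
    using sum_card_fibres[OF fin(1), of "\<lambda>x. c (x - x0)"]
    by (simp add: sum_distrib_left[symmetric] I_def p_def flip: of_nat_sum)
  moreover have "(\<Sum>n\<in>J. bm_const l ^ k * real (card (q n))) = bm_const l ^ k * card Y"
    using sum_card_fibres[OF fin(2), of "\<lambda>x. c (x - y0)"]
    by (simp add: sum_distrib_left[symmetric] J_def q_def flip: of_nat_sum)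
  moreover have "bm_const l * (bm_const l ^ k * card X) powr l * (bm_const l ^ k * card Y) powr (1 - l)
      = bm_const l ^ Suc k * real (card X) powr l * real (card Y) powr (1 - l)"
  proof -
    have "(bm_const l ^ k) powr l * (bm_const l ^ k) powr (1 - l) = bm_const l ^ k"
      using bm_const_pos[OF l] by (simp flip: powr_add)
    then show ?thesis using bm_const_pos[OF l] by (simp add: powr_mult)
  qed
  ultimately have main: "bm_const l ^ Suc k * real (card X) powr l * real (card Y) powr (1 - l)
      \<le> sum h W + (1 + k * F) * real (lines (u k) Z)" by simp
  \<comment> \<open>A line in a direction \<open>u i\<close> with i < k does not change the
    coefficient of \<open>u k\<close>, so it stays in one slice and the error terms of the slices
    add up.\<close>
  have linesW: "(\<Sum>w\<in>W. real (lines (u i) (r w))) \<le> real (lines (u i) Z)" if i: "i < k" for i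
  proof -
    have "(\<Sum>w\<in>W. lines (u i) (r w)) \<le> lines (u i) Z"
      unfolding W_def r_def
    proof (rule sum_lines_fibres[OF finZ])
      fix z z' assume z: "z \<in> Z" "z' \<in> Z" "line (u i) z = line (u i) z'"
      then obtain n where n: "z' = z + n *s u i" by (auto simp: line_eq_iff)
      have "z - (x0 + y0) - c (z - (x0 + y0)) *s u k + n *s u i \<in> lat u k"
        by (intro lat_add Z1 z lat_generator i)
      then have "c (z' - (x0 + y0)) = c (z - (x0 + y0))"
        by (intro cU) (simp add: n algebra_simps)
      then show "c (z - (x0 + y0)) = c (z' - (x0 + y0))" by simp
    qed
    then show ?thesis by (simp flip: of_nat_sum)
  qed
  have "sum h W = real (card Z) + F * (\<Sum>w\<in>W. \<Sum>i<k. real (lines (u i) (r w)))"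
    using sum_card_fibres[OF finZ, of "\<lambda>z. c (z - (x0 + y0))"]
    by (simp add: h_def sum.distrib sum_distrib_left[symmetric] W_def r_def flip: of_nat_sum)
  also have "(\<Sum>w\<in>W. \<Sum>i<k. real (lines (u i) (r w))) = (\<Sum>i<k. \<Sum>w\<in>W. real (lines (u i) (r w)))"
    by (rule sum.swap)
  also have "F * \<dots> \<le> F * (\<Sum>i<k. real (lines (u i) Z))"
    using F1 linesW by (intro mult_left_mono sum_mono) auto
  also have "\<dots> \<le> fact (Suc (Suc k)) * (\<Sum>i<k. real (lines (u i) Z))"
    unfolding F_def by (intro mult_right_mono fact_mono sum_nonneg) auto
  finally have "sum h W \<le> real (card Z) + fact (Suc (Suc k)) * (\<Sum>i<k. real (lines (u i) Z))" by simp
  moreover have "(1 + k * F) * real (lines (u k) Z) \<le> fact (Suc (Suc k)) * real (lines (u k) Z)"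
  proof (rule mult_right_mono)
    \<comment> \<open>The recursion 1 + k F \<le> (k + 2) F is the origin of the factorial.\<close>
    have "fact (Suc (Suc k)) = (real k + 2) * F" by (simp add: F_def algebra_simps)
    then show "1 + k * F \<le> fact (Suc (Suc k))" using F1 by (simp add: algebra_simps)
  qed simp
  ultimately have "sum h W + (1 + k * F) * real (lines (u k) Z)
     \<le> real (card Z) + fact (Suc (Suc k)) * ((\<Sum>i<k. real (lines (u i) Z)) + real (lines (u k) Z))"
    unfolding distrib_left by linarith
  then show ?case using main unfolding Z_def by simp
qed

text \<open>Here the sets may be spread over many cosets of \<open>lat u k\<close>. Pairing all
  classes of \<open>X\<close> with the largest class of \<open>Y\<close>, and the reverse, gives two
  bounds by disjoint pieces. In their geometric mean with weights l and 1-l the sizes of the largest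
  classes cancel.\<close>

theorem brunn_minkowski_int:
  fixes u :: "nat \<Rightarrow> int^'n"
  assumes l: "0 < l" "l < 1"
    and indep: "\<And>i n. i < k \<Longrightarrow> n *s u i \<in> lat u i \<Longrightarrow> n = 0"
    and fin: "finite X" "finite Y" and ne: "X \<noteq> {}" "Y \<noteq> {}"
  shows "bm_const l ^ k * real (card X) powr l * real (card Y) powr (1 - l)
    \<le> real (card (X + Y)) + fact (Suc k) * (\<Sum>i<k. real (lines (u i) (X + Y)))"
proof -
  define Z where "Z = X + Y"
  have finZ: "finite Z" using fin by (simp add: Z_def finite_set_plus)
  define c where "c z = {y. y - z \<in> lat u k}" for z
  have ceq: "c z = c z' \<longleftrightarrow> z - z' \<in> lat u k" for z z'
  proof
    assume "c z = c z'"
    moreover have "z \<in> c z" using lat_zero by (simp add: c_def)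
    ultimately show "z - z' \<in> lat u k" by (simp add: c_def)
  next
    assume zz: "z - z' \<in> lat u k"
    have "y - z' = (y - z) + (z - z')" "y - z = (y - z') - (z - z')" for y by simp_all
    then show "c z = c z'" unfolding c_def using lat_add[OF _ zz] lat_diff[OF _ zz] by (metis (no_types, lifting))
  qed
  define F :: real where "F = fact (Suc k)"
  define H where "H V = real (card V) + F * (\<Sum>i<k. real (lines (u i) V))" for V
  have F0: "0 \<le> F" by (simp add: F_def)
  \<comment> \<open>Pieces in different cosets share neither points nor lines in the directions
    \<open>u i\<close>, so the right side of the inequality is superadditive over them.\<close>
  have fam: "(\<Sum>w\<in>S. H (V w)) \<le> H Z"
    if S: "finite S" and V: "\<And>w. w \<in> S \<Longrightarrow> V w \<subseteq> Z"
      and dis: "\<And>w w' z z'. w \<in> S \<Longrightarrow> w' \<in> S \<Longrightarrow> z \<in> V w \<Longrightarrow> z' \<in> V w' \<Longrightarrow> c z = c z' \<Longrightarrow> w = w'"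
    for S :: "'w set" and V
  proof -
    have fV: "finite (V w)" if "w \<in> S" for w using V[OF that] finZ by (rule finite_subset)
    have "(\<Sum>w\<in>S. card (V w)) = card (\<Union>w\<in>S. V w)"
    proof (rule card_UN_disjoint[symmetric])
      show "\<forall>i\<in>S. \<forall>j\<in>S. i \<noteq> j \<longrightarrow> V i \<inter> V j = {}" using dis by blast
    qed (use S fV in auto)
    also have "\<dots> \<le> card Z" using V finZ by (intro card_mono) auto
    finally have 1: "(\<Sum>w\<in>S. real (card (V w))) \<le> real (card Z)" by (simp flip: of_nat_sum)
    have 2: "(\<Sum>w\<in>S. real (lines (u i) (V w))) \<le> real (lines (u i) Z)" if i: "i < k" for i
    proof -
      have cl: "c z = c z'" if "line (u i) z = line (u i) z'" for z z'
      proof -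
        obtain n where "z' = z + n *s u i" using \<open>line (u i) z = line (u i) z'\<close> by (auto simp: line_eq_iff)
        then have "z' - z = n *s u i" by simp
        then have "c z' = c z" using lat_generator[OF i] ceq by metis
        then show ?thesis by simp
      qed
      have "(\<Sum>w\<in>S. lines (u i) (V w)) = card (\<Union>w\<in>S. line (u i) ` V w)"
        unfolding lines_def
      proof (rule card_UN_disjoint[symmetric])
        show "\<forall>w\<in>S. \<forall>w'\<in>S. w \<noteq> w' \<longrightarrow> line (u i) ` V w \<inter> line (u i) ` V w' = {}"
        proof (intro ballI impI equals0I)
          fix w w' L assume w: "w \<in> S" "w' \<in> S" "w \<noteq> w'" "L \<in> line (u i) ` V w \<inter> line (u i) ` V w'"
          then obtain z z' where "z \<in> V w" "z' \<in> V w'" "line (u i) z = line (u i) z'" by auto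
          then show False using dis[OF w(1,2)] cl w(3) by blast
        qed
      qed (use S fV in auto)
      also have "\<dots> \<le> lines (u i) Z" unfolding lines_def using V finZ by (intro card_mono) auto
      finally show ?thesis by (simp flip: of_nat_sum)
    qed
    have "(\<Sum>w\<in>S. H (V w)) = (\<Sum>w\<in>S. real (card (V w))) + F * (\<Sum>w\<in>S. \<Sum>i<k. real (lines (u i) (V w)))"
      by (simp add: H_def sum.distrib sum_distrib_left)
    also have "(\<Sum>w\<in>S. \<Sum>i<k. real (lines (u i) (V w))) = (\<Sum>i<k. \<Sum>w\<in>S. real (lines (u i) (V w)))"
      by (rule sum.swap)
    finally have "(\<Sum>w\<in>S. H (V w)) = (\<Sum>w\<in>S. real (card (V w))) + F * (\<Sum>i<k. \<Sum>w\<in>S. real (lines (u i) (V w)))" .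
    also have "\<dots> \<le> real (card Z) + F * (\<Sum>i<k. real (lines (u i) Z))"
      using 1 2 F0 by (intro add_mono mult_left_mono sum_mono) auto
    finally show ?thesis by (simp add: H_def)
  qed
  define p where "p C = {x \<in> X. c x = C}" for C
  define q where "q C = {y \<in> Y. c y = C}" for C
  have fpq: "finite (p C)" "finite (q C)" for C using fin by (auto simp: p_def q_def)
  have base: "bm_const l ^ k * real (card (p C)) powr l * real (card (q D)) powr (1 - l) \<le> H (p C + q D)"
    if "C \<in> c ` X" "D \<in> c ` Y" for C D
    unfolding H_def F_def
    by (rule brunn_minkowski_lat[OF l indep fpq]) (use that in \<open>auto simp: p_def q_def simp flip: ceq\<close>)
  obtain C0 where C0: "C0 \<in> c ` X" "\<And>C. C \<in> c ` X \<Longrightarrow> card (p C) \<le> card (p C0)"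
    by (rule finite_obtain_max[of "c ` X" "\<lambda>C. card (p C)"]) (use fin ne in auto)
  obtain D0 where D0: "D0 \<in> c ` Y" "\<And>C. C \<in> c ` Y \<Longrightarrow> card (q C) \<le> card (q D0)"
    by (rule finite_obtain_max[of "c ` Y" "\<lambda>C. card (q C)"]) (use fin ne in auto)
  define P where "P = real (card (p C0))"
  define Q where "Q = real (card (q D0))"
  have P: "0 < P" and Q: "0 < Q" using C0(1) D0(1) fpq by (auto simp: P_def Q_def p_def q_def card_gt_0_iff)
  define B where "B = bm_const l ^ k"
  have B: "0 < B" using bm_const_pos[OF l] by (simp add: B_def)
  have shift: "C = C'" if "x \<in> p C" "y \<in> q D" "x' \<in> p C'" "y' \<in> q D" "c (x + y) = c (x' + y')" for x y x' y' C C' D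
  proof -
    have "(x + y) - (x' + y') \<in> lat u k" "y - y' \<in> lat u k" using that by (auto simp: q_def simp flip: ceq)
    from lat_diff[OF this] have "x - x' \<in> lat u k" by simp
    then show ?thesis using that by (auto simp: p_def simp flip: ceq)
  qed
  have shift': "D = D'" if "x \<in> p C" "y \<in> q D" "x' \<in> p C" "y' \<in> q D'" "c (x + y) = c (x' + y')" for x y x' y' C D D'
  proof -
    have "(x + y) - (x' + y') \<in> lat u k" "x - x' \<in> lat u k" using that by (auto simp: p_def simp flip: ceq)
    from lat_diff[OF this] have "y - y' \<in> lat u k" by simp
    then show ?thesis using that by (auto simp: q_def simp flip: ceq)
  qed
  have subZ: "p C + q D \<subseteq> Z" for C D by (auto simp: p_def q_def Z_def set_plus_def)
  have "B * (real (card X) * P powr (l - 1)) * Q powr (1 - l)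
      = (\<Sum>C\<in>c ` X. B * (real (card (p C)) * P powr (l - 1)) * Q powr (1 - l))"
    using sum_card_fibres[OF fin(1), of c]
    by (simp add: p_def flip: sum_distrib_left sum_distrib_right of_nat_sum)
  also have "\<dots> \<le> (\<Sum>C\<in>c ` X. H (p C + q D0))"
  proof (rule sum_mono)
    fix C assume C: "C \<in> c ` X"
    then have C': "0 < card (p C)" using fpq by (auto simp: p_def card_gt_0_iff)
    \<comment> \<open>\<open>P\<close> is the largest class size and the exponent is negative. The
      replacement makes the bound linear in the size of \<open>p C\<close>, so that it can be summed
      over the classes.\<close>
    have "P powr (l - 1) \<le> real (card (p C)) powr (l - 1)"
      using C' C0(2)[OF C] l by (intro powr_mono2') (auto simp: P_def)
    then have "real (card (p C)) * P powr (l - 1) \<le> real (card (p C)) * real (card (p C)) powr (l - 1)"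
      by (intro mult_left_mono) auto
    also have "\<dots> = real (card (p C)) powr l" using C' powr_mult_base[of "real (card (p C))" "l - 1"] by simp
    finally have "B * (real (card (p C)) * P powr (l - 1)) * Q powr (1 - l)
       \<le> B * real (card (p C)) powr l * Q powr (1 - l)"
      using B by (intro mult_right_mono mult_left_mono) auto
    also have "\<dots> \<le> H (p C + q D0)" using base[OF C D0(1)] by (simp add: B_def Q_def)
    finally show "B * (real (card (p C)) * P powr (l - 1)) * Q powr (1 - l) \<le> H (p C + q D0)" .
  qed
  also have "\<dots> \<le> H Z"
  proof (rule fam)
    fix C C' z z'
    assume z: "z \<in> p C + q D0" "z' \<in> p C' + q D0" "c z = c z'"
    obtain x y where xy: "x \<in> p C" "y \<in> q D0" "z = x + y" using z(1) by (rule set_plus_elim)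
    obtain x' y' where xy': "x' \<in> p C'" "y' \<in> q D0" "z' = x' + y'" using z(2) by (rule set_plus_elim)
    show "C = C'" by (rule shift[OF xy(1,2) xy'(1,2)]) (use z(3) xy(3) xy'(3) in simp)
  qed (use fin subZ in auto)
  finally have h1: "B * (real (card X) * P powr (l - 1)) * Q powr (1 - l) \<le> H Z" .
  have "B * (real (card Y) * Q powr (- l)) * P powr l
      = (\<Sum>C\<in>c ` Y. B * (real (card (q C)) * Q powr (- l)) * P powr l)"
    using sum_card_fibres[OF fin(2), of c]
    by (simp add: q_def flip: sum_distrib_left sum_distrib_right of_nat_sum)
  also have "\<dots> \<le> (\<Sum>C\<in>c ` Y. H (p C0 + q C))"
  proof (rule sum_mono)
    fix C assume C: "C \<in> c ` Y"
    then have C': "0 < card (q C)" using fpq by (auto simp: q_def card_gt_0_iff)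
    have "Q powr (- l) \<le> real (card (q C)) powr (- l)"
      using C' D0(2)[OF C] l by (intro powr_mono2') (auto simp: Q_def)
    then have "real (card (q C)) * Q powr (- l) \<le> real (card (q C)) * real (card (q C)) powr (- l)"
      by (intro mult_left_mono) auto
    also have "\<dots> = real (card (q C)) powr (1 - l)" using C' powr_mult_base[of "real (card (q C))" "- l"] by simp
    finally have "B * (real (card (q C)) * Q powr (- l)) * P powr l
       \<le> B * real (card (q C)) powr (1 - l) * P powr l"
      using B by (intro mult_right_mono mult_left_mono) auto
    also have "\<dots> \<le> H (p C0 + q C)" using base[OF C0(1) C] by (simp add: B_def P_def mult_ac)
    finally show "B * (real (card (q C)) * Q powr (- l)) * P powr l \<le> H (p C0 + q C)" .
  qed
  also have "\<dots> \<le> H Z"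
  proof (rule fam)
    fix C C' z z'
    assume z: "z \<in> p C0 + q C" "z' \<in> p C0 + q C'" "c z = c z'"
    obtain x y where xy: "x \<in> p C0" "y \<in> q C" "z = x + y" using z(1) by (rule set_plus_elim)
    obtain x' y' where xy': "x' \<in> p C0" "y' \<in> q C'" "z' = x' + y'" using z(2) by (rule set_plus_elim)
    show "C = C'" by (rule shift'[OF xy(1,2) xy'(1,2)]) (use z(3) xy(3) xy'(3) in simp)
  qed (use fin subZ in auto)
  finally have h2: "B * (real (card Y) * Q powr (- l)) * P powr l \<le> H Z" .
  have X0: "0 < real (card X)" "0 < real (card Y)" using fin ne by (auto simp: card_gt_0_iff)
  have HZ: "0 < H Z" by (rule less_le_trans[OF _ h2]) (use B X0 P Q in auto)
  have "B * real (card X) powr l * real (card Y) powr (1 - l)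
     = (B * (real (card X) * P powr (l - 1)) * Q powr (1 - l)) powr l
       * (B * (real (card Y) * Q powr (- l)) * P powr l) powr (1 - l)"
    (is "?L = ?R")
  proof -
    have "?R = (B powr l * B powr (1 - l)) * real (card X) powr l * real (card Y) powr (1 - l)
       * (P powr ((l - 1) * l) * P powr (l * (1 - l))) * (Q powr ((1 - l) * l) * Q powr (- l * (1 - l)))"
      using B X0 P Q by (simp add: powr_mult powr_powr mult_ac)
    also have "\<dots> = ?L" using B P Q by (simp flip: powr_add add: algebra_simps)
    finally show ?thesis by simp
  qed
  also have "\<dots> \<le> H Z powr l * H Z powr (1 - l)"
    using h1 h2 l B X0 P Q by (intro mult_mono powr_mono2) auto
  also have "\<dots> = H Z" using HZ by (simp flip: powr_add)
  finally show ?thesis by (simp add: B_def H_def F_def Z_def)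
qed

section \<open>Pluennecke-Ruzsa calculus and directions met by few lines\<close>

primrec msum :: "nat \<Rightarrow> 'g::comm_monoid_add set \<Rightarrow> 'g set" where
  "msum 0 S = {0}"
| "msum (Suc n) S = S + msum n S"

lemma finite_msum: "finite S \<Longrightarrow> finite (msum n S)"
  by (induction n) (auto intro: finite_set_plus)

lemma card_set_plus_le: "finite A \<Longrightarrow> finite B \<Longrightarrow> card (A + B) \<le> card A * card B"
proof -
  assume f: "finite A" "finite B"
  have "A + B = (\<lambda>(x, y). x + y) ` (A \<times> B)" by (auto simp: set_plus_def)
  then show ?thesis using f card_image_le[of "A \<times> B" "\<lambda>(x, y). x + y"] by (simp add: card_cartesian_product)
qed

lemma card_add_singleton: "card (A + {c :: 'g::ab_group_add}) = card A"
proof -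
  have "A + {c} = (\<lambda>x. x + c) ` A" by (auto simp: set_plus_def)
  then show ?thesis by (simp add: card_image inj_on_def)
qed

text \<open>\<open>X'\<close> minimises |V + Y| / |V| over the nonempty subsets of \<open>X\<close>.
  When \<open>c\<close> joins \<open>C\<close>, at most |X' + Y| - |Z + Y| new sums appear, where
  \<open>Z\<close> collects the points whose translate by \<open>c\<close> was already present, and
  minimality bounds |Z + Y| from below.\<close>

lemma petridis:
  fixes X Y :: "'g::ab_group_add set"
  assumes fin: "finite X" "finite Y" and ne: "X \<noteq> {}"
  obtains X' where "X' \<subseteq> X" "X' \<noteq> {}" "card (X' + Y) * card X \<le> card (X + Y) * card X'"
    "\<And>C. finite C \<Longrightarrow> card (X' + Y + C) * card X' \<le> card (X' + Y) * card (X' + C)"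
proof -
  define k where "k V = real (card (V + Y)) / real (card V)" for V
  obtain X' where X': "X' \<in> Pow X - {{}}" "\<And>V. V \<in> Pow X - {{}} \<Longrightarrow> - k V \<le> - k X'"
    by (rule finite_obtain_max[of "Pow X - {{}}" "\<lambda>V. - k V"]) (use fin ne in auto)
  have fX': "finite X'" "X' \<noteq> {}" "X' \<subseteq> X" using X' fin finite_subset by auto
  have pos: "0 < card X'" using fX' by (simp add: card_gt_0_iff)
  have min: "card (X' + Y) * card V \<le> card (V + Y) * card X'" if "V \<subseteq> X" for V
  proof (cases "V = {}")
    case False
    then have "0 < card V" using that fin finite_subset by (auto simp: card_gt_0_iff)
    moreover have "k X' \<le> k V" using X'(2)[of V] that False by auto
    ultimately have "real (card (X' + Y) * card V) \<le> real (card (V + Y) * card X')"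
      using pos by (simp add: k_def divide_simps mult_ac)
    then show ?thesis by linarith
  qed simp
  have "card (X' + Y + C) * card X' \<le> card (X' + Y) * card (X' + C)" if "finite C" for C
    using that
  proof (induction C rule: finite_induct)
    case empty
    then show ?case by (simp add: set_plus_def)
  next
    case (insert c C)
    define Z where "Z = {x \<in> X'. x + c \<in> X' + C}"
    have ZX: "Z \<subseteq> X'" by (auto simp: Z_def)
    then have fZ: "finite Z" using fX' finite_subset by blast
    let ?U = "X' + Y + {c}" and ?V = "Z + Y + {c}"
    have sub: "?V \<subseteq> ?U" using ZX by (intro set_plus_mono2) auto
    have "?V \<subseteq> X' + Y + C"
    proof
      fix z assume "z \<in> ?V"
      then obtain x y where xy: "x \<in> Z" "y \<in> Y" "z = x + y + c" by (auto simp: set_plus_def)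
      then obtain x' c' where "x' \<in> X'" "c' \<in> C" "x + c = x' + c'" by (auto simp: Z_def set_plus_def)
      then have "z = (x' + y) + c'" using xy(3) by (metis add.commute add.left_commute)
      then show "z \<in> X' + Y + C" using \<open>x' \<in> X'\<close> \<open>c' \<in> C\<close> xy(2) by (simp add: set_plus_intro)
    qed
    moreover have "X' + Y + insert c C \<subseteq> (X' + Y + C) \<union> ?U"
    proof
      fix z assume "z \<in> X' + Y + insert c C"
      then obtain w d where "w \<in> X' + Y" "d \<in> insert c C" "z = w + d" by (rule set_plus_elim)
      then show "z \<in> (X' + Y + C) \<union> ?U" by (cases "d = c") (auto intro: set_plus_intro)
    qed
    ultimately have "X' + Y + insert c C \<subseteq> (X' + Y + C) \<union> (?U - ?V)" by blast
    then have "card (X' + Y + insert c C) \<le> card ((X' + Y + C) \<union> (?U - ?V))"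
      using fX' fin insert.hyps by (intro card_mono finite_UnI finite_Diff finite_set_plus) auto
    also have "\<dots> \<le> card (X' + Y + C) + card (?U - ?V)" by (rule card_Un_le)
    also have "card (?U - ?V) = card ?U - card ?V"
      using sub fZ fin by (intro card_Diff_subset finite_set_plus) auto
    finally have 1: "card (X' + Y + insert c C) \<le> card (X' + Y + C) + (card (X' + Y) - card (Z + Y))"
      by (simp only: card_add_singleton)
    have le: "card (Z + Y) \<le> card (X' + Y)"
      using ZX fX' fin by (intro card_mono finite_set_plus set_plus_mono2) auto
    have "X' + insert c C = (X' + C) \<union> (X' - Z + {c})"
      by (auto simp: set_plus_def Z_def)
    moreover have "(X' + C) \<inter> (X' - Z + {c}) = {}" by (auto simp: set_plus_def Z_def) metis
    ultimately have "card (X' + insert c C) = card (X' + C) + card (X' - Z + {c})"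
      using fX' insert.hyps by (simp add: card_Un_disjoint finite_set_plus)
    also have "card (X' - Z + {c}) = card X' - card Z" using fZ ZX by (simp add: card_add_singleton card_Diff_subset)
    finally have 2: "card (X' + insert c C) = card (X' + C) + (card X' - card Z)" .
    have 3: "card Z \<le> card X'" using ZX fX' by (simp add: card_mono)
    have 4: "card (X' + Y) * card Z \<le> card (Z + Y) * card X'" using min ZX fX' by blast
    \<comment> \<open>The subtractions of naturals are exact by the second and third hypothesis;
      with \<open>p'\<close> and \<open>x'\<close> in their place only sums and products
      remain.\<close>
    have arith: "w * x \<le> p * (c2 + (x - y))"
      if h: "w \<le> c1 + (p - z)" "z \<le> p" "y \<le> x" "p * y \<le> z * x" "c1 * x \<le> p * c2" for w c1 p z c2 x y :: nat
    proof -
      obtain p' x' where e: "p = z + p'" "x = y + x'" using h(2,3) le_Suc_ex by blast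
      have "w * x \<le> (c1 + p') * x" using h(1) e by (intro mult_le_mono1) simp
      also have "\<dots> \<le> p * c2 + p' * x" using h(5) by (simp add: distrib_right)
      also have "p' * x \<le> p * x'" using h(4) by (simp add: e algebra_simps)
      finally show ?thesis using e by (simp add: distrib_left)
    qed
    show ?case unfolding 2 by (rule arith[OF 1 le 3 4 insert.IH])
  qed
  then show thesis using that[OF fX'(3,2) min[OF order_refl]] by blast
qed

text \<open>Fix one representation d = p d - q d of each difference. The pair (p d + v, v + q d)
  determines d as the difference of its entries, and then v.\<close>

lemma ruzsa_triangle:
  fixes U V W :: "'g::ab_group_add set"
  assumes "finite U" "finite V" "finite W"
  shows "card (U + uminus ` W) * card V \<le> card (U + V) * card (V + W)"
proof -
  have "\<forall>d\<in>U + uminus ` W. \<exists>u w. u \<in> U \<and> w \<in> W \<and> d = u - w" by (auto simp: set_plus_def)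
  then obtain p q where pq: "\<And>d. d \<in> U + uminus ` W \<Longrightarrow> p d \<in> U \<and> q d \<in> W \<and> d = p d - q d" by metis
  let ?h = "\<lambda>(d, v). (p d + v, v + q d)"
  have "inj_on ?h ((U + uminus ` W) \<times> V)"
  proof (rule inj_onI, clarify)
    fix d v d' v'
    assume d: "d \<in> U + uminus ` W" "d' \<in> U + uminus ` W" and e: "p d + v = p d' + v'" "v + q d = v' + q d'"
    have "p d - q d = (p d + v) - (v + q d)" "p d' - q d' = (p d' + v') - (v' + q d')" by (simp_all add: algebra_simps)
    then have "d = d'" using e pq[OF d(1)] pq[OF d(2)] by metis
    then show "d = d' \<and> v = v'" using e by simp
  qed
  moreover have "?h ` ((U + uminus ` W) \<times> V) \<subseteq> (U + V) \<times> (V + W)"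
    using pq by (auto intro!: set_plus_intro)
  ultimately have "card ((U + uminus ` W) \<times> V) \<le> card ((U + V) \<times> (V + W))"
    using assms by (intro card_inj_on_le[of ?h]) (auto intro: finite_set_plus)
  then show ?thesis by (simp add: card_cartesian_product)
qed

text \<open>\<open>T\<close> is a largest set of points of \<open>A\<close> whose translates of
  \<open>B\<close> are pairwise disjoint. No further point can be added, so the translate at any
  point of \<open>A\<close> meets one of these.\<close>

lemma ruzsa_covering:
  fixes A B :: "'g::ab_group_add set"
  assumes fin: "finite A" "finite B" and ne: "B \<noteq> {}"
  obtains T where "T \<subseteq> A" "card T * card B \<le> card (A + B)" "A \<subseteq> T + (B + uminus ` B)"
proof -
  define \<D> where "\<D> = {T. T \<subseteq> A \<and> (\<forall>t\<in>T. \<forall>t'\<in>T. t \<noteq> t' \<longrightarrow> ({t} + B) \<inter> ({t'} + B) = {})}"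
  have "finite \<D>" "{} \<in> \<D>" using fin by (auto simp: \<D>_def)
  then obtain T where T: "T \<in> \<D>" "\<And>T'. T' \<in> \<D> \<Longrightarrow> card T' \<le> card T"
    by (metis finite_obtain_max[of \<D> card] empty_iff)
  have fT: "finite T" "T \<subseteq> A" using T fin finite_subset by (auto simp: \<D>_def)
  have "card T * card B = (\<Sum>t\<in>T. card ({t} + B))"
    by (subst add.commute[of "{_}" B]) (simp add: card_add_singleton)
  also have "\<dots> = card (\<Union>t\<in>T. {t} + B)"
    using T(1) fT fin by (intro card_UN_disjoint[symmetric]) (auto simp: \<D>_def intro: finite_set_plus)
  also have "\<dots> \<le> card (A + B)"
    using fin fT by (intro card_mono finite_set_plus) (auto simp: set_plus_def)
  finally have 1: "card T * card B \<le> card (A + B)" .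
  have "A \<subseteq> T + (B + uminus ` B)"
  proof
    fix x assume x: "x \<in> A"
    have "\<exists>t\<in>T. ({t} + B) \<inter> ({x} + B) \<noteq> {}"
    proof (cases "x \<in> T")
      case True
      then show ?thesis using ne by (auto simp: set_plus_def)
    next
      case False
      show ?thesis
      proof (rule ccontr)
        assume "\<not> ?thesis"
        then have dis: "({t} + B) \<inter> ({x} + B) = {}" "({x} + B) \<inter> ({t} + B) = {}" if "t \<in> T" for t
          using that by blast+
        have "insert x T \<in> \<D>" using T(1) x dis unfolding \<D>_def by simp
        then have "card (insert x T) \<le> card T" by (rule T(2))
        then show False using False fT by simp
      qed
    qed
    then obtain t b b' where "t \<in> T" "b \<in> B" "b' \<in> B" "t + b = x + b'" by (auto simp: set_plus_def)
    then have "x = t + (b + - b')" by (simp add: algebra_simps)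
    moreover have "b + - b' \<in> B + uminus ` B" using \<open>b \<in> B\<close> \<open>b' \<in> B\<close> by (intro set_plus_intro) auto
    ultimately show "x \<in> T + (B + uminus ` B)" using set_plus_intro[OF \<open>t \<in> T\<close>] by metis
  qed
  then show thesis using that fT 1 by blast
qed

text \<open>For the subset given by \<open>petridis\<close> each further summand \<open>Y\<close>
  costs one factor \<open>C\<close>. The triangle inequality through this subset then joins an
  m-fold and an n-fold sum into a difference.\<close>

lemma plunnecke:
  fixes X Y :: "'g::ab_group_add set" and C :: real
  assumes fin: "finite X" "finite Y" and ne: "X \<noteq> {}" and C: "real (card (X + Y)) \<le> C * card X"
  shows "real (card (msum m Y + uminus ` msum n Y)) \<le> C ^ (m + n) * card X"
proof -
  obtain X' where X': "X' \<subseteq> X" "X' \<noteq> {}" "card (X' + Y) * card X \<le> card (X + Y) * card X'"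
    and P: "\<And>C. finite C \<Longrightarrow> card (X' + Y + C) * card X' \<le> card (X' + Y) * card (X' + C)"
    using petridis[OF fin ne] by metis
  have fX': "finite X'" using X' fin finite_subset by blast
  have p: "0 < real (card X)" "0 < real (card X')" using fin ne fX' X' by (auto simp: card_gt_0_iff)
  have C0: "0 \<le> C" using C p by (metis of_nat_0_le_iff order_trans zero_le_mult_iff not_less)
  have "real (card (X' + Y)) * card X \<le> real (card (X + Y)) * card X'" using X'(3) by (simp flip: of_nat_mult)
  also have "\<dots> \<le> C * card X * card X'" using C by (intro mult_right_mono) auto
  finally have k: "real (card (X' + Y)) \<le> C * card X'" using p by (simp add: mult_ac)
  have pow: "real (card (X' + msum m Y)) \<le> C ^ m * card X'" for m
  proof (induction m)
    case (Suc m)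
    have "real (card (X' + Y + msum m Y)) * card X' \<le> real (card (X' + Y)) * card (X' + msum m Y)"
      using P[OF finite_msum[OF fin(2)], of m] by (simp flip: of_nat_mult)
    also have "\<dots> \<le> (C * card X') * (C ^ m * card X')" using k Suc C0 by (intro mult_mono) auto
    finally show ?case using p by (simp add: add.assoc mult_ac)
  qed simp
  have "real (card (msum m Y + uminus ` msum n Y)) * card X' \<le> real (card (msum m Y + X')) * card (X' + msum n Y)"
    using ruzsa_triangle[of "msum m Y" X' "msum n Y"] fin fX' by (simp add: finite_msum flip: of_nat_mult)
  also have "\<dots> \<le> (C ^ m * card X') * (C ^ n * card X')"
    using pow[of m] pow[of n] C0 by (intro mult_mono) (auto simp: add.commute)
  finally have "real (card (msum m Y + uminus ` msum n Y)) \<le> C ^ (m + n) * card X'"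
    using p by (simp add: power_add mult_ac)
  also have "\<dots> \<le> C ^ (m + n) * card X"
    using X' fin C0 by (intro mult_left_mono) (auto intro: card_mono)
  finally show ?thesis .
qed

lemma msum_insert:
  fixes t :: "int^'n"
  shows "msum m (insert t T) \<subseteq> (\<Union>j\<le>m. {int j *s t} + msum (m - j) T)"
proof (induction m)
  case (Suc m)
  show ?case
  proof
    fix z assume "z \<in> msum (Suc m) (insert t T)"
    then obtain y w where yw: "y \<in> insert t T" "w \<in> msum m (insert t T)" "z = y + w"
      unfolding msum.simps by (rule set_plus_elim)
    then obtain j x where jx: "j \<le> m" "x \<in> msum (m - j) T" "w = int j *s t + x"
      using Suc by (auto simp: set_plus_def)
    show "z \<in> (\<Union>j\<le>Suc m. {int j *s t} + msum (Suc m - j) T)"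
    proof (cases "y = t")
      case True
      then have "z = int (Suc j) *s t + x" using yw jx by (simp add: vector_sadd_rdistrib algebra_simps)
      then show ?thesis using jx by (intro UN_I[of "Suc j"]) (auto simp: set_plus_def)
    next
      case False
      then have "y \<in> T" using yw by simp
      moreover have "Suc m - j = Suc (m - j)" using jx by simp
      ultimately have "y + x \<in> msum (Suc m - j) T" using jx by auto
      moreover have "z = int j *s t + (y + x)" using yw jx by (simp add: algebra_simps)
      ultimately show ?thesis using jx by (intro UN_I[of j]) (auto intro!: set_plus_intro)
    qed
  qed
qed auto

text \<open>An m-fold sum is determined by how often each element of \<open>T\<close> occurs. For
  fixed \<open>T\<close> the growth in m is thus polynomial; the contrast with the exponential
  number of multiples in \<open>multiples_in_msum\<close> is the source of the power saving.\<close>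

lemma card_msum_le:
  fixes T :: "(int^'n) set"
  assumes "finite T"
  shows "card (msum m T) \<le> (m + 1) ^ card T"
  using assms
proof (induction T arbitrary: m rule: finite_induct)
  case empty
  then show ?case by (induction m) (auto simp: set_plus_def)
next
  case (insert t T)
  have "card (msum m (insert t T)) \<le> card (\<Union>j\<le>m. {int j *s t} + msum (m - j) T)"
    using insert.hyps by (intro card_mono[OF _ msum_insert]) (auto intro!: finite_set_plus finite_msum)
  also have "\<dots> \<le> (\<Sum>j\<le>m. card ({int j *s t} + msum (m - j) T))" by (rule card_UN_le) simp
  also have "\<dots> = (\<Sum>j\<le>m. card (msum (m - j) T))"
    by (subst add.commute[of "{_}"]) (simp add: card_add_singleton)
  also have "\<dots> \<le> (\<Sum>j\<le>m. (m + 1) ^ card T)"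
    by (intro sum_mono order_trans[OF insert.IH] power_mono) auto
  also have "\<dots> = (m + 1) ^ card (insert t T)" using insert.hyps by simp
  finally show ?case .
qed

text \<open>If doubling \<open>S\<close> costs only translates from \<open>T\<close>, then all
  copies of \<open>S\<close> but one can be traded, one after the other, for elements of
  \<open>T\<close>.\<close>

lemma msum_Suc_subset:
  fixes S T :: "'g::comm_monoid_add set"
  assumes "S + S \<subseteq> S + T"
  shows "msum (Suc m) S \<subseteq> S + msum m T"
proof (induction m)
  case (Suc m)
  have "msum (Suc (Suc m)) S \<subseteq> S + (S + msum m T)" 
    by (subst msum.simps(2), intro set_plus_mono2 order_refl Suc.IH)
  also have "\<dots> = (S + S) + msum m T" by (simp add: add.assoc)
  also have "\<dots> \<subseteq> (S + T) + msum m T" by (intro set_plus_mono2 order_refl assms)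
  finally show ?case by (simp add: add.assoc)
qed (simp only: msum.simps order_refl)

text \<open>One point of \<open>Z\<close> on each line, shifted by 0 up to n-1 times
  \<open>u\<close>, yields n distinct points of that same line.\<close>

lemma lines_mult_le:
  fixes u :: "int^'n"
  assumes "u \<noteq> 0" "finite Z"
  shows "lines u Z * n \<le> card (Z + (\<lambda>i. int i *s u) ` {..<n})"
proof -
  define rep where "rep L = (SOME z. z \<in> Z \<and> line u z = L)" for L
  have rep: "rep L \<in> Z" "line u (rep L) = L" if "L \<in> line u ` Z" for L
    using someI_ex[of "\<lambda>z. z \<in> Z \<and> line u z = L"] that unfolding rep_def by auto
  have shift: "line u (z + i *s u) = line u z" for z i using line_eq_iff[of u z "z + i *s u"] by auto
  let ?h = "\<lambda>(L, i). rep L + int i *s u"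
  have "inj_on ?h (line u ` Z \<times> {..<n})"
  proof (rule inj_onI, clarify)
    fix z i z' j
    assume z: "z \<in> Z" "z' \<in> Z" and e: "rep (line u z) + int i *s u = rep (line u z') + int j *s u"
    then have "line u (rep (line u z)) = line u (rep (line u z'))" by (metis shift)
    then have L: "line u z = line u z'" using rep z by (metis imageI)
    then have "(int i - int j) *s u = 0" using e by (simp add: vector_sub_rdistrib)
    then have "int i - int j = 0" using assms(1) unfolding vector_mul_eq_0 by simp
    then have "i = j" by simp
    then show "line u z = line u z' \<and> i = j" using L by simp
  qed
  then have "card (line u ` Z \<times> {..<n}) = card (?h ` (line u ` Z \<times> {..<n}))" by (simp add: card_image)
  also have "\<dots> \<le> card (Z + (\<lambda>i. int i *s u) ` {..<n})"
    using assms(2) rep by (intro card_mono finite_set_plus) (auto intro!: set_plus_intro)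
  finally show ?thesis by (simp add: lines_def card_cartesian_product)
qed

text \<open>Binary expansion: each of the \<open>I\<close> digits costs one element of S + S, and a
  zero digit is paid with 0 + 0.\<close>

lemma multiples_in_msum:
  fixes u :: "int^'n"
  assumes z: "0 \<in> S" and p: "\<And>i. i < I \<Longrightarrow> 2 ^ i *s u \<in> S + S" and n: "n < 2 ^ I"
  shows "int n *s u \<in> msum (2 * I) S"
  using p n
proof (induction I arbitrary: n)
  case (Suc I)
  define e where "e = (if n < 2 ^ I then 0 else 2 ^ I *s u)"
  define m where "m = (if n < 2 ^ I then n else n - 2 ^ I)"
  have m: "m < 2 ^ I" "int n *s u = e + int m *s u"
    using Suc.prems(2) by (auto simp: m_def e_def of_nat_diff vector_sub_rdistrib)
  have e: "e \<in> S + S" using Suc.prems(1)[of I] z set_plus_intro[OF z z] by (auto simp: e_def)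
  have "int m *s u \<in> msum (2 * I) S" using Suc m by simp
  with e have "e + int m *s u \<in> (S + S) + msum (2 * I) S" by (rule set_plus_intro)
  then show ?case using m by (simp add: add.assoc)
qed simp

text \<open>Doubling an element of \<open>S\<close> and subtracting a suitable element of
  \<open>T\<close> returns to \<open>S\<close>; \<open>I\<close> such steps record a word of
  \<open>I\<close> letters from \<open>T\<close>. Points with the same word undergo the same
  subtractions, which cancel in their difference, so 2^i (y - y') is a difference of two elements of
  \<open>S\<close>. \<open>Y0\<close> is the fibre of the most popular word.\<close>

lemma doubling_code:
  fixes S T Y :: "(int^'n) set"
  assumes fin: "finite Y" "finite T" and Y: "Y \<noteq> {}"
    and S: "\<And>y y'. y \<in> Y \<Longrightarrow> y' \<in> Y \<Longrightarrow> y - y' \<in> S" and neg: "\<And>s. s \<in> S \<Longrightarrow> - s \<in> S"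
    and dbl: "S + S \<subseteq> S + T"
  obtains Y0 where "Y0 \<subseteq> Y" "card Y \<le> card Y0 * card T ^ I"
    "\<And>y y' i. y \<in> Y0 \<Longrightarrow> y' \<in> Y0 \<Longrightarrow> i \<le> I \<Longrightarrow> 2 ^ i *s (y - y') \<in> S + S"
proof -
  obtain y0 where y0: "y0 \<in> Y" using Y by auto
  have "\<forall>s\<in>S. \<exists>t\<in>T. s + s - t \<in> S"
  proof
    fix s assume "s \<in> S"
    then have "s + s \<in> S + T" using dbl set_plus_intro[of s S s S] by auto
    then obtain w t where "w \<in> S" "t \<in> T" "s + s = w + t" by (rule set_plus_elim)
    then show "\<exists>t\<in>T. s + s - t \<in> S" by (intro bexI[of _ t]) auto
  qed
  then obtain \<tau> where \<tau>: "\<And>s. s \<in> S \<Longrightarrow> \<tau> s \<in> T \<and> s + s - \<tau> s \<in> S" by metis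
  define \<phi> where "\<phi> s = s + s - \<tau> s" for s
  have it: "(\<phi> ^^ i) s \<in> S" if "s \<in> S" for s i using that \<tau> by (induction i) (auto simp: \<phi>_def)
  define code where "code y = map (\<lambda>i. \<tau> ((\<phi> ^^ i) (y - y0))) [0..<I]" for y
  let ?L = "{xs. set xs \<subseteq> T \<and> length xs = I}"
  have code: "code ` Y \<subseteq> ?L" using \<tau> it S y0 by (auto simp: code_def)
  have fL: "finite ?L" "card ?L = card T ^ I" using fin finite_lists_length_eq card_lists_length_eq by auto
  obtain c where c: "c \<in> code ` Y" "\<And>d. d \<in> code ` Y \<Longrightarrow> card {y \<in> Y. code y = d} \<le> card {y \<in> Y. code y = c}"
    by (rule finite_obtain_max[of "code ` Y" "\<lambda>d. card {y \<in> Y. code y = d}"]) (use fin Y in auto)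
  define Y0 where "Y0 = {y \<in> Y. code y = c}"
  have "card Y = (\<Sum>d\<in>code ` Y. card {y \<in> Y. code y = d})" using sum_card_fibres[OF fin(1), of code] by simp
  also have "\<dots> \<le> (\<Sum>d\<in>code ` Y. card Y0)" using c by (intro sum_mono) (auto simp: Y0_def)
  also have "\<dots> \<le> card Y0 * card T ^ I" using card_mono[OF fL(1) code] fL by simp
  finally have 1: "card Y \<le> card Y0 * card T ^ I" .
  have "2 ^ i *s (y - y') \<in> S + S" if y: "y \<in> Y0" "y' \<in> Y0" "i \<le> I" for y y' i
  proof -
    have "(\<phi> ^^ i) (y - y0) - (\<phi> ^^ i) (y' - y0) = 2 ^ i *s (y - y')"
      using y(3)
    proof (induction i)
      case (Suc i)
      have "code y ! i = code y' ! i" using y by (simp add: Y0_def)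
      then have e: "\<tau> ((\<phi> ^^ i) (y - y0)) = \<tau> ((\<phi> ^^ i) (y' - y0))" using Suc.prems by (simp add: code_def)
      have "(\<phi> ^^ Suc i) (y - y0) - (\<phi> ^^ Suc i) (y' - y0)
         = ((\<phi> ^^ i) (y - y0) - (\<phi> ^^ i) (y' - y0)) + ((\<phi> ^^ i) (y - y0) - (\<phi> ^^ i) (y' - y0))"
        using e by (simp add: \<phi>_def algebra_simps)
      also have "\<dots> = 2 ^ i *s (y - y') + 2 ^ i *s (y - y')" using Suc by simp
      also have "\<dots> = 2 ^ Suc i *s (y - y')"
        unfolding vector_sadd_rdistrib[symmetric] by simp
      finally show ?case .
    qed simp
    moreover have "(\<phi> ^^ i) (y - y0) + - (\<phi> ^^ i) (y' - y0) \<in> S + S"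
      using y y0 S by (intro set_plus_intro it neg) (auto simp: Y0_def)
    ultimately show ?thesis by simp
  qed
  then show thesis using that[of Y0] 1 by (auto simp: Y0_def)
qed

text \<open>Each difference within \<open>Y0\<close> has 2^I multiples in an iterated sumset whose
  size is only polynomial in \<open>I\<close>, so few lines in that direction can meet X + Y. The
  exponent 5 comes from covering S + S with S = Y - Y, through the size of 3Y - 2Y. The exponent 6
  is 4 for covering X + Y plus 2 for the size of S.\<close>

theorem rich_directions:
  fixes X Y :: "(int^'n) set"
  assumes fin: "finite X" "finite Y" and N: "card X = N" "card Y = N" "0 < N"
    and C: "real (card (X + Y)) \<le> C * N" "1 \<le> C" and r: "C ^ 5 \<le> real r"
  obtains Y0 where "Y0 \<subseteq> Y" "N \<le> card Y0 * r ^ I"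
    "\<And>y y'. y \<in> Y0 \<Longrightarrow> y' \<in> Y0 \<Longrightarrow> y \<noteq> y' \<Longrightarrow>
       real (lines (y - y') (X + Y)) * 2 ^ I \<le> C ^ 6 * N * (2 * real I + 1) ^ r"
proof -
  have ne: "X \<noteq> {}" "Y \<noteq> {}" using N by auto
  note pl = plunnecke[OF fin ne(1), where C=C, unfolded N, OF C(1)]
  define S where "S = Y + uminus ` Y"
  have fS: "finite S" using fin by (simp add: S_def finite_set_plus)
  have negS: "- s \<in> S" if "s \<in> S" for s
  proof -
    obtain y y' where "y \<in> Y" "y' \<in> Y" "s = y + - y'" using \<open>s \<in> S\<close> by (auto simp: S_def elim!: set_plus_elim)
    then have "- s = y' + - y" by simp
    then show ?thesis using \<open>y \<in> Y\<close> \<open>y' \<in> Y\<close> unfolding S_def by (metis imageI set_plus_intro)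
  qed
  have dS: "y - y' \<in> S" if "y \<in> Y" "y' \<in> Y" for y y'
    using set_plus_intro[of y Y "- y'" "uminus ` Y"] that by (auto simp: S_def)
  have zS: "0 \<in> S" using dS ne(2) by fastforce
  have um: "uminus ` (A + B) = uminus ` A + uminus ` B" for A B :: "(int^'n) set"
  proof (intro set_eqI iffI)
    fix z assume "z \<in> uminus ` (A + B)"
    then obtain a b where "a \<in> A" "b \<in> B" "z = - a + - b" by (auto elim!: set_plus_elim)
    then show "z \<in> uminus ` A + uminus ` B" by (metis imageI set_plus_intro)
  next
    fix z assume "z \<in> uminus ` A + uminus ` B"
    then obtain a b where "a \<in> A" "b \<in> B" "z = - (a + b)" by (auto elim!: set_plus_elim)
    then show "z \<in> uminus ` (A + B)" by (metis imageI set_plus_intro)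
  qed
  have m1: "msum 1 Y = Y" "msum 2 Y = Y + Y" "msum 3 Y = Y + (Y + Y)"
    by (simp_all add: numeral_2_eq_2 numeral_3_eq_3)
  have SS: "S + S = (Y + Y) + uminus ` (Y + Y)" by (simp add: S_def um add_ac)
  have cS: "real (card S) \<le> C ^ 2 * N" using pl[of 1 1] m1 by (simp add: S_def numeral_2_eq_2)
  obtain T where T: "T \<subseteq> S + S" "card T * card Y \<le> card (S + S + Y)" "S + S \<subseteq> T + (Y + uminus ` Y)"
    by (rule ruzsa_covering[of "S + S" Y]) (use fS fin ne in \<open>auto intro: finite_set_plus\<close>)
  have fT: "finite T" using T(1) fS finite_subset by (auto intro: finite_set_plus)
  have "S + S + Y = msum 3 Y + uminus ` msum 2 Y" by (simp add: SS m1 add_ac)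
  then have "real (card (S + S + Y)) \<le> C ^ 5 * N" using pl[of 3 2] by simp
  then have "real (card T) * N \<le> C ^ 5 * N" using T(2) N by (simp flip: of_nat_mult)
  then have cT: "card T \<le> r" using N(3) r by simp
  have dbl: "S + S \<subseteq> S + T" using T(3) by (simp add: S_def add.commute)
  obtain T' where T': "T' \<subseteq> X + Y" "card T' * card Y \<le> card (X + Y + Y)" "X + Y \<subseteq> T' + (Y + uminus ` Y)"
    by (rule ruzsa_covering[of "X + Y" Y]) (use fin ne in \<open>auto intro: finite_set_plus\<close>)
  have fT': "finite T'" using T'(1) fin finite_subset by (auto intro: finite_set_plus)
  \<comment> \<open>Triangle inequality through \<open>Y\<close>: |X + 2Y| |Y| \<le> |X + Y| |Y -
    2Y|.\<close>
  have "real (card (X + Y + Y)) * N \<le> real (card (X + Y)) * real (card (Y + uminus ` (Y + Y)))"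
    using ruzsa_triangle[of X Y "uminus ` (Y + Y)"] fin N
    by (simp add: finite_set_plus image_image add.assoc flip: of_nat_mult)
  also have "\<dots> \<le> (C * N) * (C ^ 3 * N)"
    using C pl[of 1 2] m1 by (intro mult_mono) (auto simp: numeral_3_eq_3)
  finally have "real (card (X + Y + Y)) \<le> C ^ 4 * N" using N(3) by (simp add: eval_nat_numeral mult_ac)
  then have "real (card T') * N \<le> C ^ 4 * N" using T'(2) N by (simp flip: of_nat_mult)
  then have cT': "real (card T') \<le> C ^ 4" using N(3) by simp
  obtain Y0 where Y0: "Y0 \<subseteq> Y" "card Y \<le> card Y0 * card T ^ I"
    and P: "\<And>y y' i. y \<in> Y0 \<Longrightarrow> y' \<in> Y0 \<Longrightarrow> i \<le> I \<Longrightarrow> 2 ^ i *s (y - y') \<in> S + S"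
    using doubling_code[OF fin(2) fT ne(2) dS negS dbl, of I] by metis
  have "N \<le> card Y0 * r ^ I"
    using Y0(2) mult_le_mono2[OF power_mono[OF cT zero_le, of I], of "card Y0"] N(2) by linarith
  moreover have "real (lines (y - y') (X + Y)) * 2 ^ I \<le> C ^ 6 * N * (2 * real I + 1) ^ r"
    if y: "y \<in> Y0" "y' \<in> Y0" "y \<noteq> y'" for y y'
  proof -
    let ?u = "y - y'"
    have sub: "(\<lambda>i. int i *s ?u) ` {..<2 ^ I} \<subseteq> msum (2 * I) S"
      using multiples_in_msum[OF zS, of I ?u] P[OF y(1,2)] by auto
    have "lines ?u (X + Y) * 2 ^ I \<le> card (X + Y + (\<lambda>i. int i *s ?u) ` {..<2 ^ I})"
      using y fin by (intro lines_mult_le) (auto intro: finite_set_plus)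
    also have "\<dots> \<le> card (T' + (S + msum (2 * I) T))"
    proof (rule card_mono)
      have "X + Y + (\<lambda>i. int i *s ?u) ` {..<2 ^ I} \<subseteq> (T' + S) + msum (2 * I) S"
        by (rule set_plus_mono2[OF T'(3)[folded S_def] sub])
      also have "\<dots> = T' + msum (Suc (2 * I)) S" by (simp add: add.assoc)
      also have "\<dots> \<subseteq> T' + (S + msum (2 * I) T)" by (rule set_plus_mono2[OF order_refl msum_Suc_subset[OF dbl]])
      finally show "X + Y + (\<lambda>i. int i *s ?u) ` {..<2 ^ I} \<subseteq> T' + (S + msum (2 * I) T)" .
    qed (intro finite_set_plus fT' fS finite_msum fT)
    also have "\<dots> \<le> card T' * card (S + msum (2 * I) T)"
      by (intro card_set_plus_le fT' finite_set_plus fS finite_msum fT)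
    also have "\<dots> \<le> card T' * (card S * card (msum (2 * I) T))"
      by (intro mult_le_mono2 card_set_plus_le fS finite_msum fT)
    also have "\<dots> \<le> card T' * (card S * (2 * I + 1) ^ r)"
      using card_msum_le[OF fT, of "2 * I"] power_increasing[OF cT, of "2 * I + 1"]
      by (intro mult_le_mono2) linarith
    finally have "real (lines ?u (X + Y) * 2 ^ I) \<le> real (card T' * (card S * (2 * I + 1) ^ r))"
      by (simp only: of_nat_le_iff)
    also have "\<dots> = real (card T') * (real (card S) * (2 * real I + 1) ^ r)" by (simp add: add.commute)
    also have "\<dots> \<le> C ^ 4 * ((C ^ 2 * N) * (2 * real I + 1) ^ r)"
      using cT' cS C(2) by (intro mult_mono mult_right_mono) auto
    also have "\<dots> = C ^ 6 * N * (2 * real I + 1) ^ r" by (simp flip: power_add mult.assoc)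
    finally show ?thesis by simp
  qed
  ultimately show thesis using that Y0(1) by blast
qed

section \<open>Partitions of a set by the cosets of a subgroup\<close>

definition subgrp :: "'g::ab_group_add set \<Rightarrow> bool" where
  "subgrp H \<longleftrightarrow> 0 \<in> H \<and> (\<forall>x\<in>H. \<forall>y\<in>H. x - y \<in> H)"

text \<open>The trace on \<open>A\<close> of a coset. Quotients are handled through such traces:
  \<open>parts H A\<close> lists the occupied cosets, and for a group \<open>G\<close> containing
  \<open>H\<close> its cardinality \<open>card (parts H G)\<close> is the index, if finite.\<close>

definition part :: "'g::ab_group_add set \<Rightarrow> 'g set \<Rightarrow> 'g \<Rightarrow> 'g set" where
  "part H A x = {y \<in> A. y - x \<in> H}"

definition parts :: "'g::ab_group_add set \<Rightarrow> 'g set \<Rightarrow> 'g set set" where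
  "parts H A = part H A ` A"

definition in_coset :: "'g::ab_group_add set \<Rightarrow> 'g set \<Rightarrow> bool" where
  "in_coset H A \<longleftrightarrow> (\<forall>x\<in>A. \<forall>y\<in>A. x - y \<in> H)"

lemma subgrp_zero: "subgrp H \<Longrightarrow> 0 \<in> H" by (simp add: subgrp_def)
lemma subgrp_diff: "subgrp H \<Longrightarrow> x \<in> H \<Longrightarrow> y \<in> H \<Longrightarrow> x - y \<in> H" by (simp add: subgrp_def)
lemma subgrp_minus: "subgrp H \<Longrightarrow> x \<in> H \<Longrightarrow> - x \<in> H" using subgrp_diff[of H 0 x] subgrp_zero[of H] by simp
lemma subgrp_add: "subgrp H \<Longrightarrow> x \<in> H \<Longrightarrow> y \<in> H \<Longrightarrow> x + y \<in> H"
  using subgrp_diff[of H x "- y"] subgrp_minus[of H y] by simp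
lemma subgrp_diff_swap: "subgrp H \<Longrightarrow> x - y \<in> H \<Longrightarrow> y - x \<in> H"
  using subgrp_minus[of H "x - y"] by simp
lemma subgrp_trans: "subgrp H \<Longrightarrow> x - y \<in> H \<Longrightarrow> y - z \<in> H \<Longrightarrow> x - z \<in> H"
  using subgrp_add[of H "x - y" "y - z"] by simp
lemma subgrp_cong: "subgrp H \<Longrightarrow> x - y \<in> H \<Longrightarrow> z - x \<in> H \<longleftrightarrow> z - y \<in> H"
  using subgrp_trans[of H z x y] subgrp_trans[of H z y x] subgrp_diff_swap[of H x y] by blast
lemma subgrp_Int: "subgrp H \<Longrightarrow> subgrp K \<Longrightarrow> subgrp (H \<inter> K)" by (simp add: subgrp_def)
lemma subgrp_UNIV: "subgrp UNIV" by (simp add: subgrp_def)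

lemma part_subset: "part H A x \<subseteq> A" by (auto simp: part_def)
lemma part_self: "subgrp H \<Longrightarrow> x \<in> A \<Longrightarrow> x \<in> part H A x" by (simp add: part_def subgrp_zero)
lemma part_eqI: "subgrp H \<Longrightarrow> x - y \<in> H \<Longrightarrow> part H A x = part H A y"
  using subgrp_cong[of H x y] by (simp add: part_def)
lemma part_eq_iff:
  assumes "subgrp H" "x \<in> A"
  shows "part H A x = part H A y \<longleftrightarrow> x - y \<in> H"
proof
  assume "part H A x = part H A y"
  then have "x \<in> part H A y" using part_self[OF assms] by simp
  then show "x - y \<in> H" by (simp add: part_def)
qed (rule part_eqI[OF assms(1)])
lemma in_coset_part: "subgrp H \<Longrightarrow> in_coset H (part H A x)"
  using subgrp_cong[of H _ x] by (auto simp: in_coset_def part_def)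
lemma in_coset_subset: "in_coset H A \<Longrightarrow> B \<subseteq> A \<Longrightarrow> in_coset H B" by (auto simp: in_coset_def)

lemma parts_mem:
  assumes "subgrp H" "C \<in> parts H A" "x \<in> C"
  shows "x \<in> A \<and> C = part H A x"
proof -
  obtain y where y: "C = part H A y" using assms(2) by (auto simp: parts_def)
  then have "x \<in> A" "x - y \<in> H" using assms(3) by (auto simp: part_def)
  then show ?thesis using part_eqI[OF assms(1)] y by metis
qed
lemma parts_subset: "C \<in> parts H A \<Longrightarrow> C \<subseteq> A" by (auto simp: parts_def part_def)
lemma parts_nonempty: "subgrp H \<Longrightarrow> C \<in> parts H A \<Longrightarrow> C \<noteq> {}"
  using part_self by (auto simp: parts_def)
lemma parts_disjoint: "subgrp H \<Longrightarrow> C \<in> parts H A \<Longrightarrow> D \<in> parts H A \<Longrightarrow> C \<noteq> D \<Longrightarrow> C \<inter> D = {}"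
  using parts_mem by blast
lemma parts_in_coset: "subgrp H \<Longrightarrow> C \<in> parts H A \<Longrightarrow> in_coset H C"
  by (auto simp: parts_def intro: in_coset_part)
lemma Union_parts: "subgrp H \<Longrightarrow> \<Union> (parts H A) = A"
  using part_self[of H _ A] part_subset[of H A] unfolding parts_def by blast
lemma part_in_parts: "x \<in> A \<Longrightarrow> part H A x \<in> parts H A" by (simp add: parts_def)
lemma finite_parts: "finite A \<Longrightarrow> finite (parts H A)" by (simp add: parts_def)
lemma parts_finite: "finite A \<Longrightarrow> C \<in> parts H A \<Longrightarrow> finite C" by (meson parts_subset finite_subset)

lemma sum_card_parts:
  assumes "finite A" "subgrp H"
  shows "(\<Sum>C\<in>parts H A. card C) = card A"
proof -
  have "card (\<Union> (parts H A)) = (\<Sum>C\<in>parts H A. card C)"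
  proof (rule card_Union_disjoint)
    show "pairwise disjnt (parts H A)"
      unfolding pairwise_def disjnt_def by (intro ballI impI parts_disjoint[OF assms(2)])
  qed (rule parts_finite[OF assms(1)])
  then show ?thesis by (simp add: Union_parts[OF assms(2)])
qed

lemma part_refine: "H' \<subseteq> H \<Longrightarrow> subgrp H \<Longrightarrow> y - x \<in> H \<Longrightarrow> part H' (part H A x) y = part H' A y"
  using subgrp_trans[of H _ y x] by (auto simp: part_def)

lemma parts_refine:
  assumes "H' \<subseteq> H" "subgrp H"
  shows "parts H' A = (\<Union>R\<in>parts H A. parts H' R)"
proof (intro set_eqI iffI)
  fix C assume "C \<in> parts H' A"
  then obtain x where x: "x \<in> A" "C = part H' A x" by (auto simp: parts_def)
  then have "C = part H' (part H A x) x" using assms part_refine subgrp_zero by (metis diff_self)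
  then show "C \<in> (\<Union>R\<in>parts H A. parts H' R)"
    using x part_self[OF assms(2) x(1)] by (auto simp: parts_def)
next
  fix C assume "C \<in> (\<Union>R\<in>parts H A. parts H' R)"
  then obtain x y where "x \<in> A" "y \<in> part H A x" "C = part H' (part H A x) y" by (auto simp: parts_def)
  then show "C \<in> parts H' A" using assms part_refine[of H' H y x A] by (auto simp: parts_def part_def)
qed

lemma sum_parts_refine:
  assumes "H' \<subseteq> H" "subgrp H" "subgrp H'" "finite A"
  shows "sum h (parts H' A) = (\<Sum>R\<in>parts H A. sum h (parts H' R))"
proof -
  have "parts H' R \<inter> parts H' R' = {}" if "R \<in> parts H A" "R' \<in> parts H A" "R \<noteq> R'" for R R'
  proof (rule equals0I)
    fix C assume C: "C \<in> parts H' R \<inter> parts H' R'"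
    then obtain x where "x \<in> C" using parts_nonempty[OF assms(3)] by blast
    then show False using C that parts_disjoint[OF assms(2) that] parts_subset by blast
  qed
  then show ?thesis
    unfolding parts_refine[OF assms(1,2), of A]
    using assms(4) by (intro sum.UNION_disjoint) (auto intro: finite_parts parts_finite)
qed

section \<open>Growth of sets that lie in a proper rational subspace\<close>

definition rv :: "int^'n \<Rightarrow> rat^'n" where
  "rv x = (\<chi> i. of_int (x $ i))"

lemma rv_diff: "rv (x - y) = rv x - rv y" by (simp add: rv_def vec_eq_iff)
lemma rv_add: "rv (x + y) = rv x + rv y" by (simp add: rv_def vec_eq_iff)
lemma rv_zero [simp]: "rv 0 = 0" by (simp add: rv_def vec_eq_iff)
lemma rv_eq_iff [simp]: "rv x = rv y \<longleftrightarrow> x = y" by (simp add: rv_def vec_eq_iff)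
lemma rv_smult: "rv (n *s x) = of_int n *s rv x" by (simp add: rv_def vec_eq_iff)
lemma rv_mult: "rv (L *v x) = rat_mat L *v rv x"
  by (simp add: rv_def rat_mat_def vec_eq_iff matrix_vector_mult_def)

lemma det_rat_mat: "det (rat_mat L) = of_int (det L)"
  by (simp add: det_def rat_mat_def)

lemma subgrp_rv_vimage: "vec.subspace U \<Longrightarrow> subgrp {z. rv z \<in> U}"
  by (auto simp: subgrp_def rv_diff vec.subspace_0 vec.subspace_diff)

lemma inj_mult_of_det:
  fixes R :: "rat^'n^'n"
  assumes "det R \<noteq> 0"
  shows "inj ((*v) R)"
proof -
  obtain S where S: "S ** R = mat 1" using assms invertible_det_nz[of R] by (auto simp: invertible_def)
  then have "S *v (R *v x) = x" for x by (simp add: matrix_vector_mul_assoc)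
  then show ?thesis by (metis injI)
qed

lemma inj_int_mult_of_det:
  fixes L :: "int^'n^'n"
  assumes "det L \<noteq> 0"
  shows "inj ((*v) L)"
proof (rule injI)
  fix x y assume "L *v x = L *v y"
  then have "rat_mat L *v rv x = rat_mat L *v rv y" by (simp flip: rv_mult)
  moreover have "inj ((*v) (rat_mat L))" using assms by (intro inj_mult_of_det) (simp add: det_rat_mat)
  ultimately show "x = y" by (metis injD rv_eq_iff)
qed

lemma vec_linear_mult: "Vector_Spaces.linear (*s) (*s) ((*v) (R :: rat^'n^'n))"
  by (rule matrix_vector_mul_linear_gen)

text \<open>Irreducibility is applied to \<open>U\<close> and V = L1 U, which have the same
  dimension because \<open>L1\<close> is injective; so L2 U cannot be contained in L1 U.\<close>

lemma proper_preimage: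
  fixes L1 L2 :: "int^'n^'n" and U :: "(rat^'n) set"
  assumes irr: "irreducible_pair L1 L2" and det: "det L1 \<noteq> 0"
    and U: "vec.subspace U" "U \<noteq> {0}" "U \<noteq> UNIV"
  shows "\<exists>u\<in>U. rat_mat L2 *v u \<notin> (*v) (rat_mat L1) ` U"
proof (rule ccontr)
  assume "\<not> ?thesis"
  then have sub: "(\<lambda>u. rat_mat L2 *v u) ` U \<subseteq> (*v) (rat_mat L1) ` U" by auto
  let ?V = "(*v) (rat_mat L1) ` U"
  have inj: "inj ((*v) (rat_mat L1))" using det by (intro inj_mult_of_det) (simp add: det_rat_mat)
  have sV: "vec.subspace ?V" using U(1) by (rule vec.subspace_image)
  have dV: "vec.dim ?V = vec.dim U"
    by (intro vec.dim_image_eq vec_linear_mult inj_on_subset[OF inj] subset_UNIV)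
  have "vec.dim U \<noteq> 0"
  proof
    assume "vec.dim U = 0"
    then have "U \<subseteq> {0}" by (simp only: vec.dim_eq_0)
    then show False using U(2) vec.subspace_0[OF U(1)] by blast
  qed
  then have V0: "?V \<noteq> {0}" using dV vec.dim_eq_0[of ?V] by (metis order_refl)
  have VU: "?V \<noteq> UNIV"
  proof
    assume "?V = UNIV"
    then have "vec.dim (UNIV :: (rat^'n) set) \<le> vec.dim U" using dV by simp
    then have "U = UNIV" by (intro vec.subspace_dim_equal[OF U(1) vec.subspace_UNIV]) auto
    then show False using U(3) by simp
  qed
  have "\<exists>U V. vec.subspace U \<and> vec.subspace V \<and> U \<noteq> {0} \<and> U \<noteq> UNIV \<and> V \<noteq> {0} \<and> V \<noteq> UNIV \<and>
      vec.dim U = vec.dim V \<and> (\<lambda>u. rat_mat L1 *v u) ` U \<subseteq> V \<and> (\<lambda>u. rat_mat L2 *v u) ` U \<subseteq> V"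
    by (rule exI[of _ U], rule exI[of _ ?V]) (intro conjI U sV V0 VU dV[symmetric] sub order_refl)
  then show False using irr unfolding irreducible_pair_def by (rule notE[rotated])
qed

text \<open>\<open>T\<close> counts classes and \<open>B\<close> is the size of the largest one. If
  T \<ge> n^(e'/4), the bound \<open>s1\<close> suffices. Otherwise B \<ge> n^(1 - e'/4), and
  \<open>s2\<close> suffices because (1 - e'/4) (1 + e') \<ge> 1 + e'/4.\<close>

lemma powr_growth_aux:
  fixes n T B s e e' :: real
  assumes n: "1 \<le> n" and T: "0 < T" and e: "0 < e'" "e' \<le> 1" "e \<le> e' / 4"
    and s1: "n * T \<le> s" and B: "n \<le> B * T" and s2: "B powr (1 + e') \<le> s"
  shows "n powr (1 + e) \<le> s"
proof -
  have le: "n powr (1 + e) \<le> n powr (1 + e' / 4)" using n e by (intro powr_mono) auto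
  show ?thesis
  proof (cases "n powr (e' / 4) \<le> T")
    case True
    have "n powr (1 + e' / 4) = n * n powr (e' / 4)" using n by (simp add: powr_add)
    also have "\<dots> \<le> n * T" using True n by (intro mult_left_mono) auto
    finally show ?thesis using le s1 by linarith
  next
    case False
    have "n \<le> B * T" by fact
    moreover have "0 < B" using B n T by (metis less_le_trans zero_less_mult_pos2 zero_less_one)
    ultimately have "n \<le> B * n powr (e' / 4)" using False
      by (metis (no_types) less_eq_real_def linorder_not_le mult_left_mono order_trans)
    then have "n / n powr (e' / 4) \<le> B" using n by (simp add: divide_le_eq)
    moreover have "n / n powr (e' / 4) = n powr (1 - e' / 4)" using n by (simp add: powr_diff)
    ultimately have "(n powr (1 - e' / 4)) powr (1 + e') \<le> B powr (1 + e')"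
      using e n by (intro powr_mono2) auto
    moreover have "n powr (1 + e' / 4) \<le> (n powr (1 - e' / 4)) powr (1 + e')"
    proof -
      have "e' * e' \<le> e' * 1" using e by (intro mult_left_mono) auto
      then have "1 + e' / 4 \<le> (1 - e' / 4) * (1 + e')" using e by (simp add: algebra_simps add_divide_distrib)
      then show ?thesis using n by (simp add: powr_powr powr_mono)
    qed
    ultimately show ?thesis using le s2 by linarith
  qed
qed

text \<open>Induction on the dimension through \<open>W\<close>, the part of \<open>U\<close> that
  \<open>L2\<close> sends into L1 U, which is proper by irreducibility. Points in different classes
  modulo \<open>W\<close> contribute disjoint translates of L1 A, and the largest class lies in a
  coset of the smaller space. Each dimension divides the gain in the exponent by 4.\<close>

theorem subspace_growth:
  fixes L1 L2 :: "int^'n^'n" and U :: "(rat^'n) set"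
  assumes irr: "irreducible_pair L1 L2" and det: "det L1 \<noteq> 0"
    and U: "vec.subspace U" "U \<noteq> UNIV" and A: "finite A" "in_coset {z. rv z \<in> U} A"
  shows "real (card A) powr (1 + (1 / 4) ^ vec.dim U) \<le> real (card (lin_sumset L1 L2 A))"
  using U A
proof (induction "vec.dim U" arbitrary: U A rule: less_induct)
  case less
  note A = less.prems(3,4) and U = less.prems(1,2)
  have fS: "finite (lin_sumset L1 L2 A)"
  proof -
    have "lin_sumset L1 L2 A = (\<lambda>(x, y). L1 *v x + L2 *v y) ` (A \<times> A)" by (auto simp: lin_sumset_def)
    then show ?thesis using A by simp
  qed
  show ?case
  proof (cases "A = {}")
    case False
    then obtain a0 where a0: "a0 \<in> A" by blast
    show ?thesis
    proof (cases "U = {0}")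
      case True
      have "A = {a0}"
        using A(2) a0 unfolding True in_coset_def by (auto simp: rv_diff)
      moreover have "L1 *v a0 + L2 *v a0 \<in> lin_sumset L1 L2 A" using a0 by (auto simp: lin_sumset_def)
      then have "1 \<le> card (lin_sumset L1 L2 A)" using fS by (metis One_nat_def Suc_leI card_gt_0_iff empty_iff)
      ultimately show ?thesis by simp
    next
      case U0: False
      define M where "M = (*v) (rat_mat L1) ` U"
      define W where "W = {u \<in> U. rat_mat L2 *v u \<in> M}"
      have sM: "vec.subspace M" unfolding M_def using U(1) by (rule vec.subspace_image)
      have sW: "vec.subspace W"
        unfolding W_def using U(1) sM
        by (auto simp: vec.subspace_def matrix_vector_right_distrib vector_scalar_commute)
      have WU: "W \<subset> U" using proper_preimage[OF irr det U(1) U0 U(2)] by (auto simp: W_def M_def)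
      have WN: "W \<noteq> UNIV" using WU by auto
      have dW: "vec.dim W < vec.dim U"
        using WU sW U(1) by (intro vec.dim_psubset) (simp add: vec.span_eq_iff[THEN iffD2])
      define H where "H = {z :: int^'n. rv z \<in> W}"
      have sH: "subgrp H" unfolding H_def by (rule subgrp_rv_vimage[OF sW])
      define rep where "rep C = (SOME x. x \<in> C)" for C :: "(int^'n) set"
      have rep: "rep C \<in> C" if "C \<in> parts H A" for C
        using parts_nonempty[OF sH that] unfolding rep_def by (simp add: some_in_eq)
      have repA: "rep C \<in> A" if "C \<in> parts H A" for C using rep[OF that] parts_subset[OF that] by blast
      let ?h = "\<lambda>(x, C). L1 *v x + L2 *v rep C"
      have inj: "inj_on ?h (A \<times> parts H A)"
      proof (rule inj_onI, clarify)
        fix x C x' C'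
        assume x: "x \<in> A" "x' \<in> A" "C \<in> parts H A" "C' \<in> parts H A"
          and e: "L1 *v x + L2 *v rep C = L1 *v x' + L2 *v rep C'"
        then have "L2 *v (rep C - rep C') = L1 *v (x' - x)"
          by (simp add: matrix_vector_mult_diff_distrib algebra_simps)
        then have "rat_mat L2 *v rv (rep C - rep C') = rat_mat L1 *v rv (x' - x)" by (metis rv_mult)
        moreover have "rv (x' - x) \<in> U" "rv (rep C - rep C') \<in> U"
          using A(2) x repA by (auto simp: in_coset_def)
        ultimately have "rep C - rep C' \<in> H" by (auto simp: H_def W_def M_def)
        then have "C = C'" using parts_mem[OF sH x(3) rep[OF x(3)]] parts_mem[OF sH x(4) rep[OF x(4)]] part_eqI[OF sH]
          by metis
        moreover from this have "L1 *v x = L1 *v x'" using e by simp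
        ultimately show "x = x' \<and> C = C'" using inj_int_mult_of_det[OF det] by (auto dest: injD)
      qed
      have "?h ` (A \<times> parts H A) \<subseteq> lin_sumset L1 L2 A" using repA by (auto simp: lin_sumset_def)
      then have s1: "card A * card (parts H A) \<le> card (lin_sumset L1 L2 A)"
        using card_inj_on_le[OF inj _ fS] by (simp add: card_cartesian_product)
      have pne: "parts H A \<noteq> {}" using a0 by (auto simp: parts_def)
      obtain B where B: "B \<in> parts H A" "\<And>C. C \<in> parts H A \<Longrightarrow> card C \<le> card B"
        by (rule finite_obtain_max[OF finite_parts[OF A(1)] pne, of card]) blast
      have "card A = (\<Sum>C\<in>parts H A. card C)" using sum_card_parts[OF A(1) sH] by simp
      also have "\<dots> \<le> card B * card (parts H A)" using B sum_bounded_above[of "parts H A" card "card B"] by (simp add: mult.commute)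
      finally have BT: "card A \<le> card B * card (parts H A)" .
      have "real (card B) powr (1 + (1 / 4) ^ vec.dim W) \<le> real (card (lin_sumset L1 L2 B))"
        using less.hyps[OF dW sW WN] B parts_finite[OF A(1)] parts_in_coset[OF sH] unfolding H_def by blast
      also have "\<dots> \<le> real (card (lin_sumset L1 L2 A))"
        using parts_subset[OF B(1)] fS by (intro of_nat_mono card_mono) (auto simp: lin_sumset_def)
      finally have s2: "real (card B) powr (1 + (1 / 4) ^ vec.dim W) \<le> real (card (lin_sumset L1 L2 A))" .
      show ?thesis
      proof (rule powr_growth_aux[OF _ _ _ _ _ _ _ s2])
        show "1 \<le> real (card A)" using a0 A(1) by (simp add: Suc_le_eq card_gt_0_iff) blast
        show "0 < real (card (parts H A))" using pne finite_parts[OF A(1)] by (simp add: card_gt_0_iff)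
        show "real (card A) * real (card (parts H A)) \<le> real (card (lin_sumset L1 L2 A))"
          using s1 by (simp flip: of_nat_mult)
        show "real (card A) \<le> real (card B) * real (card (parts H A))" using BT by (simp flip: of_nat_mult)
        show "0 < (1 / 4 :: real) ^ vec.dim W" "(1 / 4 :: real) ^ vec.dim W \<le> 1" by (auto intro: power_le_one)
        have "(1 / 4 :: real) ^ vec.dim U \<le> (1 / 4) ^ Suc (vec.dim W)"
          using dW by (intro power_decreasing) auto
        then show "(1 / 4 :: real) ^ vec.dim U \<le> (1 / 4) ^ vec.dim W / 4" by simp
      qed
    qed
  qed simp
qed

section \<open>Indices of lattices and determinants\<close>

text \<open>Both images are copies of \<open>G\<close> modulo the same equivalence relation.
  Comparisons of indices are reduced to this.\<close>

lemma card_image_same_kernel: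
  assumes "\<And>x y. x \<in> G \<Longrightarrow> y \<in> G \<Longrightarrow> p x = p y \<longleftrightarrow> q x = q y"
  shows "card (p ` G) = card (q ` G)" "finite (p ` G) \<longleftrightarrow> finite (q ` G)"
proof -
  have "bij_betw (\<lambda>c. q (SOME x. x \<in> G \<and> p x = c)) (p ` G) (q ` G)"
  proof (rule bij_betwI')
    have ex: "(SOME x. x \<in> G \<and> p x = c) \<in> G \<and> p (SOME x. x \<in> G \<and> p x = c) = c" if "c \<in> p ` G" for c
      using that by (intro someI_ex[of "\<lambda>x. x \<in> G \<and> p x = c"]) auto
    show "q (SOME x. x \<in> G \<and> p x = c) = q (SOME x. x \<in> G \<and> p x = c') \<longleftrightarrow> c = c'"
      if "c \<in> p ` G" "c' \<in> p ` G" for c c'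
      using ex[OF that(1)] ex[OF that(2)] assms by metis
    show "q (SOME x. x \<in> G \<and> p x = c) \<in> q ` G" if "c \<in> p ` G" for c using ex[OF that] by blast
    show "\<exists>c\<in>p ` G. d = q (SOME x. x \<in> G \<and> p x = c)" if d: "d \<in> q ` G" for d
    proof -
      obtain x where x: "x \<in> G" "d = q x" using d by blast
      then have "p x \<in> p ` G" by blast
      moreover from ex[OF this] have "d = q (SOME y. y \<in> G \<and> p y = p x)" using x assms by metis
      ultimately show ?thesis by blast
    qed
  qed
  then show "card (p ` G) = card (q ` G)" "finite (p ` G) \<longleftrightarrow> finite (q ` G)"
    by (rule bij_betw_same_card, rule bij_betw_finite)
qed

text \<open>The first isomorphism theorem in counting form: \<open>G\<close> modulo the preimage of
  \<open>M\<close> corresponds to (h G + M) / M, where the sum enters because \<open>M\<close> need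
  not lie in the image.\<close>

lemma parts_hom:
  fixes h :: "'g::ab_group_add \<Rightarrow> 'k::ab_group_add"
  assumes h: "\<And>x y. h (x - y) = h x - h y" and G: "subgrp G" and M: "subgrp M"
  shows "card (parts {x \<in> G. h x \<in> M} G) = card (parts M (h ` G + M))"
    and "finite (parts {x \<in> G. h x \<in> M} G) \<longleftrightarrow> finite (parts M (h ` G + M))"
proof -
  let ?N = "h ` G + M"
  have sK: "subgrp {x \<in> G. h x \<in> M}"
    using G M h by (auto simp: subgrp_def) (metis diff_self)
  have hN: "h x \<in> ?N" if "x \<in> G" for x
    using set_plus_intro[of "h x" "h ` G" 0 M] that subgrp_zero[OF M] by auto
  have im: "parts M ?N = (\<lambda>x. part M ?N (h x)) ` G"
  proof (intro set_eqI iffI)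
    fix C assume "C \<in> parts M ?N"
    then obtain n where n: "n \<in> ?N" "C = part M ?N n" by (auto simp: parts_def)
    then obtain x m where "x \<in> G" "m \<in> M" "n = h x + m" by (auto elim!: set_plus_elim)
    then have "C = part M ?N (h x)" using n part_eqI[OF M, of n "h x"] by simp
    then show "C \<in> (\<lambda>x. part M ?N (h x)) ` G" using \<open>x \<in> G\<close> by blast
  qed (use hN in \<open>auto simp: parts_def\<close>)
  have k: "part {x \<in> G. h x \<in> M} G x = part {x \<in> G. h x \<in> M} G y \<longleftrightarrow> part M ?N (h x) = part M ?N (h y)"
    if "x \<in> G" "y \<in> G" for x y
    using part_eq_iff[OF sK that(1), of y] part_eq_iff[OF M hN[OF that(1)], of "h y"] that subgrp_diff[OF G]
    by (simp add: h)
  show "card (parts {x \<in> G. h x \<in> M} G) = card (parts M ?N)"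
    "finite (parts {x \<in> G. h x \<in> M} G) \<longleftrightarrow> finite (parts M ?N)"
    unfolding im unfolding parts_def using card_image_same_kernel[of G, OF k] by auto
qed

lemma card_parts_coset:
  assumes G: "subgrp G" "G \<subseteq> F" and H: "subgrp H" "H \<subseteq> G" and F: "subgrp F" and C: "C \<in> parts G F"
  shows "card (parts H C) = card (parts H G)" "finite (parts H C) \<longleftrightarrow> finite (parts H G)"
proof -
  obtain r where r: "r \<in> F" "C = part G F r" using C by (auto simp: parts_def)
  have "C = (\<lambda>x. r + x) ` G"
  proof (intro set_eqI iffI)
    fix y assume "y \<in> C"
    then have "y - r \<in> G" by (simp add: r part_def)
    then show "y \<in> (\<lambda>x. r + x) ` G" by (intro image_eqI[of _ _ "y - r"]) auto
  qed (use r G F subgrp_add in \<open>auto simp: part_def\<close>)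
  then have "parts H C = (\<lambda>x. part H C (r + x)) ` G" by (simp add: parts_def image_image)
  moreover have k: "part H G x = part H G y \<longleftrightarrow> part H C (r + x) = part H C (r + y)" if "x \<in> G" "y \<in> G" for x y
    using part_eq_iff[OF H(1) that(1), of y] part_eq_iff[OF H(1), of "r + x" C "r + y"] that \<open>C = (\<lambda>x. r + x) ` G\<close>
    by auto
  ultimately show "card (parts H C) = card (parts H G)" "finite (parts H C) \<longleftrightarrow> finite (parts H G)"
    using card_image_same_kernel[of G, OF k] by (auto simp: parts_def)
qed

lemma card_parts_tower:
  assumes G: "subgrp G" "G \<subseteq> F" and H: "subgrp H" "H \<subseteq> G" and F: "subgrp F"
    and fin: "finite (parts G F)" "finite (parts H G)"
  shows "card (parts H F) = card (parts G F) * card (parts H G)" "finite (parts H F)"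
proof -
  have u: "parts H F = (\<Union>C\<in>parts G F. parts H C)" using parts_refine[OF H(2) G(1)] .
  show "finite (parts H F)" unfolding u using fin card_parts_coset(2)[OF G H F] by auto
  have "card (parts H F) = (\<Sum>C\<in>parts G F. card (parts H C))"
    unfolding u
  proof (rule card_UN_disjoint)
    show "\<forall>C\<in>parts G F. \<forall>D\<in>parts G F. C \<noteq> D \<longrightarrow> parts H C \<inter> parts H D = {}"
    proof (intro ballI impI equals0I)
      fix C D E assume CD: "C \<in> parts G F" "D \<in> parts G F" "C \<noteq> D" and E: "E \<in> parts H C \<inter> parts H D"
      then obtain x where "x \<in> E" using parts_nonempty[OF H(1)] by blast
      then have "x \<in> C \<inter> D" using E parts_subset by blast
      then show False using parts_disjoint[OF G(1) CD] by simp
    qed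
  qed (use fin card_parts_coset(2)[OF G H F] in auto)
  then show "card (parts H F) = card (parts G F) * card (parts H G)"
    using card_parts_coset(1)[OF G H F] by simp
qed

lemma parts_finite_mono:
  assumes "subgrp H" "subgrp G" "H \<subseteq> G" "finite (parts H UNIV)"
  shows "finite (parts G UNIV)" "finite (parts H G)" "card (parts G UNIV) \<le> card (parts H UNIV)"
proof -
  define p where "p C = part G UNIV (SOME x. x \<in> C)" for C
  have "parts G UNIV = p ` parts H UNIV"
  proof (intro set_eqI iffI)
    fix D assume "D \<in> parts G UNIV"
    then obtain x where x: "D = part G UNIV x" by (auto simp: parts_def)
    have "x \<in> part H UNIV x" using part_self[OF assms(1)] by simp
    then have "(SOME y. y \<in> part H UNIV x) \<in> part H UNIV x" by (rule someI)
    then have "(SOME y. y \<in> part H UNIV x) - x \<in> G" using assms(3) by (auto simp: part_def)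
    then have "p (part H UNIV x) = D" unfolding x p_def by (rule part_eqI[OF assms(2)])
    then show "D \<in> p ` parts H UNIV" by (auto simp: parts_def)
  qed (auto simp: p_def parts_def)
  then show "finite (parts G UNIV)" "card (parts G UNIV) \<le> card (parts H UNIV)"
    using assms(4) by (auto intro: card_image_le)
  have "G \<in> parts G UNIV" by (auto simp: parts_def part_def intro!: image_eqI[of _ _ 0])
  then have "parts H G \<subseteq> parts H UNIV" using parts_refine[OF assms(3,2), of UNIV] by blast
  then show "finite (parts H G)" using assms(4) finite_subset by blast
qed

lemma subgrp_image:
  assumes "\<And>x y. h (x - y) = h x - h y" "subgrp G"
  shows "subgrp (h ` G)"
  unfolding subgrp_def
proof (intro conjI ballI)
  have "h 0 = 0" using assms(1)[of 0 0] by simp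
  then show "0 \<in> h ` G" using subgrp_zero[OF assms(2)] by force
next
  fix x y assume "x \<in> h ` G" "y \<in> h ` G"
  then obtain u v where uv: "u \<in> G" "v \<in> G" "x = h u" "y = h v" by blast
  then have "x - y = h (u - v)" by (simp add: assms(1))
  then show "x - y \<in> h ` G" using subgrp_diff[OF assms(2) uv(1,2)] by blast
qed

lemma subgrp_plus: "subgrp G \<Longrightarrow> subgrp H \<Longrightarrow> subgrp (G + H)"
proof -
  assume a: "subgrp G" "subgrp H"
  have "x - y \<in> G + H" if xy: "x \<in> G + H" "y \<in> G + H" for x y
  proof -
    obtain g h g' h' where "g \<in> G" "h \<in> H" "x = g + h" "g' \<in> G" "h' \<in> H" "y = g' + h'"
      using xy by (auto elim!: set_plus_elim)
    then have "x - y = (g - g') + (h - h')" "g - g' \<in> G" "h - h' \<in> H" using a subgrp_diff by auto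
    then show ?thesis by (metis set_plus_intro)
  qed
  moreover have "0 \<in> G + H" using set_plus_intro[of 0 G 0 H] a subgrp_zero by auto
  ultimately show ?thesis by (simp add: subgrp_def)
qed

lemma finite_parts_of_multiple:
  fixes G :: "(int^'n) set"
  assumes G: "subgrp G" and c: "0 < c" "\<And>x. c *s x \<in> G"
  shows "finite (parts G UNIV)"
proof -
  let ?B = "{x :: int^'n. \<forall>i. x $ i \<in> {0..<c}}"
  have "finite ?B"
  proof -
    have "?B \<subseteq> vec_lambda ` (UNIV \<rightarrow>\<^sub>E {0..<c})" by (auto intro!: image_eqI[where x="vec_nth _"])
    then show ?thesis by (rule finite_subset) (auto intro!: finite_PiE)
  qed
  moreover have "parts G UNIV \<subseteq> part G UNIV ` ?B"
  proof
    fix C assume "C \<in> parts G UNIV"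
    then obtain x where x: "C = part G UNIV x" by (auto simp: parts_def)
    define y where "y = (\<chi> i. x $ i mod c)"
    have "x - y = c *s (\<chi> i. x $ i div c)" by (simp add: vec_eq_iff y_def minus_mod_eq_mult_div)
    then have "C = part G UNIV y" using x part_eqI[OF G] c(2) by metis
    moreover have "y \<in> ?B" using c(1) by (simp add: y_def)
    ultimately show "C \<in> part G UNIV ` ?B" by blast
  qed
  ultimately show ?thesis using finite_surj by blast
qed

text \<open>\<open>h\<close> supplies an order on the index type. A permutation with nonzero product
  never lowers \<open>h\<close>; since it preserves the sum of \<open>h\<close>, it fixes every
  value, and only the identity survives.\<close>

lemma det_triangular:
  fixes Q :: "int^'n^'n" and h :: "'n \<Rightarrow> nat"
  assumes h: "inj h" and z: "\<And>i k. h k < h i \<Longrightarrow> Q $ i $ k = 0"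
  shows "det Q = (\<Prod>i\<in>UNIV. Q $ i $ i)"
proof -
  have "(\<Prod>i\<in>UNIV. Q $ i $ p i) = 0" if p: "p permutes UNIV" "p \<noteq> id" for p
  proof (rule ccontr)
    assume "(\<Prod>i\<in>UNIV. Q $ i $ p i) \<noteq> 0"
    then have "Q $ i $ p i \<noteq> 0" for i by (auto simp: prod_zero_iff)
    then have le: "h i \<le> h (p i)" for i using z by (meson linorder_not_less)
    have "(\<Sum>i\<in>UNIV. h (p i)) = (\<Sum>i\<in>UNIV. h i)" using sum.permute[OF p(1), of h] by (simp add: o_def)
    then have "\<not> (\<exists>i. h i < h (p i))"
      using sum_strict_mono_ex1[of UNIV h "\<lambda>i. h (p i)"] le by auto
    then have "h (p i) = h i" for i using le by (metis le_neq_implies_less)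
    then have "p i = i" for i using h by (meson injD)
    then show False using p(2) by auto
  qed
  then have "det Q = (\<Sum>p\<in>{id}. of_int (sign p) * (\<Prod>i\<in>UNIV. Q $ i $ p i))"
    unfolding det_def by (intro sum.mono_neutral_right) (auto simp: permutes_id)
  then show ?thesis by simp
qed

lemma int_mult_smult: "(L :: int^'n^'m) *v (c *s x) = c *s (L *v x)"
  by (simp add: vec_eq_iff matrix_vector_mult_def sum_distrib_left mult_ac)

text \<open>Hermite normal form. In the order given by \<open>h\<close>, the vector
  \<open>q k\<close> of \<open>G\<close> vanishes at all coordinates above k and has the least
  positive k-th entry \<open>g k\<close>. The box with sides \<open>g i\<close> represents each
  coset once, so the index is the product of the diagonal entries.\<close>

lemma lattice_basis:
  fixes G :: "(int^'n) set"
  assumes G: "subgrp G" and fin: "finite (parts G UNIV)"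
  obtains Q :: "int^'n^'n" where "G = range ((*v) Q)" "\<bar>det Q\<bar> = int (card (parts G UNIV))"
proof -
  obtain h :: "'n \<Rightarrow> nat" where h: "inj h"
    using finite_imp_inj_to_nat_seg[of "UNIV :: 'n set"] by auto
  define GG where "GG k = {x \<in> G. \<forall>i. h k < h i \<longrightarrow> x $ i = 0}" for k
  \<comment> \<open>Finite index puts two different multiples of a coordinate vector in one coset,
    hence a positive multiple into \<open>G\<close>.\<close>
  have ex: "\<exists>n>0. \<exists>x\<in>GG k. x $ k = int n" for k
  proof -
    have "\<not> inj (\<lambda>j::nat. part G UNIV (axis k (int j)))"
    proof
      assume "inj (\<lambda>j::nat. part G UNIV (axis k (int j)))"
      then have "infinite (range (\<lambda>j::nat. part G UNIV (axis k (int j))))" by (rule range_inj_infinite)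
      moreover have "range (\<lambda>j::nat. part G UNIV (axis k (int j))) \<subseteq> parts G UNIV" by (auto simp: parts_def)
      ultimately show False using fin finite_subset by blast
    qed
    then obtain i j where ij: "i \<noteq> j" "part G UNIV (axis k (int i)) = part G UNIV (axis k (int j))"
      by (auto simp: inj_def)
    have *: "axis k (int i) - axis k (int j) \<in> G" "axis k (int j) - axis k (int i) \<in> G"
      using ij part_eq_iff[OF G] subgrp_diff_swap[OF G] by auto
    have "axis k (int (max i j - min i j)) \<in> G"
    proof -
      have "axis k (int (max i j - min i j)) = axis k (int (max i j)) - axis k (int (min i j))"
        by (simp add: vec_eq_iff axis_def of_nat_diff)
      then show ?thesis using * by (cases "i \<le> j") (auto simp: max_def min_def)
    qed
    moreover have "0 < max i j - min i j" using ij(1) by (auto simp: max_def min_def)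
    ultimately show ?thesis
      by (intro exI[of _ "max i j - min i j"] conjI bexI[of _ "axis k (int (max i j - min i j))"])
        (auto simp: GG_def axis_def)
  qed
  define g where "g k = (LEAST n. 0 < n \<and> (\<exists>x\<in>GG k. x $ k = int n))" for k
  have g: "0 < g k" "\<exists>x\<in>GG k. x $ k = int (g k)" for k
    using LeastI_ex[OF ex[of k]] unfolding g_def by auto
  have gmin: "g k \<le> n" if "0 < n" "x \<in> GG k" "x $ k = int n" for k n x
    unfolding g_def by (rule Least_le) (use that in auto)
  obtain q where q: "\<And>k. q k \<in> GG k" "\<And>k. q k $ k = int (g k)" using g(2) by metis
  have qG: "q k \<in> G" for k using q(1) by (simp add: GG_def)
  have q0: "q k $ i = 0" if "h k < h i" for k i using q(1) that by (simp add: GG_def)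
  define Q where "Q = (\<chi> i k. q k $ i)"
  have Qv: "Q *v y = (\<Sum>k\<in>UNIV. y $ k *s q k)" for y
    by (simp add: Q_def vec_eq_iff matrix_vector_mult_def mult.commute)
  have nmul: "int n *s x \<in> G" if "x \<in> G" for n x
    using that by (induction n) (auto simp: subgrp_zero[OF G] vector_sadd_rdistrib intro: subgrp_add[OF G])
  have mul: "m *s x \<in> G" if "x \<in> G" for m x
  proof (cases m)
    case (nonneg n) then show ?thesis using nmul that by simp
  next
    case (neg n)
    then have e: "m *s x = - (int (Suc n) *s x)" by (simp only: vector_smult_lneg)
    show ?thesis unfolding e by (rule subgrp_minus[OF G nmul[OF that]])
  qed
  have sums: "(\<Sum>k\<in>S. y $ k *s q k) \<in> G" for y S
  proof (induction S rule: infinite_finite_induct)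
    case (insert k S)
    then show ?case using subgrp_add[OF G mul[OF qG, of "y $ k" k] insert.IH] by simp
  qed (simp_all add: subgrp_zero[OF G])
  have rG: "range ((*v) Q) \<subseteq> G" using sums Qv by auto
  have dvd: "x $ k = 0" if x: "x \<in> GG k" "\<bar>x $ k\<bar> < int (g k)" for x k
  proof (rule ccontr)
    assume n: "x $ k \<noteq> 0"
    define x' where "x' = (if x $ k > 0 then x else - x)"
    have "x' \<in> GG k" using x(1) subgrp_minus[OF G] by (auto simp: x'_def GG_def)
    moreover have "x' $ k = int (nat \<bar>x $ k\<bar>)" by (simp add: x'_def)
    ultimately have "g k \<le> nat \<bar>x $ k\<bar>" using n by (intro gmin[of _ x']) auto
    then show False using x(2) by linarith
  qed
  let ?B = "{x :: int^'n. \<forall>i. x $ i \<in> {0..<int (g i)}}"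
  have red: "\<exists>y. x - Q *v y \<in> ?B" for x
  proof -
    define m where "m = Suc (Max (range h))"
    have hm: "h i < m" for i by (simp add: m_def less_Suc_eq_le)
    \<comment> \<open>Coordinates are reduced from the top down: \<open>q k\<close> vanishes above
      k, so correcting coordinate k spares those already reduced. As \<open>m\<close> exceeds all
      values of \<open>h\<close>, n = 0 asks for nothing and n = \<open>m\<close> for
      everything.\<close>
    have "\<exists>y. \<forall>i. m - n \<le> h i \<longrightarrow> (x - Q *v y) $ i \<in> {0..<int (g i)}" for n
    proof (induction n)
      case 0
      then show ?case using hm by (metis diff_zero leD)
    next
      case (Suc n)
      then obtain y where y: "\<And>i. m - n \<le> h i \<Longrightarrow> (x - Q *v y) $ i \<in> {0..<int (g i)}" by blast
      show ?case
      proof (cases "\<exists>k. h k = m - Suc n \<and> h k < m - n")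
        case True
        then obtain k where k: "h k = m - Suc n" "h k < m - n" by blast
        define t where "t = (x - Q *v y) $ k div int (g k)"
        define y' where "y' = y + t *s axis k 1"
        have "(Q *v axis k 1) $ i = q k $ i" for i
        proof -
          have "(Q *v axis k 1) $ i = (\<Sum>j\<in>UNIV. q j $ i * (if j = k then 1 else 0))"
            by (simp add: matrix_vector_mult_def Q_def axis_def)
          also have "\<dots> = (\<Sum>j\<in>UNIV. if j = k then q j $ i else 0)" by (rule sum.cong) auto
          finally show ?thesis by simp
        qed
        then have "Q *v axis k 1 = q k" by (simp add: vec_eq_iff)
        then have e: "x - Q *v y' = (x - Q *v y) - t *s q k"
          by (simp add: y'_def matrix_vector_right_distrib int_mult_smult)
        have "(x - Q *v y') $ i \<in> {0..<int (g i)}" if i: "m - Suc n \<le> h i" for i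
        proof (cases "i = k")
          case True
          have "(x - Q *v y') $ k = (x - Q *v y) $ k mod int (g k)"
            unfolding e by (simp add: q(2) t_def minus_div_mult_eq_mod)
          then show ?thesis using g(1)[of k] True by simp
        next
          case False
          then have "h k < h i" using i k h by (metis injD le_neq_implies_less)
          then have "(x - Q *v y') $ i = (x - Q *v y) $ i" unfolding e by (simp add: q0)
          moreover have "m - n \<le> h i" using \<open>h k < h i\<close> k by linarith
          ultimately show ?thesis using y by metis
        qed
        then show ?thesis by blast
      next
        case False
        have "m - n \<le> h i" if "m - Suc n \<le> h i" for i
        proof (rule ccontr)
          assume "\<not> m - n \<le> h i"
          then have "h i = m - Suc n \<and> h i < m - n" using that by linarith
          then show False using False by blast
        qed
        then show ?thesis using y by blast
      qed
    qed
    from this[of m] show ?thesis by auto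
  qed
  have uniq: "z = z'" if z: "z \<in> ?B" "z' \<in> ?B" "z - z' \<in> G" for z z'
  proof (rule ccontr)
    assume "z \<noteq> z'"
    then have ne: "{i. z $ i \<noteq> z' $ i} \<noteq> {}" by (auto simp: vec_eq_iff)
    obtain k where k: "k \<in> {i. z $ i \<noteq> z' $ i}" "\<And>i. i \<in> {i. z $ i \<noteq> z' $ i} \<Longrightarrow> h i \<le> h k"
      by (rule finite_obtain_max[OF _ ne, of h]) auto
    have "z $ i = z' $ i" if "h k < h i" for i using k(2)[of i] that by force
    then have "z - z' \<in> GG k" using z(3) by (simp add: GG_def)
    moreover have "0 \<le> z $ k" "z $ k < int (g k)" "0 \<le> z' $ k" "z' $ k < int (g k)"
      using z(1,2) by auto
    then have "\<bar>(z - z') $ k\<bar> < int (g k)" by simp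
    ultimately have "(z - z') $ k = 0" by (rule dvd)
    then show False using k(1) by simp
  qed
  have "G = range ((*v) Q)"
  proof
    show "G \<subseteq> range ((*v) Q)"
    proof
      fix x assume x: "x \<in> G"
      obtain y where y: "x - Q *v y \<in> ?B" using red by blast
      have "x - Q *v y - 0 \<in> G" using x rG subgrp_diff[OF G] by auto
      moreover have "0 \<in> ?B" using g(1) by simp
      ultimately have "x - Q *v y = 0" using uniq[OF y] by blast
      then show "x \<in> range ((*v) Q)" by auto
    qed
  qed (rule rG)
  moreover have "card (parts G UNIV) = card ?B"
  proof -
    have "bij_betw (part G UNIV) ?B (parts G UNIV)"
    proof (rule bij_betw_imageI)
      show "inj_on (part G UNIV) ?B" using uniq part_eq_iff[OF G] by (auto intro!: inj_onI)
      show "part G UNIV ` ?B = parts G UNIV"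
      proof
        show "parts G UNIV \<subseteq> part G UNIV ` ?B"
        proof
          fix C assume "C \<in> parts G UNIV"
          then obtain x where x: "C = part G UNIV x" by (auto simp: parts_def)
          obtain y where y: "x - Q *v y \<in> ?B" using red by blast
          have "C = part G UNIV (x - Q *v y)" unfolding x using rG by (intro part_eqI[OF G]) auto
          then show "C \<in> part G UNIV ` ?B" using y by blast
        qed
      qed (auto simp: parts_def)
    qed
    from bij_betw_same_card[OF this] show ?thesis by simp
  qed
  moreover have "card ?B = (\<Prod>i\<in>UNIV. g i)"
  proof -
    have "bij_betw vec_lambda (\<Pi>\<^sub>E i\<in>UNIV. {0..<int (g i)}) ?B"
      by (rule bij_betwI[where g=vec_nth]) (auto simp: PiE_UNIV_domain)
    from bij_betw_same_card[OF this] show ?thesis by (simp add: card_PiE)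
  qed
  moreover have "det Q = (\<Prod>i\<in>UNIV. int (g i))"
    using det_triangular[OF h, of Q] q0 q(2) by (simp add: Q_def)
  ultimately show thesis using that[of Q] by (simp add: prod_nonneg)
qed

section \<open>Tight lattices and coprimality\<close>

definition idx :: "'g::ab_group_add set \<Rightarrow> nat" where
  "idx G = card (parts G UNIV)"

text \<open>For the two maps \<open>f\<close> and \<open>g\<close>, \<open>pre f g G\<close> is the
  sublattice T1 (its cosets are called rows below) and \<open>pre g f G\<close> is T2
  (columns).\<close>

definition pre :: "('g \<Rightarrow> 'g) \<Rightarrow> ('g \<Rightarrow> 'g) \<Rightarrow> 'g::ab_group_add set \<Rightarrow> 'g set" where
  "pre f g G = {x \<in> G. f x \<in> g ` G}"

text \<open>Coprimality bounds the index of f G + g G by that of \<open>G\<close> for each subgroup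
  of finite index, see \<open>coprime_idx_le\<close>. Tight lattices are the case of equality, in
  which T1 and T2 get exactly the expected indices.\<close>

definition tight :: "('g \<Rightarrow> 'g) \<Rightarrow> ('g \<Rightarrow> 'g) \<Rightarrow> 'g::ab_group_add set \<Rightarrow> bool" where
  "tight f g G \<longleftrightarrow> subgrp G \<and> finite (parts G UNIV) \<and> idx (f ` G + g ` G) = idx G"

text \<open>\<open>A\<close> generates \<open>G\<close> modulo T2, up to translation. Only subgroups
  above T2 are tested: those between T2 and a tight \<open>G\<close> are tight again by
  \<open>tight_between\<close>, so minimality of \<open>G\<close> among tight lattices provides this
  property.\<close>

definition gen :: "('g \<Rightarrow> 'g) \<Rightarrow> ('g \<Rightarrow> 'g) \<Rightarrow> 'g::ab_group_add set \<Rightarrow> 'g set \<Rightarrow> bool" where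
  "gen f g G A \<longleftrightarrow> (\<forall>M. subgrp M \<and> pre g f G \<subseteq> M \<and> M \<subseteq> G \<and> in_coset M A \<longrightarrow> M = G)"

lemma tight_swap: "tight f g G \<longleftrightarrow> tight g f G" by (simp add: tight_def add.commute)

lemma pre_subset: "pre f g G \<subseteq> G" by (auto simp: pre_def)

lemma subgrp_pre:
  assumes "\<And>x y. f (x - y) = f x - f y" "\<And>x y. g (x - y) = g x - g y" "subgrp G"
  shows "subgrp (pre f g G)"
proof -
  have gG: "subgrp (g ` G)" using assms by (intro subgrp_image) auto
  have "f 0 = 0" using assms(1)[of 0 0] by simp
  then show ?thesis
    unfolding pre_def subgrp_def[of "{x \<in> G. f x \<in> g ` G}"]
    using subgrp_zero[OF assms(3)] subgrp_diff[OF assms(3)] subgrp_zero[OF gG] subgrp_diff[OF gG]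
    by (simp add: assms(1))
qed

lemma image_pre: "f ` pre f g G = g ` pre g f G" by (auto simp: pre_def image_iff) metis+

lemma idx_pos: "finite (parts G UNIV) \<Longrightarrow> 0 < idx G"
  by (auto simp: idx_def parts_def card_gt_0_iff)

lemma idx_tower:
  assumes "subgrp H" "subgrp G" "H \<subseteq> G" "finite (parts H UNIV)"
  shows "idx H = idx G * card (parts H G)"
  using card_parts_tower(1)[of G UNIV H] parts_finite_mono[OF assms] assms
  by (simp add: idx_def subgrp_UNIV)

lemma eq_of_idx_le:
  assumes "subgrp H" "subgrp G" "H \<subseteq> G" "finite (parts H UNIV)" "idx H \<le> idx G"
  shows "H = G"
proof -
  have "idx G * card (parts H G) \<le> idx G * 1" using idx_tower[OF assms(1-4)] assms(5) by simp
  moreover have "0 < idx G" using idx_pos parts_finite_mono(1)[OF assms(1-4)] by blast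
  ultimately have c: "card (parts H G) \<le> 1" by simp
  have "x \<in> H" if x: "x \<in> G" for x
  proof -
    have "part H G x \<in> parts H G" "part H G 0 \<in> parts H G"
      using x subgrp_zero[OF assms(2)] by (auto intro: part_in_parts)
    then have "part H G x = part H G 0"
      using c parts_finite_mono(2)[OF assms(1-4)] card_le_Suc0_iff_eq by (metis One_nat_def)
    then show ?thesis using part_eq_iff[OF assms(1) x, of 0] by simp
  qed
  then show ?thesis using assms(3) by blast
qed

lemma rat_common_denominator:
  fixes S :: "rat set"
  assumes "finite S"
  obtains c :: int where "0 < c" "\<And>r. r \<in> S \<Longrightarrow> of_int c * r \<in> \<int>"
proof -
  define c where "c = (\<Prod>r\<in>S. snd (quotient_of r))"
  have pos: "0 < c" unfolding c_def by (intro prod_pos) (simp add: quotient_of_denom_pos')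
  have "of_int c * r \<in> \<int>" if r: "r \<in> S" for r
  proof -
    obtain p q where pq: "quotient_of r = (p, q)" by fastforce
    then have q: "0 < q" "r = of_int p / of_int q" using quotient_of_denom_pos quotient_of_div by auto
    have "q dvd c" unfolding c_def using dvd_prodI[OF assms r, of "\<lambda>r. snd (quotient_of r)"] pq by simp
    then obtain k where "c = q * k" by (auto simp: dvd_def)
    then have "of_int c * r = of_int (k * p)" using q by simp
    then show ?thesis by simp
  qed
  then show thesis using that pos by blast
qed

lemma mult_axis_nth:
  fixes N :: "'a::comm_ring_1^'n^'m"
  shows "(N *v axis j 1) $ i = N $ i $ j"
proof -
  have "(N *v axis j 1) $ i = (\<Sum>k\<in>UNIV. N $ i $ k * (if k = j then 1 else 0))"
    by (simp add: matrix_vector_mult_def axis_def)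
  also have "\<dots> = (\<Sum>k\<in>UNIV. if k = j then N $ i $ k else 0)" by (rule sum.cong) auto
  finally show ?thesis by simp
qed

lemma multiple_in_range:
  fixes L :: "int^'n^'n"
  assumes "det L \<noteq> 0"
  obtains c where "0 < c" "\<And>x. c *s x \<in> range ((*v) L)"
proof -
  have "det (rat_mat L) \<noteq> 0" using assms by (simp add: det_rat_mat)
  then obtain S where S: "rat_mat L ** S = mat 1" using invertible_det_nz by (auto simp: invertible_def)
  obtain c :: int where c: "0 < c" "\<And>r. r \<in> (\<lambda>(i, j). S $ i $ j) ` UNIV \<Longrightarrow> of_int c * r \<in> \<int>"
    using rat_common_denominator[of "(\<lambda>(i, j). S $ i $ j) ` UNIV"] by auto
  define M where "M = (\<chi> i j. \<lfloor>of_int c * S $ i $ j\<rfloor>)"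
  have M: "of_int (M $ i $ j) = of_int c * S $ i $ j" for i j
  proof -
    have "S $ i $ j \<in> (\<lambda>(i, j). S $ i $ j) ` UNIV" by (rule image_eqI[of _ _ "(i, j)"]) auto
    then show ?thesis using c(2) by (auto simp: M_def elim!: Ints_cases)
  qed
  have "rv (M *v x) = of_int c *s (S *v rv x)" for x
    by (simp add: rv_def vec_eq_iff matrix_vector_mult_def M sum_distrib_left mult_ac)
  then have "rv (L *v (M *v x)) = of_int c *s (rat_mat L *v (S *v rv x))" for x
    by (simp only: rv_mult[of L] vector_scalar_commute)
  then have "rv (L *v (M *v x)) = rv (c *s x)" for x
    by (simp only: matrix_vector_mul_assoc S rv_smult matrix_vector_mul_lid)
  then have "c *s x = L *v (M *v x)" for x by simp
  then show thesis using that[of c] c(1) by (metis rangeI)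
qed

lemma mv_diff: "(L :: int^'n^'n) *v (x - y) = L *v x - L *v y"
  by (rule matrix_vector_mult_diff_distrib)

text \<open>\<open>L\<close> and a normal-form basis \<open>Q\<close> of the same lattice are
  integral multiples of each other, so their determinants divide each other; for \<open>Q\<close>
  the index is already known.\<close>

lemma idx_range:
  fixes L :: "int^'n^'n"
  assumes "det L \<noteq> 0"
  shows "finite (parts (range ((*v) L)) UNIV)" "int (idx (range ((*v) L))) = \<bar>det L\<bar>"
proof -
  have s: "subgrp (range ((*v) L))" by (intro subgrp_image subgrp_UNIV mv_diff)
  obtain c where c: "0 < c" "\<And>x. c *s x \<in> range ((*v) L)" using multiple_in_range[OF assms] by blast
  show fin: "finite (parts (range ((*v) L)) UNIV)" using finite_parts_of_multiple[OF s c] .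
  obtain Q where Q: "range ((*v) L) = range ((*v) Q)" "\<bar>det Q\<bar> = int (idx (range ((*v) L)))"
    using lattice_basis[OF s fin] unfolding idx_def by metis
  have fac: "\<exists>U. A = B ** U" if r: "range ((*v) A) \<subseteq> range ((*v) B)" for A B :: "int^'n^'n"
  proof -
    have "\<forall>j. \<exists>u. column j A = B *v u"
    proof
      fix j
      have "A *v axis j 1 \<in> range ((*v) B)" using r by blast
      moreover have "A *v axis j 1 = column j A"
        by (simp add: vec_eq_iff column_def mult_axis_nth)
      ultimately show "\<exists>u. column j A = B *v u" by auto
    qed
    then obtain u where u: "\<And>j. column j A = B *v u j" by metis
    have "A = B ** (\<chi> i j. u j $ i)"
      using u by (simp add: vec_eq_iff column_def matrix_vector_mult_def matrix_matrix_mult_def)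
    then show ?thesis by blast
  qed
  obtain U where U: "L = Q ** U" using fac[of L Q] Q(1) by auto
  obtain U' where U': "Q = L ** U'" using fac[of Q L] Q(1) by auto
  have "\<bar>det L\<bar> dvd \<bar>det Q\<bar>" "\<bar>det Q\<bar> dvd \<bar>det L\<bar>"
    using U U' by (metis abs_dvd_iff dvd_abs_iff det_mul dvd_triv_left)+
  then show "int (idx (range ((*v) L))) = \<bar>det L\<bar>" using Q(2) by (metis abs_ge_zero zdvd_antisym_nonneg)
qed

lemma idx_image:
  fixes L :: "int^'n^'n"
  assumes det: "det L \<noteq> 0" and G: "subgrp G" "finite (parts G UNIV)"
  shows "finite (parts ((*v) L ` G) UNIV)" "int (idx ((*v) L ` G)) = \<bar>det L\<bar> * int (idx G)"
proof -
  let ?R = "range ((*v) L)" and ?H = "(*v) L ` G"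
  have sH: "subgrp ?H" using G(1) by (intro subgrp_image mv_diff)
  have sR: "subgrp ?R" by (intro subgrp_image subgrp_UNIV mv_diff)
  have inj: "inj ((*v) L)" by (rule inj_int_mult_of_det[OF det])
  have "{x \<in> UNIV. L *v x \<in> ?H} = G" using inj by (auto dest: injD)
  moreover have "range ((*v) L) + ?H = ?R"
  proof
    show "?R + ?H \<subseteq> ?R" using subgrp_add[OF sR] by (auto elim!: set_plus_elim)
    show "?R \<subseteq> ?R + ?H" using subgrp_zero[OF sH] set_plus_intro[of _ ?R 0 ?H] by auto
  qed
  ultimately have c: "card (parts G UNIV) = card (parts ?H ?R)" "finite (parts ?H ?R)"
    using parts_hom[of "(*v) L" UNIV ?H, OF mv_diff subgrp_UNIV sH] G(2) by simp_all
  note tw = card_parts_tower[of ?R UNIV ?H, OF sR _ sH _ subgrp_UNIV idx_range(1)[OF det] c(2)]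
  show "finite (parts ?H UNIV)" by (rule tw(2)) auto
  have "idx ?H = idx ?R * idx G" unfolding idx_def c(1) by (rule tw(1)) auto
  then show "int (idx ?H) = \<bar>det L\<bar> * int (idx G)" using idx_range(2)[OF det] by simp
qed

text \<open>Take bases \<open>Q\<close> of \<open>G\<close> and \<open>Q'\<close> of the sum
  lattice. With \<open>P\<close> the inverse of \<open>Q'\<close>, the products P L1 Q and P L2 Q
  are integral, and |det P det Q| is the index of \<open>G\<close> divided by that of the sum.
  Coprimality forbids a value below 1.\<close>

lemma coprime_idx_le:
  fixes L1 L2 :: "int^'n^'n"
  assumes cop: "coprime_pair L1 L2" and det: "det L1 \<noteq> 0" and G: "subgrp G" "finite (parts G UNIV)"
  shows "finite (parts ((*v) L1 ` G + (*v) L2 ` G) UNIV)" "idx ((*v) L1 ` G + (*v) L2 ` G) \<le> idx G"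
proof -
  let ?H = "(*v) L1 ` G + (*v) L2 ` G"
  have s1: "subgrp ((*v) L1 ` G)" "subgrp ((*v) L2 ` G)" using G(1) by (auto intro!: subgrp_image mv_diff)
  then have sH: "subgrp ?H" by (rule subgrp_plus)
  have sub1: "(*v) L1 ` G \<subseteq> ?H" and sub2: "(*v) L2 ` G \<subseteq> ?H"
    using subgrp_zero[OF s1(2)] subgrp_zero[OF s1(1)] set_plus_intro[of _ "(*v) L1 ` G" 0 "(*v) L2 ` G"]
      set_plus_intro[of 0 "(*v) L1 ` G" _ "(*v) L2 ` G"] by auto
  show fin: "finite (parts ?H UNIV)"
    using parts_finite_mono(1)[OF s1(1) sH sub1] idx_image(1)[OF det G] by blast
  obtain Q where Q: "G = range ((*v) Q)" "\<bar>det Q\<bar> = int (idx G)"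
    using lattice_basis[OF G] unfolding idx_def by metis
  obtain Q' where Q': "?H = range ((*v) Q')" "\<bar>det Q'\<bar> = int (idx ?H)"
    using lattice_basis[OF sH fin] unfolding idx_def by metis
  have p: "0 < idx G" "0 < idx ?H" using idx_pos G(2) fin by auto
  have d: "det Q \<noteq> 0" "det Q' \<noteq> 0" using p Q(2) Q'(2) by auto
  have "det (rat_mat Q') \<noteq> 0" using d by (simp add: det_rat_mat)
  then obtain P where P: "P ** rat_mat Q' = mat 1" using invertible_det_nz by (auto simp: invertible_def)
  have im: "int_matrix (P ** rat_mat L ** rat_mat Q)" if L: "(*v) L ` G \<subseteq> ?H" for L
    unfolding int_matrix_def
  proof (intro allI)
    fix i j
    have "L *v (Q *v axis j 1) \<in> ?H" using L Q(1) by auto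
    then obtain y where y: "L *v (Q *v axis j 1) = Q' *v y" using Q'(1) by auto
    have "(P ** rat_mat L ** rat_mat Q) *v rv (axis j 1) = P *v rv (L *v (Q *v axis j 1))"
      by (simp only: rv_mult matrix_vector_mul_assoc[symmetric])
    also have "\<dots> = rv y" unfolding y using P by (simp add: rv_mult matrix_vector_mul_assoc)
    finally have "(P ** rat_mat L ** rat_mat Q) *v rv (axis j 1) = rv y" .
    moreover have "rv (axis j 1) = axis j 1" by (simp add: rv_def axis_def vec_eq_iff)
    moreover have "(N *v axis j 1) $ i = N $ i $ j" for N :: "rat^'n^'n"
      by (rule mult_axis_nth)
    ultimately have "(P ** rat_mat L ** rat_mat Q) $ i $ j = of_int (y $ i)" by (metis rv_def vec_lambda_beta)
    then show "(P ** rat_mat L ** rat_mat Q) $ i $ j \<in> \<int>" by simp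
  qed
  have dP: "det P * of_int (det Q') = 1" using P by (metis det_I det_mul det_rat_mat)
  have "\<not> \<bar>det P * det (rat_mat Q)\<bar> < 1"
  proof
    assume lt: "\<bar>det P * det (rat_mat Q)\<bar> < 1"
    have "det P \<noteq> 0" "det (rat_mat Q) \<noteq> 0" using dP d by (auto simp: det_rat_mat)
    moreover from this have "0 < \<bar>det P * det (rat_mat Q)\<bar>" by simp
    ultimately show False using cop lt im[OF sub1] im[OF sub2] unfolding coprime_pair_def by blast
  qed
  then have ge: "1 \<le> \<bar>det P\<bar> * \<bar>of_int (det Q)\<bar>" by (simp add: det_rat_mat abs_mult)
  have one: "\<bar>det P\<bar> * \<bar>of_int (det Q')\<bar> = 1" using dP by (metis abs_mult abs_one)
  have "\<bar>of_int (det Q') :: rat\<bar> * 1 \<le> \<bar>of_int (det Q')\<bar> * (\<bar>det P\<bar> * \<bar>of_int (det Q)\<bar>)"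
    using ge by (intro mult_left_mono) auto
  also have "\<dots> = \<bar>of_int (det Q)\<bar>" using one by (simp add: mult_ac)
  finally have "\<bar>det Q'\<bar> \<le> \<bar>det Q\<bar>" by (simp flip: of_int_abs)
  then show "idx ?H \<le> idx G" using Q(2) Q'(2) by simp
qed

text \<open>Only \<open>L1\<close> is taken to be nonsingular, so that the same lemmas serve pairs
  with singular \<open>L2\<close>. Statements about the other sublattice come from exchanging the
  two matrices.\<close>

context
  fixes L1 L2 :: "int^'n^'n" and f g :: "int^'n \<Rightarrow> int^'n"
  assumes cop: "coprime_pair L1 L2" and det: "det L1 \<noteq> 0"
    and f: "f = (*v) L1" and g: "g = (*v) L2"
begin

lemma fd: "f (x - y) = f x - f y" and gd: "g (x - y) = g x - g y"
  by (simp_all add: f g mv_diff)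

lemma finj: "inj f" using inj_int_mult_of_det[OF det] by (simp add: f)

lemma tight_UNIV_pair: "tight f g UNIV"
proof -
  have p: "parts UNIV (UNIV :: (int^'n) set) = {UNIV}" by (auto simp: parts_def part_def)
  then have fin: "finite (parts UNIV (UNIV :: (int^'n) set))" "idx (UNIV :: (int^'n) set) = 1" by (simp_all add: idx_def)
  have "idx (f ` UNIV + g ` UNIV) \<le> 1" "finite (parts (f ` UNIV + g ` UNIV) UNIV)"
    using coprime_idx_le[OF cop det subgrp_UNIV fin(1)] fin(2) by (simp_all add: f g)
  then show ?thesis using fin idx_pos[of "f ` UNIV + g ` UNIV"] by (simp add: tight_def subgrp_UNIV)
qed

context
  fixes G assumes G: "tight f g G"
begin

lemma sG: "subgrp G" "finite (parts G UNIV)" and iG: "idx (f ` G + g ` G) = idx G"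
  using G by (auto simp: tight_def)

lemma sfg: "subgrp (f ` G)" "subgrp (g ` G)" "subgrp (f ` G + g ` G)"
  using sG(1) fd gd by (auto intro!: subgrp_image subgrp_plus)

lemma sub_plus: "subgrp A \<Longrightarrow> subgrp B \<Longrightarrow> A \<subseteq> A + B \<and> B \<subseteq> A + (B :: (int^'n) set)"
  using set_plus_intro[of _ A 0 B] set_plus_intro[of 0 A _ B] subgrp_zero by auto

text \<open>G / T2 corresponds to (g G + f G) / f G. The index of f G is |det L1| times that of
  \<open>G\<close>, and the sum has the index of \<open>G\<close> by tightness.\<close>

lemma card_parts_pre: "finite (parts (pre g f G) G)" "int (card (parts (pre g f G) G)) = \<bar>det L1\<bar>"
proof -
  have i: "finite (parts (f ` G) UNIV)" "int (idx (f ` G)) = \<bar>det L1\<bar> * int (idx G)"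
    using idx_image[OF det sG] by (simp_all add: f)
  have sub: "f ` G \<subseteq> g ` G + f ` G" using sub_plus sfg by blast
  have s: "subgrp (g ` G + f ` G)" using sfg(3) by (simp add: add.commute)
  have h: "card (parts (pre g f G) G) = card (parts (f ` G) (g ` G + f ` G))"
    "finite (parts (pre g f G) G) \<longleftrightarrow> finite (parts (f ` G) (g ` G + f ` G))"
    unfolding pre_def using parts_hom[of g G "f ` G", OF gd sG(1) sfg(1)] by auto
  show "finite (parts (pre g f G) G)" using h(2) parts_finite_mono(2)[OF sfg(1) s sub i(1)] by simp
  have "idx (f ` G) = idx (g ` G + f ` G) * card (parts (pre g f G) G)"
    using idx_tower[OF sfg(1) s sub i(1)] h(1) by simp
  then have "int (idx G) * int (card (parts (pre g f G) G)) = int (idx G) * \<bar>det L1\<bar>"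
    using i(2) iG by (simp add: add.commute[of "g ` G"] mult.commute flip: of_nat_mult)
  then show "int (card (parts (pre g f G) G)) = \<bar>det L1\<bar>" using idx_pos[OF sG(2)] by simp
qed

lemma spre: "subgrp (pre f g G)" "subgrp (pre g f G)"
  using subgrp_pre[of f g G, OF fd gd sG(1)] subgrp_pre[of g f G, OF gd fd sG(1)] by auto

lemma fin_pre: "finite (parts (pre g f G) UNIV)" "int (idx (pre g f G)) = \<bar>det L1\<bar> * int (idx G)"
proof -
  note t = card_parts_tower[OF sG(1) subset_UNIV spre(2) pre_subset subgrp_UNIV sG(2) card_parts_pre(1)]
  show "finite (parts (pre g f G) UNIV)" by (rule t(2))
  show "int (idx (pre g f G)) = \<bar>det L1\<bar> * int (idx G)"
    using t(1) card_parts_pre(2) by (simp add: idx_def mult.commute)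
qed

lemma image_plus: "f ` A + f ` B = f ` (A + B)"
proof -
  have "f 0 = 0" using fd[of 0 0] by simp
  then have "f (- y) = - f y" for y using fd[of 0 y] by simp
  then have fa: "f (x + y) = f x + f y" for x y using fd[of x "- y"] by simp
  show ?thesis
  proof (intro set_eqI iffI)
    fix z assume "z \<in> f ` A + f ` B"
    then obtain a b where "a \<in> A" "b \<in> B" "z = f (a + b)" by (auto elim!: set_plus_elim simp: fa)
    then show "z \<in> f ` (A + B)" using set_plus_intro by blast
  next
    fix z assume "z \<in> f ` (A + B)"
    then obtain a b where "a \<in> A" "b \<in> B" "z = f a + f b" by (auto elim!: set_plus_elim simp: fa)
    then show "z \<in> f ` A + f ` B" using set_plus_intro by blast
  qed
qed

text \<open>Let S = T1 + T2. Because f T1 = g T2, the sum lattice f T2 + g T2 equals f S, of index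
  |det L1| idx S. Coprimality applied to T2 bounds it by idx T2 = |det L1| idx G. So idx S \<le> idx
  G, which forces S = G, and the bound for T2 is an equality.\<close>

lemma pre_plus_pre: "pre f g G + pre g f G = G" and tight_pre: "tight f g (pre g f G)"
proof -
  let ?S = "pre f g G + pre g f G"
  have sS: "subgrp ?S" using spre by (rule subgrp_plus)
  have SG: "?S \<subseteq> G" using subgrp_add[OF sG(1)] by (auto elim!: set_plus_elim simp: pre_def)
  have finS: "finite (parts ?S UNIV)"
    using parts_finite_mono(1)[OF spre(2) sS _ fin_pre(1)] sub_plus[OF spre] by blast
  have e: "f ` pre g f G + g ` pre g f G = f ` ?S"
    unfolding image_pre[of f g G, symmetric] image_plus by (simp add: add.commute)
  have le: "idx (f ` ?S) \<le> idx (pre g f G)"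
    using coprime_idx_le(2)[OF cop det spre(2) fin_pre(1)] e by (simp add: f g)
  have "int (idx (f ` ?S)) = \<bar>det L1\<bar> * int (idx ?S)" using idx_image(2)[OF det sS finS] by (simp add: f)
  then have "\<bar>det L1\<bar> * int (idx ?S) \<le> \<bar>det L1\<bar> * int (idx G)" using le fin_pre(2) by linarith
  then have "idx ?S \<le> idx G" using det by simp
  then show S: "?S = G" by (rule eq_of_idx_le[OF sS sG(1) SG finS])
  have "int (idx (f ` G)) = \<bar>det L1\<bar> * int (idx G)" using idx_image(2)[OF det sG] by (simp add: f)
  then have "idx (f ` ?S) = idx (pre g f G)" using fin_pre(2) S by simp
  then show "tight f g (pre g f G)" unfolding tight_def e using spre(2) fin_pre(1) by simp
qed

text \<open>f G = f T2 + f T1 = f T2 + g T2 already lies in f M + g M, so the sum lattice of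
  \<open>M\<close> is f G + g M. The part of \<open>G\<close> that \<open>g\<close> maps into it is
  \<open>M\<close>; therefore passing from f G + g G to it multiplies the index by that of
  \<open>M\<close> in \<open>G\<close>.\<close>

lemma tight_between:
  assumes M: "subgrp M" "pre g f G \<subseteq> M" "M \<subseteq> G"
  shows "tight f g M"
proof -
  have finM: "finite (parts M UNIV)" using parts_finite_mono(1)[OF spre(2) M(1,2) fin_pre(1)] .
  have sM: "subgrp (f ` M)" "subgrp (g ` M)" using M(1) fd gd by (auto intro!: subgrp_image)
  have sH: "subgrp (f ` G + g ` M)" using sfg(1) sM(2) by (rule subgrp_plus)
  have e: "f ` M + g ` M = f ` G + g ` M"
  proof
    show "f ` M + g ` M \<subseteq> f ` G + g ` M" using M(3) by (intro set_plus_mono2) auto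
    have "f ` G = f ` pre f g G + f ` pre g f G" unfolding image_plus pre_plus_pre ..
    also have "\<dots> = g ` pre g f G + f ` pre g f G" unfolding image_pre[of f g G] ..
    also have "\<dots> \<subseteq> g ` M + f ` M" using M(2) by (intro set_plus_mono2 image_mono)
    finally have "f ` G \<subseteq> f ` M + g ` M" by (simp add: add.commute)
    moreover have "g ` M \<subseteq> f ` M + g ` M" using sub_plus[OF sM] by blast
    ultimately have "x + y \<in> f ` M + g ` M" if "x \<in> f ` G" "y \<in> g ` M" for x y
      using that by (intro subgrp_add[OF subgrp_plus[OF sM]]) auto
    then show "f ` G + g ` M \<subseteq> f ` M + g ` M" by (metis set_plus_elim subsetI)
  qed
  have k: "{x \<in> G. g x \<in> f ` G + g ` M} = M"
  proof (intro set_eqI iffI)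
    fix x assume "x \<in> {x \<in> G. g x \<in> f ` G + g ` M}"
    then obtain y m where x: "x \<in> G" "y \<in> G" "m \<in> M" "g x = f y + g m" by (auto elim!: set_plus_elim)
    then have "g (x - m) = f y" by (simp add: gd)
    then have "x - m \<in> pre g f G" using x M(3) subgrp_diff[OF sG(1)] by (auto simp: pre_def)
    then have "x - m \<in> M" using M(2) by blast
    then show "x \<in> M" using subgrp_add[OF M(1) _ x(3)] by (metis diff_add_cancel)
  next
    fix x assume "x \<in> M"
    then show "x \<in> {x \<in> G. g x \<in> f ` G + g ` M}" using M(3) sub_plus[OF sfg(1) sM(2)] by auto
  qed
  have full: "g ` G + (f ` G + g ` M) = f ` G + g ` G"
  proof
    show "g ` G + (f ` G + g ` M) \<subseteq> f ` G + g ` G"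
    proof
      fix z assume "z \<in> g ` G + (f ` G + g ` M)"
      then obtain x y m where "x \<in> G" "y \<in> G" "m \<in> M" "z = g x + (f y + g m)" by (auto elim!: set_plus_elim)
      then have z: "z = f y + (g x + g m)" "y \<in> G" by (simp_all add: algebra_simps)
      have "g x + g m \<in> g ` G" using \<open>x \<in> G\<close> \<open>m \<in> M\<close> M(3) subgrp_add[OF sfg(2)] by blast
      then show "z \<in> f ` G + g ` G" using z set_plus_intro by blast
    qed
    show "f ` G + g ` G \<subseteq> g ` G + (f ` G + g ` M)"
      using sub_plus[OF sfg(1) sM(2)] unfolding add.commute[of "f ` G" "g ` G"] by (intro set_plus_mono2) auto
  qed
  have finH: "finite (parts (f ` G + g ` M) UNIV)"
    using parts_finite_mono(1)[OF sfg(1) sH] sub_plus[OF sfg(1) sM(2)] idx_image(1)[OF det sG] f by blast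
  have "f ` G + g ` M \<subseteq> f ` G + g ` G" using M(3) by (intro set_plus_mono2) auto
  from idx_tower[OF sH sfg(3) this finH]
  have "idx (f ` G + g ` M) = idx G * card (parts M G)"
    using parts_hom(1)[of g G "f ` G + g ` M", OF gd sG(1) sH] k full iG by simp
  also have "\<dots> = idx M" using idx_tower[OF M(1) sG(1) M(3) finM] by simp
  finally show ?thesis unfolding tight_def e using M(1) finM by simp
qed

end

text \<open>Take a tight lattice of largest index with \<open>A\<close> in one coset. The indices
  are bounded because each candidate contains \<open>c\<close> times every vector. A tight
  sublattice with the same property has at least this index, so it is the same lattice.\<close>

lemma exists_gen:
  assumes c: "0 < c" and m: "\<And>G x. subgrp G \<Longrightarrow> in_coset G A \<Longrightarrow> c *s x \<in> G"
  obtains G where "tight f g G" "in_coset G A"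
    "\<And>M. tight f g M \<Longrightarrow> M \<subseteq> G \<Longrightarrow> in_coset M A \<Longrightarrow> M = G"
proof -
  define Z where "Z = range (\<lambda>x :: int^'n. c *s x)"
  have sZ: "subgrp Z" unfolding Z_def by (intro subgrp_image subgrp_UNIV) (simp add: vector_ssub_ldistrib)
  have fZ: "finite (parts Z UNIV)" by (rule finite_parts_of_multiple[OF sZ c]) (simp add: Z_def)
  have bnd: "idx G \<le> idx Z" if "tight f g G" "in_coset G A" for G
  proof -
    have sG: "subgrp G" using that(1) by (simp add: tight_def)
    have "Z \<subseteq> G" using m[OF sG that(2)] by (auto simp: Z_def)
    then show ?thesis unfolding idx_def by (rule parts_finite_mono(3)[OF sZ sG _ fZ])
  qed
  let ?P = "\<lambda>n. \<exists>G. tight f g G \<and> in_coset G A \<and> idx G = n"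
  have "?P (idx (UNIV :: (int^'n) set))" using tight_UNIV_pair by (intro exI[of _ UNIV]) (auto simp: in_coset_def)
  then have ne: "{n. ?P n} \<noteq> {}" by blast
  have "{n. ?P n} \<subseteq> {..idx Z}" using bnd by auto
  then have fP: "finite {n. ?P n}" by (rule finite_subset) simp
  obtain n where "n \<in> {n. ?P n}" and n2: "\<And>k. k \<in> {n. ?P n} \<Longrightarrow> k \<le> n"
    by (rule finite_obtain_max[OF fP ne, of "\<lambda>k. k"]) blast
  then obtain G where G: "tight f g G" "in_coset G A" "idx G = n" by blast
  have "M = G" if M: "tight f g M" "M \<subseteq> G" "in_coset M A" for M
  proof (rule eq_of_idx_le[OF _ _ M(2)])
    show "idx M \<le> idx G" using n2[of "idx M"] G(3) M by auto
  qed (use M G in \<open>auto simp: tight_def\<close>)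
  then show thesis using that G by blast
qed

end

section \<open>Cells of a sumset and superadditivity\<close>

definition lsum :: "('g \<Rightarrow> 'g) \<Rightarrow> ('g \<Rightarrow> 'g) \<Rightarrow> 'g set \<Rightarrow> 'g set \<Rightarrow> 'g::ab_group_add set" where
  "lsum f g X Y = (\<lambda>(x, y). f x + g y) ` (X \<times> Y)"

lemma lsum_swap: "lsum g f Y X = lsum f g X Y"
  unfolding lsum_def by (auto simp: image_iff add.commute)

lemma finite_lsum: "finite X \<Longrightarrow> finite Y \<Longrightarrow> finite (lsum f g X Y)" by (simp add: lsum_def)

lemma lsum_mono: "X \<subseteq> X' \<Longrightarrow> Y \<subseteq> Y' \<Longrightarrow> lsum f g X Y \<subseteq> lsum f g X' Y'" by (auto simp: lsum_def)

lemma lsumI: "x \<in> X \<Longrightarrow> y \<in> Y \<Longrightarrow> f x + g y \<in> lsum f g X Y" by (auto simp: lsum_def)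

lemma lsumE: "z \<in> lsum f g X Y \<Longrightarrow> (\<And>x y. x \<in> X \<Longrightarrow> y \<in> Y \<Longrightarrow> z = f x + g y \<Longrightarrow> P) \<Longrightarrow> P"
  by (auto simp: lsum_def)

lemma card_lsum_ge_left:
  assumes "inj f" "finite X" "finite Y" "Y \<noteq> {}"
  shows "card X \<le> card (lsum f g X Y)"
proof -
  obtain y where y: "y \<in> Y" using assms(4) by blast
  have "card X = card ((\<lambda>x. f x + g y) ` X)"
    using assms(1) by (intro card_image[symmetric]) (auto simp: inj_on_def dest: injD)
  also have "\<dots> \<le> card (lsum f g X Y)"
    using y assms(2,3) by (intro card_mono finite_lsum) (auto simp: lsum_def)
  finally show ?thesis .
qed

lemma card_lsum_ge_right:
  "inj g \<Longrightarrow> finite X \<Longrightarrow> finite Y \<Longrightarrow> X \<noteq> {} \<Longrightarrow> card Y \<le> card (lsum f g X Y)"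
  using card_lsum_ge_left[of g Y X f] lsum_swap[of g f Y X] by simp

lemma card_parts_le:
  assumes H: "subgrp H" and R: "in_coset G R" and fin: "finite (parts H G)"
  shows "card (parts H R) \<le> card (parts H G)"
proof (cases "R = {}")
  case False
  then obtain r where r: "r \<in> R" by blast
  have mem: "x - r \<in> G" if "x \<in> R" for x using R r that by (auto simp: in_coset_def)
  have k: "part H R x = part H R y \<longleftrightarrow> part H G (x - r) = part H G (y - r)" if "x \<in> R" "y \<in> R" for x y
    using part_eq_iff[OF H that(1), of y] part_eq_iff[OF H mem[OF that(1)], of "y - r"] by simp
  have "card (parts H R) = card ((\<lambda>x. part H G (x - r)) ` R)"
    unfolding parts_def by (rule card_image_same_kernel(1)[of R, OF k])
  also have "\<dots> \<le> card (parts H G)"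
    using fin mem by (intro card_mono) (auto simp: parts_def)
  finally show ?thesis .
qed (simp add: parts_def)

lemma card_parts_full:
  assumes H: "subgrp H" and R: "in_coset G R" and r: "r \<in> R"
    and full: "\<And>z. z \<in> G \<Longrightarrow> \<exists>x\<in>R. x - (r + z) \<in> H"
  shows "card (parts H R) = card (parts H G)"
proof -
  have mem: "x - r \<in> G" if "x \<in> R" for x using R r that by (auto simp: in_coset_def)
  have k: "part H R x = part H R y \<longleftrightarrow> part H G (x - r) = part H G (y - r)" if "x \<in> R" "y \<in> R" for x y
    using part_eq_iff[OF H that(1), of y] part_eq_iff[OF H mem[OF that(1)], of "y - r"] by simp
  have "card (parts H R) = card ((\<lambda>x. part H G (x - r)) ` R)"
    unfolding parts_def by (rule card_image_same_kernel(1)[of R, OF k])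
  also have "(\<lambda>x. part H G (x - r)) ` R = parts H G"
  proof (intro set_eqI iffI)
    fix C assume "C \<in> parts H G"
    then obtain z where z: "z \<in> G" "C = part H G z" by (auto simp: parts_def)
    obtain x where x: "x \<in> R" "x - (r + z) \<in> H" using full[OF z(1)] by blast
    then have "part H G (x - r) = C" unfolding z(2) by (intro part_eqI[OF H]) (simp add: algebra_simps)
    then show "C \<in> (\<lambda>x. part H G (x - r)) ` R" using x(1) by blast
  qed (use mem in \<open>auto simp: parts_def\<close>)
  finally show ?thesis .
qed

text \<open>One level down: a coset of T1 \<inter> T2 is the intersection of a row and a column. The
  occupied cosets of this lattice inside a class are its children.\<close>

definition dpre :: "('g \<Rightarrow> 'g) \<Rightarrow> ('g \<Rightarrow> 'g) \<Rightarrow> 'g::ab_group_add set \<Rightarrow> 'g set" where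
  "dpre f g G = pre f g G \<inter> pre g f G"

lemma dpre_swap: "dpre g f = dpre f g" by (auto simp: dpre_def fun_eq_iff)

primrec lev :: "('g \<Rightarrow> 'g) \<Rightarrow> ('g \<Rightarrow> 'g) \<Rightarrow> 'g::ab_group_add set \<Rightarrow> nat \<Rightarrow> 'g set" where
  "lev f g G 0 = G"
| "lev f g G (Suc k) = dpre f g (lev f g G k)"

lemma lev_swap: "lev g f G k = lev f g G k" by (induction k) (simp_all add: dpre_swap[of g f])

text \<open>From here on matrices are replaced by a family \<open>\<T>\<close> of subgroups closed
  under the level step, with constant indices. Note the crossing: there are at most \<open>b\<close>
  rows (cosets of T1) and at most \<open>a\<close> columns (cosets of T2). The symmetric form lets
  facts about columns be reused for rows by exchanging \<open>f\<close> and
  \<open>g\<close>.\<close>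

locale tight_pair =
  fixes f g :: "'g::ab_group_add \<Rightarrow> 'g" and \<T> :: "'g set \<Rightarrow> bool" and a b :: nat
  assumes fd: "f (x - y) = f x - f y" and gd: "g (x - y) = g x - g y"
    and finj: "inj f" and ginj: "inj g"
    and T_sub: "\<T> G \<Longrightarrow> subgrp G"
    and T_pre: "\<T> G \<Longrightarrow> \<T> (pre f g G \<inter> pre g f G)"
    and T_a: "\<T> G \<Longrightarrow> finite (parts (pre g f G) G) \<and> card (parts (pre g f G) G) = a"
    and T_b: "\<T> G \<Longrightarrow> finite (parts (pre f g G) G) \<and> card (parts (pre f g G) G) = b"
    and ab_pos: "0 < a" "0 < b"

lemma tight_pair_swap: "tight_pair f g \<T> a b \<Longrightarrow> tight_pair g f \<T> b a"
  unfolding tight_pair_def by (simp add: Int_commute)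

context tight_pair
begin

abbreviation "T1 \<equiv> pre f g"
abbreviation "T2 \<equiv> pre g f"
abbreviation "s X \<equiv> card (lsum f g X X)"

abbreviation "D \<equiv> dpre f g"
abbreviation "lv \<equiv> lev f g"

lemma TD: "\<T> G \<Longrightarrow> \<T> (D G)" unfolding dpre_def by (rule T_pre)

lemma f0: "f 0 = 0" using fd[of 0 0] by simp
lemma g0: "g 0 = 0" using gd[of 0 0] by simp
lemma fm: "f (- x) = - f x" using fd[of 0 x] f0 by simp
lemma gm: "g (- x) = - g x" using gd[of 0 x] g0 by simp
lemma fa: "f (x + y) = f x + f y" using fd[of x "- y"] fm by simp
lemma ga: "g (x + y) = g x + g y" using gd[of x "- y"] gm by simp

lemma sub_T: assumes "\<T> G" shows "subgrp (T1 G)" "subgrp (T2 G)" "subgrp (D G)"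
proof -
  show 1: "subgrp (T1 G)" by (rule subgrp_pre[of f g, OF fd gd T_sub[OF assms]])
  show 2: "subgrp (T2 G)" by (rule subgrp_pre[of g f, OF gd fd T_sub[OF assms]])
  show "subgrp (D G)" unfolding dpre_def using 1 2 by (rule subgrp_Int)
qed

lemma D_subset: "D G \<subseteq> G" "D G \<subseteq> T1 G" "D G \<subseteq> T2 G" by (auto simp: dpre_def pre_def)

text \<open>Equality of the sums means f (x - x') = g (y' - y), which puts x - x' in T1 and y - y'
  in T2. A sum therefore determines the row of its first and the column of its second
  argument.\<close>

lemma cell_inj:
  assumes G: "\<T> G" and "x - x' \<in> G" "y - y' \<in> G" "f x + g y = f x' + g y'"
  shows "x - x' \<in> T1 G" "y - y' \<in> T2 G"
proof -
  have y: "y' - y \<in> G" "x' - x \<in> G" using assms subgrp_diff_swap[OF T_sub[OF G]] by auto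
  have "f (x - x') = g (y' - y)" "g (y - y') = f (x' - x)" using assms(4) by (simp_all add: fd gd algebra_simps)
  then show "x - x' \<in> T1 G" "y - y' \<in> T2 G" using y assms(2,3) by (auto simp: pre_def)
qed

lemma card_lsum_cells:
  assumes G: "\<T> G" and X: "in_coset G X" "finite X" and Y: "in_coset G Y" "finite Y"
  shows "card (lsum f g X Y) = (\<Sum>P\<in>parts (T1 G) X. \<Sum>Q\<in>parts (T2 G) Y. card (lsum f g P Q))"
proof -
  let ?I = "parts (T1 G) X \<times> parts (T2 G) Y"
  have u: "lsum f g X Y = (\<Union>(P, Q)\<in>?I. lsum f g P Q)"
  proof (intro set_eqI iffI)
    fix z assume "z \<in> lsum f g X Y"
    then obtain x y where xy: "x \<in> X" "y \<in> Y" "z = f x + g y" by (rule lsumE)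
    have "z \<in> lsum f g (part (T1 G) X x) (part (T2 G) Y y)"
      unfolding xy(3) using xy sub_T[OF G] by (intro lsumI part_self) auto
    then show "z \<in> (\<Union>(P, Q)\<in>?I. lsum f g P Q)" using xy by (auto simp: parts_def)
  next
    fix z assume "z \<in> (\<Union>(P, Q)\<in>?I. lsum f g P Q)"
    then obtain P Q where PQ: "P \<in> parts (T1 G) X" "Q \<in> parts (T2 G) Y" "z \<in> lsum f g P Q" by auto
    then show "z \<in> lsum f g X Y" using lsum_mono[OF parts_subset[OF PQ(1)] parts_subset[OF PQ(2)], of f g] by blast
  qed
  have "card (lsum f g X Y) = (\<Sum>i\<in>?I. card (case i of (P, Q) \<Rightarrow> lsum f g P Q))"
    unfolding u
  proof (rule card_UN_disjoint)
    show "finite ?I" using X Y by (simp add: finite_parts)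
    show "\<forall>i\<in>?I. finite (case i of (P, Q) \<Rightarrow> lsum f g P Q)"
      using X Y by (auto intro!: finite_lsum intro: parts_finite)
    show "\<forall>i\<in>?I. \<forall>j\<in>?I. i \<noteq> j \<longrightarrow> (case i of (P, Q) \<Rightarrow> lsum f g P Q) \<inter> (case j of (P, Q) \<Rightarrow> lsum f g P Q) = {}"
    proof (intro ballI impI equals0I)
      fix i j z
      assume ij: "i \<in> ?I" "j \<in> ?I" "i \<noteq> j"
        and z: "z \<in> (case i of (P, Q) \<Rightarrow> lsum f g P Q) \<inter> (case j of (P, Q) \<Rightarrow> lsum f g P Q)"
      obtain P Q where i: "i = (P, Q)" by fastforce
      obtain P' Q' where j: "j = (P', Q')" by fastforce
      have m: "P \<in> parts (T1 G) X" "Q \<in> parts (T2 G) Y" "P' \<in> parts (T1 G) X" "Q' \<in> parts (T2 G) Y"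
        using ij i j by auto
      have "z \<in> lsum f g P Q" "z \<in> lsum f g P' Q'" using z i j by auto
      then obtain x y x' y' where xy: "x \<in> P" "y \<in> Q" "z = f x + g y" "x' \<in> P'" "y' \<in> Q'" "z = f x' + g y'"
        by (meson lsumE)
      have in_XY: "x \<in> X" "x' \<in> X" "y \<in> Y" "y' \<in> Y" using xy m parts_subset by blast+
      then have "x - x' \<in> G" "y - y' \<in> G" using X(1) Y(1) by (auto simp: in_coset_def)
      from cell_inj[OF G this] xy have "x - x' \<in> T1 G" "y - y' \<in> T2 G" by auto
      then have "P = P'" "Q = Q'"
        using parts_mem[OF sub_T(1)[OF G] m(1) xy(1)] parts_mem[OF sub_T(1)[OF G] m(3) xy(4)]
          parts_mem[OF sub_T(2)[OF G] m(2) xy(2)] parts_mem[OF sub_T(2)[OF G] m(4) xy(5)]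
          part_eqI[OF sub_T(1)[OF G]] part_eqI[OF sub_T(2)[OF G]] by metis+
      then show False using ij(3) i j by simp
    qed
  qed
  also have "\<dots> = (\<Sum>(P, Q)\<in>?I. card (lsum f g P Q))" by (rule sum.cong) auto
  finally show ?thesis by (simp add: sum.cartesian_product)
qed

lemma child_eq:
  assumes G: "\<T> G" and z: "z \<in> part (T1 G) R x" "z \<in> part (T2 G) R y"
  shows "part (T1 G) R x \<inter> part (T2 G) R y = part (D G) R z"
proof -
  have "part (T1 G) R x = part (T1 G) R z" "part (T2 G) R y = part (T2 G) R z"
    using z part_eqI[OF sub_T(1)[OF G], of z x R] part_eqI[OF sub_T(2)[OF G], of z y R] by (auto simp: part_def)
  then show ?thesis by (auto simp: part_def dpre_def)
qed

lemma part_D: "part (D G) R z = part (T1 G) R z \<inter> part (T2 G) R z" by (auto simp: part_def dpre_def)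

text \<open>The sums within a child belong to the cell formed by its own row and column. Hence
  different children have disjoint sums, and the cell of \<open>x\<close> and \<open>y\<close> is
  disjoint from the sums of all children except its own, which it may replace. If that child is
  empty, the cell is a pure gain.\<close>

lemma superadd_cell:
  assumes G: "\<T> G" and R: "in_coset G R" "finite R" and x: "x \<in> R" and y: "y \<in> R"
  shows "card (lsum f g (part (T1 G) R x) (part (T2 G) R y))
      + (\<Sum>C\<in>parts (D G) R - {part (T1 G) R x \<inter> part (T2 G) R y}. s C) \<le> s R"
proof -
  let ?P = "part (T1 G) R x" and ?Q = "part (T2 G) R y"
  let ?F = "parts (D G) R - {?P \<inter> ?Q}"
  let ?U = "\<Union>C\<in>?F. lsum f g C C"
  have fin: "finite ?F" using R by (simp add: finite_parts)
  have fC: "finite C" if "C \<in> ?F" for C using that parts_finite[OF R(2)] by auto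
  have key: "c \<in> part (T1 G) R x' \<and> c' \<in> part (T2 G) R y' "
    if "c \<in> R" "c' \<in> R" "u \<in> part (T1 G) R x'" "v \<in> part (T2 G) R y'" "f c + g c' = f u + g v" for c c' u v x' y'
  proof -
    have "c - u \<in> G" "c' - v \<in> G" using that R(1) by (auto simp: in_coset_def part_def)
    from cell_inj[OF G this that(5)] have "c - u \<in> T1 G" "c' - v \<in> T2 G" by auto
    then have "c - x' \<in> T1 G" "c' - y' \<in> T2 G"
      using that(3,4) subgrp_trans[OF sub_T(1)[OF G], of c u x'] subgrp_trans[OF sub_T(2)[OF G], of c' v y']
      by (auto simp: part_def)
    then show ?thesis using that(1,2) by (simp add: part_def)
  qed
  have CD: "C = part (D G) R c" "c \<in> R" if "C \<in> parts (D G) R" "c \<in> C" for C c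
    using parts_mem[OF sub_T(3)[OF G] that] by auto
  have dis: "lsum f g ?P ?Q \<inter> ?U = {}"
  proof (rule equals0I)
    fix z assume z: "z \<in> lsum f g ?P ?Q \<inter> ?U"
    then obtain C where C: "C \<in> ?F" "z \<in> lsum f g C C" "z \<in> lsum f g ?P ?Q" by blast
    obtain u v where uv: "u \<in> ?P" "v \<in> ?Q" "z = f u + g v" using C(3) by (rule lsumE)
    obtain c c' where c: "c \<in> C" "c' \<in> C" "z = f c + g c'" using C(2) by (rule lsumE)
    have m: "C = part (D G) R c" "c \<in> R" "c' \<in> R" "C = part (D G) R c'" using CD[of C] C(1) c by auto
    have "c \<in> ?P" "c' \<in> ?Q" using key[OF m(2,3) uv(1,2)] c uv by auto
    moreover have "c \<in> part (T2 G) R c'" using c(1) m(4) part_D by blast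
    then have "c \<in> ?Q" using \<open>c' \<in> ?Q\<close> part_eqI[OF sub_T(2)[OF G], of c' y R] by (auto simp: part_def)
    ultimately have "?P \<inter> ?Q = C" using child_eq[OF G] m(1) by metis
    then show False using C(1) by simp
  qed
  have "card ?U = (\<Sum>C\<in>?F. s C)"
  proof (rule card_UN_disjoint)
    show "\<forall>i\<in>?F. \<forall>j\<in>?F. i \<noteq> j \<longrightarrow> lsum f g i i \<inter> lsum f g j j = {}"
    proof (intro ballI impI equals0I)
      fix C E z assume C: "C \<in> ?F" "E \<in> ?F" "C \<noteq> E" and z: "z \<in> lsum f g C C \<inter> lsum f g E E"
      obtain c c' where c: "c \<in> C" "c' \<in> C" "z = f c + g c'" using z by (auto elim: lsumE)
      obtain e e' where e: "e \<in> E" "e' \<in> E" "z = f e + g e'" using z by (auto elim: lsumE)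
      have m: "C = part (D G) R c" "c \<in> R" "c' \<in> R" "C = part (D G) R c'" using CD[of C] C(1) c by auto
      have n: "E = part (D G) R e" "e \<in> R" "e' \<in> R" "E = part (D G) R e'" using CD[of E] C(2) e by auto
      have "e \<in> part (T1 G) R e" "e' \<in> part (T2 G) R e'" using n sub_T[OF G] by (auto intro: part_self)
      from key[OF m(2,3) this] c e have k: "c \<in> part (T1 G) R e" "c' \<in> part (T2 G) R e'" by auto
      have "c - c' \<in> D G" using c m(4) by (auto simp: part_def)
      moreover have "e' - e \<in> D G" using e n(1) by (auto simp: part_def)
      ultimately have "c - c' \<in> T2 G" "e' - e \<in> T2 G" "c' - e' \<in> T2 G"
        using k subsetD[OF D_subset(3)] by (auto simp: part_def)
      then have "c - e \<in> T2 G" using subgrp_trans[OF sub_T(2)[OF G]] by blast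
      then have "c - e \<in> D G" using k by (simp add: dpre_def part_def)
      then have "C = E" unfolding m(1) n(1) by (rule part_eqI[OF sub_T(3)[OF G]])
      then show False using C(3) by simp
    qed
    show "finite ?F" by (rule fin)
    show "\<forall>i\<in>?F. finite (lsum f g i i)" using fC finite_lsum by blast
  qed
  then have "card (lsum f g ?P ?Q) + (\<Sum>C\<in>?F. s C) = card (lsum f g ?P ?Q \<union> ?U)"
    using dis R fin fC by (subst card_Un_disjoint) (auto intro!: finite_lsum finite_subset[OF part_subset])
  also have "\<dots> \<le> s R"
  proof (rule card_mono)
    show "finite (lsum f g R R)" using R by (simp add: finite_lsum)
    have "lsum f g C C \<subseteq> lsum f g R R" if "C \<in> ?F" for C using that parts_subset[of C "D G" R] by (intro lsum_mono) auto
    then show "lsum f g ?P ?Q \<union> ?U \<subseteq> lsum f g R R"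
      using lsum_mono[OF part_subset part_subset, of f g "T1 G" R x "T2 G" R y] by blast
  qed
  finally show ?thesis .
qed

lemma superadd:
  assumes G: "\<T> G" and R: "in_coset G R" "finite R"
  shows "(\<Sum>C\<in>parts (D G) R. s C) \<le> s R"
proof (cases "R = {}")
  case False
  then obtain x where x: "x \<in> R" by blast
  let ?P = "part (T1 G) R x" and ?Q = "part (T2 G) R x"
  have e: "?P \<inter> ?Q = part (D G) R x" by (simp add: part_D)
  have "part (D G) R x \<in> parts (D G) R" using x by (rule part_in_parts)
  then have "(\<Sum>C\<in>parts (D G) R. s C) = s (?P \<inter> ?Q) + (\<Sum>C\<in>parts (D G) R - {?P \<inter> ?Q}. s C)"
    unfolding e using finite_parts[OF R(2)] by (simp add: sum.remove)
  moreover have "s (?P \<inter> ?Q) \<le> card (lsum f g ?P ?Q)"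
    using R(2) by (intro card_mono finite_lsum lsum_mono finite_subset[OF part_subset]) auto
  ultimately show ?thesis using superadd_cell[OF G R x x] by linarith
qed (simp add: parts_def)

lemma T_lev: "\<T> G \<Longrightarrow> \<T> (lv G k)" by (induction k) (auto intro: TD)

lemma parts_level_coset: "\<T> G \<Longrightarrow> R \<in> parts (lv G k) A \<Longrightarrow> in_coset (lv G k) R"
  using parts_in_coset[OF T_sub[OF T_lev]] by blast

lemma superadd_level:
  assumes G: "\<T> G" and A: "in_coset G A" "finite A"
  shows "(\<Sum>R\<in>parts (lv G k) A. s R) \<le> s A"
proof (induction k)
  case 0
  show ?case
  proof (cases "A = {}")
    case False
    then obtain x where x: "x \<in> A" by blast
    have "part G A y = A" if "y \<in> A" for y using A(1) that by (auto simp: part_def in_coset_def)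
    then have "parts G A = {A}" using x by (auto simp: parts_def)
    then show ?thesis by simp
  qed (simp add: parts_def)
next
  case (Suc k)
  have "(\<Sum>C\<in>parts (lv G (Suc k)) A. s C) = (\<Sum>R\<in>parts (lv G k) A. \<Sum>C\<in>parts (lv G (Suc k)) R. s C)"
    using D_subset sub_T(3) T_lev[OF G] T_sub A(2) by (intro sum_parts_refine) auto
  also have "\<dots> \<le> (\<Sum>R\<in>parts (lv G k) A. s R)"
    using superadd[OF T_lev[OF G]] parts_level_coset[OF G] parts_finite[OF A(2)] by (intro sum_mono) auto
  finally show ?case using Suc by linarith
qed

text \<open>The replacement of one child by its cell is made inside the single class
  \<open>R\<close> of level \<open>k\<close>; plain superadditivity takes care of the other
  classes.\<close>

lemma superadd_level_cell:
  assumes G: "\<T> G" and A: "in_coset G A" "finite A" and R: "R \<in> parts (lv G k) A" and x: "x \<in> R" and y: "y \<in> R"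
  defines "P \<equiv> part (T1 (lv G k)) R x" and "Q \<equiv> part (T2 (lv G k)) R y"
  shows "card (lsum f g P Q) + (\<Sum>C\<in>parts (lv G (Suc k)) A - {P \<inter> Q}. s C) \<le> s A"
proof -
  let ?G = "lv G k"
  \<comment> \<open>Zero weight on the replaced child, so that the sum over all children can be
    regrouped along the classes of level \<open>k\<close>.\<close>
  define h where "h C = (if C = P \<inter> Q then 0 else s C)" for C
  have eq: "(\<Sum>C\<in>F - {P \<inter> Q}. s C) = sum h F" if "finite F" for F
    using that by (simp add: h_def sum.If_cases Diff_eq Compl_eq flip: Collect_neg_eq)
  have fA: "finite (parts ?G A)" using A(2) by (rule finite_parts)
  have sh: "sum h (parts (D ?G) R') \<le> s R'" if "R' \<in> parts ?G A" for R'
  proof -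
    have "sum h (parts (D ?G) R') \<le> (\<Sum>C\<in>parts (D ?G) R'. s C)" by (intro sum_mono) (simp add: h_def)
    then show ?thesis
      using superadd[OF T_lev[OF G] parts_level_coset[OF G that] parts_finite[OF A(2) that]] by linarith
  qed
  have R1: "card (lsum f g P Q) + sum h (parts (D ?G) R) \<le> s R"
    using superadd_cell[OF T_lev[OF G] parts_level_coset[OF G R] parts_finite[OF A(2) R] x y]
      eq[OF finite_parts[OF parts_finite[OF A(2) R]], of "D ?G"] unfolding P_def Q_def by simp
  have "sum h (parts (lv G (Suc k)) A) = (\<Sum>R'\<in>parts ?G A. sum h (parts (lv G (Suc k)) R'))"
    using D_subset sub_T(3) T_lev[OF G] T_sub A(2) by (intro sum_parts_refine) auto
  also have "\<dots> = sum h (parts (D ?G) R) + (\<Sum>R'\<in>parts ?G A - {R}. sum h (parts (D ?G) R'))"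
    using fA R by (simp add: sum.remove)
  also have "(\<Sum>R'\<in>parts ?G A - {R}. sum h (parts (D ?G) R')) \<le> (\<Sum>R'\<in>parts ?G A - {R}. s R')"
    using sh by (intro sum_mono) auto
  finally have "card (lsum f g P Q) + sum h (parts (lv G (Suc k)) A) \<le> s R + (\<Sum>R'\<in>parts ?G A - {R}. s R')"
    using R1 by linarith
  also have "\<dots> = (\<Sum>R'\<in>parts ?G A. s R')" using fA R by (simp add: sum.remove)
  also have "\<dots> \<le> s A" by (rule superadd_level[OF G A])
  finally show ?thesis using eq[OF finite_parts[OF A(2)]] by simp
qed

lemma card_rows_le: "\<T> G \<Longrightarrow> in_coset G R \<Longrightarrow> card (parts (T1 G) R) \<le> b"
  using card_parts_le[of "T1 G" G R] T_b[of G] sub_T(1)[of G] by auto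

lemma card_cols_le: "\<T> G \<Longrightarrow> in_coset G R \<Longrightarrow> card (parts (T2 G) R) \<le> a"
  using card_parts_le[of "T2 G" G R] T_a[of G] sub_T(2)[of G] by auto

lemma children_inj:
  assumes G: "\<T> G"
  shows "inj_on (\<lambda>C. (part (T1 G) R (SOME z. z \<in> C), part (T2 G) R (SOME z. z \<in> C))) (parts (D G) R)"
proof (rule inj_onI)
  fix C E assume C: "C \<in> parts (D G) R" "E \<in> parts (D G) R"
    and e: "(part (T1 G) R (SOME z. z \<in> C), part (T2 G) R (SOME z. z \<in> C)) =
      (part (T1 G) R (SOME z. z \<in> E), part (T2 G) R (SOME z. z \<in> E))"
  have "(SOME z. z \<in> C) \<in> C" "(SOME z. z \<in> E) \<in> E"
    using parts_nonempty[OF sub_T(3)[OF G]] C by (simp_all add: some_in_eq)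
  then have "C = part (D G) R (SOME z. z \<in> C)" "E = part (D G) R (SOME z. z \<in> E)"
    using parts_mem[OF sub_T(3)[OF G]] C by blast+
  then show "C = E" using e by (metis part_D prod.inject)
qed

lemma card_children_le:
  assumes G: "\<T> G" and R: "in_coset G R" "finite R"
  shows "card (parts (D G) R) \<le> card (parts (T1 G) R) * card (parts (T2 G) R)"
proof -
  let ?h = "\<lambda>C. (part (T1 G) R (SOME z. z \<in> C), part (T2 G) R (SOME z. z \<in> C))"
  have "?h ` parts (D G) R \<subseteq> parts (T1 G) R \<times> parts (T2 G) R"
  proof
    fix p assume "p \<in> ?h ` parts (D G) R"
    then obtain C where C: "C \<in> parts (D G) R" "p = ?h C" by blast
    have "(SOME z. z \<in> C) \<in> C" using parts_nonempty[OF sub_T(3)[OF G] C(1)] by (simp add: some_in_eq)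
    then have "(SOME z. z \<in> C) \<in> R" using parts_subset[OF C(1)] by blast
    then show "p \<in> parts (T1 G) R \<times> parts (T2 G) R" using C(2) by (auto intro: part_in_parts)
  qed
  then have "card (parts (D G) R) \<le> card (parts (T1 G) R \<times> parts (T2 G) R)"
    using children_inj[OF G] R(2) by (intro card_inj_on_le[of ?h]) (auto intro: finite_parts)
  then show ?thesis by (simp add: card_cartesian_product)
qed

lemma card_children_product:
  assumes G: "\<T> G" and R: "in_coset G R" "finite R"
    and pr: "\<And>x y. x \<in> R \<Longrightarrow> y \<in> R \<Longrightarrow> part (T1 G) R x \<inter> part (T2 G) R y \<noteq> {}"
  shows "card (parts (D G) R) = card (parts (T1 G) R) * card (parts (T2 G) R)"
proof (rule antisym[OF card_children_le[OF G R]])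
  let ?h = "\<lambda>(P, Q). P \<inter> Q"
  have ne: "P \<inter> Q \<in> parts (D G) R \<and> P \<inter> Q \<noteq> {}" if PQ: "P \<in> parts (T1 G) R" "Q \<in> parts (T2 G) R" for P Q
  proof -
    obtain x y where xy: "x \<in> R" "y \<in> R" "P = part (T1 G) R x" "Q = part (T2 G) R y" using PQ by (auto simp: parts_def)
    then obtain z where z: "z \<in> P" "z \<in> Q" using pr[OF xy(1,2)] by blast
    then have "P \<inter> Q = part (D G) R z" using child_eq[OF G] xy by blast
    moreover have "z \<in> R" using z xy by (auto simp: part_def)
    ultimately show ?thesis using z by (auto intro: part_in_parts)
  qed
  have "inj_on ?h (parts (T1 G) R \<times> parts (T2 G) R)"
  proof (rule inj_onI, clarify)
    fix P Q P' Q'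
    assume m: "P \<in> parts (T1 G) R" "Q \<in> parts (T2 G) R" "P' \<in> parts (T1 G) R" "Q' \<in> parts (T2 G) R"
      and e: "P \<inter> Q = P' \<inter> Q'"
    obtain z where "z \<in> P \<inter> Q" using ne[OF m(1,2)] by blast
    then have "z \<in> P" "z \<in> Q" "z \<in> P'" "z \<in> Q'" using e by auto
    then show "P = P' \<and> Q = Q'"
      using m parts_disjoint[OF sub_T(1)[OF G], of P R P'] parts_disjoint[OF sub_T(2)[OF G], of Q R Q'] by blast
  qed
  moreover have "?h ` (parts (T1 G) R \<times> parts (T2 G) R) \<subseteq> parts (D G) R" using ne by auto
  ultimately have "card (parts (T1 G) R \<times> parts (T2 G) R) \<le> card (parts (D G) R)"
    using R(2) by (intro card_inj_on_le[of ?h]) (auto intro: finite_parts)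
  then show "card (parts (T1 G) R) * card (parts (T2 G) R) \<le> card (parts (D G) R)"
    by (simp add: card_cartesian_product)
qed

lemma card_parts_lev_Suc:
  assumes G: "\<T> G" and A: "finite A"
  shows "card (parts (lv G (Suc k)) A) = (\<Sum>R\<in>parts (lv G k) A. card (parts (D (lv G k)) R))"
  using sum_parts_refine[of "lv G (Suc k)" "lv G k" A "\<lambda>_. 1::nat"]
    D_subset sub_T(3) T_lev[OF G] T_sub A by simp

lemma card_parts_lev_le:
  assumes G: "\<T> G" and A: "in_coset G A" "finite A"
  shows "card (parts (lv G k) A) \<le> (a * b) ^ k"
proof (induction k)
  case 0
  have "part G A y = A" if "y \<in> A" for y using A(1) that by (auto simp: part_def in_coset_def)
  then have "parts G A \<subseteq> {A}" by (auto simp: parts_def)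
  then show ?case using card_mono[of "{A}" "parts G A"] by simp
next
  case (Suc k)
  have "card (parts (D (lv G k)) R) \<le> a * b" if R: "R \<in> parts (lv G k) A" for R
  proof -
    note r = T_lev[OF G, of k] parts_level_coset[OF G R] parts_finite[OF A(2) R]
    have "card (parts (D (lv G k)) R) \<le> card (parts (T1 (lv G k)) R) * card (parts (T2 (lv G k)) R)"
      by (rule card_children_le[OF r])
    also have "\<dots> \<le> b * a" by (intro mult_le_mono card_rows_le card_cols_le r)
    finally show ?thesis by (simp add: mult.commute)
  qed
  then have "card (parts (lv G (Suc k)) A) \<le> card (parts (lv G k) A) * (a * b)"
    unfolding card_parts_lev_Suc[OF G A(2)] using sum_bounded_above[of "parts (lv G k) A" "\<lambda>R. card (parts (D (lv G k)) R)" "a * b"]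
    by (simp add: mult.commute)
  also have "\<dots> \<le> (a * b) ^ k * (a * b)" using Suc by (rule mult_le_mono1)
  finally show ?case by (simp add: mult.commute)
qed

end

section \<open>Sets without excess in their cells\<close>

text \<open>What a minimal counterexample satisfies on levels 0 to \<open>N\<close>: up to \<theta>
  |A|, no cell beats \<open>K\<close> times its child (\<open>CELL\<close>), and no cell through a
  common point beats the sums inside that child (\<open>EXTRA\<close>). The bound on \<theta> is the
  least relative size of a class of level N + 1, so a single additional class would already be too
  much.\<close>

locale violator = tight_pair f g \<T> a b
  for f g :: "'g::ab_group_add \<Rightarrow> 'g" and \<T> :: "'g set \<Rightarrow> bool" and a b :: nat +
  fixes A G :: "'g set" and K \<theta> :: real and N :: nat
  assumes TG: "\<T> G" and cosA: "in_coset G A" and finA: "finite A" and neA: "A \<noteq> {}"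
    and gens: "gen f g G A" "gen g f G A"
    and K1: "1 \<le> K" and th: "0 \<le> \<theta>" "\<theta> < (1 / (4 * real a * real b * K ^ 2)) ^ Suc N"
    and CELL: "\<lbrakk>k \<le> N; R \<in> parts (lev f g G k) A; x \<in> R; y \<in> R\<rbrakk> \<Longrightarrow>
      real (card (lsum f g (part (pre f g (lev f g G k)) R x) (part (pre g f (lev f g G k)) R y)))
      \<le> K * real (card (part (pre f g (lev f g G k)) R x \<inter> part (pre g f (lev f g G k)) R y)) + \<theta> * real (card A)"
    and EXTRA: "\<lbrakk>k \<le> N; R \<in> parts (lev f g G k) A; x \<in> R\<rbrakk> \<Longrightarrow>
      real (card (lsum f g (part (pre f g (lev f g G k)) R x) (part (pre g f (lev f g G k)) R x)))
      \<le> real (card (lsum f g (part (dpre f g (lev f g G k)) R x) (part (dpre f g (lev f g G k)) R x))) + \<theta> * real (card A)"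

lemma violator_swap:
  assumes "violator f g \<T> a b A G K \<theta> N"
  shows "violator g f \<T> b a A G K \<theta> N"
proof -
  interpret violator f g \<T> a b A G K \<theta> N by (rule assms)
  show ?thesis
  proof (intro violator.intro violator_axioms.intro)
    show "tight_pair g f \<T> b a" by (rule tight_pair_swap) unfold_locales
    show "\<theta> < (1 / (4 * real b * real a * K\<^sup>2)) ^ Suc N" using th(2) by (simp add: mult_ac)
    fix k R x y assume h: "k \<le> N" "R \<in> parts (lev g f G k) A" "x \<in> R"
    then have R: "R \<in> parts (lev f g G k) A" by (simp add: lev_swap[of g f])
    show "real (card (lsum g f (part (pre g f (lev g f G k)) R x) (part (pre f g (lev g f G k)) R x)))
      \<le> real (card (lsum g f (part (dpre g f (lev g f G k)) R x) (part (dpre g f (lev g f G k)) R x))) + \<theta> * real (card A)"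
      using EXTRA[OF h(1) R h(3)] by (simp add: lev_swap[of g f] dpre_swap[of g f] lsum_swap[of g f])
    assume y: "y \<in> R"
    show "real (card (lsum g f (part (pre g f (lev g f G k)) R x) (part (pre f g (lev g f G k)) R y)))
      \<le> K * real (card (part (pre g f (lev g f G k)) R x \<inter> part (pre f g (lev g f G k)) R y)) + \<theta> * real (card A)"
      using CELL[OF h(1) R y h(3)] by (simp add: lev_swap[of g f] lsum_swap[of g f] Int_commute)
  qed (use TG cosA finA neA gens K1 th in auto)
qed

context violator
begin

text \<open>A lower bound for the share of a class that falls to each of its children; its factors
  are the losses in \<open>child_size\<close>.\<close>

definition \<rho> :: real where "\<rho> = 1 / (4 * real a * real b * K ^ 2)"

lemma ab1: "1 \<le> real a" "1 \<le> real b" using ab_pos by auto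

lemma cA: "0 < real (card A)" using finA neA by (simp add: card_gt_0_iff)

lemma rho: "0 < \<rho>" "\<rho> \<le> 1" "\<rho> * (4 * real a * real b * K ^ 2) = 1" "\<theta> < \<rho> ^ Suc N"
proof -
  have p: "1 \<le> real a * real b" using mult_mono[of 1 "real a" 1 "real b"] ab1 by simp
  have "1 \<le> K ^ 2" using K1 by simp
  then have q: "1 \<le> real a * real b * K ^ 2" using mult_mono[of 1 "real a * real b" 1 "K ^ 2"] p by simp
  then show "\<rho> \<le> 1" unfolding \<rho>_def by (simp add: divide_le_eq)
  show "0 < \<rho>" "\<rho> * (4 * real a * real b * K ^ 2) = 1" unfolding \<rho>_def using ab_pos K1 by auto
  show "\<theta> < \<rho> ^ Suc N" using th(2) unfolding \<rho>_def .
qed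

lemma Tlv: "\<T> (lv G k)" by (rule T_lev[OF TG])

lemma R_props:
  assumes "R \<in> parts (lv G k) A"
  shows "in_coset (lv G k) R" "finite R" "R \<noteq> {}" "R \<subseteq> A"
  using parts_level_coset[OF TG assms] parts_finite[OF finA assms] parts_nonempty[OF T_sub[OF Tlv] assms] parts_subset[OF assms]
  by auto

lemma child_in_level:
  assumes "R \<in> parts (lv G k) A" "C \<in> parts (D (lv G k)) R"
  shows "C \<in> parts (lv G (Suc k)) A"
  using parts_refine[of "lv G (Suc k)" "lv G k" A] D_subset T_sub[OF Tlv] assms by auto

lemma level_child:
  assumes "C \<in> parts (lv G (Suc k)) A"
  obtains R where "R \<in> parts (lv G k) A" "C \<in> parts (D (lv G k)) R"
  using parts_refine[of "lv G (Suc k)" "lv G k" A] D_subset T_sub[OF Tlv] assms by auto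

text \<open>Two transfers by \<open>CELL\<close>. The largest row has at least |R| / b points;
  paired with the column of \<open>y\<close> it forces this column to be large, up to a factor
  \<open>K\<close>. That column, paired with the row of \<open>x\<close>, forces their intersection
  to be large, at the cost of another \<open>K\<close>.\<close>

lemma child_size:
  assumes k: "k \<le> N" and R: "R \<in> parts (lv G k) A" and sz: "\<rho> ^ k * card A \<le> card R" and x: "x \<in> R" and y: "y \<in> R"
  shows "\<rho> * card R \<le> card (part (T1 (lv G k)) R x \<inter> part (T2 (lv G k)) R y)"
proof -
  let ?G = "lv G k"
  note Rp = R_props[OF R]
  obtain P where P: "P \<in> parts (T1 ?G) R" "\<And>Q. Q \<in> parts (T1 ?G) R \<Longrightarrow> card Q \<le> card P"
    by (rule finite_obtain_max[OF finite_parts[OF Rp(2)], of "T1 ?G" card]) (use Rp(3) in \<open>auto simp: parts_def\<close>)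
  obtain x0 where x0: "x0 \<in> R" "P = part (T1 ?G) R x0" using P(1) by (auto simp: parts_def)
  have "card R = (\<Sum>Q\<in>parts (T1 ?G) R. card Q)" using sum_card_parts[OF Rp(2) sub_T(1)[OF Tlv]] by simp
  also have "\<dots> \<le> card (parts (T1 ?G) R) * card P" using P(2) sum_bounded_above[of "parts (T1 ?G) R" card "card P"] by simp
  also have "\<dots> \<le> b * card P" using card_rows_le[OF Tlv Rp(1)] by (rule mult_le_mono1)
  finally have RP: "real (card R) \<le> b * real (card P)" by (simp flip: of_nat_mult)
  have "\<theta> * card A \<le> \<rho> ^ Suc N * card A" using rho(4) cA by (intro mult_right_mono) auto
  also have "\<dots> \<le> \<rho> ^ Suc k * card A" using k rho(1,2) by (intro mult_right_mono power_decreasing) auto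
  also have "\<dots> \<le> \<rho> * card R" using sz rho(1) by (simp add: mult.assoc)
  finally have t: "\<theta> * card A \<le> \<rho> * card R" .
  define r where "r = \<rho> * real (card R)"
  have r: "real (card R) = r * (4 * real a * real b * K ^ 2)" using rho(3) by (simp add: r_def mult_ac)
  have r0: "0 \<le> r" using rho(1) by (simp add: r_def)
  have aK: "r \<le> r * real a * K" "r * real a * K \<le> r * real a * K^2"
  proof -
    have "1 \<le> real a * K" using mult_mono[of 1 "real a" 1 K] ab1 K1 by simp
    then show "r \<le> r * real a * K" using r0 mult_left_mono[of 1 "real a * K" r] by (simp add: mult_ac)
    have "K * 1 \<le> K * K" using K1 by (intro mult_left_mono) auto
    then show "r * real a * K \<le> r * real a * K^2" using r0 by (simp add: power2_eq_square mult_left_mono mult.assoc)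
  qed
  have fP: "finite P" using x0 Rp(2) part_subset finite_subset by metis
  define Q where "Q = part (T2 ?G) R y"
  have fQ: "finite Q" "Q \<noteq> {}" using Rp(2) part_subset finite_subset part_self[OF sub_T(2)[OF Tlv] y] unfolding Q_def by (metis, blast)
  have Pn: "P \<noteq> {}" using x0 part_self[OF sub_T(1)[OF Tlv]] by blast
  have "real (card P) \<le> real (card (lsum f g P Q))" using card_lsum_ge_left[OF finj fP fQ] by simp
  also have "\<dots> \<le> K * card (P \<inter> Q) + \<theta> * card A" unfolding x0(2) Q_def by (rule CELL[OF k R x0(1) y])
  also have "\<dots> \<le> K * card Q + r"
    using K1 fQ t by (intro add_mono mult_left_mono) (auto simp: r_def intro: card_mono)
  finally have "card P \<le> K * card Q + r" .
  then have "b * real (card P) \<le> b * (K * card Q + r)" by (intro mult_left_mono) auto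
  then have "r * (4 * real a * real b * K ^ 2) \<le> b * (K * card Q + r)" using RP r by linarith
  then have "r * (4 * real a * K ^ 2) * b \<le> (K * card Q + r) * b" by (simp add: mult_ac)
  then have "r * (4 * real a * K ^ 2) \<le> K * card Q + r" using ab1(2) by (simp add: mult_le_cancel_right)
  then have q: "3 * (r * real a * K^2) \<le> K * card Q" using aK by (simp add: mult_ac)
  have "real (card Q) \<le> real (card (lsum f g (part (T1 ?G) R x) Q))"
    using card_lsum_ge_right[OF ginj _ fQ(1), of "part (T1 ?G) R x"] Rp(2) part_self[OF sub_T(1)[OF Tlv] x] finite_subset[OF part_subset Rp(2)]
    by auto
  also have "\<dots> \<le> K * card (part (T1 ?G) R x \<inter> Q) + \<theta> * card A" unfolding Q_def by (rule CELL[OF k R x y])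
  finally have "real (card Q) \<le> K * card (part (T1 ?G) R x \<inter> Q) + r" using t by (simp add: r_def)
  then have "K * card Q \<le> K * (K * card (part (T1 ?G) R x \<inter> Q) + r)" using K1 by (intro mult_left_mono) auto
  moreover have "K * r \<le> r * real a * K^2"
  proof -
    have "K * r * 1 \<le> K * r * real a" using ab1 K1 r0 by (intro mult_left_mono) auto
    also have "\<dots> = r * real a * K" by (simp add: mult_ac)
    finally show ?thesis using aK(2) by simp
  qed
  ultimately have "2 * (r * real a * K^2) \<le> K^2 * card (part (T1 ?G) R x \<inter> Q)"
    using q by (simp add: distrib_left power2_eq_square mult.assoc)
  then have "K^2 * (2 * (r * real a)) \<le> K^2 * card (part (T1 ?G) R x \<inter> Q)" by (simp add: mult_ac)
  then have "2 * (r * real a) \<le> card (part (T1 ?G) R x \<inter> Q)" using K1 by (simp add: mult_le_cancel_left)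
  moreover have "r \<le> r * real a" using mult_left_mono[of 1 "real a" r] ab1 r0 by simp
  ultimately show ?thesis using r0 by (simp add: r_def Q_def)
qed

lemma level_size:
  assumes "k \<le> Suc N" "R \<in> parts (lv G k) A"
  shows "\<rho> ^ k * card A \<le> card R"
  using assms
proof (induction k arbitrary: R)
  case 0
  then obtain x where "x \<in> A" "R = part G A x" by (auto simp: parts_def)
  then have "R = A" using cosA by (auto simp: part_def in_coset_def)
  then show ?case by simp
next
  case (Suc k)
  obtain R' where R': "R' \<in> parts (lv G k) A" "R \<in> parts (D (lv G k)) R'" using level_child[OF Suc.prems(2)] by blast
  obtain z where z: "z \<in> R'" "R = part (D (lv G k)) R' z" using R'(2) by (auto simp: parts_def)
  have sz: "\<rho> ^ k * card A \<le> card R'" using Suc R' by simp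
  have "\<rho> * card R' \<le> card R"
    using child_size[OF _ R'(1) sz z(1) z(1)] Suc.prems(1) unfolding z(2) part_D by simp
  moreover have "\<rho> * (\<rho> ^ k * card A) \<le> \<rho> * card R'" using sz rho(1) by (intro mult_left_mono) auto
  ultimately show ?case by (simp add: mult.assoc)
qed

lemma child_size':
  assumes "k \<le> N" "R \<in> parts (lv G k) A" "x \<in> R" "y \<in> R"
  shows "\<rho> * card R \<le> card (part (T1 (lv G k)) R x \<inter> part (T2 (lv G k)) R y)"
    "part (T1 (lv G k)) R x \<inter> part (T2 (lv G k)) R y \<noteq> {}"
proof -
  show 1: "\<rho> * card R \<le> card (part (T1 (lv G k)) R x \<inter> part (T2 (lv G k)) R y)"
    using child_size assms level_size[of k R] by simp
  have "0 < card R" using R_props[OF assms(2)] by (simp add: card_gt_0_iff)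
  then have "0 < \<rho> * card R" using rho(1) by simp
  then show "part (T1 (lv G k)) R x \<inter> part (T2 (lv G k)) R y \<noteq> {}" using 1 by auto
qed

text \<open>Let w be a difference of points of \<open>R\<close> inside the row of \<open>C\<close>.
  Shifting g C by f w must permute the classes of g C modulo f D, since otherwise all of another
  child would be new in a cell that \<open>EXTRA\<close> declares full. The admissible shifts form a
  group, which by generation exhausts T1. As g D is contained in f T1, the classes of g C are
  invariant under g D, so \<open>C\<close> meets all cosets of T2(D).\<close>

lemma full_columns:
  assumes k: "k \<le> N" and R: "R \<in> parts (lv G k) A" and gR: "gen f g (lv G k) R"
    and C: "C \<in> parts (D (lv G k)) R" and x: "x \<in> C" and z: "z \<in> D (lv G k)"
  shows "\<exists>x'\<in>C. x' - (x + z) \<in> T2 (D (lv G k))"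
proof -
  let ?G = "lv G k" and ?D = "D (lv G k)"
  note Rp = R_props[OF R] and sT = sub_T[OF Tlv, of k]
  have CD: "C = part ?D R x" "x \<in> R" using parts_mem[OF sT(3) C x] by auto
  have CR: "C \<subseteq> R" and fC: "finite C" using parts_subset[OF C] parts_finite[OF Rp(2) C] by auto
  have dC: "c - c' \<in> ?D" if "c \<in> C" "c' \<in> C" for c c'
    using parts_in_coset[OF sT(3) C] that by (auto simp: in_coset_def)
  \<comment> \<open>Only the inclusion of the shifted classes is required. The inverse shift is then
    admissible too, because an injective self-map of the finite set of classes is onto.\<close>
  define Fwd where "Fwd w \<longleftrightarrow> (\<forall>c\<in>C. \<exists>c'\<in>C. \<exists>\<gamma>\<in>?D. f w + g c = g c' + f \<gamma>)" for w
  have sfD: "subgrp (f ` ?D)" using sT(3) by (intro subgrp_image fd)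
  have Fwd_minus: "Fwd (- w)" if w: "Fwd w" for w
  proof -
    let ?cl = "\<lambda>v. part (f ` ?D) UNIV v"
    let ?J = "(\<lambda>c. ?cl (g c)) ` C"
    have cl: "?cl u = ?cl v \<longleftrightarrow> u - v \<in> f ` ?D" for u v using part_eq_iff[OF sfD, of u UNIV v] by simp
    define m where "m c = (SOME c'. c' \<in> C \<and> (\<exists>\<gamma>\<in>?D. f w + g c = g c' + f \<gamma>))" for c
    have m: "m c \<in> C \<and> (\<exists>\<gamma>\<in>?D. f w + g c = g (m c) + f \<gamma>)" if "c \<in> C" for c
    proof -
      have "\<exists>c'. c' \<in> C \<and> (\<exists>\<gamma>\<in>?D. f w + g c = g c' + f \<gamma>)" using w that unfolding Fwd_def by blast
      then show ?thesis unfolding m_def by (rule someI_ex)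
    qed
    have mcl: "f w + g c - g (m c) \<in> f ` ?D" if "c \<in> C" for c using m[OF that] by auto
    have inj: "?cl (g c) = ?cl (g c')" if cc: "c \<in> C" "c' \<in> C" and e: "?cl (g (m c)) = ?cl (g (m c'))" for c c'
    proof -
      have "g (m c) - g (m c') \<in> f ` ?D" using e cl by simp
      from subgrp_add[OF sfD subgrp_diff[OF sfD mcl[OF cc(1)] mcl[OF cc(2)]] this]
      have "g c - g c' \<in> f ` ?D" by (simp add: algebra_simps)
      then show ?thesis using cl by simp
    qed
    have "card ?J \<le> card ((\<lambda>c. ?cl (g (m c))) ` C)"
    proof -
      define h where "h L = (SOME c. c \<in> C \<and> ?cl (g (m c)) = L)" for L
      have h: "h (?cl (g (m c))) \<in> C \<and> ?cl (g (m (h (?cl (g (m c)))))) = ?cl (g (m c))" if "c \<in> C" for c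
        unfolding h_def by (rule someI[of "\<lambda>d. d \<in> C \<and> ?cl (g (m d)) = ?cl (g (m c))"]) (use that in simp)
      have "?J \<subseteq> (\<lambda>L. ?cl (g (h L))) ` ((\<lambda>c. ?cl (g (m c))) ` C)"
      proof
        fix L assume "L \<in> ?J"
        then obtain c where c: "c \<in> C" "L = ?cl (g c)" by blast
        have "?cl (g c) = ?cl (g (h (?cl (g (m c)))))" 
          using inj[OF c(1), of "h (?cl (g (m c)))"] h[OF c(1)] by simp
        then show "L \<in> (\<lambda>L. ?cl (g (h L))) ` ((\<lambda>c. ?cl (g (m c))) ` C)" using c by blast
      qed
      then show ?thesis by (rule surj_card_le[rotated]) (use fC in simp)
    qed
    moreover have sub: "(\<lambda>c. ?cl (g (m c))) ` C \<subseteq> ?J" using m by blast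
    ultimately have eq: "(\<lambda>c. ?cl (g (m c))) ` C = ?J" using fC by (intro card_seteq) auto
    show ?thesis unfolding Fwd_def
    proof
      fix c assume c: "c \<in> C"
      then have "?cl (g c) \<in> (\<lambda>c. ?cl (g (m c))) ` C" using eq by blast
      then obtain c' where c': "c' \<in> C" "?cl (g c) = ?cl (g (m c'))" by blast
      have "g c - g (m c') \<in> f ` ?D" using c'(2) cl by simp
      from subgrp_diff[OF sfD this mcl[OF c'(1)]]
      have "g c - g c' - f w \<in> f ` ?D" by (simp add: algebra_simps)
      then obtain \<gamma> where "\<gamma> \<in> ?D" "g c - g c' - f w = f \<gamma>" by blast
      then have "f (- w) + g c = g c' + f \<gamma>" by (simp add: fm algebra_simps)
      then show "\<exists>c'\<in>C. \<exists>\<gamma>\<in>?D. f (- w) + g c = g c' + f \<gamma>" using c'(1) \<open>\<gamma> \<in> ?D\<close> by blast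
    qed
  qed
  have Fwd_add: "Fwd (w + w')" if ww: "Fwd w" "Fwd w'" for w w'
    unfolding Fwd_def
  proof
    fix c assume "c \<in> C"
    then obtain c' \<gamma> where 1: "c' \<in> C" "\<gamma> \<in> ?D" "f w' + g c = g c' + f \<gamma>" using ww(2) by (auto simp: Fwd_def)
    then obtain c'' \<gamma>' where 2: "c'' \<in> C" "\<gamma>' \<in> ?D" "f w + g c' = g c'' + f \<gamma>'" using ww(1) by (auto simp: Fwd_def)
    have "f (w + w') + g c = f w + (f w' + g c)" by (simp add: fa add.assoc)
    also have "\<dots> = (f w + g c') + f \<gamma>" unfolding 1(3) by (simp add: add.assoc)
    also have "\<dots> = g c'' + f (\<gamma>' + \<gamma>)" unfolding 2(3) by (simp add: fa add.assoc)
    finally show "\<exists>c'\<in>C. \<exists>\<gamma>\<in>?D. f (w + w') + g c = g c' + f \<gamma>"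
      using 2(1) subgrp_add[OF sT(3) 2(2) 1(2)] by blast
  qed
  have FwdD: "Fwd w" if "w \<in> ?D" for w
    unfolding Fwd_def using that by (auto simp: add.commute)
  define H where "H = {w \<in> T1 ?G. Fwd w}"
  have sH: "subgrp H"
    unfolding subgrp_def
  proof (intro conjI ballI)
    show "0 \<in> H" using subgrp_zero[OF sT(1)] FwdD[OF subgrp_zero[OF sT(3)]] by (simp add: H_def)
    fix u v assume uv: "u \<in> H" "v \<in> H"
    then have "Fwd (u + - v)" by (intro Fwd_add Fwd_minus) (simp_all add: H_def)
    then show "u - v \<in> H" using uv subgrp_diff[OF sT(1), of u v] by (simp add: H_def)
  qed
  have row: "x' - x \<in> H" if x': "x' \<in> R" "x' - x \<in> T1 ?G" for x'
  proof -
    define P where "P = part (T1 ?G) R x"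
    define Q where "Q = part (T2 ?G) R x"
    have CPQ: "C = P \<inter> Q" unfolding CD(1) P_def Q_def by (rule part_D)
    define C' where "C' = part ?D R x'"
    have x'C': "x' \<in> C'" unfolding C'_def using x' sT(3) by (intro part_self)
    have C'P: "C' \<subseteq> P"
    proof
      fix u assume "u \<in> C'"
      then have "u \<in> R" "u - x' \<in> T1 ?G" using subsetD[OF D_subset(2)] by (auto simp: C'_def part_def)
      then show "u \<in> P" using subgrp_trans[OF sT(1) _ x'(2)] by (auto simp: P_def part_def)
    qed
    have fC': "finite C'" unfolding C'_def by (rule finite_subset[OF part_subset Rp(2)])
    have fPQ: "finite P" "finite Q" unfolding P_def Q_def by (auto intro: finite_subset[OF part_subset Rp(2)])
    have "Fwd (x' - x)" unfolding Fwd_def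
    proof
      fix c assume c: "c \<in> C"
      \<comment> \<open>All points of \<open>Ct\<close> have the same image under \<open>g\<close>
        modulo f D, so one common sum with f C + g C already tells where this class is sent.\<close>
      define Ct where "Ct = part (T2 ?D) C c"
      have sTD: "subgrp (T2 ?D)" by (rule sub_T(2)[OF TD[OF Tlv]])
      have cCt: "c \<in> Ct" unfolding Ct_def using c by (intro part_self[OF sTD])
      have CtC: "Ct \<subseteq> C" unfolding Ct_def by (rule part_subset)
      \<comment> \<open>If the two sets were disjoint, the cell would exceed the sums inside
        \<open>C\<close> by at least |C'|, more than the slack in \<open>EXTRA\<close>
        allows.\<close>
      have "lsum f g C' Ct \<inter> lsum f g C C \<noteq> {}"
      proof
        assume dis: "lsum f g C' Ct \<inter> lsum f g C C = {}"
        have "lsum f g C' Ct \<union> lsum f g C C \<subseteq> lsum f g P Q"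
          using C'P CtC CPQ lsum_mono[of C' P Ct Q f g] lsum_mono[of C P C Q f g] by blast
        then have "card (lsum f g C' Ct \<union> lsum f g C C) \<le> card (lsum f g P Q)"
          using fPQ by (intro card_mono finite_lsum)
        then have "card (lsum f g C' Ct) + card (lsum f g C C) \<le> card (lsum f g P Q)"
          using dis fC' fC finite_subset[OF CtC fC] by (simp add: card_Un_disjoint finite_lsum)
        moreover have "card C' \<le> card (lsum f g C' Ct)"
          using card_lsum_ge_left[OF finj fC' finite_subset[OF CtC fC]] cCt by blast
        moreover have "real (card (lsum f g P Q)) \<le> real (card (lsum f g C C)) + \<theta> * card A"
          unfolding P_def Q_def CD(1) by (rule EXTRA[OF k R CD(2)])
        ultimately have le: "real (card C') \<le> \<theta> * card A" by linarith
        have "\<rho> * card R \<le> card C'" unfolding C'_def part_D by (rule child_size'(1)[OF k R x'(1) x'(1)])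
        moreover have "\<rho> ^ k * card A \<le> card R" using level_size k R by simp
        then have "\<rho> * (\<rho> ^ k * card A) \<le> \<rho> * card R" using rho(1) by (intro mult_left_mono) auto
        ultimately have "\<rho> ^ Suc k * card A \<le> \<theta> * card A" using le by (simp add: mult.assoc)
        then have "\<rho> ^ Suc k \<le> \<theta>" using cA by simp
        moreover have "\<rho> ^ Suc N \<le> \<rho> ^ Suc k" using k rho(1,2) by (intro power_decreasing) auto
        ultimately show False using rho(4) by linarith
      qed
      then obtain v where v: "v \<in> lsum f g C' Ct" "v \<in> lsum f g C C" by blast
      obtain u w where uw: "u \<in> C'" "w \<in> Ct" "v = f u + g w" using v(1) by (rule lsumE)
      obtain u' w' where uw': "u' \<in> C" "w' \<in> C" "v = f u' + g w'" using v(2) by (rule lsumE)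
      have g1: "u - x' \<in> ?D" using uw(1) by (simp add: C'_def part_def)
      have g2: "u' - x \<in> ?D" using dC uw'(1) x by blast
      obtain \<gamma> where g3: "\<gamma> \<in> ?D" "g (w - c) = f \<gamma>" using uw(2) by (auto simp: Ct_def part_def pre_def)
      have "f (x' - x) + g c = g w' + f ((u' - x) - (u - x') - \<gamma>)"
      proof -
        have "g w = g c + f \<gamma>" using g3(2) by (simp add: gd algebra_simps)
        then have "f u + (g c + f \<gamma>) = f u' + g w'" using uw(3) uw'(3) by simp
        then have gc: "g c = f u' + g w' - f u - f \<gamma>" by (simp add: algebra_simps)
        show ?thesis unfolding gc by (simp add: fd fa algebra_simps)
      qed
      moreover have "(u' - x) - (u - x') - \<gamma> \<in> ?D" by (rule subgrp_diff[OF sT(3) subgrp_diff[OF sT(3) g2 g1] g3(1)])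
      ultimately show "\<exists>c'\<in>C. \<exists>\<gamma>\<in>?D. f (x' - x) + g c = g c' + f \<gamma>" using uw'(2) by blast
    qed
    then show ?thesis using x'(2) by (simp add: H_def)
  qed
  \<comment> \<open>\<open>H\<close> accounts for differences within the row of \<open>x\<close> and
    T2 for differences within a column. A point in the row of \<open>x\<close> and the column of any
    x' connects the two, so \<open>R\<close> lies in a coset of \<open>M\<close>.\<close>
  define M where "M = H + T2 ?G"
  have sM: "subgrp M" unfolding M_def using sH sT(2) by (rule subgrp_plus)
  have T2M: "T2 ?G \<subseteq> M" using set_plus_intro[OF subgrp_zero[OF sH]] by (auto simp: M_def)
  have MG: "M \<subseteq> ?G"
  proof
    fix v assume "v \<in> M"
    then obtain h w where hw: "h \<in> H" "w \<in> T2 ?G" "v = h + w" unfolding M_def by (rule set_plus_elim)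
    have "h \<in> ?G" "w \<in> ?G" using hw(1,2) by (simp_all add: H_def pre_def)
    then show "v \<in> ?G" unfolding hw(3) by (rule subgrp_add[OF T_sub[OF Tlv]])
  qed
  have base: "x' - x \<in> M" if x': "x' \<in> R" for x'
  proof -
    obtain y where y: "y \<in> part (T1 ?G) R x" "y \<in> part (T2 ?G) R x'"
      using child_size'(2)[OF k R CD(2) x'] by blast
    have "y - x \<in> H" using row y by (auto simp: part_def)
    moreover have "x' - y \<in> T2 ?G" using y(2) subgrp_diff_swap[OF sT(2)] by (simp add: part_def)
    ultimately have "(y - x) + (x' - y) \<in> M" unfolding M_def by (rule set_plus_intro)
    then show ?thesis by simp
  qed
  have "in_coset M R" unfolding in_coset_def
  proof (intro ballI)
    fix u v assume "u \<in> R" "v \<in> R"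
    from subgrp_diff[OF sM base[OF this(1)] base[OF this(2)]] show "u - v \<in> M" by simp
  qed
  then have M: "M = ?G" using gR sM T2M MG unfolding gen_def by blast
  \<comment> \<open>Write an element of T1 as h + w with h in \<open>H\<close> and w in T2. Then w
    also lies in T1, hence in D, and shifts by f D change no class.\<close>
  have T1F: "Fwd t" if t: "t \<in> T1 ?G" for t
  proof -
    have "t \<in> M" using t M by (simp add: pre_def)
    then obtain h w where hw: "h \<in> H" "w \<in> T2 ?G" "t = h + w" unfolding M_def by (rule set_plus_elim)
    have "w = t - h" using hw(3) by simp
    then have "w \<in> T1 ?G" using subgrp_diff[OF sT(1) t] hw(1) by (simp add: H_def)
    then have "Fwd w" using hw(2) by (intro FwdD) (simp add: dpre_def)
    then show ?thesis unfolding hw(3) using Fwd_add hw(1) by (simp add: H_def)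
  qed
  obtain y where y: "y \<in> ?G" "g z = f y" using z by (auto simp: dpre_def pre_def)
  have "y \<in> T1 ?G" using y(1) imageI[OF subsetD[OF D_subset(1) z], of g] unfolding y(2) by (simp add: pre_def)
  then obtain c' \<gamma> where c': "c' \<in> C" "\<gamma> \<in> ?D" "f y + g x = g c' + f \<gamma>" using T1F x unfolding Fwd_def by blast
  then have "g (c' - (x + z)) = f (- \<gamma>)" using y(2) by (simp add: gd ga fm algebra_simps)
  moreover have "c' - (x + z) \<in> ?D"
    using subgrp_diff[OF sT(3) dC[OF c'(1) x] z] by (simp add: algebra_simps)
  ultimately have "c' - (x + z) \<in> T2 ?D" using subgrp_minus[OF sT(3) c'(2)] by (auto simp: pre_def)
  then show ?thesis using c'(1) by blast
qed

text \<open>Since \<open>C\<close> meets all cosets of T2(D) in D, each element of D is a difference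
  of points of \<open>C\<close> modulo T2(D). This inheritance is what allows
  \<open>full_columns\<close> to be iterated.\<close>

lemma gen_child:
  assumes k: "k \<le> N" and R: "R \<in> parts (lv G k) A" and gR: "gen f g (lv G k) R" and C: "C \<in> parts (D (lv G k)) R"
  shows "gen f g (D (lv G k)) C"
  unfolding gen_def
proof (intro allI impI)
  let ?D = "D (lv G k)"
  fix M assume M: "subgrp M \<and> T2 ?D \<subseteq> M \<and> M \<subseteq> ?D \<and> in_coset M C"
  obtain x where x: "x \<in> C" using parts_nonempty[OF sub_T(3)[OF Tlv] C] by blast
  have "z \<in> M" if z: "z \<in> ?D" for z
  proof -
    obtain x' where x': "x' \<in> C" "x' - (x + z) \<in> T2 ?D" using full_columns[OF k R gR C x z] by blast
    have sM: "subgrp M" and 1: "x' - (x + z) \<in> M" and 2: "x' - x \<in> M" using M x x' by (auto simp: in_coset_def)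
    show ?thesis using subgrp_diff[OF sM 2 1] by simp
  qed
  then show "M = ?D" using M by blast
qed

lemma gen_level: "k \<le> Suc N \<Longrightarrow> R \<in> parts (lv G k) A \<Longrightarrow> gen f g (lv G k) R"
proof (induction k arbitrary: R)
  case 0
  then obtain x where "x \<in> A" "R = part G A x" by (auto simp: parts_def)
  then have "R = A" using cosA by (auto simp: part_def in_coset_def)
  then show ?case using gens by simp
next
  case (Suc k)
  obtain R' where R': "R' \<in> parts (lv G k) A" "R \<in> parts (D (lv G k)) R'" using level_child[OF Suc.prems(2)] by blast
  show ?case using gen_child[OF _ R'(1) Suc.IH[OF _ R'(1)] R'(2)] Suc.prems(1) by simp
qed

text \<open>Fullness is deduced from the parent class, so it starts at level 1. The first step of
  \<open>n\<close> is only bounded by a b, while the later ones are exact.\<close>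

lemma card_columns:
  assumes k: "k \<le> N" and C: "C \<in> parts (lv G (Suc k)) A"
  shows "card (parts (T2 (lv G (Suc k))) C) = a"
proof -
  obtain R where R: "R \<in> parts (lv G k) A" "C \<in> parts (D (lv G k)) R" using level_child[OF C] by blast
  obtain x where x: "x \<in> C" using R_props(3)[OF C] by blast
  have "card (parts (T2 (D (lv G k))) C) = card (parts (T2 (D (lv G k))) (D (lv G k)))"
  proof (rule card_parts_full[OF sub_T(2)[OF TD[OF Tlv]] _ x])
    show "in_coset (D (lv G k)) C" using R_props(1)[OF C] by simp
    show "\<exists>x'\<in>C. x' - (x + z) \<in> T2 (D (lv G k))" if "z \<in> D (lv G k)" for z
      using full_columns[OF k R(1) gen_level[OF _ R(1)] R(2) x that] k by simp
  qed
  then show ?thesis using T_a[OF TD[OF Tlv]] by simp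
qed

lemma card_rows:
  assumes k: "k \<le> N" and C: "C \<in> parts (lv G (Suc k)) A"
  shows "card (parts (T1 (lv G (Suc k))) C) = b"
proof -
  interpret sw: violator g f \<T> b a A G K \<theta> N by (rule violator_swap) unfold_locales
  show ?thesis using sw.card_columns[OF k] C by (simp add: lev_swap[of g f] dpre_swap[of g f])
qed

lemma card_children:
  assumes k: "Suc k \<le> N" and C: "C \<in> parts (lv G (Suc k)) A"
  shows "card (parts (D (lv G (Suc k))) C) = a * b"
  using card_children_product[OF Tlv R_props(1,2)[OF C]] child_size'(2)[OF k C] card_rows[OF _ C] card_columns[OF _ C] k
  by simp

definition n :: "nat \<Rightarrow> nat" where "n k = card (parts (lv G k) A)"

lemma n_pos: "0 < n k" using neA finA by (auto simp: n_def card_gt_0_iff parts_def)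

lemma n_0: "n 0 = 1" "parts (lv G 0) A = {A}"
proof -
  have "part G A y = A" if "y \<in> A" for y using cosA that by (auto simp: part_def in_coset_def)
  then show "parts (lv G 0) A = {A}" using neA by (auto simp: parts_def)
  then show "n 0 = 1" by (simp add: n_def)
qed

lemma n_Suc: "1 \<le> k \<Longrightarrow> k \<le> N \<Longrightarrow> n (Suc k) = n k * (a * b)"
  unfolding n_def card_parts_lev_Suc[OF TG finA] using card_children[of "k - 1"] by simp

lemma n_1_le: "n 1 \<le> a * b" using card_parts_lev_le[OF TG cosA finA, of 1] by (simp add: n_def)

lemma n_Suc_le: "k \<le> N \<Longrightarrow> n (Suc k) \<le> n k * (a * b)"
  using n_Suc[of k] n_1_le n_0 by (cases "k = 0") auto

text \<open>The points of \<open>W\<close> have equal image under \<open>g\<close> modulo f of the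
  level \<open>k\<close> lattice, so translates of g W by f of one representative for each class of
  level \<open>k\<close> are disjoint. This caps the density of a class and thereby stops the
  density increment.\<close>

lemma density_bound:
  assumes W: "W \<in> parts (lv G (Suc k)) A"
  shows "n k * card W \<le> s A"
proof -
  let ?G = "lv G k"
  note Wp = R_props[OF W]
  define rep where "rep R = (SOME x. x \<in> R)" for R :: "'g set"
  have rep: "rep R \<in> R" if "R \<in> parts ?G A" for R
    using R_props(3)[OF that] unfolding rep_def by (simp add: some_in_eq)
  let ?h = "\<lambda>(R, w). f (rep R) + g w"
  have "inj_on ?h (parts ?G A \<times> W)"
  proof (rule inj_onI, clarify)
    fix R w R' w'
    assume R: "R \<in> parts ?G A" "R' \<in> parts ?G A" and w: "w \<in> W" "w' \<in> W"
      and e: "f (rep R) + g w = f (rep R') + g w'"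
    have "w' - w \<in> T2 ?G" using Wp(1) w subsetD[OF D_subset(3)] by (auto simp: in_coset_def)
    then obtain y where y: "y \<in> ?G" "g (w' - w) = f y" by (auto simp: pre_def)
    have "f (rep R - rep R') = f y" using e y(2) by (simp add: fd gd algebra_simps)
    then have "rep R - rep R' \<in> ?G" using injD[OF finj] y(1) by metis
    then have "R = R'"
      using parts_mem[OF T_sub[OF Tlv] R(1) rep[OF R(1)]] parts_mem[OF T_sub[OF Tlv] R(2) rep[OF R(2)]] part_eqI[OF T_sub[OF Tlv]]
      by metis
    moreover from this have "g w = g w'" using e by simp
    ultimately show "R = R' \<and> w = w'" using injD[OF ginj] by blast
  qed
  moreover have "?h ` (parts ?G A \<times> W) \<subseteq> lsum f g A A"
    using rep parts_subset[of _ ?G A] Wp(4) by (auto intro!: lsumI)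
  ultimately have "card (parts ?G A \<times> W) \<le> s A"
    using finA by (intro card_inj_on_le[of ?h]) (auto intro: finite_lsum)
  then show ?thesis by (simp add: n_def card_cartesian_product)
qed

end

section \<open>Weighted means, and the gain from an unbalanced pair\<close>

text \<open>AM-GM for the reciprocals. The harmonic mean is a rational function, which makes the
  near and far estimates purely algebraic.\<close>

lemma geo_ge_harmonic:
  fixes x y l :: real
  assumes "0 < x" "0 < y" "0 < l" "l < 1"
  shows "x * y / (l * y + (1 - l) * x) \<le> x powr l * y powr (1 - l)"
proof -
  have "(1 / x) powr l * (1 / y) powr (1 - l) \<le> l * (1 / x) + (1 - l) * (1 / y)"
    using assms by (intro Youngs_inequality_0) auto
  also have "\<dots> = (l * y + (1 - l) * x) / (x * y)" using assms by (simp add: field_simps)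
  finally have "1 / (x powr l * y powr (1 - l)) \<le> (l * y + (1 - l) * x) / (x * y)"
    using assms by (simp add: powr_divide)
  moreover have "0 < l * y + (1 - l) * x" using assms by (intro add_pos_pos mult_pos_pos) auto
  ultimately show ?thesis using assms by (simp add: field_simps)
qed

text \<open>The harmonic mean falls short of the arithmetic mean by exactly l (1-l) (x-y)^2 / d with
  d = l y + (1-l) x. Here l (1-l) \<le> 1/4 and d \<ge> 1/2, hence the coefficient 1/2.\<close>

lemma geo_ge_near:
  fixes x y l :: real
  assumes x: "1 / 2 \<le> x" "1 / 2 \<le> y" and l: "0 < l" "l < 1"
  shows "l * x + (1 - l) * y - (x - y)\<^sup>2 / 2 \<le> x powr l * y powr (1 - l)"
proof -
  define d where "d = l * y + (1 - l) * x"
  have "l * (1 / 2) + (1 - l) * (1 / 2) \<le> d" unfolding d_def using assms by (intro add_mono mult_left_mono) auto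
  then have d: "1 / 2 \<le> d" by (simp add: diff_divide_distrib)
  have "0 \<le> (l - 1 / 2)\<^sup>2" by simp
  then have l4: "l * (1 - l) \<le> 1 / 4" by (simp add: power2_eq_square algebra_simps)
  have "l * (1 - l) * (x - y)\<^sup>2 \<le> 1 / 4 * (x - y)\<^sup>2" using l4 by (intro mult_right_mono) auto
  also have "\<dots> \<le> (x - y)\<^sup>2 / 2 * d" using d mult_left_mono[of "1 / 2" d "(x - y)\<^sup>2 / 2"] by simp
  finally have "l * (1 - l) * (x - y)\<^sup>2 \<le> (x - y)\<^sup>2 / 2 * d" .
  moreover have "(l * x + (1 - l) * y) * d - l * (1 - l) * (x - y)\<^sup>2 = x * y"
    unfolding d_def by (simp add: power2_eq_square algebra_simps)
  ultimately have "(l * x + (1 - l) * y - (x - y)\<^sup>2 / 2) * d \<le> x * y" by (simp add: algebra_simps)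
  then have "l * x + (1 - l) * y - (x - y)\<^sup>2 / 2 \<le> x * y / d" using d by (simp add: pos_le_divide_eq)
  also have "\<dots> \<le> x powr l * y powr (1 - l)" unfolding d_def using assms by (intro geo_ge_harmonic) auto
  finally show ?thesis .
qed

text \<open>The gain over the smaller number is linear in the difference; this serves a row that is
  much too light.\<close>

lemma geo_ge_far:
  fixes x y l :: real
  assumes x: "0 < x" "x \<le> y" "y \<le> 2" and l: "0 < l" "l < 1"
  shows "x + x * (1 - l) * (y - x) / 2 \<le> x powr l * y powr (1 - l)"
proof -
  define d where "d = l * y + (1 - l) * x"
  have d0: "0 < d" unfolding d_def using assms by (intro add_pos_pos mult_pos_pos) auto
  have "d \<le> l * y + (1 - l) * y" unfolding d_def using assms by (intro add_mono mult_left_mono) auto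
  then have d: "d \<le> 2" using x by (simp add: algebra_simps)
  have "0 \<le> x * (1 - l) * (y - x) / 2" using assms by simp
  from mult_left_mono[OF d this] have "x * (1 - l) * (y - x) / 2 * d \<le> x * (1 - l) * (y - x)" by simp
  moreover have "x * d + x * (1 - l) * (y - x) = x * y" unfolding d_def by (simp add: algebra_simps)
  ultimately have "(x + x * (1 - l) * (y - x) / 2) * d \<le> x * y" by (simp add: distrib_right)
  then have "x + x * (1 - l) * (y - x) / 2 \<le> x * y / d" using d0 by (simp add: pos_le_divide_eq)
  also have "\<dots> \<le> x powr l * y powr (1 - l)" unfolding d_def using assms by (intro geo_ge_harmonic) auto
  finally show ?thesis .
qed

lemma geo_ge_min:
  fixes x y l m :: real
  assumes "0 \<le> m" "m \<le> x" "m \<le> y" and l: "0 < l" "l < 1"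
  shows "m \<le> x powr l * y powr (1 - l)"
proof (cases "m = 0")
  case False
  then have "m = m powr l * m powr (1 - l)" using assms by (simp flip: powr_add)
  also have "\<dots> \<le> x powr l * y powr (1 - l)" using assms by (intro mult_mono powr_mono2) auto
  finally show ?thesis .
qed simp

text \<open>What the other terms cannot supply must come from \<open>i\<close>. In this way upper
  bounds alone give two-sided control once the total is known.\<close>

lemma uniform_of_upper:
  fixes z :: "'i \<Rightarrow> real"
  assumes I: "finite I" "i \<in> I" and up: "\<And>j. j \<in> I \<Longrightarrow> z j \<le> B"
  shows "sum z I - (real (card I) - 1) * B \<le> z i"
proof -
  have "sum z I = z i + sum z (I - {i})" using I by (simp add: sum.remove)
  also have "sum z (I - {i}) \<le> real (card (I - {i})) * B" using up by (intro sum_bounded_above) auto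
  also have "real (card (I - {i})) = real (card I) - 1"
  proof -
    have "0 < card I" using I by (auto simp: card_gt_0_iff)
    then show ?thesis using I by (simp add: card_Diff_singleton of_nat_diff Suc_le_eq)
  qed
  finally show ?thesis by simp
qed

text \<open>Here \<open>v\<close> and \<open>w\<close> are the sizes of the rows of a light class and of the columns of a dense class,
  normalised to have density about 1. If some row is much lighter than the others, it gains on its own;
  otherwise the geometric means are linear up to a quadratic error.\<close>

lemma pair_gain:
  fixes v :: "'i \<Rightarrow> real" and w :: "'j \<Rightarrow> real" and F :: "'i \<Rightarrow> 'j \<Rightarrow> real" and a b :: nat
  assumes fin: "finite I" "finite J" and cI: "card I = b" "0 < b" and cJ: "card J = a" "0 < a"
    and K: "1 \<le> K" and l: "0 < l" "l < 1"
    and L: "3 * real a + 4 / (1 - l) * (5 * K * real a * real b + 1) \<le> L"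
    and \<xi>: "0 < \<xi>" "\<xi> \<le> (1 - l) / (8 * L\<^sup>2)"
    and v: "\<And>i. i \<in> I \<Longrightarrow> 0 < v i" "\<And>i. i \<in> I \<Longrightarrow> v i \<le> 1 + 2 * \<xi>"
    and w: "\<And>j. j \<in> J \<Longrightarrow> 0 < w j" "\<And>j. j \<in> J \<Longrightarrow> w j \<le> 1 + 2 * \<xi>"
    and sw: "real a * (1 - \<xi> / 2) \<le> sum w J"
    and svw: "real a * sum v I \<le> real b * sum w J - real a * real b * \<xi> / 2"
    and F1: "\<And>i j. i \<in> I \<Longrightarrow> j \<in> J \<Longrightarrow> K * (v i powr l * w j powr (1 - l)) - E \<le> F i j"
    and F2: "\<And>i j. i \<in> I \<Longrightarrow> j \<in> J \<Longrightarrow> real b * w j - E \<le> F i j"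
  shows "K * real a * sum v I + real a * (1 - l) * \<xi> / 4 - real a * real b * E \<le> (\<Sum>i\<in>I. \<Sum>j\<in>J. F i j)"
proof -
  have ab1: "1 \<le> real a" "1 \<le> real b" using cI cJ by auto
  have Kab: "1 \<le> real a * real b" "1 \<le> K * real a" "1 \<le> K * real b"
    "1 \<le> K * real a * real b" "K * real a \<le> K * real a * real b" "real a \<le> K * real a * real b"
  proof -
    show 1: "1 \<le> real a * real b" using mult_mono[of 1 "real a" 1 "real b"] ab1 by simp
    show 2: "1 \<le> K * real a" using mult_mono[of 1 K 1 "real a"] ab1 K by simp
    show 3: "1 \<le> K * real b" using mult_mono[of 1 K 1 "real b"] ab1 K by simp
    show "1 \<le> K * real a * real b" using mult_mono[of 1 "K * real a" 1 "real b"] ab1 2 by simp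
    show "K * real a \<le> K * real a * real b" using mult_left_mono[of 1 "real b" "K * real a"] ab1 2 by simp
    show "real a \<le> K * real a * real b" using mult_left_mono[of 1 "K * real b" "real a"] ab1 3 by (simp add: mult_ac)
  qed
  \<comment> \<open>In units of a \<xi>, the number Q - 1 bounds the loss of the remaining b - 1
    rows when one row is too light. That row earns \<open>Q\<close>, so one unit is left
    over.\<close>
  define Q where "Q = 5 * K * real a * real b + 1"
  have Q: "0 < Q" "6 \<le> Q" using Kab by (simp_all add: Q_def)
  have "4 * Q \<le> 4 / (1 - l) * Q"
  proof -
    have "4 \<le> 4 / (1 - l)" using l by (simp add: le_divide_eq)
    then show ?thesis using Q by (intro mult_right_mono) auto
  qed
  then have L1: "3 * real a + 4 * Q \<le> L" using L by (simp add: Q_def)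
  have L24: "24 \<le> L" using L1 Q ab1 by simp
  have L\<xi>: "L\<^sup>2 * \<xi> \<le> (1 - l) / 8"
    using \<xi> L24 by (simp add: field_simps)
  have "L * (L * \<xi>) \<le> 1 / 8" using L\<xi> l by (simp add: power2_eq_square mult.assoc)
  moreover have "0 \<le> L * \<xi>" using L24 \<xi> by simp
  moreover have "24 * (L * \<xi>) \<le> L * (L * \<xi>)" using L24 \<xi> by (intro mult_right_mono) auto
  ultimately have L8: "L * \<xi> \<le> 1 / 8" by linarith
  have Q\<xi>: "Q * \<xi> \<le> 1 / 8" "3 * real a * \<xi> \<le> 1 / 8" "\<xi> \<le> 1 / 8"
  proof -
    have "Q * \<xi> \<le> L * \<xi>" using L1 Q ab1 \<xi> by (intro mult_right_mono) auto
    then show "Q * \<xi> \<le> 1 / 8" using L8 by simp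
    have "3 * real a * \<xi> \<le> L * \<xi>" using L1 Q \<xi> by (intro mult_right_mono) auto
    then show "3 * real a * \<xi> \<le> 1 / 8" using L8 by simp
    have "1 * \<xi> \<le> L * \<xi>" using L24 \<xi> by (intro mult_right_mono) auto
    then show "\<xi> \<le> 1 / 8" using L8 by simp
  qed
  have wlow: "1 - 3 * real a * \<xi> \<le> w j" if j: "j \<in> J" for j
  proof -
    have "sum w J - (real a - 1) * (1 + 2 * \<xi>) \<le> w j"
      using uniform_of_upper[of J j w "1 + 2 * \<xi>"] fin j w cJ by simp
    moreover have "real a * \<xi> / 2 + 2 * (real a - 1) * \<xi> \<le> 3 * real a * \<xi>"
      using \<xi>(1) ab1 by (simp add: algebra_simps)
    ultimately show ?thesis using sw by (simp add: algebra_simps)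
  qed
  show ?thesis
  proof (cases "\<forall>i\<in>I. 1 - L * \<xi> \<le> v i")
    case True
    \<comment> \<open>All rows are close to 1, so the quadratic error is at most 2 L^2 \<xi>^2 for
      each pair. The bound on \<xi> lets it consume only half of the gain that the surplus of the
      columns provides.\<close>
    have summand: "K * (l * v i + (1 - l) * w j - 2 * L\<^sup>2 * \<xi>\<^sup>2) - E \<le> F i j" if ij: "i \<in> I" "j \<in> J" for i j
    proof -
      have vi: "1 - L * \<xi> \<le> v i" "v i \<le> 1 + 2 * \<xi>" using True v ij by auto
      have wj: "1 - 3 * real a * \<xi> \<le> w j" "w j \<le> 1 + 2 * \<xi>" using wlow w ij by auto
      have t: "3 * real a * \<xi> \<le> L * \<xi>" "2 * \<xi> \<le> L * \<xi>" using L1 Q ab1 \<xi> by (auto intro!: mult_right_mono)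
      have "\<bar>v i - w j\<bar> \<le> 2 * (L * \<xi>)" using vi wj t by linarith
      then have "(v i - w j)\<^sup>2 \<le> (2 * (L * \<xi>))\<^sup>2" by (metis abs_ge_zero power2_abs power_mono)
      then have sq: "(v i - w j)\<^sup>2 / 2 \<le> 2 * L\<^sup>2 * \<xi>\<^sup>2" by (simp add: power_mult_distrib)
      have "l * v i + (1 - l) * w j - (v i - w j)\<^sup>2 / 2 \<le> v i powr l * w j powr (1 - l)"
        using vi wj L8 Q\<xi> l by (intro geo_ge_near) auto
      then have "K * (l * v i + (1 - l) * w j - 2 * L\<^sup>2 * \<xi>\<^sup>2) \<le> K * (v i powr l * w j powr (1 - l))"
        using sq K by (intro mult_left_mono) auto
      then show ?thesis using F1[OF ij] by linarith
    qed
    define Z where "Z = (1 - l) * \<xi> / 4"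
    define X where "X = K * (l * (real a * sum v I) + (1 - l) * (real b * sum w J))"
    define c where "c = K * real a * real b"
    have e1: "(\<Sum>i\<in>I. \<Sum>j\<in>J. K * (l * v i + (1 - l) * w j - 2 * L\<^sup>2 * \<xi>\<^sup>2) - E) \<le> (\<Sum>i\<in>I. \<Sum>j\<in>J. F i j)"
      using summand by (intro sum_mono)
    have e2: "(\<Sum>i\<in>I. \<Sum>j\<in>J. K * (l * v i + (1 - l) * w j - 2 * L\<^sup>2 * \<xi>\<^sup>2) - E)
      = X - c * (2 * L\<^sup>2 * \<xi>\<^sup>2) - real a * real b * E"
      using cI cJ unfolding X_def c_def
      by (simp add: sum_subtractf sum.distrib sum_distrib_left[symmetric] algebra_simps)
    have "(1 - l) * (real a * sum v I + real a * real b * \<xi> / 2) \<le> (1 - l) * (real b * sum w J)"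
      using svw l by (intro mult_left_mono) auto
    then have "real a * sum v I + (1 - l) * (real a * real b * \<xi> / 2) \<le> l * (real a * sum v I) + (1 - l) * (real b * sum w J)"
      by (simp add: algebra_simps)
    then have "K * (real a * sum v I + (1 - l) * (real a * real b * \<xi> / 2)) \<le> X"
      unfolding X_def using K by (intro mult_left_mono) auto
    moreover have "K * (real a * sum v I + (1 - l) * (real a * real b * \<xi> / 2)) = K * real a * sum v I + 2 * (c * Z)"
      by (simp add: Z_def c_def field_simps)
    ultimately have e3: "K * real a * sum v I + 2 * (c * Z) \<le> X" by simp
    have e4: "c * (2 * L\<^sup>2 * \<xi>\<^sup>2) \<le> c * Z"
    proof (rule mult_left_mono)
      show "2 * L\<^sup>2 * \<xi>\<^sup>2 \<le> Z"
        using mult_right_mono[OF L\<xi>, of "2 * \<xi>"] \<xi>(1) by (simp add: Z_def power2_eq_square mult_ac)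
    qed (use Kab in \<open>simp add: c_def\<close>)
    have e5: "real a * Z \<le> c * Z" using Kab l \<xi> unfolding c_def Z_def by (intro mult_right_mono) auto
    have "real a * (1 - l) * \<xi> / 4 = real a * Z" by (simp add: Z_def)
    then show ?thesis using e1 e2 e3 e4 e5 by linarith
  next
    case False
    then obtain i0 where i0: "i0 \<in> I" "v i0 < 1 - L * \<xi>" by auto
    define d where "d = 5 * real a * \<xi>"
    \<comment> \<open>A row exceeds no column by more than \<open>d\<close>, because rows are at
      most 1 + 2 \<xi> and columns at least 1 - 3 a \<xi>. Each pair is thus worth \<open>K\<close>
      times the row, up to \<open>d\<close>.\<close>
    have other: "K * real a * v i - K * real a * d - real a * E \<le> (\<Sum>j\<in>J. F i j)" if i: "i \<in> I" for i
    proof -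
      have "K * (v i - d) - E \<le> F i j" if j: "j \<in> J" for j
      proof -
        have vd: "v i - d \<le> v i powr l * w j powr (1 - l)"
        proof (cases "0 \<le> v i - d")
          case True
          show ?thesis
          proof (rule geo_ge_min[OF True _ _ l])
            show "v i - d \<le> v i" using \<xi> by (simp add: d_def)
            have "\<xi> \<le> real a * \<xi>" using mult_right_mono[of 1 "real a" \<xi>] ab1 \<xi> by simp
            then show "v i - d \<le> w j" using v(2)[OF i] wlow[OF j] by (simp add: d_def)
          qed
        next
          case False
          then show ?thesis by (meson linorder_linear mult_nonneg_nonneg order_trans powr_ge_zero)
        qed
        then have "K * (v i - d) \<le> K * (v i powr l * w j powr (1 - l))" using K by (intro mult_left_mono) auto
        then show ?thesis using F1[OF i j] by linarith
      qed
      then have "(\<Sum>j\<in>J. K * (v i - d) - E) \<le> (\<Sum>j\<in>J. F i j)" by (intro sum_mono)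
      then show ?thesis using cJ by (simp add: algebra_simps)
    qed
    have special: "K * real a * v i0 + real a * Q * \<xi> - real a * E \<le> (\<Sum>j\<in>J. F i0 j)"
    \<comment> \<open>The linear gain is proportional to \<open>v i0\<close> and useless for an
      extremely light row. There the trivial bound \<open>F2\<close> is enough, since K v i0 is
      below 1/2 while the columns average about 1.\<close>
    proof (cases "1 / (2 * K) \<le> v i0")
      case True
      have "K * v i0 + Q * \<xi> - E \<le> F i0 j" if j: "j \<in> J" for j
      proof -
        have gap: "(L - 3 * real a) * \<xi> \<le> w j - v i0" using wlow[OF j] i0(2) by (simp add: algebra_simps)
        have gap0: "0 \<le> (L - 3 * real a) * \<xi>" using L1 Q \<xi> by simp
        have "1 / 2 \<le> K * v i0" using True K by (simp add: field_simps)
        then have "1 / 2 * ((1 - l) * ((L - 3 * real a) * \<xi>) / 2) \<le> (K * v i0) * ((1 - l) * (w j - v i0) / 2)"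
          using gap gap0 l by (intro mult_mono divide_right_mono mult_left_mono) auto
        moreover have "Q * \<xi> \<le> 1 / 2 * ((1 - l) * ((L - 3 * real a) * \<xi>) / 2)"
        proof -
          have "4 / (1 - l) * Q \<le> L - 3 * real a" using L by (simp add: Q_def)
          then have "4 * Q \<le> (1 - l) * (L - 3 * real a)" using l by (simp add: field_simps)
          then have "4 * Q * \<xi> \<le> (1 - l) * (L - 3 * real a) * \<xi>" using \<xi> by (intro mult_right_mono) auto
          then show ?thesis by (simp add: mult_ac)
        qed
        moreover have "v i0 + v i0 * (1 - l) * (w j - v i0) / 2 \<le> v i0 powr l * w j powr (1 - l)"
          using v[OF i0(1)] w(2)[OF j] gap gap0 Q\<xi> l by (intro geo_ge_far) auto
        then have "K * (v i0 + v i0 * (1 - l) * (w j - v i0) / 2) \<le> K * (v i0 powr l * w j powr (1 - l))"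
          using K by (intro mult_left_mono) auto
        moreover have "K * (v i0 + v i0 * (1 - l) * (w j - v i0) / 2) = K * v i0 + (K * v i0) * ((1 - l) * (w j - v i0) / 2)"
          by (simp add: distrib_left mult.assoc)
        ultimately show ?thesis using F1[OF i0(1) j] by linarith
      qed
      then have "(\<Sum>j\<in>J. K * v i0 + Q * \<xi> - E) \<le> (\<Sum>j\<in>J. F i0 j)" by (intro sum_mono)
      then show ?thesis using cJ by (simp add: algebra_simps)
    next
      case False
      have "(\<Sum>j\<in>J. real b * w j - E) \<le> (\<Sum>j\<in>J. F i0 j)" using F2[OF i0(1)] by (intro sum_mono)
      then have 1: "real b * sum w J - real a * E \<le> (\<Sum>j\<in>J. F i0 j)" using cJ by (simp add: sum_subtractf sum_distrib_left)
      have "1 * sum w J \<le> real b * sum w J" using ab1 w by (intro mult_right_mono sum_nonneg) (auto intro: less_imp_le)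
      then have 2: "real a * (1 - \<xi> / 2) - real a * E \<le> (\<Sum>j\<in>J. F i0 j)" using 1 sw by linarith
      have "K * v i0 \<le> 1 / 2" using False K by (simp add: field_simps)
      then have "real a * (K * v i0 + Q * \<xi>) \<le> real a * (1 - \<xi> / 2)" using Q\<xi> by (intro mult_left_mono) auto
      then show ?thesis using 2 by (simp add: algebra_simps)
    qed
    have "(\<Sum>i\<in>I. \<Sum>j\<in>J. F i j) = (\<Sum>j\<in>J. F i0 j) + (\<Sum>i\<in>I - {i0}. \<Sum>j\<in>J. F i j)"
      using fin i0 by (simp add: sum.remove)
    moreover have "(\<Sum>i\<in>I - {i0}. K * real a * v i - K * real a * d - real a * E) \<le> (\<Sum>i\<in>I - {i0}. \<Sum>j\<in>J. F i j)"
      using other by (intro sum_mono) auto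
    moreover have "(\<Sum>i\<in>I - {i0}. K * real a * v i - K * real a * d - real a * E)
      = K * real a * (sum v I - v i0) - (real b - 1) * (K * real a * d + real a * E)"
    proof -
      have c: "real (card (I - {i0})) = real b - 1" using fin i0 cI by (simp add: of_nat_diff Suc_le_eq)
      have sv: "sum v (I - {i0}) = sum v I - v i0" using fin i0 by (simp add: sum_diff1)
      have "(\<Sum>i\<in>I - {i0}. K * real a * v i - K * real a * d - real a * E)
        = K * real a * sum v (I - {i0}) - real (card (I - {i0})) * (K * real a * d + real a * E)"
        by (simp add: sum_subtractf sum_distrib_left[symmetric] algebra_simps)
      then show ?thesis unfolding c sv .
    qed
    moreover have "(real b - 1) * (K * real a * d) \<le> real a * (Q - 1) * \<xi>"
    proof -
      have "(real b - 1) * (K * real a * d) \<le> real b * (K * real a * d)"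
        using K \<xi> by (intro mult_right_mono) (auto simp: d_def)
      then show ?thesis by (simp add: d_def Q_def algebra_simps)
    qed
    moreover have "real a * ((1 - l) * \<xi> / 4) \<le> real a * \<xi>" using l \<xi> by (intro mult_left_mono) auto
    moreover have "(real b - 1) * (K * real a * d + real a * E)
        = (real b - 1) * (K * real a * d) + real a * real b * E - real a * E"
      "K * real a * (sum v I - v i0) = K * real a * sum v I - K * real a * v i0"
      "real a * (Q - 1) * \<xi> = real a * Q * \<xi> - real a * \<xi>"
      by (simp_all add: algebra_simps)
    moreover have "real a * (1 - l) * \<xi> / 4 = real a * ((1 - l) * \<xi> / 4)" by simp
    ultimately show ?thesis using special by linarith
  qed
qed

section \<open>Equidistribution by density increment\<close>

context tight_pair
begin

text \<open>Two levels are recorded because a sharp estimate for the sums of two children needs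
  their rows and columns to be balanced, which is uniformity of the second level.\<close>

definition nice :: "real \<Rightarrow> 'g set \<Rightarrow> 'g set \<Rightarrow> bool" where
  "nice \<eta> G A \<longleftrightarrow>
     (\<forall>x\<in>A. \<forall>y\<in>A. part (T1 G) A x \<inter> part (T2 G) A y \<noteq> {}) \<and>
     (\<forall>C\<in>parts (D G) A. card (parts (T1 (D G)) C) = b \<and> card (parts (T2 (D G)) C) = a \<and>
        card (parts (D (D G)) C) = a * b \<and>
        \<bar>real (card C) * real (card (parts (D G) A)) - real (card A)\<bar> \<le> \<eta> * real (card A)) \<and>
     (\<forall>E\<in>parts (D (D G)) A.
        \<bar>real (card E) * real (card (parts (D (D G)) A)) - real (card A)\<bar> \<le> \<eta> * real (card A))"

text \<open>Inside a row, congruence modulo T1 is automatic, so splitting by T2 is splitting into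
  children. Bounds on children thus become bounds on rows.\<close>

lemma part_T2_row:
  assumes G: "\<T> G" and x: "x \<in> part (T1 G) V x0"
  shows "part (T2 G) (part (T1 G) V x0) x = part (D G) V x"
proof -
  have "part (T1 G) V x0 = part (T1 G) V x" using x part_eqI[OF sub_T(1)[OF G], of x x0 V] by (simp add: part_def)
  then show ?thesis unfolding part_D by (auto simp: part_def)
qed

lemma card_row_le:
  assumes G: "\<T> G" and V: "in_coset G V" "finite V" and P: "P \<in> parts (T1 G) V"
    and B: "\<And>E. E \<in> parts (D G) V \<Longrightarrow> real (card E) \<le> B"
  shows "real (card P) \<le> real a * B"
proof -
  obtain x0 where x0: "x0 \<in> V" "P = part (T1 G) V x0" using P by (auto simp: parts_def)
  have PV: "P \<subseteq> V" using parts_subset[OF P] .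
  have fP: "finite P" using finite_subset[OF PV V(2)] .
  have B': "real (card Q) \<le> B" if Q: "Q \<in> parts (T2 G) P" for Q
  proof -
    obtain x where x: "x \<in> P" "Q = part (T2 G) P x" using Q by (auto simp: parts_def)
    then have "Q = part (D G) V x" using part_T2_row[OF G] x0(2) by simp
    moreover have "x \<in> V" using x PV by blast
    ultimately show ?thesis using B part_in_parts by metis
  qed
  have B0: "0 \<le> B" using B[OF part_in_parts[OF x0(1)]] by (meson of_nat_0_le_iff order_trans)
  have "real (card P) = (\<Sum>Q\<in>parts (T2 G) P. real (card Q))"
    using sum_card_parts[OF fP sub_T(2)[OF G]] by (simp flip: of_nat_sum)
  also have "\<dots> \<le> real (card (parts (T2 G) P)) * B" using B' by (intro sum_bounded_above)
  also have "\<dots> \<le> real a * B"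
    using card_cols_le[OF G in_coset_subset[OF V(1) PV]] B0 by (intro mult_right_mono) auto
  finally show ?thesis .
qed

lemma card_col_le:
  assumes G: "\<T> G" and V: "in_coset G V" "finite V" and P: "P \<in> parts (T2 G) V"
    and B: "\<And>E. E \<in> parts (D G) V \<Longrightarrow> real (card E) \<le> B"
  shows "real (card P) \<le> real b * B"
proof -
  interpret sw: tight_pair g f \<T> b a by (rule tight_pair_swap) unfold_locales
  show ?thesis using sw.card_row_le[OF G V P] B by (simp add: dpre_swap[of g f])
qed

text \<open>The Brunn-Minkowski constant in the form K a^(-l) b^(-(1-l)), in which the dimension no
  longer appears; \<open>bm_const_weighted\<close> gives the translation.\<close>

definition bm :: "real \<Rightarrow> real \<Rightarrow> real \<Rightarrow> 'g set \<Rightarrow> bool" where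
  "bm K l e A \<longleftrightarrow> (\<forall>V U. V \<subseteq> A \<longrightarrow> U \<subseteq> A \<longrightarrow> V \<noteq> {} \<longrightarrow> U \<noteq> {} \<longrightarrow>
     K * (real a powr (- l) * real b powr (- (1 - l))) * (real (card V) powr l * real (card U) powr (1 - l))
     \<le> real (card (lsum f g V U)) + e * real (card A))"

text \<open>In a uniform class of size \<mu> a row has \<mu>/b points and a column has \<mu>/a.
  Measured in these units the constant becomes exactly \<open>K\<close>.\<close>

lemma bm_scaled:
  assumes "bm K l e A" "V \<subseteq> A" "U \<subseteq> A" "V \<noteq> {}" "U \<noteq> {}" "0 < \<mu>"
  shows "K * ((real b * real (card V) / \<mu>) powr l * (real a * real (card U) / \<mu>) powr (1 - l))
    \<le> (real (card (lsum f g V U)) + e * real (card A)) * (real a * real b / \<mu>)"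
proof -
  define m where "m = 1 - l"
  have h: "K * (real a powr (- l) * real b powr (- m)) * (real (card V) powr l * real (card U) powr m)
     \<le> real (card (lsum f g V U)) + e * real (card A)"
    using assms(1-5) unfolding bm_def m_def by blast
  have "0 \<le> real a * real b / \<mu>" using assms(6) by simp
  from mult_right_mono[OF h this]
  have "K * (real a powr (- l) * real b powr (- m)) * (real (card V) powr l * real (card U) powr m) * (real a * real b / \<mu>)
     \<le> (real (card (lsum f g V U)) + e * real (card A)) * (real a * real b / \<mu>)" .
  moreover have "(real b * real (card V) / \<mu>) powr l * (real a * real (card U) / \<mu>) powr m
      = (real a powr (- l) * real b powr (- m)) * (real (card V) powr l * real (card U) powr m) * (real a * real b / \<mu>)"
  proof -
    have p: "0 < real a" "0 < real b" using ab_pos by auto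
    have "real a = real a powr l * real a powr m" "real b = real b powr l * real b powr m" "\<mu> = \<mu> powr l * \<mu> powr m"
      using p assms(6) by (simp_all add: m_def flip: powr_add)
    then have "real a powr m = real a * real a powr (- l)" "real b powr l = real b * real b powr (- m)"
      "\<mu> powr l * \<mu> powr m = \<mu>"
      using p by (simp_all add: powr_minus field_simps)
    then show ?thesis using p assms(6) by (simp add: powr_mult powr_divide)
  qed
  ultimately show ?thesis unfolding m_def by (simp add: mult.assoc)
qed

end

text \<open>\<xi> is the step of the density increment. Densities stay below a b (K + 1), so
  \<open>N\<close> steps are impossible, and \<open>small\<close> keeps the slack of a cell below
  the gain of a pair even for the smallest classes.\<close>

locale violator2 = violator f g \<T> a b A G K \<theta> N
  for f g :: "'g::ab_group_add \<Rightarrow> 'g" and \<T> :: "'g set \<Rightarrow> bool" and a b :: nat and A G :: "'g set"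
    and K \<theta> :: real and N :: nat +
  fixes l \<xi> L e :: real
  assumes l: "0 < l" "l < 1"
    and L: "3 * real a + 4 / (1 - l) * (5 * K * real a * real b + 1) \<le> L"
      "3 * real b + 4 / l * (5 * K * real b * real a + 1) \<le> L"
    and xi: "0 < \<xi>" "\<xi> \<le> (1 - l) / (8 * L\<^sup>2)" "\<xi> \<le> l / (8 * L\<^sup>2)" "\<xi> \<le> 1 / 4"
    and BM: "bm K l e A" and e0: "0 \<le> e"
    and sA: "real (card (lsum f g A A)) \<le> (K + 1) * real (card A)"
    and N: "(1 - \<xi>) ^ N * (real a * real b * (K + 1)) < 1"
    and small: "4 * real b * (\<theta> + real a * real b * e) < (1 - l) * \<xi> * (1 / (4 * real a * real b * K ^ 2)) ^ N"
      "4 * real a * (\<theta> + real a * real b * e) < l * \<xi> * (1 / (4 * real a * real b * K ^ 2)) ^ N"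

lemma violator2_swap:
  assumes "violator2 f g \<T> a b A G K \<theta> N l \<xi> L e"
  shows "violator2 g f \<T> b a A G K \<theta> N (1 - l) \<xi> L e"
proof -
  interpret violator2 f g \<T> a b A G K \<theta> N l \<xi> L e by (rule assms)
  interpret sw: violator g f \<T> b a A G K \<theta> N by (rule violator_swap) unfold_locales
  show ?thesis
  proof unfold_locales
    show "sw.bm K (1 - l) e A"
      unfolding sw.bm_def
    proof (intro allI impI)
      fix V U assume h: "V \<subseteq> A" "U \<subseteq> A" "V \<noteq> {}" "U \<noteq> {}"
      show "K * (real b powr (- (1 - l)) * real a powr (- (1 - (1 - l)))) *
          (real (card V) powr (1 - l) * real (card U) powr (1 - (1 - l)))
          \<le> real (card (lsum g f V U)) + e * real (card A)"
        using BM[unfolded bm_def, rule_format, OF h(2,1,4,3)] by (simp add: lsum_swap[of g f] mult_ac)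
    qed
  qed (use l L xi e0 sA N small in \<open>simp_all add: mult_ac lsum_swap[of g f]\<close>)
qed

context violator2
begin

text \<open>Since no class one level down is overfull, the rows of \<open>V\<close> and the columns
  of \<open>U\<close> have normalised size at most 1 + 2 \<xi>. Applying \<open>pair_gain\<close> to
  the cells of the two classes then gives the surplus.\<close>

lemma pair_sum_gain:
  assumes k: "1 \<le> k" "k \<le> N" and V: "V \<in> parts (lv G k) A" and U: "U \<in> parts (lv G k) A" and \<mu>: "0 < \<mu>"
    and hU: "(1 - \<xi> / 2) * \<mu> \<le> card U" and hV: "card V \<le> card U - \<xi> / 2 * \<mu>"
    and up: "\<And>E. E \<in> parts (lv G (Suc k)) A \<Longrightarrow> real (card E) \<le> (1 + 2 * \<xi>) * \<mu> / (real a * real b)"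
  shows "K * card V + (1 - l) * \<xi> * \<mu> / (4 * real b) - real a * real b * e * card A \<le> card (lsum f g V U)"
proof -
  let ?G = "lv G k"
  note Vp = R_props[OF V] and Up = R_props[OF U] and sT = sub_T[OF Tlv, of k]
  define I where "I = parts (T1 ?G) V"
  define J where "J = parts (T2 ?G) U"
  define v where "v P = real b * real (card P) / \<mu>" for P :: "'g set"
  define w where "w P = real a * real (card P) / \<mu>" for P :: "'g set"
  define c where "c = real a * real b / \<mu>"
  define F where "F P Q = real (card (lsum f g P Q)) * c" for P Q
  define E where "E = e * real (card A) * c"
  have p: "0 < real a" "0 < real b" using ab_pos by auto
  have c0: "0 < c" using p \<mu> by (simp add: c_def)
  obtain k0 where k0: "k = Suc k0" using k(1) by (cases k) auto
  have cI: "card I = b" and cJ: "card J = a"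
    using card_rows[of k0 V] card_columns[of k0 U] V U k k0 unfolding I_def J_def by auto
  have fin: "finite I" "finite J" using Vp(2) Up(2) by (auto simp: I_def J_def finite_parts)
  have Ip: "P \<subseteq> A" "P \<noteq> {}" "finite P" if "P \<in> I" for P
    using that parts_subset[of P "T1 ?G" V] parts_nonempty[OF sT(1)] parts_finite[OF Vp(2)] Vp(4) by (auto simp: I_def)
  have Jp: "P \<subseteq> A" "P \<noteq> {}" "finite P" if "P \<in> J" for P
    using that parts_subset[of P "T2 ?G" U] parts_nonempty[OF sT(2)] parts_finite[OF Up(2)] Up(4) by (auto simp: J_def)
  have sv: "sum v I = real b * real (card V) / \<mu>"
    using sum_card_parts[OF Vp(2) sT(1)] unfolding v_def I_def
    by (simp add: sum_divide_distrib[symmetric] sum_distrib_left[symmetric] flip: of_nat_sum)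
  have sw: "sum w J = real a * real (card U) / \<mu>"
    using sum_card_parts[OF Up(2) sT(2)] unfolding w_def J_def
    by (simp add: sum_divide_distrib[symmetric] sum_distrib_left[symmetric] flip: of_nat_sum)
  have "K * real a * sum v I + real a * (1 - l) * \<xi> / 4 - real a * real b * E \<le> (\<Sum>P\<in>I. \<Sum>Q\<in>J. F P Q)"
  proof (rule pair_gain[OF fin cI _ cJ _ K1 l L(1) xi(1,2)])
    show "0 < v P" if "P \<in> I" for P using Ip[OF that] p \<mu> by (simp add: v_def card_gt_0_iff)
    show "0 < w P" if "P \<in> J" for P using Jp[OF that] p \<mu> by (simp add: w_def card_gt_0_iff)
    show "v P \<le> 1 + 2 * \<xi>" if "P \<in> I" for P
    proof -
      have "real (card P) \<le> real a * ((1 + 2 * \<xi>) * \<mu> / (real a * real b))"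
        by (rule card_row_le[OF Tlv Vp(1,2)]) (use that child_in_level[OF V] up in \<open>auto simp: I_def\<close>)
      also have "\<dots> = (1 + 2 * \<xi>) * \<mu> / real b" using p by simp
      finally show ?thesis using p \<mu> by (simp add: v_def field_simps)
    qed
    show "w P \<le> 1 + 2 * \<xi>" if "P \<in> J" for P
    proof -
      have "real (card P) \<le> real b * ((1 + 2 * \<xi>) * \<mu> / (real a * real b))"
        by (rule card_col_le[OF Tlv Up(1,2)]) (use that child_in_level[OF U] up in \<open>auto simp: J_def\<close>)
      also have "\<dots> = (1 + 2 * \<xi>) * \<mu> / real a" using p by simp
      finally show ?thesis using p \<mu> by (simp add: w_def field_simps)
    qed
    have "real a * ((1 - \<xi> / 2) * \<mu>) / \<mu> \<le> sum w J"
      unfolding sw using hU p \<mu> by (intro divide_right_mono mult_left_mono) auto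
    then show "real a * (1 - \<xi> / 2) \<le> sum w J" using \<mu> by simp
    have "real a * (real b * (card V / \<mu>)) \<le> real a * (real b * ((card U - \<xi> / 2 * \<mu>) / \<mu>))"
      using hV p \<mu> by (intro mult_left_mono divide_right_mono) auto
    then show "real a * sum v I \<le> real b * sum w J - real a * real b * \<xi> / 2"
      unfolding sv sw using \<mu> by (simp add: diff_divide_distrib algebra_simps)
    show "K * (v P powr l * w Q powr (1 - l)) - E \<le> F P Q" if "P \<in> I" "Q \<in> J" for P Q
      using bm_scaled[OF BM Ip(1)[OF that(1)] Jp(1)[OF that(2)] Ip(2)[OF that(1)] Jp(2)[OF that(2)] \<mu>]
      unfolding v_def w_def F_def E_def c_def by (simp add: distrib_right add_divide_distrib)
    show "real b * w Q - E \<le> F P Q" if "P \<in> I" "Q \<in> J" for P Q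
    proof -
      have "real (card Q) \<le> real (card (lsum f g P Q))"
        using card_lsum_ge_right[OF ginj Ip(3)[OF that(1)] Jp(3)[OF that(2)] Ip(2)[OF that(1)]] by simp
      then have "real (card Q) * c \<le> F P Q" unfolding F_def using c0 by (intro mult_right_mono) auto
      moreover have "real b * w Q = real (card Q) * c" by (simp add: w_def c_def)
      moreover have "0 \<le> E" using e0 c0 by (simp add: E_def)
      ultimately show ?thesis by linarith
    qed
  qed (use ab_pos in auto)
  moreover have "(\<Sum>P\<in>I. \<Sum>Q\<in>J. F P Q) = real (card (lsum f g V U)) * c"
    unfolding F_def I_def J_def card_lsum_cells[OF Tlv Vp(1,2) Up(1,2)]
    by (simp add: sum_distrib_right)
  moreover have "K * real a * sum v I + real a * (1 - l) * \<xi> / 4 - real a * real b * E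
      = (K * card V + (1 - l) * \<xi> * \<mu> / (4 * real b) - real a * real b * e * card A) * c"
  proof -
    have y1: "(1 - l) * \<xi> * \<mu> / (4 * real b) * c = real a * (1 - l) * \<xi> / 4"
      unfolding c_def using p \<mu> by (simp add: field_simps)
    have y2: "K * card V * c = K * real a * sum v I" unfolding c_def sv by simp
    have y3: "(x + y - z) * c = x * c + y * c - z * c" for x y z by (simp add: algebra_simps)
    have y4: "real a * real b * E = real a * real b * e * card A * c" by (simp add: E_def)
    show ?thesis by (simp only: y1 y2 y3 y4)
  qed
  ultimately show ?thesis using c0 by (simp add: mult_le_cancel_right)
qed

lemma pair_contradiction:
  assumes k: "1 \<le> k" "k \<le> N" and V: "V \<in> parts (lv G k) A" and U: "U \<in> parts (lv G k) A" and \<mu>: "\<rho> ^ N * card A \<le> \<mu>"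
    and hU: "(1 - \<xi> / 2) * \<mu> \<le> card U" and hV: "card V \<le> card U - \<xi> / 2 * \<mu>"
    and up: "\<And>E. E \<in> parts (lv G (Suc k)) A \<Longrightarrow> real (card E) \<le> (1 + 2 * \<xi>) * \<mu> / (real a * real b)"
    and le: "card (lsum f g V U) \<le> K * card V + \<theta> * card A"
  shows False
proof -
  have p: "0 < real b" using ab_pos by auto
  have "0 < \<rho> ^ N * card A" using rho(1) cA by simp
  then have \<mu>0: "0 < \<mu>" using \<mu> by linarith
  have "(1 - l) * \<xi> * \<mu> / (4 * real b) \<le> (\<theta> + real a * real b * e) * card A"
    using pair_sum_gain[OF k V U \<mu>0 hU hV up] le by (simp add: algebra_simps)
  then have "(1 - l) * \<xi> * \<mu> \<le> 4 * real b * (\<theta> + real a * real b * e) * card A"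
    using p by (simp add: field_simps)
  also have "\<dots> < (1 - l) * \<xi> * \<rho> ^ N * card A"
    using small(1) cA unfolding \<rho>_def by (intro mult_strict_right_mono) auto
  also have "\<dots> \<le> (1 - l) * \<xi> * \<mu>"
    using \<mu> l xi(1) mult_left_mono[OF \<mu>, of "(1 - l) * \<xi>"] by (simp add: mult.assoc)
  finally show False by simp
qed

lemma xi_inv: "1 \<le> (1 - \<xi>) * (1 + 2 * \<xi>)"
proof -
  have "0 \<le> \<xi> * (1 - 2 * \<xi>)" using xi by (intro mult_nonneg_nonneg) auto
  then show ?thesis by (simp add: algebra_simps)
qed

lemma N2: "2 \<le> N"
proof (rule ccontr)
  assume "\<not> 2 \<le> N"
  then have "N = 0 \<or> N = 1" by auto
  moreover have "1 * 2 \<le> real a * real b * (K + 1)"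
    using mult_mono[of 1 "real a" 1 "real b"] ab1 K1 by (intro mult_mono) auto
  then have "3 / 4 * 2 \<le> (1 - \<xi>) * (real a * real b * (K + 1))" using xi(4) by (intro mult_mono) auto
  ultimately show False using N \<open>1 * 2 \<le> real a * real b * (K + 1)\<close> by auto
qed

text \<open>Choose a class that maximises its size times the number of classes times (1-\<xi>)^k. If
  k > 0, the density cap keeps it above level \<open>N\<close>, maximality leaves no overfull class
  on the next level, and the parent has a child that is lighter by \<xi>; this leads to a forbidden
  surplus. If k = 0, the class is \<open>A\<close> itself, all densities on levels 1 and 2 are
  bounded above, and hence they are uniform.\<close>

theorem violator_nice: "nice (8 * (real a * real b)\<^sup>2 * \<xi>) G A"
proof -
  define X where "X = Sigma {..N} (\<lambda>k. parts (lv G k) A)"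
  define h where "h p = real (card (snd p)) * real (n (fst p)) * (1 - \<xi>) ^ fst p" for p :: "nat \<times> 'g set"
  have "finite X" unfolding X_def by (intro finite_SigmaI) (auto intro: finite_parts[OF finA])
  moreover have A0: "(0, A) \<in> X" unfolding X_def using n_0(2) by simp
  ultimately obtain q where q: "q \<in> X" "\<And>p. p \<in> X \<Longrightarrow> h p \<le> h q"
    using finite_obtain_max[of X h] by (metis empty_iff)
  obtain k R where kR: "q = (k, R)" by fastforce
  have k: "k \<le> N" and R: "R \<in> parts (lv G k) A" using q(1) kR by (auto simp: X_def)
  have mx: "real (card R') * real (n k') * (1 - \<xi>) ^ k' \<le> real (card R) * real (n k) * (1 - \<xi>) ^ k"
    if "k' \<le> N" "R' \<in> parts (lv G k') A" for k' R'
    using q(2)[of "(k', R')"] that by (simp add: X_def h_def kR)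
  have hA: "real (card A) \<le> real (card R) * real (n k) * (1 - \<xi>) ^ k"
    using q(2)[OF A0] n_0 by (simp add: h_def kR)
  have x1: "0 < 1 - \<xi>" using xi by simp
  have ab0: "0 < real a * real b" using ab_pos by simp
  show ?thesis
  proof (cases "k = 0")
    case False
    then obtain k0 where k0: "k = Suc k0" by (cases k) auto
    have "n k * card R \<le> n k0 * (a * b) * card R" using n_Suc_le[of k0] k k0 by (intro mult_le_mono1) auto
    also have "\<dots> \<le> (a * b) * s A" using density_bound[of R k0] R k0 by (simp add: mult_ac)
    finally have "real (n k) * real (card R) \<le> real a * real b * real (s A)" by (simp flip: of_nat_mult)
    also have "\<dots> \<le> real a * real b * ((K + 1) * card A)" using sA ab0 by (intro mult_left_mono) auto
    finally have dens: "real (card R) * real (n k) \<le> real a * real b * (K + 1) * card A" by (simp add: mult_ac)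
    have kN: "Suc k \<le> N"
    proof (rule ccontr)
      assume "\<not> Suc k \<le> N"
      then have "k = N" using k by simp
      then have "real (card A) \<le> real a * real b * (K + 1) * card A * (1 - \<xi>) ^ N"
        using order_trans[OF hA mult_right_mono[OF dens zero_le_power[OF less_imp_le[OF x1], of k]]] by simp
      also have "\<dots> = ((1 - \<xi>) ^ N * (real a * real b * (K + 1))) * card A" by (simp add: mult_ac)
      also have "\<dots> < 1 * real (card A)" using N cA by (intro mult_strict_right_mono) auto
      finally show False by simp
    qed
    define \<mu> where "\<mu> = real (card R)"
    have nk: "0 < real (n k)" using n_pos by simp
    have pk: "0 < (1 - \<xi>) ^ k0" using x1 by simp
    have up: "real (card E) \<le> (1 + 2 * \<xi>) * \<mu> / (real a * real b)" if E: "E \<in> parts (lv G (Suc k)) A" for E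
    proof -
      have "real (card E) * (real (n k) * (real a * real b)) * ((1 - \<xi>) ^ k * (1 - \<xi>)) \<le> \<mu> * real (n k) * (1 - \<xi>) ^ k"
        using mx[OF kN E] n_Suc[of k] k k0 by (simp add: \<mu>_def mult_ac)
      then have "(real (n k) * (1 - \<xi>) ^ k) * (real (card E) * (real a * real b) * (1 - \<xi>)) \<le> (real (n k) * (1 - \<xi>) ^ k) * \<mu>"
        by (simp add: mult_ac)
      then have "real (card E) * (real a * real b) * (1 - \<xi>) \<le> \<mu>"
        using nk x1 by (simp add: mult_le_cancel_left)
      then have "real (card E) * (real a * real b) * (1 - \<xi>) * (1 + 2 * \<xi>) \<le> \<mu> * (1 + 2 * \<xi>)"
        using xi by (intro mult_right_mono) auto
      moreover have "real (card E) * (real a * real b) * 1 \<le> real (card E) * (real a * real b) * ((1 - \<xi>) * (1 + 2 * \<xi>))"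
        using xi_inv ab0 by (intro mult_left_mono) auto
      ultimately have "real (card E) * (real a * real b) \<le> (1 + 2 * \<xi>) * \<mu>" by (simp add: mult_ac)
      then show ?thesis using ab0 by (simp add: pos_le_divide_eq)
    qed
    have \<mu>N: "\<rho> ^ N * card A \<le> \<mu>"
    proof -
      have "\<rho> ^ N * card A \<le> \<rho> ^ k * card A" using k rho(1,2) by (intro mult_right_mono power_decreasing) auto
      also have "\<dots> \<le> \<mu>" using level_size[of k R] k R by (simp add: \<mu>_def)
      finally show ?thesis .
    qed
    obtain R' where R': "R' \<in> parts (lv G k0) A" "R \<in> parts (D (lv G k0)) R'" using level_child R k0 by metis
    note R'p = R_props[OF R'(1)] and sT = sub_T[OF Tlv, of k0]
    define m where "m = card (parts (D (lv G k0)) R')"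
    have nm: "n k = n k0 * m"
    proof (cases "k0 = 0")
      case True
      then show ?thesis using n_0 R'(1) by (simp add: k0 m_def n_def)
    next
      case False
      then obtain k1 where k1: "k0 = Suc k1" by (cases k0) auto
      have "m = a * b" unfolding m_def using card_children[of k1 R'] R'(1) k k0 k1 by simp
      then show ?thesis using n_Suc[of k0] False k k0 by simp
    qed
    have "real (card R') * (real (n k0) * (1 - \<xi>) ^ k0) \<le> \<mu> * real m * (1 - \<xi>) * (real (n k0) * (1 - \<xi>) ^ k0)"
      using mx[OF _ R'(1)] k k0 nm by (simp add: \<mu>_def mult_ac)
    moreover have "0 < real (n k0) * (1 - \<xi>) ^ k0" using n_pos[of k0] x1 by simp
    ultimately have R'le: "real (card R') \<le> \<mu> * real m * (1 - \<xi>)" by (simp add: mult_le_cancel_right)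
    \<comment> \<open>The parent lost the comparison with \<open>R\<close>, so its children average
      at most (1-\<xi>) \<mu>.\<close>
    have "\<exists>C\<in>parts (D (lv G k0)) R'. real (card C) \<le> (1 - \<xi>) * \<mu>"
    proof (rule ccontr)
      assume "\<not> ?thesis"
      then have "(1 - \<xi>) * \<mu> < real (card C)" if "C \<in> parts (D (lv G k0)) R'" for C using that by force
      then have "(\<Sum>C\<in>parts (D (lv G k0)) R'. (1 - \<xi>) * \<mu>) < (\<Sum>C\<in>parts (D (lv G k0)) R'. real (card C))"
        using R'(2) by (intro sum_strict_mono finite_parts[OF R'p(2)]) auto
      also have "\<dots> = real (card R')" using sum_card_parts[OF R'p(2) sT(3)] by (simp flip: of_nat_sum)
      finally show False using R'le by (simp add: m_def mult_ac)
    qed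
    then obtain C where C: "C \<in> parts (D (lv G k0)) R'" "real (card C) \<le> (1 - \<xi>) * \<mu>" by blast
    obtain x where x: "x \<in> R" using R_props(3)[OF R] by blast
    obtain y where y: "y \<in> C" using parts_nonempty[OF sT(3) C(1)] by blast
    have xR: "x \<in> R'" "R = part (D (lv G k0)) R' x" using parts_mem[OF sT(3) R'(2) x] by auto
    have yR: "y \<in> R'" "C = part (D (lv G k0)) R' y" using parts_mem[OF sT(3) C(1) y] by auto
    \<comment> \<open>\<open>W\<close> is the corner in the row of the light child \<open>C\<close>
      and the column of the heavy child \<open>R\<close>. It is lighter than \<open>R\<close> or
      heavier than \<open>C\<close> by \<xi> \<mu> / 2, and such a pair in a common column or row is
      contradictory; the row case is the column case with \<open>f\<close> and \<open>g\<close>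
      exchanged.\<close>
    define W where "W = part (T1 (lv G k0)) R' y \<inter> part (T2 (lv G k0)) R' x"
    have k0N: "k0 \<le> N" using k k0 by simp
    obtain z where z: "z \<in> part (T1 (lv G k0)) R' y" "z \<in> part (T2 (lv G k0)) R' x"
      using child_size'(2)[OF k0N R'(1) yR(1) xR(1)] by blast
    have Wz: "W = part (D (lv G k0)) R' z" unfolding W_def by (rule child_eq[OF Tlv z])
    have "z \<in> R'" using z by (simp add: part_def)
    then have "W \<in> parts (D (lv G k0)) R'" unfolding Wz by (rule part_in_parts)
    then have Wl: "W \<in> parts (lv G k) A" using child_in_level[OF R'(1)] k0 by simp
    have Cl: "C \<in> parts (lv G k) A" using child_in_level[OF R'(1) C(1)] k0 by simp
    have fP: "finite (part H R' u)" for H u by (rule finite_subset[OF part_subset R'p(2)])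
    have False
    proof (cases "real (card W) \<le> (1 - \<xi> / 2) * \<mu>")
      case True
      show False
      proof (rule pair_contradiction[OF _ k Wl R \<mu>N _ _ up])
        show "1 \<le> k" using k0 by simp
        show "(1 - \<xi> / 2) * \<mu> \<le> card R" using xi(1) by (simp add: \<mu>_def algebra_simps)
        show "card W \<le> card R - \<xi> / 2 * \<mu>" using True by (simp add: \<mu>_def algebra_simps)
        have "R \<subseteq> part (T2 (lv G k0)) R' x" unfolding xR(2) part_D by blast
        then have "lsum f g W R \<subseteq> lsum f g (part (T1 (lv G k0)) R' y) (part (T2 (lv G k0)) R' x)"
          by (intro lsum_mono) (auto simp: W_def)
        then have "card (lsum f g W R) \<le> card (lsum f g (part (T1 (lv G k0)) R' y) (part (T2 (lv G k0)) R' x))"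
          by (intro card_mono finite_lsum fP)
        then show "card (lsum f g W R) \<le> K * card W + \<theta> * card A"
          using CELL[OF k0N R'(1) yR(1) xR(1)] unfolding W_def by linarith
      qed
    next
      case False
      interpret sw: violator2 g f \<T> b a A G K \<theta> N "1 - l" \<xi> L e by (rule violator2_swap) unfold_locales
      have rr: "sw.\<rho> = \<rho>" unfolding sw.\<rho>_def \<rho>_def by (simp add: mult_ac)
      show False
      proof (rule sw.pair_contradiction[of k C W \<mu>])
        show "1 \<le> k" "k \<le> N" using k0 k by simp_all
        show "C \<in> parts (lev g f G k) A" "W \<in> parts (lev g f G k) A" using Cl Wl by (simp_all add: lev_swap[of g f])
        show "sw.\<rho> ^ N * card A \<le> \<mu>" using \<mu>N rr by simp
        show "(1 - \<xi> / 2) * \<mu> \<le> card W" using False by simp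
        then show "card C \<le> card W - \<xi> / 2 * \<mu>" using C(2) by (simp add: algebra_simps)
        show "real (card E) \<le> (1 + 2 * \<xi>) * \<mu> / (real b * real a)" if "E \<in> parts (lev g f G (Suc k)) A" for E
          using up[of E] that unfolding lev_swap[of g f] by (simp add: mult_ac)
        have "C \<subseteq> part (T2 (lv G k0)) R' y" unfolding yR(2) part_D by blast
        then have "lsum f g W C \<subseteq> lsum f g (part (T1 (lv G k0)) R' y) (part (T2 (lv G k0)) R' y)"
          by (intro lsum_mono) (auto simp: W_def)
        then have "card (lsum f g W C) \<le> card (lsum f g (part (T1 (lv G k0)) R' y) (part (T2 (lv G k0)) R' y))"
          by (intro card_mono finite_lsum fP)
        then show "card (lsum g f C W) \<le> K * card C + \<theta> * card A"
          using CELL[OF k0N R'(1) yR(1) yR(1)] unfolding lsum_swap[of g f] yR(2) part_D by linarith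
      qed
    qed
    then show ?thesis ..
  next
    case True
    then have "R = A" using R n_0(2) by simp
    then have mx0: "real (card R') * real (n k') * (1 - \<xi>) ^ k' \<le> real (card A)"
      if "k' \<le> N" "R' \<in> parts (lv G k') A" for k' R'
      using mx[OF that] True n_0 by simp
    have nle: "real (n k') \<le> (real a * real b)\<^sup>2" if "k' \<le> 2" for k'
    proof -
      have "n k' \<le> (a * b) ^ k'" unfolding n_def by (rule card_parts_lev_le[OF TG cosA finA])
      also have "\<dots> \<le> (a * b) ^ 2" using that ab_pos by (intro power_increasing) (auto simp: Suc_le_eq)
      finally have "real (n k') \<le> real ((a * b) ^ 2)" by (simp only: of_nat_le_iff)
      then show ?thesis by simp
    qed
    have uni: "\<bar>real (card R') * real (n k') - real (card A)\<bar> \<le> 8 * (real a * real b)\<^sup>2 * \<xi> * real (card A)"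
      if k': "k' \<in> {1, 2}" and R': "R' \<in> parts (lv G k') A" for k' R'
    proof -
      have k'N: "k' \<le> N" "k' \<le> 2" using k' N2 by auto
      have up: "real (card Q) * real (n k') \<le> (1 + 6 * \<xi>) * real (card A)" if Q: "Q \<in> parts (lv G k') A" for Q
      proof -
        have pw: "1 \<le> (1 - \<xi>) ^ k' * (1 + 6 * \<xi>)"
        proof -
          have "1 * 1 \<le> ((1 - \<xi>) * (1 + 2 * \<xi>)) * ((1 - \<xi>) * (1 + 2 * \<xi>))" using xi_inv by (intro mult_mono) auto
          also have "\<dots> = (1 - \<xi>)\<^sup>2 * ((1 + 2 * \<xi>) * (1 + 2 * \<xi>))" by (simp add: power2_eq_square mult_ac)
          also have "\<dots> \<le> (1 - \<xi>)\<^sup>2 * (1 + 6 * \<xi>)"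
          proof (rule mult_left_mono)
            have "\<xi> * \<xi> \<le> \<xi> * (1 / 4)" using xi by (intro mult_left_mono) auto
            then show "(1 + 2 * \<xi>) * (1 + 2 * \<xi>) \<le> 1 + 6 * \<xi>" using xi(1) by (simp add: algebra_simps)
          qed simp
          also have "\<dots> \<le> (1 - \<xi>) ^ k' * (1 + 6 * \<xi>)"
            using k'N(2) x1 xi(1) by (intro mult_right_mono power_decreasing) auto
          finally show ?thesis by simp
        qed
        have "real (card Q) * real (n k') * 1 \<le> real (card Q) * real (n k') * ((1 - \<xi>) ^ k' * (1 + 6 * \<xi>))"
          using pw by (intro mult_left_mono) auto
        also have "\<dots> = (real (card Q) * real (n k') * (1 - \<xi>) ^ k') * (1 + 6 * \<xi>)" by (simp add: mult_ac)
        also have "\<dots> \<le> real (card A) * (1 + 6 * \<xi>)" using mx0[OF k'N(1) Q] xi(1) by (intro mult_right_mono) auto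
        finally show ?thesis by (simp add: mult.commute)
      qed
      have sm: "(\<Sum>Q\<in>parts (lv G k') A. real (card Q) * real (n k')) = real (card A) * real (n k')"
        using sum_card_parts[OF finA T_sub[OF Tlv], of k'] by (simp only: sum_distrib_right[symmetric] of_nat_sum[symmetric])
      have "real (card A) * real (n k') - (real (n k') - 1) * ((1 + 6 * \<xi>) * real (card A)) \<le> real (card R') * real (n k')"
        using uniform_of_upper[OF finite_parts[OF finA] R', of "\<lambda>Q. real (card Q) * real (n k')", OF up]
        by (simp only: sm n_def[symmetric])
      moreover have "real (card A) * real (n k') - (real (n k') - 1) * ((1 + 6 * \<xi>) * real (card A))
         = real (card A) - (real (n k') - 1) * (6 * \<xi> * real (card A))" by (simp add: algebra_simps)
      moreover have "(real (n k') - 1) * (6 * \<xi> * real (card A)) \<le> (real a * real b)\<^sup>2 * (8 * \<xi> * real (card A))"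
        using nle[OF k'N(2)] xi(1) n_pos[of k'] by (intro mult_mono) (auto simp: Suc_le_eq)
      moreover have "6 * \<xi> * real (card A) \<le> (real a * real b)\<^sup>2 * (8 * \<xi> * real (card A))"
      proof -
        have "1 \<le> (real a * real b)\<^sup>2" using mult_mono[of 1 "real a" 1 "real b"] ab1 by simp
        then have "1 * (8 * \<xi> * real (card A)) \<le> (real a * real b)\<^sup>2 * (8 * \<xi> * real (card A))"
          using xi(1) by (intro mult_right_mono) auto
        moreover have "6 * \<xi> * real (card A) \<le> 8 * \<xi> * real (card A)" using xi(1) by (intro mult_right_mono) auto
        ultimately show ?thesis by linarith
      qed
      moreover have "real (card R') * real (n k') \<le> real (card A) + 6 * \<xi> * real (card A)"
        using up[OF R'] by (simp add: algebra_simps)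
      ultimately show ?thesis by (simp add: abs_le_iff mult_ac)
    qed
    show ?thesis unfolding nice_def
    proof (intro conjI ballI)
      have A0': "A \<in> parts (lv G 0) A" using n_0(2) by simp
      show "part (T1 G) A x \<inter> part (T2 G) A y \<noteq> {}" if "x \<in> A" "y \<in> A" for x y
        using child_size'(2)[OF _ A0' that] by simp
      fix C assume C: "C \<in> parts (D G) A"
      then have Cl: "C \<in> parts (lv G (Suc 0)) A" by simp
      show "card (parts (T1 (D G)) C) = b" "card (parts (T2 (D G)) C) = a"
        using card_rows[OF _ Cl] card_columns[OF _ Cl] by simp_all
      show "card (parts (D (D G)) C) = a * b" using card_children[OF _ Cl] N2 by simp
      show "\<bar>real (card C) * real (card (parts (D G) A)) - real (card A)\<bar> \<le> 8 * (real a * real b)\<^sup>2 * \<xi> * real (card A)"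
        using uni[of 1 C] C by (simp add: n_def)
    next
      fix E assume "E \<in> parts (D (D G)) A"
      then show "\<bar>real (card E) * real (card (parts (D (D G)) A)) - real (card A)\<bar> \<le> 8 * (real a * real b)\<^sup>2 * \<xi> * real (card A)"
        using uni[of 2 E] by (simp add: n_def numeral_2_eq_2)
    qed
  qed
qed

end

section \<open>Lower bound for an equidistributed set\<close>

context tight_pair
begin

text \<open>Normalised rows and columns differ by at most 4 a b d, so each cell is worth the
  arithmetic mean up to 8 (a b d)^2. The linear terms sum to the sizes of \<open>V\<close> and
  \<open>U\<close>.\<close>

lemma pair_near_uniform:
  assumes G: "\<T> G" and V: "in_coset G V" "finite V" "V \<noteq> {}" "V \<subseteq> A" and U: "in_coset G U" "finite U" "U \<noteq> {}" "U \<subseteq> A"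
    and rows: "card (parts (T1 G) V) = b" and cols: "card (parts (T2 G) U) = a"
    and K: "1 \<le> K" and l: "0 < l" "l < 1" and BM: "bm K l e A"
    and \<mu>: "0 < \<mu>" and d: "0 \<le> d" "real a * real b * d \<le> 1 / 4"
    and dV: "(1 - d) * \<mu> \<le> card V" and dU: "(1 - d) * \<mu> \<le> card U"
    and upV: "\<And>E. E \<in> parts (D G) V \<Longrightarrow> real (card E) \<le> (1 + d) * \<mu> / (real a * real b)"
    and upU: "\<And>E. E \<in> parts (D G) U \<Longrightarrow> real (card E) \<le> (1 + d) * \<mu> / (real a * real b)"
  shows "K * (l * card V + (1 - l) * card U) - 8 * K * (real a * real b * d)\<^sup>2 * \<mu> - real a * real b * e * card A
    \<le> card (lsum f g V U)"
proof -
  note sT = sub_T[OF G]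
  define I where "I = parts (T1 G) V"
  define J where "J = parts (T2 G) U"
  define v where "v P = real b * real (card P) / \<mu>" for P :: "'g set"
  define w where "w P = real a * real (card P) / \<mu>" for P :: "'g set"
  define c where "c = real a * real b / \<mu>"
  define E where "E = e * real (card A) * c"
  define k where "k = real a * real b * d"
  have p: "0 < real a" "0 < real b" "1 \<le> real a" "1 \<le> real b" using ab_pos by auto
  have c0: "0 < c" using p \<mu> by (simp add: c_def)
  have fin: "finite I" "finite J" using V(2) U(2) by (auto simp: I_def J_def finite_parts)
  have Ip: "P \<subseteq> A" "P \<noteq> {}" if "P \<in> I" for P
    using that parts_subset[of P "T1 G" V] parts_nonempty[OF sT(1)] V(4) by (auto simp: I_def)
  have Jp: "P \<subseteq> A" "P \<noteq> {}" if "P \<in> J" for P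
    using that parts_subset[of P "T2 G" U] parts_nonempty[OF sT(2)] U(4) by (auto simp: J_def)
  have sv: "sum v I = real b * real (card V) / \<mu>"
    using sum_card_parts[OF V(2) sT(1)] unfolding v_def I_def
    by (simp add: sum_divide_distrib[symmetric] sum_distrib_left[symmetric] flip: of_nat_sum)
  have sw: "sum w J = real a * real (card U) / \<mu>"
    using sum_card_parts[OF U(2) sT(2)] unfolding w_def J_def
    by (simp add: sum_divide_distrib[symmetric] sum_distrib_left[symmetric] flip: of_nat_sum)
  have vup: "v P \<le> 1 + d" if "P \<in> I" for P
  proof -
    have "real (card P) \<le> real a * ((1 + d) * \<mu> / (real a * real b))"
      by (rule card_row_le[OF G V(1,2)]) (use that upV in \<open>auto simp: I_def\<close>)
    also have "\<dots> = (1 + d) * \<mu> / real b" using p by simp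
    finally show ?thesis using p \<mu> by (simp add: v_def field_simps)
  qed
  have wup: "w P \<le> 1 + d" if "P \<in> J" for P
  proof -
    have "real (card P) \<le> real b * ((1 + d) * \<mu> / (real a * real b))"
      by (rule card_col_le[OF G U(1,2)]) (use that upU in \<open>auto simp: J_def\<close>)
    also have "\<dots> = (1 + d) * \<mu> / real a" using p by simp
    finally show ?thesis using p \<mu> by (simp add: w_def field_simps)
  qed
  have kd: "real a * d \<le> k" "real b * d \<le> k" "d \<le> k"
  proof -
    show "real a * d \<le> k" using mult_left_mono[of 1 "real b" "real a * d"] p d by (simp add: k_def mult_ac)
    show 2: "real b * d \<le> k" using mult_left_mono[of 1 "real a" "real b * d"] p d by (simp add: k_def mult_ac)
    have "1 * d \<le> real b * d" using p d by (intro mult_right_mono) auto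
    then show "d \<le> k" using 2 by simp
  qed
  have vlow: "1 - 2 * k \<le> v P" if P: "P \<in> I" for P
  proof -
    have "sum v I - (real b - 1) * (1 + d) \<le> v P"
      using uniform_of_upper[OF fin(1) P vup] rows by (simp add: I_def)
    moreover have "real b * (1 - d) \<le> sum v I"
    proof -
      have "real b * ((1 - d) * \<mu>) / \<mu> \<le> sum v I"
        unfolding sv using dV p \<mu> by (intro divide_right_mono mult_left_mono) auto
      then show ?thesis using \<mu> by simp
    qed
    ultimately have "1 - 2 * (real b * d) \<le> v P" using d by (simp add: algebra_simps)
    then show ?thesis using kd by linarith
  qed
  have wlow: "1 - 2 * k \<le> w P" if P: "P \<in> J" for P
  proof -
    have "sum w J - (real a - 1) * (1 + d) \<le> w P"
      using uniform_of_upper[OF fin(2) P wup] cols by (simp add: J_def)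
    moreover have "real a * (1 - d) \<le> sum w J"
    proof -
      have "real a * ((1 - d) * \<mu>) / \<mu> \<le> sum w J"
        unfolding sw using dU p \<mu> by (intro divide_right_mono mult_left_mono) auto
      then show ?thesis using \<mu> by simp
    qed
    ultimately have "1 - 2 * (real a * d) \<le> w P" using d by (simp add: algebra_simps)
    then show ?thesis using kd by linarith
  qed
  have summand: "K * (l * v P + (1 - l) * w Q - 8 * k\<^sup>2) - E \<le> real (card (lsum f g P Q)) * c" if PQ: "P \<in> I" "Q \<in> J" for P Q
  proof -
    have "\<bar>v P - w Q\<bar> \<le> 4 * k"
      using vup[OF PQ(1)] wup[OF PQ(2)] vlow[OF PQ(1)] wlow[OF PQ(2)] kd d by linarith
    then have "(v P - w Q)\<^sup>2 \<le> (4 * k)\<^sup>2" by (metis abs_ge_zero power2_abs power_mono)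
    then have sq: "(v P - w Q)\<^sup>2 / 2 \<le> 8 * k\<^sup>2" by (simp add: power_mult_distrib)
    have "l * v P + (1 - l) * w Q - (v P - w Q)\<^sup>2 / 2 \<le> v P powr l * w Q powr (1 - l)"
      using vlow[OF PQ(1)] wlow[OF PQ(2)] d(2) l by (intro geo_ge_near) (auto simp: k_def)
    then have "K * (l * v P + (1 - l) * w Q - 8 * k\<^sup>2) \<le> K * (v P powr l * w Q powr (1 - l))"
      using sq K by (intro mult_left_mono) auto
    also have "\<dots> \<le> (real (card (lsum f g P Q)) + e * real (card A)) * c"
      using bm_scaled[OF BM Ip(1)[OF PQ(1)] Jp(1)[OF PQ(2)] Ip(2)[OF PQ(1)] Jp(2)[OF PQ(2)] \<mu>]
      unfolding v_def w_def c_def .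
    finally show ?thesis by (simp add: E_def distrib_right)
  qed
  have "(\<Sum>P\<in>I. \<Sum>Q\<in>J. K * (l * v P + (1 - l) * w Q - 8 * k\<^sup>2) - E) \<le> (\<Sum>P\<in>I. \<Sum>Q\<in>J. real (card (lsum f g P Q)) * c)"
    using summand by (intro sum_mono)
  also have "\<dots> = real (card (lsum f g V U)) * c"
    unfolding I_def J_def card_lsum_cells[OF G V(1,2) U(1,2)] by (simp add: sum_distrib_right)
  also have "(\<Sum>P\<in>I. \<Sum>Q\<in>J. K * (l * v P + (1 - l) * w Q - 8 * k\<^sup>2) - E)
    = K * l * (real a * sum v I) + K * (1 - l) * (real b * sum w J) - real a * real b * (8 * K * k\<^sup>2) - real a * real b * E"
    using rows cols unfolding I_def[symmetric] J_def[symmetric]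
    by (simp add: sum_subtractf sum.distrib sum_distrib_left[symmetric] algebra_simps)
  also have "\<dots> = (K * (l * card V + (1 - l) * card U) - 8 * K * k\<^sup>2 * \<mu> - real a * real b * e * card A) * c"
  proof -
    have y1: "real a * sum v I = card V * c" "real b * sum w J = card U * c" unfolding c_def sv sw by simp_all
    have y2: "real a * real b * (8 * K * k\<^sup>2) = 8 * K * k\<^sup>2 * \<mu> * c" unfolding c_def using \<mu> by simp
    have y3: "real a * real b * E = real a * real b * e * card A * c" by (simp add: E_def)
    have "(x + y - z - t) * c = x * c + y * c - z * c - t * c" for x y z t by (simp add: algebra_simps)
    then show ?thesis unfolding y1 y2 y3 distrib_left[of K] by (simp add: mult.assoc)
  qed
  finally show ?thesis using c0 by (simp add: k_def mult_le_cancel_right)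
qed

text \<open>In the cell of a row and a column, use the largest child of the row as first and the
  largest child of the column as second summand. The total is \<open>K\<close> |A| plus the profit
  from taking maxima, which is linear in the first-level deviation \<delta>. The error is quadratic
  in \<open>d\<close>, a common bound for the deviations of both levels.\<close>

lemma nice_lower_bound:
  assumes G: "\<T> G" and A: "in_coset G A" "finite A" "A \<noteq> {}" and nice: "nice \<eta> G A"
    and K: "1 \<le> K" and l: "0 < l" "l < 1" and BM: "bm K l e A" and e: "0 \<le> e"
    and d: "0 \<le> d" "real a * real b * d \<le> 1 / 4"
    and d1: "\<And>C. C \<in> parts (D G) A \<Longrightarrow> \<bar>real (card C) * real (card (parts (D G) A)) - real (card A)\<bar> \<le> d * real (card A)"
    and d2: "\<And>E. E \<in> parts (D (D G)) A \<Longrightarrow> \<bar>real (card E) * real (card (parts (D (D G)) A)) - real (card A)\<bar> \<le> d * real (card A)"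
    and C0: "C0 \<in> parts (D G) A" "\<delta> * real (card A) \<le> \<bar>real (card C0) * real (card (parts (D G) A)) - real (card A)\<bar>"
    and l0: "l0 \<le> l" "l0 \<le> 1 - l" "0 \<le> l0" and \<delta>: "0 \<le> \<delta>"
  shows "K * card A + K * l0 / (2 * real a * real b) * \<delta> * card A - 8 * K * (real a * real b * d)\<^sup>2 * card A
      - (real a * real b)\<^sup>2 * e * card A \<le> s A"
proof -
  note sT = sub_T[OF G] and TDG = TD[OF G]
  have subDD: "D (D G) \<subseteq> D G" by (rule D_subset(1))
  define m where "m = card (parts (D G) A)"
  define \<mu> where "\<mu> = real (card A) / real m"
  have p: "0 < real a" "0 < real b" "1 \<le> real a * real b"
    using ab_pos mult_mono[of 1 "real a" 1 "real b"] by auto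
  have cA: "0 < real (card A)" using A by (simp add: card_gt_0_iff)
  have m0: "0 < real m" using C0(1) finite_parts[OF A(2)] by (auto simp: m_def card_gt_0_iff)
  have \<mu>: "0 < \<mu>" "real m * \<mu> = card A" using cA m0 by (auto simp: \<mu>_def)
  define R where "R = parts (T1 G) A"
  define Y where "Y = parts (T2 G) A"
  have fRY: "finite R" "finite Y" using A(2) by (auto simp: R_def Y_def finite_parts)
  have pr: "part (T1 G) A x \<inter> part (T2 G) A y \<noteq> {}" if "x \<in> A" "y \<in> A" for x y
    using nice that unfolding nice_def by blast
  have mRY: "m = card R * card Y" unfolding m_def R_def Y_def by (rule card_children_product[OF G A(1,2) pr])
  have mab: "real m \<le> real a * real b"
  proof -
    have "m \<le> b * a" unfolding mRY R_def Y_def by (intro mult_le_mono card_rows_le card_cols_le G A(1))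
    then have "real m \<le> real (b * a)" by (simp only: of_nat_le_iff)
    then show ?thesis by (simp add: mult.commute)
  qed
  have cell: "P \<inter> Q \<in> parts (D G) A" if PQ: "P \<in> R" "Q \<in> Y" for P Q
  proof -
    obtain x y where xy: "x \<in> A" "y \<in> A" "P = part (T1 G) A x" "Q = part (T2 G) A y"
      using PQ by (auto simp: R_def Y_def parts_def)
    obtain z where z: "z \<in> part (T1 G) A x" "z \<in> part (T2 G) A y" using pr[OF xy(1,2)] by blast
    have "P \<inter> Q = part (D G) A z" unfolding xy by (rule child_eq[OF G z])
    moreover have "z \<in> A" using z by (simp add: part_def)
    ultimately show ?thesis by (simp add: part_in_parts)
  qed
  have m2: "card (parts (D (D G)) A) = m * (a * b)"
  proof -
    have "card (parts (D (D G)) A) = (\<Sum>C\<in>parts (D G) A. card (parts (D (D G)) C))"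
      using sum_parts_refine[OF subDD sT(3) sub_T(3)[OF TDG] A(2), of "\<lambda>_. 1::nat"] by simp
    also have "\<dots> = (\<Sum>C\<in>parts (D G) A. a * b)" using nice unfolding nice_def by (intro sum.cong) auto
    finally show ?thesis by (simp add: m_def)
  qed
  have C1: "(1 - d) * \<mu> \<le> card C" "C \<subseteq> A" "finite C" "C \<noteq> {}" "in_coset (D G) C"
    "card (parts (T1 (D G)) C) = b" "card (parts (T2 (D G)) C) = a"
    "\<And>E. E \<in> parts (D (D G)) C \<Longrightarrow> real (card E) \<le> (1 + d) * \<mu> / (real a * real b)"
    if C: "C \<in> parts (D G) A" for C
  proof -
    show "C \<subseteq> A" "finite C" "C \<noteq> {}" "in_coset (D G) C"
      using parts_subset[OF C] parts_finite[OF A(2) C] parts_nonempty[OF sT(3) C] parts_in_coset[OF sT(3) C] by auto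
    show "card (parts (T1 (D G)) C) = b" "card (parts (T2 (D G)) C) = a" using nice C unfolding nice_def by auto
    have "(1 - d) * card A \<le> real (card C) * real m" using d1[OF C] by (simp add: m_def abs_le_iff algebra_simps)
    then show "(1 - d) * \<mu> \<le> card C" using m0 by (simp add: \<mu>_def field_simps)
    fix E assume "E \<in> parts (D (D G)) C"
    then have E: "E \<in> parts (D (D G)) A" using parts_refine[OF subDD sT(3), of A] C by blast
    have "real (card E) * (real m * (real a * real b)) \<le> (1 + d) * card A"
      using d2[OF E] unfolding m2 by (simp add: abs_le_iff algebra_simps)
    then show "real (card E) \<le> (1 + d) * \<mu> / (real a * real b)" using m0 p by (simp add: \<mu>_def field_simps)
  qed
  have exV: "\<exists>V\<in>parts (D G) A. V \<subseteq> P \<and> (\<forall>Q\<in>Y. card (P \<inter> Q) \<le> card V)" if P: "P \<in> R" for P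
  proof -
    have "Y \<noteq> {}" using A(3) by (auto simp: Y_def parts_def)
    then obtain Q where Q: "Q \<in> Y" "\<And>Q'. Q' \<in> Y \<Longrightarrow> card (P \<inter> Q') \<le> card (P \<inter> Q)"
      using finite_obtain_max[OF fRY(2), of "\<lambda>Q. card (P \<inter> Q)"] by metis
    then show ?thesis using cell[OF P Q(1)] by (intro bexI[of _ "P \<inter> Q"]) auto
  qed
  then obtain V where V: "\<And>P. P \<in> R \<Longrightarrow> V P \<in> parts (D G) A \<and> V P \<subseteq> P \<and> (\<forall>Q\<in>Y. card (P \<inter> Q) \<le> card (V P))" by metis
  have exU: "\<exists>U\<in>parts (D G) A. U \<subseteq> Q \<and> (\<forall>P\<in>R. card (P \<inter> Q) \<le> card U)" if Q: "Q \<in> Y" for Q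
  proof -
    have "R \<noteq> {}" using A(3) by (auto simp: R_def parts_def)
    then obtain P where P: "P \<in> R" "\<And>P'. P' \<in> R \<Longrightarrow> card (P' \<inter> Q) \<le> card (P \<inter> Q)"
      using finite_obtain_max[OF fRY(1), of "\<lambda>P. card (P \<inter> Q)"] by metis
    then show ?thesis using cell[OF P(1) Q] by (intro bexI[of _ "P \<inter> Q"]) auto
  qed
  then obtain U where U: "\<And>Q. Q \<in> Y \<Longrightarrow> U Q \<in> parts (D G) A \<and> U Q \<subseteq> Q \<and> (\<forall>P\<in>R. card (P \<inter> Q) \<le> card (U Q))" by metis
  define err where "err = 8 * K * (real a * real b * d)\<^sup>2 * \<mu> + real a * real b * e * card A"
  have cellb: "K * (l * card (V P) + (1 - l) * card (U Q)) - err \<le> card (lsum f g P Q)" if PQ: "P \<in> R" "Q \<in> Y" for P Q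
  proof -
    have VU: "V P \<in> parts (D G) A" "U Q \<in> parts (D G) A" "V P \<subseteq> P" "U Q \<subseteq> Q" using V[OF PQ(1)] U[OF PQ(2)] by auto
    note v = C1[OF VU(1)] and u = C1[OF VU(2)]
    have "K * (l * card (V P) + (1 - l) * card (U Q)) - 8 * K * (real a * real b * d)\<^sup>2 * \<mu> - real a * real b * e * card A
        \<le> card (lsum f g (V P) (U Q))"
      by (rule pair_near_uniform[OF TDG v(5,3,4,2) u(5,3,4,2) v(6) u(7) K l BM \<mu>(1) d v(1) u(1) v(8) u(8)])
    moreover have "card (lsum f g (V P) (U Q)) \<le> card (lsum f g P Q)"
      using PQ VU A(2) by (intro card_mono finite_lsum lsum_mono) (auto simp: R_def Y_def intro: parts_finite)
    ultimately show ?thesis unfolding err_def by linarith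
  qed
  define gain where "gain P Q = l * (real (card (V P)) - card (P \<inter> Q)) + (1 - l) * (real (card (U Q)) - card (P \<inter> Q))" for P Q
  have g0: "0 \<le> gain P Q" if "P \<in> R" "Q \<in> Y" for P Q
    unfolding gain_def using V[OF that(1)] U[OF that(2)] that l by (intro add_nonneg_nonneg mult_nonneg_nonneg) auto
  have allcells: "\<exists>P\<in>R. \<exists>Q\<in>Y. C = P \<inter> Q" if C: "C \<in> parts (D G) A" for C
  proof -
    obtain x where x: "x \<in> A" "C = part (D G) A x" using C by (auto simp: parts_def)
    show ?thesis unfolding x(2) part_D using x(1) by (auto simp: R_def Y_def intro: part_in_parts)
  qed
  have "\<exists>P\<in>R. \<exists>Q\<in>Y. l0 * (\<delta> * \<mu> / 2) \<le> gain P Q"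
  proof -
    have sumC: "(\<Sum>C\<in>parts (D G) A. real (card C)) = real m * \<mu>"
      using sum_card_parts[OF A(2) sT(3)] \<mu>(2) by (simp flip: of_nat_sum)
    have exlow: "\<exists>C\<in>parts (D G) A. card C \<le> \<mu>"
    proof (rule ccontr)
      assume "\<not> ?thesis"
      then have "(\<Sum>C\<in>parts (D G) A. \<mu>) < (\<Sum>C\<in>parts (D G) A. real (card C))"
        using C0(1) finite_parts[OF A(2)] by (intro sum_strict_mono) (auto simp: not_le)
      then show False using sumC by (simp add: m_def)
    qed
    have exhigh: "\<exists>C\<in>parts (D G) A. \<mu> \<le> card C"
    proof (rule ccontr)
      assume "\<not> ?thesis"
      then have "(\<Sum>C\<in>parts (D G) A. real (card C)) < (\<Sum>C\<in>parts (D G) A. \<mu>)"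
        using C0(1) finite_parts[OF A(2)] by (intro sum_strict_mono) (auto simp: not_le)
      then show False using sumC by (simp add: m_def)
    qed
    have C0': "\<delta> * \<mu> \<le> \<bar>real (card C0) - \<mu>\<bar>"
    proof -
      have "\<delta> * \<mu> * real m \<le> \<bar>real (card C0) * real m - \<mu> * real m\<bar>"
        using C0(2) \<mu>(2) by (simp add: m_def mult_ac)
      also have "\<dots> = \<bar>real (card C0) - \<mu>\<bar> * real m" using m0 by (simp add: abs_mult flip: left_diff_distrib)
      finally show ?thesis using m0 by (simp add: mult_le_cancel_right)
    qed
    obtain C C' where CC: "C \<in> parts (D G) A" "C' \<in> parts (D G) A" "\<delta> * \<mu> \<le> real (card C) - real (card C')"
    proof (cases "\<mu> \<le> card C0")
      case True
      obtain C' where "C' \<in> parts (D G) A" "card C' \<le> \<mu>" using exlow by blast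
      then show thesis using that[of C0 C'] C0(1) C0' True by auto
    next
      case False
      obtain C where "C \<in> parts (D G) A" "\<mu> \<le> card C" using exhigh by blast
      then show thesis using that[of C C0] C0(1) C0' False by auto
    qed
    obtain P Q where PQ: "P \<in> R" "Q \<in> Y" "C = P \<inter> Q" using allcells[OF CC(1)] by blast
    obtain P' Q' where PQ': "P' \<in> R" "Q' \<in> Y" "C' = P' \<inter> Q'" using allcells[OF CC(2)] by blast
    show ?thesis
    \<comment> \<open>Two children whose sizes differ by \<delta> \<mu> are joined through the child
      in the row of the first and the column of the second. One of the two steps accounts for half
      the difference, and the maximum of that row or column exceeds the smaller child by as
      much.\<close>
    proof (cases "\<delta> * \<mu> / 2 \<le> real (card (P \<inter> Q)) - card (P \<inter> Q')")
      case True
      have "real (card (P \<inter> Q)) \<le> card (V P)" using V[OF PQ(1)] PQ(2) by auto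
      then have "\<delta> * \<mu> / 2 \<le> real (card (V P)) - card (P \<inter> Q')" using True by linarith
      then have "l0 * (\<delta> * \<mu> / 2) \<le> l * (real (card (V P)) - card (P \<inter> Q'))"
        using l0 l \<delta> \<mu> by (intro mult_mono) auto
      moreover have "0 \<le> (1 - l) * (real (card (U Q')) - card (P \<inter> Q'))" using U[OF PQ'(2)] PQ(1) l by auto
      ultimately have "l0 * (\<delta> * \<mu> / 2) \<le> gain P Q'" unfolding gain_def by linarith
      then show ?thesis using PQ(1) PQ'(2) by blast
    next
      case False
      then have h: "\<delta> * \<mu> / 2 \<le> real (card (P \<inter> Q')) - card (P' \<inter> Q')" using CC(3) PQ(3) PQ'(3) by simp
      have "real (card (P \<inter> Q')) \<le> card (U Q')" using U[OF PQ'(2)] PQ(1) by auto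
      then have "\<delta> * \<mu> / 2 \<le> real (card (U Q')) - card (P' \<inter> Q')" using h by linarith
      then have "l0 * (\<delta> * \<mu> / 2) \<le> (1 - l) * (real (card (U Q')) - card (P' \<inter> Q'))"
        using l0 l \<delta> \<mu> by (intro mult_mono) auto
      moreover have "0 \<le> l * (real (card (V P')) - card (P' \<inter> Q'))" using V[OF PQ'(1)] PQ'(2) l by auto
      ultimately have "l0 * (\<delta> * \<mu> / 2) \<le> gain P' Q'" unfolding gain_def by linarith
      then show ?thesis using PQ'(1,2) by blast
    qed
  qed
  then obtain P0 Q0 where PQ0: "P0 \<in> R" "Q0 \<in> Y" "l0 * (\<delta> * \<mu> / 2) \<le> gain P0 Q0" by blast
  have gsum: "l0 * (\<delta> * \<mu> / 2) \<le> (\<Sum>P\<in>R. \<Sum>Q\<in>Y. gain P Q)"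
  proof -
    have "gain P0 Q0 \<le> (\<Sum>Q\<in>Y. gain P0 Q)" using fRY PQ0 g0 by (intro member_le_sum) auto
    also have "\<dots> \<le> (\<Sum>P\<in>R. \<Sum>Q\<in>Y. gain P Q)" using fRY PQ0 g0 by (intro member_le_sum sum_nonneg) auto
    finally show ?thesis using PQ0(3) by linarith
  qed
  have csum: "(\<Sum>P\<in>R. \<Sum>Q\<in>Y. real (card (P \<inter> Q))) = card A"
  proof -
    have "(\<Sum>Q\<in>Y. card (P \<inter> Q)) = card P" if P: "P \<in> R" for P
    proof -
      have "card P = card (\<Union>Q\<in>Y. P \<inter> Q)"
        using Union_parts[OF sT(2), of A] parts_subset[of P "T1 G" A] P by (intro arg_cong[of _ _ card]) (auto simp: R_def Y_def)
      also have "\<dots> = (\<Sum>Q\<in>Y. card (P \<inter> Q))"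
      proof (rule card_UN_disjoint)
        show "finite Y" by (rule fRY)
        show "\<forall>Q\<in>Y. finite (P \<inter> Q)" using P parts_finite[OF A(2), of P "T1 G"] by (simp add: R_def)
        show "\<forall>Q\<in>Y. \<forall>Q'\<in>Y. Q \<noteq> Q' \<longrightarrow> P \<inter> Q \<inter> (P \<inter> Q') = {}"
        proof (intro ballI impI)
          fix Q Q' assume "Q \<in> Y" "Q' \<in> Y" "Q \<noteq> Q'"
          then have "Q \<inter> Q' = {}" using parts_disjoint[OF sT(2)] unfolding Y_def by metis
          then show "P \<inter> Q \<inter> (P \<inter> Q') = {}" by auto
        qed
      qed
      finally show ?thesis by simp
    qed
    then have "(\<Sum>P\<in>R. \<Sum>Q\<in>Y. card (P \<inter> Q)) = card A"
      using sum_card_parts[OF A(2) sT(1)] by (simp add: R_def)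
    then show ?thesis by (simp flip: of_nat_sum)
  qed
  have "(\<Sum>P\<in>R. \<Sum>Q\<in>Y. K * (real (card (P \<inter> Q)) + gain P Q) - err) \<le> (\<Sum>P\<in>R. \<Sum>Q\<in>Y. real (card (lsum f g P Q)))"
  proof (intro sum_mono)
    fix P Q assume "P \<in> R" "Q \<in> Y"
    moreover have "l * card (V P) + (1 - l) * card (U Q) = real (card (P \<inter> Q)) + gain P Q"
      by (simp add: gain_def algebra_simps)
    ultimately show "K * (real (card (P \<inter> Q)) + gain P Q) - err \<le> real (card (lsum f g P Q))" using cellb by metis
  qed
  also have "\<dots> = s A" unfolding card_lsum_cells[OF G A(1,2) A(1,2)] R_def Y_def by simp
  also have "(\<Sum>P\<in>R. \<Sum>Q\<in>Y. K * (real (card (P \<inter> Q)) + gain P Q) - err)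
      = K * ((\<Sum>P\<in>R. \<Sum>Q\<in>Y. real (card (P \<inter> Q))) + (\<Sum>P\<in>R. \<Sum>Q\<in>Y. gain P Q)) - real m * err"
    using mRY by (simp add: sum_subtractf sum.distrib sum_distrib_left distrib_left)
  finally have main: "K * (card A + (\<Sum>P\<in>R. \<Sum>Q\<in>Y. gain P Q)) - real m * err \<le> s A" unfolding csum .
  have "K * (l0 * (\<delta> * \<mu> / 2)) \<le> K * (\<Sum>P\<in>R. \<Sum>Q\<in>Y. gain P Q)" using gsum K by (intro mult_left_mono) auto
  moreover have "K * l0 / (2 * real a * real b) * \<delta> * card A \<le> K * (l0 * (\<delta> * \<mu> / 2))"
  proof -
    have "card A / (real a * real b) \<le> \<mu>" unfolding \<mu>_def using mab m0 cA by (intro divide_left_mono) (auto intro!: mult_pos_pos simp: p)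
    then have "K * l0 * \<delta> / 2 * (card A / (real a * real b)) \<le> K * l0 * \<delta> / 2 * \<mu>"
      using K l0 \<delta> by (intro mult_left_mono) auto
    then show ?thesis by (simp add: mult_ac)
  qed
  moreover have "real m * err \<le> 8 * K * (real a * real b * d)\<^sup>2 * card A + (real a * real b)\<^sup>2 * e * card A"
  proof -
    have "real m * (real a * real b * e * card A) \<le> (real a * real b) * (real a * real b * e * card A)"
      using mab e p by (intro mult_right_mono) auto
    moreover have "real m * (8 * K * (real a * real b * d)\<^sup>2 * \<mu>) = 8 * K * (real a * real b * d)\<^sup>2 * card A"
      using \<mu>(2) by (simp add: mult_ac)
    moreover have "(real a * real b) * (real a * real b * e * card A) = (real a * real b)\<^sup>2 * e * card A"
      by (simp add: power2_eq_square)
    ultimately show ?thesis unfolding err_def distrib_left by linarith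
  qed
  ultimately show ?thesis using main unfolding distrib_left by linarith
qed

end

section \<open>Induction on the size of the set\<close>

text \<open>Concavity of the loss: at most \<open>P\<close> pieces lose together at most P^\<sigma>
  times the loss of the whole. The estimate is Young's inequality for each piece against the mean X
  / P.\<close>

lemma powr_sum_le:
  fixes x :: "'i \<Rightarrow> real"
  assumes I: "finite I" and x: "\<And>i. i \<in> I \<Longrightarrow> 0 < x i" and X: "sum x I = X" "0 < X"
    and P: "real (card I) \<le> P" "0 < P" and \<sigma>: "0 < \<sigma>" "\<sigma> < 1"
  shows "(\<Sum>i\<in>I. x i powr (1 - \<sigma>)) \<le> P powr \<sigma> * X powr (1 - \<sigma>)"
proof -
  have "(\<Sum>i\<in>I. x i powr (1 - \<sigma>)) * (X / P) powr \<sigma> = (\<Sum>i\<in>I. x i powr (1 - \<sigma>) * (X / P) powr \<sigma>)"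
    by (simp add: sum_distrib_right)
  also have "\<dots> \<le> (\<Sum>i\<in>I. (1 - \<sigma>) * x i + \<sigma> * (X / P))"
    using x X P \<sigma> by (intro sum_mono Youngs_inequality_0) auto
  also have "\<dots> = (1 - \<sigma>) * X + real (card I) * (\<sigma> * (X / P))"
    by (simp add: sum.distrib sum_distrib_left[symmetric] X)
  also have "\<dots> \<le> (1 - \<sigma>) * X + P * (\<sigma> * (X / P))"
    using X P \<sigma> by (intro add_left_mono mult_right_mono) auto
  also have "\<dots> = X" using P by (simp add: algebra_simps)
  finally have "(\<Sum>i\<in>I. x i powr (1 - \<sigma>)) * (X / P) powr \<sigma> * (P / X) powr \<sigma> \<le> X * (P / X) powr \<sigma>"
    by (intro mult_right_mono) auto
  moreover have "(X / P) powr \<sigma> * (P / X) powr \<sigma> = 1" using X P by (simp flip: powr_mult)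
  moreover have "X * (P / X) powr \<sigma> = P powr \<sigma> * X powr (1 - \<sigma>)"
    using X P by (simp add: powr_divide powr_diff)
  ultimately show ?thesis by (simp add: mult.assoc)
qed

context tight_pair
begin

lemma loss_level:
  assumes G: "\<T> G" and A: "in_coset G A" "finite A" "A \<noteq> {}" and \<sigma>: "0 < \<sigma>" "\<sigma> < 1" and d: "0 \<le> d"
  shows "(\<Sum>C\<in>parts (lv G k) A. d * real (card C) powr (1 - \<sigma>))
    \<le> ((real a * real b) ^ k) powr \<sigma> * (d * real (card A) powr (1 - \<sigma>))"
proof -
  have "card (parts (lv G k) A) \<le> (a * b) ^ k" by (rule card_parts_lev_le[OF G A(1,2)])
  then have "real (card (parts (lv G k) A)) \<le> real ((a * b) ^ k)" by (simp only: of_nat_le_iff)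
  then have c: "real (card (parts (lv G k) A)) \<le> (real a * real b) ^ k" by simp
  have "(\<Sum>C\<in>parts (lv G k) A. real (card C) powr (1 - \<sigma>)) \<le> ((real a * real b) ^ k) powr \<sigma> * real (card A) powr (1 - \<sigma>)"
    using sum_card_parts[OF A(2) T_sub[OF T_lev[OF G]], of k] A \<sigma> c ab_pos
      parts_nonempty[OF T_sub[OF T_lev[OF G]]] parts_finite[OF A(2)]
    by (intro powr_sum_le finite_parts) (auto simp: card_gt_0_iff simp flip: of_nat_sum)
  from mult_left_mono[OF this d] show ?thesis by (simp add: sum_distrib_left mult_ac)
qed

text \<open>By induction the classes of level k + 1 satisfy the bound. Superadditivity leaves for
  the chosen cell only the excess of \<open>A\<close> over their total, namely the increase of the
  loss under splitting plus \<epsilon> |A|. The two conclusions are \<open>CELL\<close> and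
  \<open>EXTRA\<close> of the locale \<open>violator\<close>.\<close>

lemma cell_excess:
  fixes \<epsilon> \<theta> :: real
  assumes G: "\<T> G" and A: "in_coset G A" "finite A" "A \<noteq> {}" and \<sigma>: "0 < \<sigma>" "\<sigma> < 1" and d: "0 \<le> d" and K: "0 \<le> K" and \<theta>: "0 \<le> \<theta>"
    and IH: "\<And>C. C \<subset> A \<Longrightarrow> K * real (card C) - d * real (card C) powr (1 - \<sigma>) \<le> real (s C)"
    and sA: "real (s A) \<le> K * card A + \<epsilon> * card A - d * real (card A) powr (1 - \<sigma>)"
    and w: "(((real a * real b) ^ Suc k) powr \<sigma> - 1) * (d * real (card A) powr (1 - \<sigma>)) + \<epsilon> * card A \<le> \<theta> * card A"
    and R: "R \<in> parts (lv G k) A" and x: "x \<in> R" and y: "y \<in> R"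
  defines "P \<equiv> part (T1 (lv G k)) R x" and "Q \<equiv> part (T2 (lv G k)) R y" and "Q' \<equiv> part (T2 (lv G k)) R x"
  shows "real (card (lsum f g P Q)) \<le> K * card (P \<inter> Q) + \<theta> * card A"
    and "real (card (lsum f g P Q')) \<le> real (s (part (D (lv G k)) R x)) + \<theta> * card A"
proof -
  let ?Ps = "parts (lv G (Suc k)) A"
  note Tk = T_lev[OF G, of k]
  have sk: "subgrp (lv G k)" "subgrp (D (lv G k))" using T_sub[OF Tk] sub_T[OF Tk] by auto
  have fPs: "finite ?Ps" using A(2) by (rule finite_parts)
  have q1: "1 \<le> ((real a * real b) ^ Suc k) powr \<sigma>"
  proof -
    have "1 \<le> real a * real b" using mult_mono[of 1 "real a" 1 "real b"] ab_pos by auto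
    then have "1 \<le> (real a * real b) ^ Suc k" by (rule one_le_power)
    then show ?thesis using \<sigma> by (simp add: ge_one_powr_ge_zero)
  qed
  have l0: "0 \<le> d * real (card A) powr (1 - \<sigma>)" using d by simp
  obtain r where r: "r \<in> A" "R = part (lv G k) A r" using R by (auto simp: parts_def)
  have RA: "R \<subseteq> A" using parts_subset[OF R] .
  have xr: "x - r \<in> lv G k" "x \<in> A" using x r by (auto simp: part_def)
  have Z': "part (D (lv G k)) R x = part (D (lv G k)) A x"
    unfolding r(2) using xr by (intro part_refine D_subset(1) sk)
  have Z'in: "part (D (lv G k)) R x \<in> ?Ps" unfolding Z' using xr by (simp add: part_in_parts)
  have PQ': "P \<inter> Q' = part (D (lv G k)) R x" unfolding P_def Q'_def part_D ..
  show "real (card (lsum f g P Q)) \<le> K * card (P \<inter> Q) + \<theta> * card A"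
    "real (card (lsum f g P Q')) \<le> real (s (part (D (lv G k)) R x)) + \<theta> * card A"
  proof -
    \<comment> \<open>If \<open>A\<close> is a single class of level k + 1, it is its own child and
      the induction hypothesis says nothing about it; but then the cell is all of \<open>A\<close>
      and its sumset is that of \<open>A\<close>.\<close>
    consider (whole) "A \<in> ?Ps" | (proper) "A \<notin> ?Ps" by blast
    then have "real (card (lsum f g P Q)) \<le> K * card (P \<inter> Q) + \<theta> * card A
      \<and> real (card (lsum f g P Q')) \<le> real (s (part (D (lv G k)) R x)) + \<theta> * card A"
    proof cases
      case whole
      then have cA: "in_coset (D (lv G k)) A" using parts_in_coset[of "lv G (Suc k)" A A] sk(2) by simp
      have all: "part H A z = A" if "D (lv G k) \<subseteq> H" "z \<in> A" for H z
        using cA that unfolding in_coset_def part_def by blast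
      have RA': "R = A" unfolding r(2) using r(1) by (intro all D_subset(1))
      have eq: "P = A" "Q = A" "Q' = A" "part (D (lv G k)) R x = A"
        unfolding P_def Q_def Q'_def RA' using x y RA' by (auto intro!: all D_subset)
      have "0 \<le> (((real a * real b) ^ Suc k) powr \<sigma> - 1) * (d * real (card A) powr (1 - \<sigma>))"
        by (intro mult_nonneg_nonneg) (use q1 d in auto)
      then have e: "\<epsilon> * card A \<le> \<theta> * card A" using w by linarith
      show ?thesis
      proof
        show "real (card (lsum f g P Q)) \<le> K * card (P \<inter> Q) + \<theta> * card A"
          using sA e l0 unfolding eq by simp
        show "real (card (lsum f g P Q')) \<le> real (s (part (D (lv G k)) R x)) + \<theta> * card A" unfolding eq using \<theta> by simp
      qed
    next
      case proper
      have sub: "C \<subset> A" if "C \<in> ?Ps" for C using parts_subset[OF that] that proper by blast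
      have loss: "(\<Sum>C\<in>?Ps. d * real (card C) powr (1 - \<sigma>))
          \<le> ((real a * real b) ^ Suc k) powr \<sigma> * (d * real (card A) powr (1 - \<sigma>))"
        by (rule loss_level[OF G A \<sigma> d])
      have tot: "(\<Sum>C\<in>?Ps. K * real (card C)) = K * card A"
        using sum_card_parts[OF A(2) T_sub[OF T_lev[OF G]], of "Suc k"] by (simp add: sum_distrib_left[symmetric] flip: of_nat_sum)
      have low: "K * card A - (\<Sum>C\<in>?Ps. d * real (card C) powr (1 - \<sigma>)) \<le> (\<Sum>C\<in>?Ps. real (s C))"
        unfolding tot[symmetric] sum_subtractf[symmetric] by (intro sum_mono IH sub)
      have low': "K * card A - K * card Z - (\<Sum>C\<in>?Ps. d * real (card C) powr (1 - \<sigma>)) \<le> (\<Sum>C\<in>?Ps - {Z}. real (s C))" for Z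
      proof (cases "Z \<in> ?Ps")
        case True
        have "(\<Sum>C\<in>?Ps - {Z}. K * real (card C) - d * real (card C) powr (1 - \<sigma>)) \<le> (\<Sum>C\<in>?Ps - {Z}. real (s C))"
          by (intro sum_mono IH sub) auto
        moreover have "(\<Sum>C\<in>?Ps - {Z}. d * real (card C) powr (1 - \<sigma>)) \<le> (\<Sum>C\<in>?Ps. d * real (card C) powr (1 - \<sigma>))"
          using fPs d by (intro sum_mono2) auto
        moreover have "(\<Sum>C\<in>?Ps. K * real (card C)) = K * card Z + (\<Sum>C\<in>?Ps - {Z}. K * real (card C))"
          using fPs True by (rule sum.remove)
        ultimately show ?thesis unfolding sum_subtractf tot by linarith
      next
        case False
        then have "?Ps - {Z} = ?Ps" by blast
        moreover have "0 \<le> K * card Z" using K by simp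
        ultimately show ?thesis using low by simp
      qed
      have c1: "real (card (lsum f g P Q)) + (\<Sum>C\<in>?Ps - {P \<inter> Q}. real (s C)) \<le> s A"
        using superadd_level_cell[OF G A(1,2) R x y, folded P_def Q_def]
        by (simp only: of_nat_add[symmetric] of_nat_sum[symmetric] of_nat_le_iff)
      have c2: "real (card (lsum f g P Q')) + (\<Sum>C\<in>?Ps - {P \<inter> Q'}. real (s C)) \<le> s A"
        using superadd_level_cell[OF G A(1,2) R x x, folded P_def Q'_def]
        by (simp only: of_nat_add[symmetric] of_nat_sum[symmetric] of_nat_le_iff)
      have w': "((real a * real b) ^ Suc k) powr \<sigma> * (d * real (card A) powr (1 - \<sigma>)) - d * real (card A) powr (1 - \<sigma>)
          + \<epsilon> * card A \<le> \<theta> * card A" using w by (simp only: left_diff_distrib mult_1)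
      show ?thesis
      proof
        show "real (card (lsum f g P Q)) \<le> K * card (P \<inter> Q) + \<theta> * card A"
          using c1 low'[of "P \<inter> Q"] sA loss w' by linarith
        have "(\<Sum>C\<in>?Ps. real (s C)) = real (s (P \<inter> Q')) + (\<Sum>C\<in>?Ps - {P \<inter> Q'}. real (s C))"
          using fPs Z'in unfolding PQ' by (rule sum.remove)
        then show "real (card (lsum f g P Q')) \<le> real (s (part (D (lv G k)) R x)) + \<theta> * card A"
          using c2 low sA loss w' unfolding PQ' by linarith
      qed
    qed
    then show "real (card (lsum f g P Q)) \<le> K * card (P \<inter> Q) + \<theta> * card A"
      "real (card (lsum f g P Q')) \<le> real (s (part (D (lv G k)) R x)) + \<theta> * card A" by auto
  qed
qed

end

context tight_pair
begin

text \<open>\<open>a\<close> occupied columns are all the columns of \<open>G\<close>, so each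
  element of \<open>G\<close> is a difference of points of \<open>C\<close> modulo T2.\<close>

lemma gen_of_card_cols:
  assumes G: "\<T> G" and C: "in_coset G C" "C \<noteq> {}" and full: "card (parts (T2 G) C) = a"
  shows "gen f g G C"
proof -
  note H = sub_T(2)[OF G]
  obtain r where r: "r \<in> C" using C(2) by blast
  have mem: "x - r \<in> G" if "x \<in> C" for x using C(1) r that by (auto simp: in_coset_def)
  have k: "part (T2 G) C x = part (T2 G) C y \<longleftrightarrow> part (T2 G) G (x - r) = part (T2 G) G (y - r)" if "x \<in> C" "y \<in> C" for x y
    using part_eq_iff[OF H that(1), of y] part_eq_iff[OF H mem[OF that(1)], of "y - r"] by simp
  have "card ((\<lambda>x. part (T2 G) G (x - r)) ` C) = card (parts (T2 G) G)"
    using card_image_same_kernel(1)[of C, OF k] full T_a[OF G] unfolding parts_def by simp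
  moreover have "(\<lambda>x. part (T2 G) G (x - r)) ` C \<subseteq> parts (T2 G) G" using mem by (auto simp: parts_def)
  ultimately have eq: "(\<lambda>x. part (T2 G) G (x - r)) ` C = parts (T2 G) G"
    using T_a[OF G] card_subset_eq by blast
  show ?thesis unfolding gen_def
  proof (intro allI impI)
    fix M assume M: "subgrp M \<and> T2 G \<subseteq> M \<and> M \<subseteq> G \<and> in_coset M C"
    have "z \<in> M" if z: "z \<in> G" for z
    proof -
      have "part (T2 G) G z \<in> (\<lambda>x. part (T2 G) G (x - r)) ` C" unfolding eq using z by (rule part_in_parts)
      then obtain x where x: "x \<in> C" "part (T2 G) G z = part (T2 G) G (x - r)" by blast
      then have "z - (x - r) \<in> M" using part_eq_iff[OF H z] M by blast
      moreover have "x - r \<in> M" using M x(1) r by (auto simp: in_coset_def)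
      ultimately show ?thesis using subgrp_add[of M "z - (x - r)" "x - r"] M by simp
    qed
    then show "M = G" using M by blast
  qed
qed

text \<open>Let \<delta> and d' be the relative deviations of the first and the second level. If d'
  is at most a multiple of \<delta>, the linear gain in \<delta> beats the quadratic error.
  Otherwise the child with the worst second-level deviation has by \<open>H\<close> a gain in d',
  which exceeds the gain in \<delta> that is demanded of \<open>A\<close>.\<close>

lemma nice_step:
  assumes G: "\<T> G" and A: "in_coset G A" "finite A" "A \<noteq> {}" and gens: "gen f g G A" "gen g f G A"
    and nice: "nice \<eta> G A" and K: "1 \<le> K" and l: "0 < l" "l < 1" and BM: "bm K l e A" and e: "0 \<le> e"
    and p: "p = real a * real b" and l0: "l0 \<le> l" "l0 \<le> 1 - l" "0 < l0"
    and \<eta>: "0 \<le> \<eta>" "12 * p * \<eta> \<le> 1" "144 * K * p ^ 4 * \<eta> \<le> K * l0 / (2 * p)"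
    and c: "0 < c" "c \<le> K * l0 / (4 * p)"
    and \<sigma>: "0 < \<sigma>" "\<sigma> < 1" "144 * K * p ^ 3 * (p powr \<sigma> - 1) \<le> c" and d0: "0 < d0"
    and el: "p\<^sup>2 * e * card A \<le> d0 * real (card A) powr (1 - \<sigma>) / 2"
    and F: "\<And>C. C \<subset> A \<Longrightarrow> K * real (card C) - d0 * real (card C) powr (1 - \<sigma>) \<le> real (s C)"
    and H: "\<And>C E. C \<in> parts (D G) A \<Longrightarrow> C \<subset> A \<Longrightarrow> gen f g (D G) C \<Longrightarrow> gen g f (D G) C \<Longrightarrow> E \<in> parts (D (D G)) C \<Longrightarrow>
      K * real (card C) + c * \<bar>real (card E) * real (card (parts (D (D G)) C)) - real (card C)\<bar>
        - d0 * real (card C) powr (1 - \<sigma>) \<le> real (s C)"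
    and C0: "C0 \<in> parts (D G) A" "\<And>C. C \<in> parts (D G) A \<Longrightarrow>
      \<bar>real (card C) * real (card (parts (D G) A)) - real (card A)\<bar> \<le> \<bar>real (card C0) * real (card (parts (D G) A)) - real (card A)\<bar>"
  shows "K * real (card A) + c * \<bar>real (card C0) * real (card (parts (D G) A)) - real (card A)\<bar>
      - d0 * real (card A) powr (1 - \<sigma>) \<le> real (s A)"
proof (rule ccontr)
  assume nv: "\<not> ?thesis"
  define n where "n = real (card A)"
  define m where "m = real (card (parts (D G) A))"
  define \<Lambda> where "\<Lambda> = d0 * n powr (1 - \<sigma>)"
  define \<tau> where "\<tau> = \<Lambda> / n"
  define \<delta> where "\<delta> = \<bar>real (card C0) * m - n\<bar> / n"
  interpret sw: tight_pair g f \<T> b a by (rule tight_pair_swap) unfold_locales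
  note sT = sub_T[OF G] and TDG = TD[OF G]
  note sDD = sub_T(3)[OF TDG] and subDD = D_subset(1)[of "D G"]
  have p1: "1 \<le> p" using mult_mono[of 1 "real a" 1 "real b"] ab_pos by (auto simp: p)
  have n0: "0 < n" using A by (simp add: n_def card_gt_0_iff)
  have \<Lambda>0: "0 < \<Lambda>" using d0 n0 by (simp add: \<Lambda>_def)
  have \<tau>: "\<Lambda> = \<tau> * n" "0 < \<tau>" using n0 \<Lambda>0 by (auto simp: \<tau>_def)
  have \<delta>: "\<bar>real (card C0) * m - n\<bar> = \<delta> * n" "0 \<le> \<delta>" using n0 by (auto simp: \<delta>_def)
  have viol: "real (s A) < K * n + c * (\<delta> * n) - \<tau> * n"
    using nv[folded n_def m_def, folded \<Lambda>_def, unfolded \<delta>(1) \<tau>(1)] by linarith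
  have m0: "0 < m" using C0(1) finite_parts[OF A(2)] by (auto simp: m_def card_gt_0_iff)
  have mp: "m \<le> p"
  proof -
    have "card (parts (D G) A) \<le> a * b" using card_parts_lev_le[OF G A(1,2), of 1] by simp
    then have "real (card (parts (D G) A)) \<le> real (a * b)" by (simp only: of_nat_le_iff)
    then show ?thesis by (simp add: m_def p)
  qed
  have \<eta>1: "\<eta> \<le> 1" using \<eta>(1,2) p1 mult_right_mono[of 1 "12 * p" \<eta>] by simp
  have cC: "card (parts (T1 (D G)) C) = b" "card (parts (T2 (D G)) C) = a" "real (card (parts (D (D G)) C)) = p"
    "\<bar>real (card C) * m - n\<bar> \<le> \<eta> * n" "\<bar>real (card C) * m - n\<bar> \<le> \<delta> * n" if "C \<in> parts (D G) A" for C
  proof -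
    show "card (parts (T1 (D G)) C) = b" "card (parts (T2 (D G)) C) = a" "real (card (parts (D (D G)) C)) = p"
      "\<bar>real (card C) * m - n\<bar> \<le> \<eta> * n"
      using nice that unfolding nice_def n_def m_def p by auto
    show "\<bar>real (card C) * m - n\<bar> \<le> \<delta> * n" using C0(2)[OF that, folded n_def m_def] unfolding \<delta>(1) .
  qed
  have m2: "real (card (parts (D (D G)) A)) = m * p"
  proof -
    have "real (card (parts (D (D G)) A)) = (\<Sum>C\<in>parts (D G) A. real (card (parts (D (D G)) C)))"
      using sum_parts_refine[OF subDD sT(3) sDD A(2), of "\<lambda>_. 1::real"] by simp
    also have "\<dots> = (\<Sum>C\<in>parts (D G) A. p)" by (intro sum.cong cC) auto
    finally show ?thesis by (simp add: m_def)
  qed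
  have cE: "\<bar>real (card E) * (m * p) - n\<bar> \<le> \<eta> * n" if "E \<in> parts (D (D G)) A" for E
    using nice that unfolding nice_def n_def m2[symmetric] by blast
  have parent: "\<exists>C\<in>parts (D G) A. E \<in> parts (D (D G)) C" if "E \<in> parts (D (D G)) A" for E
    using that parts_refine[OF subDD sT(3), of A] by blast
  have child: "E \<in> parts (D (D G)) A" if "C \<in> parts (D G) A" "E \<in> parts (D (D G)) C" for C E
    using that parts_refine[OF subDD sT(3), of A] by blast
  define S where "S = Sigma (parts (D G) A) (\<lambda>C. parts (D (D G)) C)"
  define \<omega> where "\<omega> q = \<bar>real (card (snd q)) * p - real (card (fst q))\<bar>" for q :: "'g set \<times> 'g set"
  have fS: "finite S" unfolding S_def using A(2) by (intro finite_SigmaI finite_parts) (auto intro: parts_finite)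
  have neS: "S \<noteq> {}"
  proof -
    obtain x where x: "x \<in> A" using A(3) by blast
    then have "part (D (D G)) A x \<in> parts (D (D G)) A" by (rule part_in_parts)
    then show ?thesis using parent unfolding S_def by blast
  qed
  obtain q where q: "q \<in> S" "\<And>q'. q' \<in> S \<Longrightarrow> \<omega> q' \<le> \<omega> q" by (rule finite_obtain_max[OF fS neS, of \<omega>]) blast
  obtain C1 E1 where qe: "q = (C1, E1)" by (cases q)
  have C1: "C1 \<in> parts (D G) A" "E1 \<in> parts (D (D G)) C1" using q(1) by (auto simp: S_def qe)
  define w where "w = \<omega> q"
  define d' where "d' = m * w / n"
  have w0: "0 \<le> w" by (simp add: w_def \<omega>_def)
  have d': "m * w = d' * n" "0 \<le> d'" using n0 m0 w0 by (auto simp: d'_def)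
  have split: "real (card E) * (m * p) - n = m * (real (card E) * p - real (card C)) + (real (card C) * m - n)" for E C :: "'g set"
    by (simp add: algebra_simps)
  have d'2: "d' \<le> 2 * \<eta>"
  proof -
    have "d' * n = \<bar>m * (real (card E1) * p - real (card C1))\<bar>"
      unfolding d'(1)[symmetric] w_def \<omega>_def qe using m0 by (simp add: abs_mult)
    also have "\<dots> \<le> \<bar>real (card E1) * (m * p) - n\<bar> + \<bar>real (card C1) * m - n\<bar>" using split[of E1 C1] by linarith
    also have "\<dots> \<le> \<eta> * n + \<eta> * n" using cE[OF child[OF C1]] cC(4)[OF C1(1)] by linarith
    finally show ?thesis using n0 by (simp add: mult_le_cancel_right flip: mult_2 mult.assoc)
  qed
  have \<delta>\<eta>: "\<delta> \<le> \<eta>" using cC(4)[OF C0(1)] n0 unfolding \<delta>(1) by (simp add: mult_le_cancel_right)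
  define d where "d = \<delta> + d'"
  have d0': "0 \<le> d" "p * d \<le> 1 / 4"
  proof -
    show "0 \<le> d" using \<delta> d' by (simp add: d_def)
    have "p * d \<le> p * (3 * \<eta>)" using \<delta>\<eta> d'2 p1 by (intro mult_left_mono) (auto simp: d_def)
    then show "p * d \<le> 1 / 4" using \<eta>(2) by linarith
  qed
  have nlb: "K * n + K * l0 / (2 * real a * real b) * \<delta> * n - 8 * K * (real a * real b * d)\<^sup>2 * n
      - (real a * real b)\<^sup>2 * e * n \<le> s A"
    unfolding n_def
  proof (rule nice_lower_bound[OF G A nice K l BM e d0'(1) _ _ _ C0(1) _ l0(1,2) _ \<delta>(2)])
    show "real a * real b * d \<le> 1 / 4" using d0'(2) by (simp add: p)
    show "\<bar>real (card C) * real (card (parts (D G) A)) - real (card A)\<bar> \<le> d * real (card A)" if "C \<in> parts (D G) A" for C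
    proof -
      have "\<delta> * n \<le> d * n" using d' n0 by (intro mult_right_mono) (auto simp: d_def)
      then show ?thesis using cC(5)[OF that] unfolding m_def[symmetric] n_def[symmetric] by linarith
    qed
    show "\<bar>real (card E) * real (card (parts (D (D G)) A)) - real (card A)\<bar> \<le> d * real (card A)" if E: "E \<in> parts (D (D G)) A" for E
    proof -
      obtain C where C: "C \<in> parts (D G) A" "E \<in> parts (D (D G)) C" using parent[OF E] by blast
      have "\<bar>real (card E) * p - real (card C)\<bar> \<le> w" using q(2)[of "(C, E)"] C by (simp add: S_def \<omega>_def w_def)
      then have "m * \<bar>real (card E) * p - real (card C)\<bar> \<le> m * w" using m0 by (intro mult_left_mono) auto
      then have "\<bar>m * (real (card E) * p - real (card C))\<bar> \<le> d' * n" using m0 by (simp add: abs_mult d'(1))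
      moreover have "\<bar>real (card E) * (m * p) - n\<bar> \<le> \<bar>m * (real (card E) * p - real (card C))\<bar> + \<bar>real (card C) * m - n\<bar>"
        unfolding split[of E C] by (rule abs_triangle_ineq)
      ultimately show ?thesis using cC(5)[OF C(1)] unfolding m2 n_def[symmetric] d_def distrib_right by linarith
    qed
    show "\<delta> * real (card A) \<le> \<bar>real (card C0) * real (card (parts (D G) A)) - real (card A)\<bar>"
      using \<delta>(1) by (simp add: m_def n_def)
    show "0 \<le> l0" using l0 by simp
  qed
  define c1 where "c1 = K * l0 / (2 * p)"
  have c1: "c \<le> c1 / 2" "144 * K * p ^ 4 * \<eta> \<le> c1" using c(2) \<eta>(3) by (auto simp: c1_def)
  have main: "\<tau> / 2 + c1 / 2 * \<delta> < 8 * K * (p * d)\<^sup>2"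
  proof -
    have "(p\<^sup>2 * e) * n \<le> \<tau> * n / 2" using el[folded n_def, folded \<Lambda>_def] unfolding \<tau>(1) .
    moreover have "K * n + c1 * \<delta> * n - 8 * K * (p * d)\<^sup>2 * n - p\<^sup>2 * e * n \<le> s A"
      using nlb unfolding p[symmetric] c1_def by (simp add: p mult_ac)
    moreover have "c * (\<delta> * n) \<le> c1 / 2 * (\<delta> * n)" using c1(1) \<delta>(2) n0 by (intro mult_right_mono) auto
    ultimately have "(\<tau> / 2 + c1 / 2 * \<delta>) * n < (8 * K * (p * d)\<^sup>2) * n"
      using viol unfolding distrib_right by (simp add: mult.assoc)
    then show ?thesis using n0 by (simp add: mult_less_cancel_right)
  qed
  show False
  proof (cases "d' \<le> 2 * p * \<delta>")
    case True
    have "\<delta> \<le> p * \<delta>" using p1 \<delta>(2) mult_right_mono[of 1 p \<delta>] by simp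
    then have "d \<le> 3 * p * \<delta>" using True by (simp add: d_def)
    then have "(p * d)\<^sup>2 \<le> (p * (3 * p * \<delta>))\<^sup>2" using p1 d0'(1) by (intro power_mono mult_left_mono) auto
    also have "\<dots> = 9 * p ^ 4 * \<delta> * \<delta>" by (simp add: power2_eq_square power4_eq_xxxx)
    also have "\<dots> \<le> 9 * p ^ 4 * \<eta> * \<delta>" using \<delta>\<eta> \<delta>(2) by (intro mult_right_mono mult_left_mono) auto
    finally have "8 * K * (p * d)\<^sup>2 \<le> 8 * K * (9 * p ^ 4 * \<eta> * \<delta>)" using K by (intro mult_left_mono) auto
    also have "\<dots> = (144 * K * p ^ 4 * \<eta>) / 2 * \<delta>" by simp
    also have "\<dots> \<le> c1 / 2 * \<delta>" using c1(2) \<delta>(2) by (intro mult_right_mono divide_right_mono) auto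
    finally show False using main \<tau>(2) by linarith
  next
    case False
    have "2 * \<delta> \<le> 2 * (p * \<delta>)" using p1 \<delta>(2) mult_right_mono[of 1 p \<delta>] by simp
    then have \<delta>d: "\<delta> \<le> d' / 2" "0 < d'" using False \<delta>(2) by auto
    \<comment> \<open>If the worst child were \<open>A\<close> itself, generation would force T1 =
      T2 = G, so a b = 1 and the deviation would vanish.\<close>
    have C1A: "C1 \<noteq> A"
    proof
      assume eq: "C1 = A"
      have inc: "in_coset (D G) A" using parts_in_coset[OF sT(3) C1(1)] by (simp add: eq)
      have "in_coset (T1 G) A" "in_coset (T2 G) A" using inc D_subset[of G] unfolding in_coset_def by blast+
      then have "T2 G = G" "T1 G = G" using gens sT(1,2) unfolding gen_def by (auto simp: pre_def)
      then have DG: "D G = G" by (simp add: dpre_def)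
      have all: "part G A x = A" if "x \<in> A" for x using A(1) that by (auto simp: part_def in_coset_def)
      then have "parts G A = {A}" using A(3) by (auto simp: parts_def)
      then have "E1 = A" "p = 1" using C1(2) cC(3)[OF C1(1)] unfolding DG eq by simp_all
      then have "w = 0" by (simp add: w_def \<omega>_def qe eq)
      then show False using \<delta>d(2) by (simp add: d'_def)
    qed
    then have proper: "C \<subset> A" if "C \<in> parts (D G) A" for C
      using that parts_subset[OF that] parts_subset[OF C1(1)] parts_disjoint[OF sT(3) that C1(1)]
        parts_nonempty[OF sT(3) C1(1)] by blast
    have HC1: "K * real (card C1) + c * w - d0 * real (card C1) powr (1 - \<sigma>) \<le> real (s C1)"
    proof -
      have ic: "in_coset (D G) C1" "C1 \<noteq> {}" using parts_in_coset[OF sT(3) C1(1)] parts_nonempty[OF sT(3) C1(1)] by auto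
      have "gen f g (D G) C1" by (rule gen_of_card_cols[OF TDG ic cC(2)[OF C1(1)]])
      moreover have "gen g f (D G) C1" by (rule sw.gen_of_card_cols[OF TDG ic cC(1)[OF C1(1)]])
      ultimately show ?thesis using H[OF C1(1) proper[OF C1(1)] _ _ C1(2)] by (simp add: cC(3)[OF C1(1)] w_def \<omega>_def qe)
    qed
    have fP: "finite (parts (D G) A)" using A(2) by (rule finite_parts)
    have "K * n - (\<Sum>C\<in>parts (D G) A. d0 * real (card C) powr (1 - \<sigma>)) + c * w
        = (\<Sum>C\<in>parts (D G) A. K * real (card C) - d0 * real (card C) powr (1 - \<sigma>)) + c * w"
      using sum_card_parts[OF A(2) sT(3)] by (simp add: sum_subtractf sum_distrib_left[symmetric] n_def flip: of_nat_sum)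
    also have "\<dots> = (K * real (card C1) - d0 * real (card C1) powr (1 - \<sigma>)) + c * w
        + (\<Sum>C\<in>parts (D G) A - {C1}. K * real (card C) - d0 * real (card C) powr (1 - \<sigma>))"
      using sum.remove[OF fP C1(1), of "\<lambda>C. K * real (card C) - d0 * real (card C) powr (1 - \<sigma>)"] by simp
    also have "\<dots> \<le> real (s C1) + (\<Sum>C\<in>parts (D G) A - {C1}. real (s C))"
      using HC1 by (intro add_mono sum_mono F proper) auto
    also have "\<dots> = (\<Sum>C\<in>parts (D G) A. real (s C))" using sum.remove[OF fP C1(1), of "\<lambda>C. real (s C)"] by simp
    also have "\<dots> \<le> s A" using superadd[OF G A(1,2)] by (simp only: of_nat_sum[symmetric] of_nat_le_iff)
    finally have "K * n - (\<Sum>C\<in>parts (D G) A. d0 * real (card C) powr (1 - \<sigma>)) + c * w \<le> s A" .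
    moreover have "(\<Sum>C\<in>parts (D G) A. d0 * real (card C) powr (1 - \<sigma>)) \<le> p powr \<sigma> * (\<tau> * n)"
      using loss_level[OF G A \<sigma>(1,2) less_imp_le[OF d0], of 1, folded n_def, folded \<Lambda>_def] unfolding \<tau>(1) p by simp
    moreover have "c * (d' * n / p) \<le> c * w"
    proof -
      have "d' * n / p \<le> d' * n / m" using d'(2) n0 mp m0 p1 by (intro divide_left_mono) auto
      also have "\<dots> = w" unfolding d'(1)[symmetric] using m0 by simp
      finally show ?thesis using c(1) by (intro mult_left_mono) auto
    qed
    ultimately have "(c * d' / p) * n < (c * \<delta> + (p powr \<sigma> - 1) * \<tau>) * n"
      using viol by (simp add: algebra_simps)
    then have "c * d' / p < c * \<delta> + (p powr \<sigma> - 1) * \<tau>"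
      by (rule mult_right_less_imp_less) (use n0 in simp)
    moreover have "c * \<delta> \<le> c * (d' / (2 * p))" using False c(1) p1 by (intro mult_left_mono) (auto simp: field_simps)
    ultimately have "c * d' / (2 * p) < (p powr \<sigma> - 1) * \<tau>" by (simp add: field_simps)
    \<comment> \<open>For a counterexample \<open>main\<close> bounds the loss \<tau> per point by a
      multiple of d'. The condition on \<sigma> then keeps the increase of the loss within half of
      the gain c d' / p.\<close>
    moreover have "(p powr \<sigma> - 1) * \<tau> \<le> (p powr \<sigma> - 1) * (72 * K * p\<^sup>2 * d')"
    proof (rule mult_left_mono)
      have "(p * d)\<^sup>2 \<le> (p * (3 / 2 * d'))\<^sup>2" using p1 d0'(1) \<delta>d by (intro power_mono mult_left_mono) (auto simp: d_def)
      also have "\<dots> = 9 / 4 * p\<^sup>2 * d' * d'" by (simp add: power2_eq_square)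
      also have "\<dots> \<le> 9 / 4 * p\<^sup>2 * d' * 2" using d'2 \<eta>1 \<delta>d(2) by (intro mult_left_mono) auto
      finally have "8 * K * (p * d)\<^sup>2 \<le> 8 * K * (9 / 4 * p\<^sup>2 * d' * 2)" using K by (intro mult_left_mono) auto
      moreover have "0 \<le> c1 / 2 * \<delta>" using c1(1) c(1) \<delta>(2) by auto
      moreover have "8 * K * (9 / 4 * p\<^sup>2 * d' * 2) = 36 * K * p\<^sup>2 * d'" by simp
      ultimately show "\<tau> \<le> 72 * K * p\<^sup>2 * d'" using main by linarith
      show "0 \<le> p powr \<sigma> - 1" using p1 \<sigma>(1) by (simp add: ge_one_powr_ge_zero)
    qed
    ultimately have "c * d' / (2 * p) < (p powr \<sigma> - 1) * (72 * K * p\<^sup>2 * d')" by linarith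
    then have "c * d' / (2 * p) * (2 * p) < (p powr \<sigma> - 1) * (72 * K * p\<^sup>2 * d') * (2 * p)"
      using p1 by (intro mult_strict_right_mono) auto
    also have "\<dots> = (144 * K * p ^ 3 * (p powr \<sigma> - 1)) * d'" by (simp add: power2_eq_square power3_eq_cube)
    also have "\<dots> \<le> c * d'" using \<sigma>(3) \<delta>d(2) by (intro mult_right_mono) auto
    finally show False using p1 by simp
  qed
qed

text \<open>\<open>F\<close> is the bound and \<open>H\<close> its strengthening by \<open>c\<close>
  times the deviation, for every lattice that \<open>A\<close> generates. Both are proved together:
  the lower bound of \<open>H\<close> for \<open>A\<close> uses \<open>F\<close> and
  \<open>H\<close> for subsets, and \<open>F\<close> follows from \<open>H\<close> once a generated
  lattice exists, which \<open>HGEN\<close> grants for large sets.\<close>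

lemma main_induction:
  fixes \<theta> \<xi> L c :: real
  assumes K: "1 \<le> K" and l: "0 < l" "l < 1" and p: "p = real a * real b" and l0: "l0 \<le> l" "l0 \<le> 1 - l" "0 < l0"
    and L: "3 * real a + 4 / (1 - l) * (5 * K * real a * real b + 1) \<le> L"
      "3 * real b + 4 / l * (5 * K * real b * real a + 1) \<le> L"
    and xi: "0 < \<xi>" "\<xi> \<le> (1 - l) / (8 * L\<^sup>2)" "\<xi> \<le> l / (8 * L\<^sup>2)" "\<xi> \<le> 1 / 4"
    and \<eta>: "\<eta> = 8 * p\<^sup>2 * \<xi>" "12 * p * \<eta> \<le> 1" "144 * K * p ^ 4 * \<eta> \<le> K * l0 / (2 * p)"
    and N: "(1 - \<xi>) ^ N * (real a * real b * (K + 1)) < 1"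
    and \<theta>: "0 < \<theta>" "\<theta> < (1 / (4 * real a * real b * K ^ 2)) ^ Suc N"
      "8 * real b * \<theta> < (1 - l) * \<xi> * (1 / (4 * real a * real b * K ^ 2)) ^ N"
      "8 * real a * \<theta> < l * \<xi> * (1 / (4 * real a * real b * K ^ 2)) ^ N"
    and c: "0 < c" "c \<le> K * l0 / (4 * p)" "c * p \<le> \<theta> / 2" "c * p \<le> 1"
    and \<sigma>: "0 < \<sigma>" "\<sigma> < 1" "144 * K * p ^ 3 * (p powr \<sigma> - 1) \<le> c" "\<sigma> \<le> \<kappa>"
      "((p ^ Suc N) powr \<sigma> - 1) * (K + 1) \<le> \<theta> / 2"
    and E0: "0 \<le> E0" and d0: "0 < d0" "2 * p\<^sup>2 * E0 \<le> d0"
    and large: "\<And>x. 1 \<le> x \<Longrightarrow> d0 * x powr (- \<sigma>) \<le> K + 1 \<Longrightarrow> n0 \<le> x \<and> p * (E0 * x powr (- \<kappa>)) \<le> \<theta>"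
    and HBM: "\<And>A. finite A \<Longrightarrow> A \<noteq> {} \<Longrightarrow> real (s A) \<le> (K + 1) * card A \<Longrightarrow> bm K l (E0 * real (card A) powr (- \<kappa>)) A"
    and HGEN: "\<And>A. finite A \<Longrightarrow> A \<noteq> {} \<Longrightarrow> n0 \<le> real (card A) \<Longrightarrow> real (s A) \<le> (K + 1) * card A \<Longrightarrow>
      \<exists>G. \<T> G \<and> in_coset G A \<and> gen f g G A \<and> gen g f G A"
    and A: "finite A"
  shows "K * real (card A) - d0 * real (card A) powr (1 - \<sigma>) \<le> real (s A)"
proof -
  define F where "F A \<longleftrightarrow> K * real (card A) - d0 * real (card A) powr (1 - \<sigma>) \<le> real (s A)" for A
  define dv where "dv G A C = \<bar>real (card C) * real (card (parts (D G) A)) - real (card A)\<bar>" for G A C :: "'g set"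
  define H where "H A \<longleftrightarrow> (\<forall>G C. \<T> G \<longrightarrow> in_coset G A \<longrightarrow> gen f g G A \<longrightarrow> gen g f G A \<longrightarrow> C \<in> parts (D G) A \<longrightarrow>
      K * real (card A) + c * dv G A C - d0 * real (card A) powr (1 - \<sigma>) \<le> real (s A))" for A
  have p1: "1 \<le> p" using mult_mono[of 1 "real a" 1 "real b"] ab_pos by (auto simp: p)
  have "F A \<and> H A" using A
  proof (induction "card A" arbitrary: A rule: less_induct)
    case (less A)
    show ?case
    proof (cases "A = {}")
      case True
      then show ?thesis by (simp add: F_def H_def parts_def)
    next
      case False
      note fA = \<open>finite A\<close>
      define n where "n = real (card A)"
      define \<Lambda> where "\<Lambda> = d0 * n powr (1 - \<sigma>)"
      have n1: "1 \<le> n" using fA False by (simp add: n_def Suc_le_eq card_gt_0_iff)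
      have IH: "F C" "H C" if "C \<subset> A" for C
        using less.hyps[of C] psubset_card_mono[OF fA that] finite_subset[of C A] that fA by auto
      have \<Lambda>: "\<Lambda> = d0 * n powr (- \<sigma>) * n" "0 \<le> \<Lambda>"
      proof -
        have "n powr (1 - \<sigma>) = n powr (- \<sigma>) * n" using n1 powr_add[of n "- \<sigma>" 1] by simp
        then show "\<Lambda> = d0 * n powr (- \<sigma>) * n" using n1 by (simp add: \<Lambda>_def)
        show "0 \<le> \<Lambda>" using d0 by (simp add: \<Lambda>_def)
      qed
      \<comment> \<open>A counterexample has a loss of at most (K + 1) n. By \<open>large\<close> it
        is then big enough for a generated lattice to exist and for the Brunn-Minkowski error to be
        negligible.\<close>
      have big: "n0 \<le> n \<and> p * (E0 * n powr (- \<kappa>)) \<le> \<theta>" if "\<Lambda> \<le> (K + 1) * n"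
        using that large[OF n1] n1 unfolding \<Lambda>(1) by (simp add: mult_le_cancel_right)
      have "H A" unfolding H_def
      proof (intro allI impI)
        fix G C assume G: "\<T> G" and cos: "in_coset G A" and gens: "gen f g G A" "gen g f G A" and C: "C \<in> parts (D G) A"
        have "parts (D G) A \<noteq> {}" using C by blast
        then obtain C0 where C0: "C0 \<in> parts (D G) A" "\<And>C. C \<in> parts (D G) A \<Longrightarrow> dv G A C \<le> dv G A C0"
          by (rule finite_obtain_max[OF finite_parts[OF fA], of "D G" "dv G A"]) blast
        have "K * n + c * dv G A C0 - \<Lambda> \<le> real (s A)"
        proof (rule ccontr)
          assume nv: "\<not> ?thesis"
          have dvp: "dv G A C0 \<le> p * n"
          proof -
            have "card (parts (D G) A) \<le> a * b" using card_parts_lev_le[OF G cos fA, of 1] by simp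
            then have "real (card (parts (D G) A)) \<le> real (a * b)" by (simp only: of_nat_le_iff)
            then have "real (card C0) * real (card (parts (D G) A)) \<le> n * p"
              using card_mono[OF fA parts_subset[OF C0(1)]] by (intro mult_mono) (auto simp: n_def p)
            moreover have "1 * n \<le> p * n" using p1 n1 by (intro mult_right_mono) auto
            moreover have "0 \<le> real (card C0) * real (card (parts (D G) A))" by simp
            ultimately show ?thesis unfolding dv_def n_def[symmetric] abs_le_iff mult.commute[of p n] mult_1 using n1 by linarith
          qed
          have sA: "real (s A) \<le> K * n + (c * p) * n - \<Lambda>"
          proof -
            have "c * dv G A C0 \<le> c * (p * n)" using dvp c(1) by (intro mult_left_mono) auto
            then show ?thesis using nv unfolding mult.assoc by linarith
          qed
          have cpn: "(c * p) * n \<le> 1 * n" "(c * p) * n \<le> \<theta> / 2 * n" using c n1 by (intro mult_right_mono; simp)+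
          have sA1: "real (s A) \<le> (K + 1) * card A" using sA cpn(1) \<Lambda>(2) unfolding n_def distrib_right by linarith
          have \<Lambda>n: "\<Lambda> \<le> (K + 1) * n" using sA cpn(1) unfolding distrib_right by linarith
          define e where "e = E0 * n powr (- \<kappa>)"
          have e: "0 \<le> e" "p * e \<le> \<theta>" using big[OF \<Lambda>n] E0 by (auto simp: e_def)
          have BM: "bm K l e A" using HBM[OF fA False sA1] by (simp add: e_def n_def)
          have w: "(((real a * real b) ^ Suc k) powr \<sigma> - 1) * (d0 * real (card A) powr (1 - \<sigma>)) + (c * p) * real (card A) \<le> \<theta> * real (card A)"
            if k: "k \<le> N" for k
          proof -
            have "(p ^ Suc k) powr \<sigma> \<le> (p ^ Suc N) powr \<sigma>"
              using k p1 \<sigma>(1) by (intro powr_mono2 power_increasing) auto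
            then have "((p ^ Suc k) powr \<sigma> - 1) * \<Lambda> \<le> ((p ^ Suc N) powr \<sigma> - 1) * \<Lambda>" using \<Lambda>(2) by (intro mult_right_mono) auto
            also have "\<dots> \<le> ((p ^ Suc N) powr \<sigma> - 1) * ((K + 1) * n)"
            proof (rule mult_left_mono[OF \<Lambda>n])
              have "1 \<le> p ^ Suc N" using p1 by (rule one_le_power)
              then show "0 \<le> (p ^ Suc N) powr \<sigma> - 1" using \<sigma>(1) by (simp add: ge_one_powr_ge_zero)
            qed
            also have "\<dots> \<le> \<theta> / 2 * n" using mult_right_mono[OF \<sigma>(5), of n] n1 by (simp add: mult.assoc)
            finally have "((p ^ Suc k) powr \<sigma> - 1) * \<Lambda> \<le> \<theta> / 2 * n" .
            then have "((p ^ Suc k) powr \<sigma> - 1) * \<Lambda> + (c * p) * n \<le> \<theta> * n" using cpn(2) by linarith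
            then show ?thesis by (simp only: \<Lambda>_def n_def p)
          qed
          note ce = cell_excess[OF G cos fA False \<sigma>(1,2) less_imp_le[OF d0(1)] order_trans[OF zero_le_one K] less_imp_le[OF \<theta>(1)]
              IH(1)[unfolded F_def] sA[unfolded \<Lambda>_def n_def] w]
          interpret v: violator2 f g \<T> a b A G K \<theta> N l \<xi> L e
          proof (unfold_locales)
            fix k R x y assume h: "k \<le> N" "R \<in> parts (lv G k) A" "x \<in> R"
            show "real (card (lsum f g (part (T1 (lv G k)) R x) (part (T2 (lv G k)) R x)))
                \<le> real (card (lsum f g (part (D (lv G k)) R x) (part (D (lv G k)) R x))) + \<theta> * real (card A)"
              using ce(2)[OF _ h(1,2,3,3)] by simp
            assume y: "y \<in> R"
            show "real (card (lsum f g (part (T1 (lv G k)) R x) (part (T2 (lv G k)) R y)))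
                \<le> K * real (card (part (T1 (lv G k)) R x \<inter> part (T2 (lv G k)) R y)) + \<theta> * real (card A)"
              using ce(1)[OF _ h y] by simp
          next
            have "4 * real b * (p * e) \<le> 4 * real b * \<theta>" "4 * real a * (p * e) \<le> 4 * real a * \<theta>"
              using e by (intro mult_left_mono; simp)+
            then show "4 * real b * (\<theta> + real a * real b * e) < (1 - l) * \<xi> * (1 / (4 * real a * real b * K\<^sup>2)) ^ N"
              "4 * real a * (\<theta> + real a * real b * e) < l * \<xi> * (1 / (4 * real a * real b * K\<^sup>2)) ^ N"
              using \<theta>(3,4) unfolding p distrib_left by linarith+
          qed (use G cos fA False gens K \<theta> l L xi BM e sA1 N in simp_all)
          have nice: "nice \<eta> G A" using v.violator_nice by (simp add: \<eta>(1) p)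
          have "K * real (card A) + c * \<bar>real (card C0) * real (card (parts (D G) A)) - real (card A)\<bar>
              - d0 * real (card A) powr (1 - \<sigma>) \<le> real (s A)"
          proof (rule nice_step[OF G cos fA False gens nice K l BM e(1) p l0 _ \<eta>(2,3) c(1,2) \<sigma>(1-3) d0(1) _ _ _ C0(1)])
            show "0 \<le> \<eta>" using xi(1) by (simp add: \<eta>(1))
            have "n powr (- \<kappa>) \<le> n powr (- \<sigma>)" using n1 \<sigma>(4) by (intro powr_mono) auto
            then have "p\<^sup>2 * E0 * n powr (- \<kappa>) * n \<le> d0 / 2 * n powr (- \<sigma>) * n"
              using d0 E0 n1 by (intro mult_right_mono mult_mono) auto
            then have "p\<^sup>2 * e * n \<le> \<Lambda> / 2" unfolding \<Lambda>(1) by (simp add: e_def mult.assoc)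
            then show "p\<^sup>2 * e * card A \<le> d0 * real (card A) powr (1 - \<sigma>) / 2" by (simp only: \<Lambda>_def n_def)
            show "K * real (card C) - d0 * real (card C) powr (1 - \<sigma>) \<le> real (s C)" if "C \<subset> A" for C
              using IH(1)[OF that] unfolding F_def .
            show "K * real (card C) + c * \<bar>real (card E) * real (card (parts (D (D G)) C)) - real (card C)\<bar>
                - d0 * real (card C) powr (1 - \<sigma>) \<le> real (s C)"
              if "C \<in> parts (D G) A" "C \<subset> A" "gen f g (D G) C" "gen g f (D G) C" "E \<in> parts (D (D G)) C" for C E
              using IH(2)[OF that(2), unfolded H_def, rule_format, OF TD[OF G] parts_in_coset[OF sub_T(3)[OF G] that(1)] that(3-5)]
              unfolding dv_def .
            show "\<bar>real (card C) * real (card (parts (D G) A)) - real (card A)\<bar>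
                \<le> \<bar>real (card C0) * real (card (parts (D G) A)) - real (card A)\<bar>" if "C \<in> parts (D G) A" for C
              using C0(2)[OF that] unfolding dv_def .
          qed
          then show False using nv unfolding dv_def n_def \<Lambda>_def by simp
        qed
        moreover have "c * dv G A C \<le> c * dv G A C0" using C0(2)[OF C] c(1) by (intro mult_left_mono) auto
        ultimately show "K * real (card A) + c * dv G A C - d0 * real (card A) powr (1 - \<sigma>) \<le> real (s A)"
          unfolding n_def \<Lambda>_def by linarith
      qed
      moreover have "F A"
      proof (rule ccontr)
        assume nF: "\<not> F A"
        then have sA: "real (s A) < K * n - \<Lambda>" by (simp add: F_def n_def \<Lambda>_def)
        then have "\<Lambda> \<le> (K + 1) * n" "real (s A) \<le> (K + 1) * card A" using \<Lambda>(2) n1 unfolding n_def distrib_right by linarith+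
        then obtain G where G: "\<T> G" "in_coset G A" "gen f g G A" "gen g f G A"
          using HGEN[OF fA False] big unfolding n_def by blast
        obtain x where "x \<in> A" using False by blast
        then have C: "part (D G) A x \<in> parts (D G) A" by (rule part_in_parts)
        have "K * real (card A) + c * dv G A (part (D G) A x) - d0 * real (card A) powr (1 - \<sigma>) \<le> real (s A)"
          using \<open>H A\<close>[unfolded H_def, rule_format, OF G C] .
        moreover have "0 \<le> c * dv G A (part (D G) A x)" using c(1) by (simp add: dv_def)
        ultimately show False using nF unfolding F_def by linarith
      qed
      ultimately show ?thesis by blast
    qed
  qed
  then show ?thesis by (simp add: F_def)
qed

end

section \<open>Choice of the constants\<close>

lemma exists_small_powr:
  fixes x \<epsilon> :: real
  assumes "1 \<le> x" "0 < \<epsilon>"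
  obtains \<tau> where "0 < \<tau>" "\<And>\<sigma>. 0 \<le> \<sigma> \<Longrightarrow> \<sigma> \<le> \<tau> \<Longrightarrow> x powr \<sigma> - 1 \<le> \<epsilon>"
proof -
  define \<tau> where "\<tau> = ln (1 + \<epsilon>) / (ln x + 1)"
  have l: "0 \<le> ln x" "0 < ln (1 + \<epsilon>)" using assms by (auto simp: ln_gt_zero)
  then have t0: "0 < \<tau>" by (simp add: \<tau>_def)
  have "x powr \<sigma> - 1 \<le> \<epsilon>" if "0 \<le> \<sigma>" "\<sigma> \<le> \<tau>" for \<sigma>
  proof -
    have "\<sigma> * ln x \<le> \<tau> * (ln x + 1)" using that l by (intro mult_mono) auto
    also have "\<dots> = ln (1 + \<epsilon>)" using l by (simp add: \<tau>_def)
    finally have "exp (\<sigma> * ln x) \<le> exp (ln (1 + \<epsilon>))" by simp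
    then show ?thesis using assms by (simp add: powr_def)
  qed
  then show ?thesis using t0 that by blast
qed

text \<open>For a set of size below \<open>M\<close> the loss exceeds (K + 1) times the size, so
  only larger sets can be counterexamples.\<close>

lemma large_of_small_power:
  fixes M \<sigma> K x d0 :: real
  assumes M: "1 \<le> M" and \<sigma>: "0 < \<sigma>" and K: "0 \<le> K" and x: "1 \<le> x" and d0: "(K + 1) * M powr \<sigma> < d0" and h: "d0 * x powr (- \<sigma>) \<le> K + 1"
  shows "M \<le> x"
proof (rule ccontr)
  assume "\<not> M \<le> x"
  then have "x powr \<sigma> \<le> M powr \<sigma>" using x \<sigma> by (intro powr_mono2) auto
  then have "(K + 1) * x powr \<sigma> \<le> (K + 1) * M powr \<sigma>" using K by (intro mult_left_mono) auto
  then have "(K + 1) * x powr \<sigma> < d0" using d0 by linarith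
  moreover have "d0 \<le> (K + 1) * x powr \<sigma>" using h x by (simp add: powr_minus field_simps)
  ultimately show False by linarith
qed

text \<open>The constants are fixed before \<open>f\<close>, \<open>g\<close> and
  \<open>\<T>\<close>. This order of quantifiers makes them depend only on the dimension and the
  determinants in the end.\<close>

theorem uniform_bound:
  fixes K l \<kappa> E0 n0 :: real and a b :: nat
  assumes ab: "0 < a" "0 < b" and K: "1 \<le> K" and l: "0 < l" "l < 1" and \<kappa>: "0 < \<kappa>" and E0: "0 \<le> E0"
  shows "\<exists>d0 \<sigma>. 0 < d0 \<and> 0 < \<sigma> \<and> (\<forall>(f :: 'g::ab_group_add \<Rightarrow> 'g) g \<T>. tight_pair f g \<T> a b \<longrightarrow>
     (\<forall>A. finite A \<longrightarrow> A \<noteq> {} \<longrightarrow> real (card (lsum f g A A)) \<le> (K + 1) * card A \<longrightarrow>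
        tight_pair.bm f g a b K l (E0 * real (card A) powr (- \<kappa>)) A \<and>
        (n0 \<le> real (card A) \<longrightarrow> (\<exists>G. \<T> G \<and> in_coset G A \<and> gen f g G A \<and> gen g f G A))) \<longrightarrow>
     (\<forall>A. finite A \<longrightarrow> K * real (card A) - d0 * real (card A) powr (1 - \<sigma>) \<le> real (card (lsum f g A A))))"
proof -
  define p where "p = real a * real b"
  define l0 where "l0 = min l (1 - l)"
  define L where "L = max (3 * real a + 4 / (1 - l) * (5 * K * real a * real b + 1)) (3 * real b + 4 / l * (5 * K * real b * real a + 1))"
  \<comment> \<open>The last two entries are the conditions 12 p \<eta> \<le> 1 and 144 K p^4 \<eta>
    \<le> K l0 / (2 p), solved for \<xi> with \<eta> = 8 p^2 \<xi>.\<close>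
  define \<xi> where "\<xi> = Min {(1 - l) / (8 * L\<^sup>2), l / (8 * L\<^sup>2), 1 / 4, 1 / (96 * p ^ 3), l0 / (2304 * p ^ 7)}"
  have ab1: "1 \<le> real a" "1 \<le> real b" using ab by auto
  then have p1: "1 \<le> p" using mult_mono[of 1 "real a" 1 "real b"] by (simp add: p_def)
  have l0: "l0 \<le> l" "l0 \<le> 1 - l" "0 < l0" using l by (auto simp: l0_def)
  have L1: "0 < L"
  proof -
    have "0 \<le> 4 / (1 - l) * (5 * K * real a * real b + 1)" using l K by simp
    then have "0 < 3 * real a + 4 / (1 - l) * (5 * K * real a * real b + 1)" using ab1 by linarith
    then show ?thesis unfolding L_def by (rule less_max_iff_disj[THEN iffD2, OF disjI1])
  qed
  have \<xi>: "0 < \<xi>" "\<xi> \<le> (1 - l) / (8 * L\<^sup>2)" "\<xi> \<le> l / (8 * L\<^sup>2)" "\<xi> \<le> 1 / 4" "\<xi> \<le> 1 / (96 * p ^ 3)" "\<xi> \<le> l0 / (2304 * p ^ 7)"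
    unfolding \<xi>_def using L1 l l0 p1 by (auto simp: Min_gr_iff intro!: Min_le)
  define \<eta> where "\<eta> = 8 * p\<^sup>2 * \<xi>"
  have \<eta>: "12 * p * \<eta> \<le> 1" "144 * K * p ^ 4 * \<eta> \<le> K * l0 / (2 * p)"
  proof -
    have "12 * p * \<eta> = 96 * p ^ 3 * \<xi>" by (simp add: \<eta>_def power2_eq_square power3_eq_cube)
    also have "\<dots> \<le> 96 * p ^ 3 * (1 / (96 * p ^ 3))" using \<xi>(5) p1 by (intro mult_left_mono) auto
    finally show "12 * p * \<eta> \<le> 1" using p1 by simp
    have "144 * K * p ^ 4 * \<eta> = 1152 * K * p ^ 6 * \<xi>" by (simp add: \<eta>_def flip: power_add)
    also have "\<dots> \<le> 1152 * K * p ^ 6 * (l0 / (2304 * p ^ 7))" using \<xi>(6) p1 K by (intro mult_left_mono) auto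
    also have "\<dots> = K * l0 / (2 * p)" using p1 by (simp add: field_simps power_numeral_reduce)
    finally show "144 * K * p ^ 4 * \<eta> \<le> K * l0 / (2 * p)" .
  qed
  have X0: "0 < real a * real b * (K + 1)" using ab1 K by simp
  then obtain N where "(1 - \<xi>) ^ N < 1 / (real a * real b * (K + 1))"
    using real_arch_pow_inv[of "1 / (real a * real b * (K + 1))" "1 - \<xi>"] \<xi>(1) by auto
  then have N: "(1 - \<xi>) ^ N * (real a * real b * (K + 1)) < 1" using X0 by (simp add: pos_less_divide_eq)
  define \<rho> where "\<rho> = 1 / (4 * real a * real b * K ^ 2)"
  have \<rho>0: "0 < \<rho>" using ab1 K by (simp add: \<rho>_def)
  \<comment> \<open>Halving the minimum makes the inequalities strict. The factor 8, where
    \<open>violator2\<close> has 4, leaves room for a Brunn-Minkowski error as large as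
    \<theta>.\<close>
  define \<theta> where "\<theta> = Min {\<rho> ^ Suc N, (1 - l) * \<xi> * \<rho> ^ N / (8 * real b), l * \<xi> * \<rho> ^ N / (8 * real a)} / 2"
  have \<theta>': "0 < 2 * \<theta>" "2 * \<theta> \<le> \<rho> ^ Suc N" "2 * \<theta> \<le> (1 - l) * \<xi> * \<rho> ^ N / (8 * real b)" "2 * \<theta> \<le> l * \<xi> * \<rho> ^ N / (8 * real a)"
    unfolding \<theta>_def using \<rho>0 \<xi>(1) l ab1 by (auto simp del: power_Suc simp: Min_gr_iff intro!: Min_le)
  have \<theta>: "0 < \<theta>" "\<theta> < \<rho> ^ Suc N" "8 * real b * \<theta> < (1 - l) * \<xi> * \<rho> ^ N" "8 * real a * \<theta> < l * \<xi> * \<rho> ^ N"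
  proof -
    show t0: "0 < \<theta>" "\<theta> < \<rho> ^ Suc N" using \<theta>'(1,2) by linarith+
    have "\<theta> < (1 - l) * \<xi> * \<rho> ^ N / (8 * real b)" "\<theta> < l * \<xi> * \<rho> ^ N / (8 * real a)" using t0 \<theta>'(3,4) by linarith+
    then show "8 * real b * \<theta> < (1 - l) * \<xi> * \<rho> ^ N" "8 * real a * \<theta> < l * \<xi> * \<rho> ^ N"
      using ab1 by (simp_all add: pos_less_divide_eq mult_ac)
  qed
  define c where "c = Min {K * l0 / (4 * p), \<theta> / 2 / p, 1 / p}"
  have c': "0 < c" "c \<le> K * l0 / (4 * p)" "c \<le> \<theta> / 2 / p" "c \<le> 1 / p"
    unfolding c_def using K l0 p1 \<theta>(1) by (auto simp: Min_gr_iff intro!: Min_le)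
  have c: "c * p \<le> \<theta> / 2" "c * p \<le> 1" using c'(3,4) p1 by (simp_all add: pos_le_divide_eq)
  have e1: "0 < c / (144 * K * p ^ 3)" "0 < \<theta> / 2 / (K + 1)" using c' K p1 \<theta> by auto
  obtain \<tau>1 where t1: "0 < \<tau>1" "\<And>\<sigma>. 0 \<le> \<sigma> \<Longrightarrow> \<sigma> \<le> \<tau>1 \<Longrightarrow> p powr \<sigma> - 1 \<le> c / (144 * K * p ^ 3)"
    using exists_small_powr[OF p1 e1(1)] by blast
  have pN: "1 \<le> p ^ Suc N" using p1 by (rule one_le_power)
  obtain \<tau>2 where t2: "0 < \<tau>2" "\<And>\<sigma>. 0 \<le> \<sigma> \<Longrightarrow> \<sigma> \<le> \<tau>2 \<Longrightarrow> (p ^ Suc N) powr \<sigma> - 1 \<le> \<theta> / 2 / (K + 1)"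
    using exists_small_powr[OF pN e1(2)] by blast
  define \<sigma> where "\<sigma> = Min {\<tau>1, \<tau>2, \<kappa>, 1 / 2}"
  have \<sigma>': "0 < \<sigma>" "\<sigma> \<le> \<tau>1" "\<sigma> \<le> \<tau>2" "\<sigma> \<le> \<kappa>" "\<sigma> \<le> 1 / 2"
    unfolding \<sigma>_def using t1 t2 \<kappa> by (auto simp: Min_gr_iff intro!: Min_le)
  have \<sigma>: "\<sigma> < 1" "144 * K * p ^ 3 * (p powr \<sigma> - 1) \<le> c" "((p ^ Suc N) powr \<sigma> - 1) * (K + 1) \<le> \<theta> / 2"
  proof -
    show "\<sigma> < 1" using \<sigma>'(5) by simp
    have k0: "0 < 144 * K * p ^ 3" "0 < K + 1" using K p1 by auto
    show "144 * K * p ^ 3 * (p powr \<sigma> - 1) \<le> c"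
      using t1(2)[OF less_imp_le[OF \<sigma>'(1)] \<sigma>'(2)] unfolding pos_le_divide_eq[OF k0(1)] by (simp add: mult.commute)
    show "((p ^ Suc N) powr \<sigma> - 1) * (K + 1) \<le> \<theta> / 2"
      using t2(2)[OF less_imp_le[OF \<sigma>'(1)] \<sigma>'(3)] unfolding pos_le_divide_eq[OF k0(2)] .
  qed
  define M where "M = Max {1, n0, (p * E0 / \<theta>) powr (1 / \<kappa>)}"
  have M: "1 \<le> M" "n0 \<le> M" "(p * E0 / \<theta>) powr (1 / \<kappa>) \<le> M" unfolding M_def by (auto intro!: Max_ge)
  \<comment> \<open>The first term lifts counterexamples above the threshold \<open>M\<close>; the
    second lets half of the loss cover the Brunn-Minkowski error in
    \<open>nice_step\<close>.\<close>
  define d0 where "d0 = (K + 1) * M powr \<sigma> + 2 * p\<^sup>2 * E0 + 1"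
  have d0: "0 < d0" "2 * p\<^sup>2 * E0 \<le> d0" "(K + 1) * M powr \<sigma> < d0"
  proof -
    have "0 \<le> (K + 1) * M powr \<sigma>" "0 \<le> 2 * p\<^sup>2 * E0" using K E0 by auto
    then show "0 < d0" "2 * p\<^sup>2 * E0 \<le> d0" "(K + 1) * M powr \<sigma> < d0" unfolding d0_def by linarith+
  qed
  have large: "n0 \<le> x \<and> p * (E0 * x powr (- \<kappa>)) \<le> \<theta>" if x: "1 \<le> x" "d0 * x powr (- \<sigma>) \<le> K + 1" for x
  proof -
    have Mx: "M \<le> x" by (rule large_of_small_power[OF M(1) \<sigma>'(1) _ x(1) d0(3) x(2)]) (use K in simp)
    define q where "q = p * E0 / \<theta>"
    have q0: "0 \<le> q" using p1 E0 \<theta>(1) by (simp add: q_def)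
    have "q = (q powr (1 / \<kappa>)) powr \<kappa>" using q0 \<kappa> by (simp add: powr_powr)
    also have "\<dots> \<le> x powr \<kappa>" using M(3) Mx \<kappa> by (intro powr_mono2) (auto simp: q_def)
    finally have "p * E0 / \<theta> \<le> x powr \<kappa>" unfolding q_def .
    then have "p * E0 \<le> x powr \<kappa> * \<theta>" using \<theta>(1) by (simp add: pos_divide_le_eq)
    then have "p * (E0 * x powr (- \<kappa>)) \<le> \<theta>" using x(1) by (simp add: powr_minus field_simps)
    then show ?thesis using M(2) Mx by simp
  qed
  show ?thesis
  proof (rule exI[of _ d0], rule exI[of _ \<sigma>], intro conjI allI impI)
    fix f g :: "'g \<Rightarrow> 'g" and \<T> and A :: "'g set"
    assume tp: "tight_pair f g \<T> a b" and fA: "finite A"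
      and hyp: "\<forall>A. finite A \<longrightarrow> A \<noteq> {} \<longrightarrow> real (card (lsum f g A A)) \<le> (K + 1) * card A \<longrightarrow>
        tight_pair.bm f g a b K l (E0 * real (card A) powr (- \<kappa>)) A \<and>
        (n0 \<le> real (card A) \<longrightarrow> (\<exists>G. \<T> G \<and> in_coset G A \<and> gen f g G A \<and> gen g f G A))"
    show "K * real (card A) - d0 * real (card A) powr (1 - \<sigma>) \<le> real (card (lsum f g A A))"
      by (rule tight_pair.main_induction[OF tp K l p_def l0 _ _ \<xi>(1-4) \<eta>_def \<eta> N \<theta>(1,2,3,4)[unfolded \<rho>_def] c'(1,2) c
            \<sigma>'(1) \<sigma>(1,2) \<sigma>'(4) \<sigma>(3) E0 d0(1,2) large _ _ fA])
        (use hyp in \<open>auto simp: L_def\<close>)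
  qed (use d0 \<sigma>' in auto)
qed

section \<open>Generated lattices and the Brunn-Minkowski error for integer matrices\<close>

lemma subgrp_smult:
  fixes G :: "(int^'n) set"
  assumes G: "subgrp G" and z: "z \<in> G"
  shows "n *s z \<in> G"
proof (induction n rule: int_induct[of _ 0])
  case base
  then show ?case using subgrp_zero[OF G] by simp
next
  case (step1 i)
  have "(i + 1) *s z = i *s z + z" by (simp add: vec_eq_iff algebra_simps)
  then show ?case using subgrp_add[OF G step1.IH z] by simp
next
  case (step2 i)
  have "(i - 1) *s z = i *s z - z" by (simp add: vec_eq_iff algebra_simps)
  then show ?case using subgrp_diff[OF G step2.IH z] by simp
qed

lemma subgrp_sum: "subgrp G \<Longrightarrow> (\<And>i. i \<in> I \<Longrightarrow> z i \<in> G) \<Longrightarrow> sum z I \<in> G"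
  by (induction I rule: infinite_finite_induct) (auto simp: subgrp_zero subgrp_add)

text \<open>The multiplier depends on \<open>A\<close> alone. The rational vectors with a positive
  multiple that lies in all these \<open>G\<close> at once form a subspace containing the
  differences from \<open>x0\<close>, so they are everything; the multipliers of the coordinate
  vectors are then multiplied together.\<close>

lemma multiple_in_of_span:
  fixes A :: "(int^'n) set"
  assumes x0: "x0 \<in> A" and sp: "vec.span ((\<lambda>x. rv (x - x0)) ` A) = UNIV"
  obtains c :: int where "0 < c" "\<And>G x. subgrp G \<Longrightarrow> in_coset G A \<Longrightarrow> c *s x \<in> G"
proof -
  define S where "S = {x. \<exists>c::int. 0 < c \<and> (\<forall>G. subgrp G \<longrightarrow> in_coset G A \<longrightarrow> (\<exists>z\<in>G. of_int c *s x = rv z))}"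
  have "vec.subspace S"
  proof (rule vec.subspaceI)
    show "0 \<in> S" unfolding S_def by (auto intro!: exI[of _ 1] bexI[of _ 0] simp: subgrp_zero)
    fix x y assume "x \<in> S" "y \<in> S"
    then obtain c c' where c: "0 < c" "\<And>G. subgrp G \<Longrightarrow> in_coset G A \<Longrightarrow> \<exists>z\<in>G. of_int c *s x = rv z"
      and c': "0 < c'" "\<And>G. subgrp G \<Longrightarrow> in_coset G A \<Longrightarrow> \<exists>z\<in>G. of_int c' *s y = rv z"
      unfolding S_def by blast
    have "\<exists>z\<in>G. of_int (c * c') *s (x + y) = rv z" if G: "subgrp G" "in_coset G A" for G
    proof -
      obtain z z' where z: "z \<in> G" "of_int c *s x = rv z" "z' \<in> G" "of_int c' *s y = rv z'" using c(2)[OF G] c'(2)[OF G] by blast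
      have "of_int (c * c') *s (x + y) = of_int c' *s (of_int c *s x) + of_int c *s (of_int c' *s y)"
        by (simp add: vec_eq_iff algebra_simps)
      also have "\<dots> = rv (c' *s z + c *s z')" unfolding z(2,4) by (simp add: rv_add rv_smult)
      finally show ?thesis using subgrp_add[OF G(1) subgrp_smult[OF G(1) z(1)] subgrp_smult[OF G(1) z(3)]] by blast
    qed
    then show "x + y \<in> S" unfolding S_def using c(1) c'(1) by (auto intro!: exI[of _ "c * c'"])
  next
    fix q :: rat and x assume "x \<in> S"
    then obtain c where c: "0 < c" "\<And>G. subgrp G \<Longrightarrow> in_coset G A \<Longrightarrow> \<exists>z\<in>G. of_int c *s x = rv z"
      unfolding S_def by blast
    obtain m n where mn: "q = Fract m n" "0 < n" by (cases q) auto
    have nq: "of_int n * q = of_int m" using mn by (simp add: Fract_of_int_quotient)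
    have "\<exists>z\<in>G. of_int (c * n) *s (q *s x) = rv z" if G: "subgrp G" "in_coset G A" for G
    proof -
      obtain z where z: "z \<in> G" "of_int c *s x = rv z" using c(2)[OF G] by blast
      have "of_int (c * n) *s (q *s x) = (of_int n * q) *s (of_int c *s x)" by (simp add: vec_eq_iff algebra_simps)
      also have "\<dots> = rv (m *s z)" unfolding z(2) nq by (simp add: rv_smult)
      finally show ?thesis using subgrp_smult[OF G(1) z(1)] by blast
    qed
    then show "q *s x \<in> S" unfolding S_def using c(1) mn(2) by (auto intro!: exI[of _ "c * n"])
  qed
  moreover have "(\<lambda>x. rv (x - x0)) ` A \<subseteq> S"
  proof
    fix y assume "y \<in> (\<lambda>x. rv (x - x0)) ` A"
    then obtain x where x: "x \<in> A" "y = rv (x - x0)" by blast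
    have "\<exists>z\<in>G. of_int 1 *s y = rv z" if "in_coset G A" for G
      using that x x0 by (auto simp: in_coset_def)
    then show "y \<in> S" unfolding S_def by (auto intro!: exI[of _ 1])
  qed
  ultimately have S: "S = UNIV" using vec.span_minimal[of "(\<lambda>x. rv (x - x0)) ` A" S] sp by blast
  have "\<exists>c::int. 0 < c \<and> (\<forall>G. subgrp G \<longrightarrow> in_coset G A \<longrightarrow> c *s axis i 1 \<in> G)" for i
  proof -
    have "rv (axis i 1) \<in> S" using S by blast
    then obtain c where c: "0 < c" "\<And>G. subgrp G \<Longrightarrow> in_coset G A \<Longrightarrow> \<exists>z\<in>G. of_int c *s rv (axis i 1) = rv z"
      unfolding S_def by blast
    have "c *s axis i 1 \<in> G" if "subgrp G" "in_coset G A" for G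
      using c(2)[OF that] by (auto simp flip: rv_smult)
    then show ?thesis using c(1) by blast
  qed
  then obtain c where c: "\<And>i. 0 < c i" "\<And>i G. subgrp G \<Longrightarrow> in_coset G A \<Longrightarrow> c i *s axis i 1 \<in> G" by metis
  show ?thesis
  proof (rule that[of "\<Prod>i\<in>UNIV. c i"])
    show "0 < (\<Prod>i\<in>UNIV. c i)" using c(1) by (intro prod_pos) auto
    fix G and x :: "int^'n" assume G: "subgrp G" "in_coset G A"
    have "(\<Sum>i\<in>UNIV. (x $ i * (\<Prod>j\<in>UNIV - {i}. c j)) *s (c i *s axis i 1)) \<in> G"
      by (intro subgrp_sum subgrp_smult c(2) G)
    moreover have "(\<Sum>i\<in>UNIV. (x $ i * (\<Prod>j\<in>UNIV - {i}. c j)) *s (c i *s axis i 1)) = (\<Prod>i\<in>UNIV. c i) *s x"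
    proof (subst vec_eq_iff, rule allI)
      fix k
      have "(\<Sum>i\<in>UNIV. (x $ i * (\<Prod>j\<in>UNIV - {i}. c j)) *s (c i *s axis i 1)) $ k
          = (\<Sum>i\<in>UNIV. if i = k then x $ k * (\<Prod>j\<in>UNIV - {k}. c j) * c k else 0)"
        unfolding sum_component by (intro sum.cong) (auto simp: axis_def)
      also have "\<dots> = x $ k * ((\<Prod>j\<in>UNIV - {k}. c j) * c k)" by (simp add: mult.assoc)
      also have "(\<Prod>j\<in>UNIV - {k}. c j) * c k = (\<Prod>i\<in>UNIV. c i)" by (simp add: prod.remove[of UNIV k] mult.commute)
      finally show "(\<Sum>i\<in>UNIV. (x $ i * (\<Prod>j\<in>UNIV - {i}. c j)) *s (c i *s axis i 1)) $ k = ((\<Prod>i\<in>UNIV. c i) *s x) $ k"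
        by (simp add: mult.commute)
    qed
    ultimately show "(\<Prod>i\<in>UNIV. c i) *s x \<in> G" by simp
  qed
qed

lemma lin_sumset_lsum: "lin_sumset L1 L2 A = lsum ((*v) L1) ((*v) L2) A A"
  by (auto simp: lin_sumset_def lsum_def)

lemma lsum_plus: "lsum f g V U = f ` V + g ` U"
  by (auto simp: lsum_def set_plus_def)

lemma affine_growth:
  fixes L1 L2 :: "int^'n^'n"
  assumes irr: "irreducible_pair L1 L2" and det: "det L1 \<noteq> 0"
    and A: "finite A" "x0 \<in> A" "vec.span ((\<lambda>x. rv (x - x0)) ` A) \<noteq> UNIV"
  shows "real (card A) powr (1 + (1 / 4) ^ CARD('n)) \<le> real (card (lin_sumset L1 L2 A))"
proof -
  let ?U = "vec.span ((\<lambda>x. rv (x - x0)) ` A)"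
  have "rv (x - y) \<in> ?U" if "x \<in> A" "y \<in> A" for x y
  proof -
    have "rv (x - y) = rv (x - x0) - rv (y - x0)" by (simp flip: rv_diff)
    moreover have "rv (x - x0) \<in> ?U" "rv (y - x0) \<in> ?U" using that by (auto intro: vec.span_base)
    ultimately show ?thesis using vec.span_diff by metis
  qed
  then have "in_coset {z. rv z \<in> ?U} A" by (simp add: in_coset_def)
  then have "real (card A) powr (1 + (1 / 4) ^ vec.dim ?U) \<le> real (card (lin_sumset L1 L2 A))"
    by (intro subspace_growth[OF irr det vec.subspace_span A(3,1)])
  moreover have "real (card A) powr (1 + (1 / 4) ^ CARD('n)) \<le> real (card A) powr (1 + (1 / 4) ^ vec.dim ?U)"
  proof (rule powr_mono)
    have "vec.dim ?U \<le> CARD('n)" using vec.dim_subset_UNIV[of ?U] by (simp add: vec.dimension_def card_cart_basis)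
    then show "1 + (1 / 4) ^ CARD('n) \<le> (1::real) + (1 / 4) ^ vec.dim ?U" by (intro add_left_mono power_decreasing) auto
    show "1 \<le> real (card A)" using A(1,2) by (auto simp: Suc_le_eq card_gt_0_iff)
  qed
  ultimately show ?thesis by linarith
qed

text \<open>Above the size \<open>large\<close> a set with sumset at most \<open>C\<close> times its
  size cannot lie in a proper affine subspace, by \<open>affine_growth\<close>. So its differences
  span, which bounds the index of the lattices around it and lets \<open>exists_gen\<close> pick a
  minimal one.\<close>

lemma exists_minimal_tight:
  fixes L1 L2 :: "int^'n^'n" and C :: real
  assumes irr: "irreducible_pair L1 L2" and cop: "coprime_pair L1 L2" and det: "det L1 \<noteq> 0"
    and A: "finite A" "A \<noteq> {}" and C: "0 < C" "real (card (lin_sumset L1 L2 A)) \<le> C * card A"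
    and large: "C powr (4 ^ CARD('n)) < card A"
  shows "\<exists>G. tight ((*v) L1) ((*v) L2) G \<and> in_coset G A \<and>
    (\<forall>M. tight ((*v) L1) ((*v) L2) M \<longrightarrow> M \<subseteq> G \<longrightarrow> in_coset M A \<longrightarrow> M = G)"
proof -
  obtain x0 where x0: "x0 \<in> A" using A(2) by blast
  have n0: "0 < real (card A)" using A by (simp add: card_gt_0_iff)
  have "vec.span ((\<lambda>x. rv (x - x0)) ` A) = UNIV"
  proof (rule ccontr)
    assume "\<not> ?thesis"
    then have "real (card A) powr (1 + (1 / 4) ^ CARD('n)) \<le> C * card A"
      using affine_growth[OF irr det A(1) x0] C(2) by simp
    then have "real (card A) powr ((1 / 4) ^ CARD('n)) \<le> C" using n0 by (simp add: powr_add mult.commute)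
    then have "(real (card A) powr ((1 / 4) ^ CARD('n))) powr (4 ^ CARD('n)) \<le> C powr (4 ^ CARD('n))"
      by (intro powr_mono2) auto
    moreover have "(real (card A) powr ((1 / 4) ^ CARD('n))) powr (4 ^ CARD('n)) = card A"
      using n0 by (simp add: powr_powr flip: power_mult_distrib)
    ultimately show False using large by simp
  qed
  from multiple_in_of_span[OF x0 this] obtain c where c: "0 < c" "\<And>G x. subgrp G \<Longrightarrow> in_coset G A \<Longrightarrow> c *s x \<in> G" by blast
  show ?thesis by (rule exists_gen[OF cop det refl refl c]) blast+
qed

text \<open>A maximal independent subset of the rational differences, enumerated in any order;
  rational independence yields the triangular integral form used for \<open>lat\<close>.\<close>

lemma spanning_directions:
  fixes Y0 :: "(int^'n) set"
  assumes sp: "vec.span ((\<lambda>y. rv (y - y0)) ` Y0) = UNIV"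
  obtains u where "\<And>i. i < CARD('n) \<Longrightarrow> \<exists>y\<in>Y0. u i = y - y0 \<and> y \<noteq> y0"
    "\<And>i n. i < CARD('n) \<Longrightarrow> n *s u i \<in> lat u i \<Longrightarrow> n = 0"
proof -
  let ?S = "(\<lambda>y. rv (y - y0)) ` Y0"
  obtain B where B: "B \<subseteq> ?S" "vec.independent B" "?S \<subseteq> vec.span B" using vec.maximal_independent_subset[of ?S] by blast
  have "vec.span B = UNIV" using sp vec.span_mono[OF B(3)] unfolding vec.span_span by blast
  then have cB: "card B = CARD('n)" using vec.dim_eq_card[of B UNIV] B(2) vec.dim_UNIV[where 'a=rat and 'b='n]
    by (simp add: card_cart_basis)
  have fB: "finite B" using B(2) by (rule vec.finiteI_independent)
  obtain h where h: "bij_betw h {0..<CARD('n)} B" using ex_bij_betw_nat_finite[OF fB] unfolding cB by blast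
  have hB: "h i \<in> B" if "i < CARD('n)" for i using h that by (auto simp: bij_betw_def)
  have "\<exists>y\<in>Y0. h i = rv (y - y0)" if "i < CARD('n)" for i using hB[OF that] B(1) by blast
  then obtain y where y: "\<And>i. i < CARD('n) \<Longrightarrow> y i \<in> Y0 \<and> h i = rv (y i - y0)" by metis
  define u where "u i = y i - y0" for i
  have lat: "rv z \<in> vec.span (h ` {..<k})" if "k \<le> CARD('n)" "z \<in> lat u k" for k z
    using that
  proof (induction k arbitrary: z)
    case (Suc k)
    then obtain w n where w: "z = w + n *s u k" "w \<in> lat u k" by auto
    have "vec.span (h ` {..<k}) \<subseteq> vec.span (h ` {..<Suc k})" by (intro vec.span_mono image_mono) auto
    moreover have "rv w \<in> vec.span (h ` {..<k})" using Suc.IH[of w] Suc.prems(1) w(2) by simp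
    ultimately have "rv w \<in> vec.span (h ` {..<Suc k})" by blast
    moreover have "rv (n *s u k) \<in> vec.span (h ` {..<Suc k})"
    proof -
      have "rv (u k) = h k" using y[of k] Suc.prems(1) by (simp add: u_def)
      then show ?thesis unfolding rv_smult by (simp only:) (intro vec.span_scale vec.span_base, auto)
    qed
    ultimately show ?case unfolding w(1) rv_add by (rule vec.span_add)
  qed auto
  show ?thesis
  proof (rule that[of u])
    fix i assume i: "i < CARD('n)"
    have "h i \<noteq> 0" using hB[OF i] B(2) vec.dependent_zero by metis
    then show "\<exists>y\<in>Y0. u i = y - y0 \<and> y \<noteq> y0" using y[OF i] by (auto simp: u_def)
    fix n assume n: "n *s u i \<in> lat u i"
    show "n = 0"
    proof (rule ccontr)
      assume n0: "n \<noteq> 0"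
      have "rv (n *s u i) = of_int n *s h i" unfolding rv_smult using y[OF i] by (simp add: u_def)
      then have "of_int n *s h i \<in> vec.span (h ` {..<i})" using lat[OF less_imp_le[OF i] n] by simp
      then have "inverse (of_int n) *s (of_int n *s h i) \<in> vec.span (h ` {..<i})" by (rule vec.span_scale)
      then have "h i \<in> vec.span (h ` {..<i})" using n0 by simp
      moreover have "h ` {..<i} \<subseteq> B - {h i}"
      proof
        fix z assume "z \<in> h ` {..<i}"
        then obtain j where j: "j < i" "z = h j" by blast
        then have "h j \<noteq> h i" using inj_on_eq_iff[OF bij_betw_imp_inj_on[OF h], of j i] i by simp
        then show "z \<in> B - {h i}" using j hB i by auto
      qed
      ultimately have "h i \<in> vec.span (B - {h i})" using vec.span_mono by blast
      then show False using B(2) hB[OF i] unfolding vec.dependent_def by blast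
    qed
  qed
qed

lemma power_le_exp:
  fixes x :: real
  assumes "0 \<le> x"
  shows "x ^ r \<le> fact r * exp x"
proof -
  have "(\<Sum>n\<in>{r}. x ^ n /\<^sub>R fact n) \<le> (\<Sum>n. x ^ n /\<^sub>R fact n)"
    using assms by (intro sum_le_suminf summable_exp_generic) auto
  then show ?thesis by (simp add: exp_def field_simps)
qed

text \<open>\<open>I\<close> is the last level at which C r^(2I) stays below N^\<kappa>1. Of 2^I,
  one factor sqrt(2)^I absorbs the polynomial (2I+1)^r and the other becomes a power of
  \<open>N\<close>, since r^(2I) is comparable with N^\<kappa>1. For small \<open>N\<close> a large
  \<open>E\<close> suffices.\<close>

lemma choose_level:
  fixes C \<kappa>1 :: real and r :: nat
  assumes r: "2 \<le> r" and C: "1 \<le> C" and \<kappa>1: "0 < \<kappa>1"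
  obtains E \<kappa> where "0 < E" "0 < \<kappa>" "\<And>N. 1 \<le> N \<Longrightarrow> N powr \<kappa>1 \<le> C \<Longrightarrow> 1 \<le> E * N powr (- \<kappa>)"
    "\<And>N. 1 \<le> N \<Longrightarrow> C < N powr \<kappa>1 \<Longrightarrow> \<exists>I. C * real r ^ (2 * I) < N powr \<kappa>1 \<and> (2 * real I + 1) ^ r \<le> E * N powr (- \<kappa>) * 2 ^ I"
proof -
  define q where "q = sqrt (2::real)"
  have q: "1 < q" "q * q = 2" by (auto simp: q_def)
  define R where "R = (real r)\<^sup>2"
  have r2: "1 < R" using r by (simp add: R_def one_less_power)
  define \<beta> where "\<beta> = ln q / ln R"
  have \<beta>: "0 < \<beta>" using q r2 by (simp add: \<beta>_def)
  have rb: "R powr \<beta> = q" using r2 q by (simp add: \<beta>_def powr_def)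
  define \<kappa> where "\<kappa> = \<kappa>1 * \<beta>"
  define \<delta> where "\<delta> = ln q / 2"
  have \<delta>: "0 < \<delta>" using q by (simp add: \<delta>_def)
  define E1 where "E1 = fact r / \<delta> ^ r * exp \<delta>"
  have E1: "0 < E1" using \<delta> by (simp add: E1_def)
  have poly: "(2 * real I + 1) ^ r \<le> E1 * q ^ I" for I
  proof -
    have "\<delta> ^ r * (2 * real I + 1) ^ r = (\<delta> * (2 * real I + 1)) ^ r" by (simp add: power_mult_distrib)
    also have "\<dots> \<le> fact r * exp (\<delta> * (2 * real I + 1))" using \<delta> by (intro power_le_exp) auto
    also have "exp (\<delta> * (2 * real I + 1)) = exp \<delta> * q ^ I"
    proof -
      have "\<delta> * (2 * real I + 1) = \<delta> + real I * ln q" by (simp add: \<delta>_def algebra_simps)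
      then show ?thesis using q by (simp add: exp_add exp_of_nat_mult)
    qed
    finally show ?thesis using \<delta> by (simp add: E1_def field_simps)
  qed
  define E where "E = (E1 + 1) * C powr \<beta> * q"
  have CE: "C powr \<beta> * 1 \<le> ((E1 + 1) * C powr \<beta>) * q" using E1 q C by (intro mult_mono) auto
  show ?thesis
  proof (rule that[of E \<kappa>])
    show "0 < E" "0 < \<kappa>" using E1 q C \<kappa>1 \<beta> by (auto simp: E_def \<kappa>_def)
    fix N :: real assume N: "1 \<le> N"
    have Nk: "N powr \<kappa> = (N powr \<kappa>1) powr \<beta>" by (simp add: \<kappa>_def powr_powr)
    have inv: "x \<le> E' * N powr (- \<kappa>)" if "x * N powr \<kappa> \<le> E'" for x E' :: real
      using that N by (simp add: powr_minus field_simps)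
    show "1 \<le> E * N powr (- \<kappa>)" if "N powr \<kappa>1 \<le> C"
    proof (rule inv)
      have "N powr \<kappa> \<le> C powr \<beta>" unfolding Nk using that \<beta> by (intro powr_mono2) auto
      then show "1 * N powr \<kappa> \<le> E" using CE by (simp add: E_def)
    qed
    assume big: "C < N powr \<kappa>1"
    have ex: "\<exists>J. N powr \<kappa>1 \<le> C * real r ^ (2 * J)"
    proof -
      obtain J where J: "N powr \<kappa>1 < real r ^ J" using real_arch_pow[of "real r" "N powr \<kappa>1"] r by auto
      have "1 * real r ^ J \<le> C * real r ^ (2 * J)" using C r by (intro mult_mono power_increasing) auto
      then show ?thesis using J by (intro exI[of _ J]) linarith
    qed
    define J where "J = (LEAST J. N powr \<kappa>1 \<le> C * real r ^ (2 * J))"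
    have J: "N powr \<kappa>1 \<le> C * real r ^ (2 * J)" unfolding J_def using ex by (rule LeastI_ex)
    have "J \<noteq> 0" using J big by (intro notI) simp
    then obtain I where I: "J = Suc I" by (cases J) auto
    have lt: "C * real r ^ (2 * I) < N powr \<kappa>1"
      using not_less_Least[of I "\<lambda>J. N powr \<kappa>1 \<le> C * real r ^ (2 * J)"] I unfolding J_def by auto
    have "N powr \<kappa> \<le> (C * real r ^ (2 * J)) powr \<beta>" unfolding Nk using J \<beta> by (intro powr_mono2) auto
    also have "\<dots> = C powr \<beta> * q ^ J"
    proof -
      have "(real r ^ (2 * J)) powr \<beta> = (R powr \<beta>) ^ J"
      proof -
        have "(real r ^ (2 * J)) powr \<beta> = (R ^ J) powr \<beta>" by (simp add: power_mult R_def)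
        also have "\<dots> = (R powr real J) powr \<beta>" using r2 by (simp add: powr_realpow)
        also have "\<dots> = (R powr \<beta>) powr real J" by (simp add: powr_powr mult.commute)
        finally show ?thesis using r2 by (simp add: powr_realpow)
      qed
      then show ?thesis using C by (simp add: powr_mult rb)
    qed
    finally have Nq: "N powr \<kappa> \<le> C powr \<beta> * q ^ J" .
    have "(2 * real I + 1) ^ r * N powr \<kappa> \<le> (E1 * q ^ I) * (C powr \<beta> * q ^ J)"
      using poly[of I] Nq E1 q by (intro mult_mono) auto
    also have "\<dots> = (E1 * C powr \<beta> * q) * (q * q) ^ I" by (simp add: I power_mult_distrib)
    also have "\<dots> \<le> E * (q * q) ^ I" unfolding E_def using q E1 by (intro mult_right_mono) auto
    finally have "(2 * real I + 1) ^ r \<le> (E * 2 ^ I) * N powr (- \<kappa>)" unfolding q(2) by (rule inv)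
    then show "\<exists>I. C * real r ^ (2 * I) < N powr \<kappa>1 \<and> (2 * real I + 1) ^ r \<le> E * N powr (- \<kappa>) * 2 ^ I"
      using lt by (intro exI[of _ I]) (simp add: mult_ac)
  qed
qed

text \<open>Brunn-Minkowski needs \<open>d\<close> independent directions in which the sumset meets
  few lines. \<open>rich_directions\<close> supplies a large set \<open>Y0\<close> whose differences
  are all of this kind, and by irreducibility these differences span, as a set of that size in a
  proper subspace would grow too much. The constants are chosen before the matrices.\<close>

lemma exists_bm:
  fixes C l :: real
  assumes C: "1 \<le> C" and l: "0 < l" "l < 1"
  shows "\<exists>E0 \<kappa>. 0 \<le> E0 \<and> 0 < \<kappa> \<and> (\<forall>(L1 :: int^'n::finite^'n) (L2 :: int^'n^'n) A V U.
    irreducible_pair L1 L2 \<longrightarrow> det L1 \<noteq> 0 \<longrightarrow> det L2 \<noteq> 0 \<longrightarrow> finite A \<longrightarrow>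
    real (card (lsum ((*v) L1) ((*v) L2) A A)) \<le> C * real (card A) \<longrightarrow> V \<subseteq> A \<longrightarrow> U \<subseteq> A \<longrightarrow> V \<noteq> {} \<longrightarrow> U \<noteq> {} \<longrightarrow>
    bm_const l ^ CARD('n) * (real (card V) powr l * real (card U) powr (1 - l))
      \<le> real (card (lsum ((*v) L1) ((*v) L2) V U)) + E0 * real (card A) powr (- \<kappa>) * real (card A))"
proof -
  define d where "d = CARD('n)"
  define \<kappa>1 :: real where "\<kappa>1 = (1 / 4) ^ d"
  define r where "r = nat \<lceil>C ^ 5\<rceil> + 2"
  have \<kappa>1: "0 < \<kappa>1" "\<kappa>1 \<le> 1" by (auto simp: \<kappa>1_def power_le_one)
  have r: "2 \<le> r" "C ^ 5 \<le> real r" by (auto simp: r_def) linarith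
  obtain E \<kappa> where E: "0 < E" "0 < \<kappa>" "\<And>N. 1 \<le> N \<Longrightarrow> N powr \<kappa>1 \<le> C \<Longrightarrow> 1 \<le> E * N powr (- \<kappa>)"
    "\<And>N. 1 \<le> N \<Longrightarrow> C < N powr \<kappa>1 \<Longrightarrow> \<exists>I. C * real r ^ (2 * I) < N powr \<kappa>1 \<and> (2 * real I + 1) ^ r \<le> E * N powr (- \<kappa>) * 2 ^ I"
    by (rule choose_level[OF r(1) C \<kappa>1(1)]) blast
  define Eb :: real where "Eb = fact (Suc d) * (real d * C ^ 6)"
  define B where "B = bm_const l ^ d"
  have EB: "0 \<le> Eb" "0 \<le> B" using C bm_const_pos[OF l] by (auto simp: Eb_def B_def)
  have main: "B * (real (card V) powr l * real (card U) powr (1 - l))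
      \<le> real (card (lsum ((*v) L1) ((*v) L2) V U)) + (E * (Eb + B)) * real (card A) powr (- \<kappa>) * real (card A)"
    if irr: "irreducible_pair L1 L2" and det: "det L1 \<noteq> 0" "det L2 \<noteq> 0" and fA: "finite A"
      and sA: "real (card (lsum ((*v) L1) ((*v) L2) A A)) \<le> C * real (card A)"
      and VU: "V \<subseteq> A" "U \<subseteq> A" "V \<noteq> {}" "U \<noteq> {}" for L1 L2 :: "int^'n^'n" and A V U
  proof -
    define f where "f = (*v) L1"
    define g where "g = (*v) L2"
    define N where "N = card A"
    have injs: "inj f" "inj g" using det by (simp_all add: f_def g_def inj_int_mult_of_det)
    have fVU: "finite V" "finite U" using VU fA by (auto intro: finite_subset)
    have A0: "A \<noteq> {}" using VU by blast
    then have N1: "1 \<le> real N" "0 < N" using fA by (auto simp: N_def Suc_le_eq card_gt_0_iff)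
    define \<epsilon> where "\<epsilon> = E * real N powr (- \<kappa>) * real N"
    have \<epsilon>0: "0 \<le> \<epsilon>" using E by (simp add: \<epsilon>_def)
    have tot: "(E * (Eb + B)) * real N powr (- \<kappa>) * real N = Eb * \<epsilon> + B * \<epsilon>"
      by (simp add: \<epsilon>_def algebra_simps)
    show ?thesis
    \<comment> \<open>For small \<open>N\<close> the part \<open>B\<close> \<epsilon> of the error
      is at least \<open>B\<close> N, which bounds the left side.\<close>
    proof (cases "real N powr \<kappa>1 \<le> C")
      case True
      have "real (card V) powr l * real (card U) powr (1 - l) \<le> real N powr l * real N powr (1 - l)"
        using VU fA l by (intro mult_mono powr_mono2) (auto simp: N_def card_mono)
      also have "\<dots> = real N" using N1 by (simp flip: powr_add)
      also have "\<dots> \<le> \<epsilon>" using mult_right_mono[OF E(3)[OF N1(1) True], of "real N"] by (simp add: \<epsilon>_def)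
      finally have "B * (real (card V) powr l * real (card U) powr (1 - l)) \<le> B * \<epsilon>" using EB(2) by (rule mult_left_mono)
      moreover have "0 \<le> Eb * \<epsilon>" using EB \<epsilon>0 by simp
      ultimately show ?thesis unfolding N_def[symmetric] tot by linarith
    next
      case False
      then obtain I where I: "C * real r ^ (2 * I) < real N powr \<kappa>1" "(2 * real I + 1) ^ r \<le> E * real N powr (- \<kappa>) * 2 ^ I"
        using E(4)[OF N1(1)] by auto
      define X where "X = f ` A"
      define Y where "Y = g ` A"
      have XY: "finite X" "finite Y" "card X = N" "card Y = N"
        using fA injs by (auto simp: X_def Y_def N_def card_image inj_on_subset)
      have sXY: "real (card (X + Y)) \<le> C * real N"
        using sA by (simp add: X_def Y_def N_def f_def g_def lsum_plus)
      obtain Y0 where Y0: "Y0 \<subseteq> Y" "N \<le> card Y0 * r ^ I"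
        "\<And>y y'. y \<in> Y0 \<Longrightarrow> y' \<in> Y0 \<Longrightarrow> y \<noteq> y' \<Longrightarrow> real (lines (y - y') (X + Y)) * 2 ^ I \<le> C ^ 6 * real N * (2 * real I + 1) ^ r"
        by (rule rich_directions[OF XY N1(2) sXY C r(2), of I]) blast
      have "Y0 \<noteq> {}" using Y0(2) N1(2) by auto
      then obtain y0 where y0: "y0 \<in> Y0" by blast
      have sp: "vec.span ((\<lambda>y. rv (y - y0)) ` Y0) = UNIV"
      proof (rule ccontr)
        let ?U = "vec.span ((\<lambda>y. rv (y - y0)) ` Y0)"
        assume U: "?U \<noteq> UNIV"
        define R where "R = rat_mat L2"
        define W where "W = {w. R *v w \<in> ?U}"
        \<comment> \<open>\<open>Y0\<close> is pulled back along \<open>g\<close> to a subset of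
          \<open>A\<close>, and the subspace along with it to \<open>W\<close>, so that
          \<open>affine_growth\<close> applies.\<close>
        define A1 where "A1 = {x \<in> A. g x \<in> Y0}"
        have gA1: "g ` A1 = Y0" using Y0(1) by (auto simp: A1_def Y_def)
        have cA1: "card A1 = card Y0" unfolding gA1[symmetric] using injs(2) by (intro card_image[symmetric]) (rule inj_on_subset, auto)
        have A1A: "A1 \<subseteq> A" "finite A1" using fA by (auto simp: A1_def)
        obtain x0 where x0: "x0 \<in> A1" "g x0 = y0" using y0 unfolding gA1[symmetric] by auto
        have sW: "vec.subspace W" unfolding W_def
          by (rule vec.subspaceI)
            (auto simp: vec.span_zero matrix_vector_right_distrib vec.span_add vector_scalar_commute vec.span_scale)
        have "(\<lambda>x. rv (x - x0)) ` A1 \<subseteq> W"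
        proof
          fix w assume "w \<in> (\<lambda>x. rv (x - x0)) ` A1"
          then obtain x where x: "x \<in> A1" "w = rv (x - x0)" by blast
          have "R *v w = rv (g x - y0)" unfolding x(2) x0(2)[symmetric] by (simp add: R_def g_def mv_diff flip: rv_mult)
          moreover have "g x \<in> Y0" using x(1) gA1 by blast
          ultimately show "w \<in> W" unfolding W_def by (auto intro: vec.span_base)
        qed
        then have "vec.span ((\<lambda>x. rv (x - x0)) ` A1) \<subseteq> W" using sW by (rule vec.span_minimal)
        moreover have "W \<noteq> UNIV"
        proof
          assume WU: "W = UNIV"
          obtain S where S: "R ** S = mat 1" using det(2) invertible_det_nz[of R] by (auto simp: R_def det_rat_mat invertible_def)
          have "v \<in> ?U" for v
          proof -
            have "R *v (S *v v) \<in> ?U" using WU unfolding W_def by blast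
            then show ?thesis by (simp add: matrix_vector_mul_assoc S)
          qed
          then show False using U by blast
        qed
        ultimately have "vec.span ((\<lambda>x. rv (x - x0)) ` A1) \<noteq> UNIV" by blast
        from affine_growth[OF irr det(1) A1A(2) x0(1) this]
        have "real (card A1) powr (1 + \<kappa>1) \<le> real (card (lsum f g A1 A1))" by (simp add: lin_sumset_lsum f_def g_def \<kappa>1_def d_def)
        also have "\<dots> \<le> real (card (lsum f g A A))" using A1A fA by (simp add: card_mono finite_lsum lsum_mono)
        also have "\<dots> \<le> C * real N" using sA by (simp add: f_def g_def N_def)
        finally have gr: "real (card Y0) powr (1 + \<kappa>1) \<le> C * real N" by (simp add: cA1)
        have rI: "1 \<le> real r ^ I" using r by simp
        have "real N \<le> real (card Y0 * r ^ I)" using Y0(2) by (simp only: of_nat_le_iff)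
        then have "real N powr (1 + \<kappa>1) \<le> (real (card Y0) * real r ^ I) powr (1 + \<kappa>1)" using \<kappa>1 by (intro powr_mono2) auto
        also have "\<dots> = real (card Y0) powr (1 + \<kappa>1) * (real r ^ I) powr (1 + \<kappa>1)" by (simp add: powr_mult)
        \<comment> \<open>\<open>Y0\<close> has lost a factor r^I against \<open>N\<close>. Since 1
          + \<kappa>1 \<le> 2, this costs at most r^(2I), which explains the exponent in
          \<open>choose_level\<close>.\<close>
        also have "\<dots> \<le> (C * real N) * (real r ^ I) powr 2" using gr rI \<kappa>1 C by (intro mult_mono powr_mono) auto
        also have "(real r ^ I) powr 2 = real r ^ (2 * I)" using rI by (simp add: power_mult mult.commute[of 2] flip: power_mult)
        also have "real N powr (1 + \<kappa>1) = real N powr \<kappa>1 * real N" using N1 by (simp add: powr_add)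
        finally have "real N powr \<kappa>1 * real N \<le> (C * real r ^ (2 * I)) * real N" by (simp add: mult_ac)
        then have "real N powr \<kappa>1 \<le> C * real r ^ (2 * I)" by (rule mult_right_le_imp_le) (use N1 in simp)
        then show False using I(1) by linarith
      qed
      obtain u where u: "\<And>i. i < CARD('n) \<Longrightarrow> \<exists>y\<in>Y0. u i = y - y0 \<and> y \<noteq> y0"
        "\<And>i n. i < CARD('n) \<Longrightarrow> n *s u i \<in> lat u i \<Longrightarrow> n = 0" by (rule spanning_directions[OF sp]) blast
      have fXY: "finite (X + Y)" using XY by (simp add: finite_set_plus)
      have sub: "f ` V + g ` U \<subseteq> X + Y" unfolding X_def Y_def using VU by (intro set_plus_mono2 image_mono)
      have ln: "real (lines (u i) (f ` V + g ` U)) \<le> C ^ 6 * \<epsilon>" if i: "i < d" for i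
      proof -
        obtain y where y: "y \<in> Y0" "u i = y - y0" "y \<noteq> y0" using u(1)[of i] i by (auto simp: d_def)
        have "real (lines (u i) (f ` V + g ` U)) \<le> real (lines (u i) (X + Y))" using lines_mono[OF sub fXY] by simp
        moreover have "real (lines (u i) (X + Y)) * 2 ^ I \<le> (C ^ 6 * \<epsilon>) * 2 ^ I"
        proof -
          have "real (lines (u i) (X + Y)) * 2 ^ I \<le> C ^ 6 * real N * (2 * real I + 1) ^ r" unfolding y(2) by (rule Y0(3)[OF y(1) y0 y(3)])
          also have "\<dots> \<le> C ^ 6 * real N * (E * real N powr (- \<kappa>) * 2 ^ I)" using I(2) C by (intro mult_left_mono) auto
          finally show ?thesis by (simp add: \<epsilon>_def mult_ac)
        qed
        then have "real (lines (u i) (X + Y)) \<le> C ^ 6 * \<epsilon>" by (rule mult_right_le_imp_le) simp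
        ultimately show ?thesis by linarith
      qed
      have cVU: "card (f ` V) = card V" "card (g ` U) = card U"
        using inj_on_subset[OF injs(1) subset_UNIV] inj_on_subset[OF injs(2) subset_UNIV] by (simp_all add: card_image)
      have "B * (real (card V) powr l * real (card U) powr (1 - l))
          \<le> real (card (f ` V + g ` U)) + fact (Suc d) * (\<Sum>i<d. real (lines (u i) (f ` V + g ` U)))"
        using brunn_minkowski_int[of l d u "f ` V" "g ` U"] u(2) l fVU VU(3,4)
        unfolding cVU d_def[symmetric] by (simp add: B_def mult.assoc)
      also have "fact (Suc d) * (\<Sum>i<d. real (lines (u i) (f ` V + g ` U))) \<le> Eb * \<epsilon>"
      proof -
        have "(\<Sum>i<d. real (lines (u i) (f ` V + g ` U))) \<le> (\<Sum>i<d. C ^ 6 * \<epsilon>)" using ln by (intro sum_mono) auto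
        also have "\<dots> = real d * C ^ 6 * \<epsilon>" by simp
        finally have "fact (Suc d) * (\<Sum>i<d. real (lines (u i) (f ` V + g ` U))) \<le> fact (Suc d) * (real d * C ^ 6 * \<epsilon>)"
          by (intro mult_left_mono) auto
        then show ?thesis by (simp only: Eb_def mult.assoc)
      qed
      finally have "B * (real (card V) powr l * real (card U) powr (1 - l)) \<le> real (card (f ` V + g ` U)) + Eb * \<epsilon>" by simp
      moreover have "0 \<le> B * \<epsilon>" using EB \<epsilon>0 by simp
      ultimately show ?thesis unfolding N_def[symmetric] tot lsum_plus f_def[symmetric] g_def[symmetric] by linarith
    qed
  qed
  show ?thesis
  proof (rule exI[of _ "E * (Eb + B)"], rule exI[of _ \<kappa>], intro conjI allI impI)
    show "0 \<le> E * (Eb + B)" "0 < \<kappa>" using E EB by auto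
  qed (use main in \<open>unfold d_def B_def, blast\<close>)
qed

section \<open>Both determinants nonzero\<close>

lemma irreducible_pair_sym: "irreducible_pair L1 L2 \<Longrightarrow> irreducible_pair L2 L1"
  unfolding irreducible_pair_def by blast

lemma coprime_pair_sym: "coprime_pair L1 L2 \<Longrightarrow> coprime_pair L2 L1"
  unfolding coprime_pair_def by blast

text \<open>If f x = g y with x and y in \<open>G\<close>, then y lies in T2 by this very equation.
  So the next level arises by two applications of \<open>tight_pre\<close>, the second with the maps
  exchanged.\<close>

lemma pre_pre: "pre f g (pre g f G) = pre f g G \<inter> pre g f G"
  by (auto simp: pre_def image_iff) metis

lemma tight_pair_int:
  fixes L1 L2 :: "int^'n^'n"
  assumes cop: "coprime_pair L1 L2" and det: "det L1 \<noteq> 0" "det L2 \<noteq> 0"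
  shows "tight_pair ((*v) L1) ((*v) L2) (tight ((*v) L1) ((*v) L2)) (nat \<bar>det L1\<bar>) (nat \<bar>det L2\<bar>)"
proof
  let ?f = "(*v) L1" and ?g = "(*v) L2"
  note cop' = coprime_pair_sym[OF cop]
  fix G assume G: "tight ?f ?g G"
  then have G': "tight ?g ?f G" by (simp add: tight_swap)
  show "subgrp G" using G by (simp add: tight_def)
  have "tight ?f ?g (pre ?g ?f G)" by (rule tight_pre[OF cop det(1) refl refl G])
  then have "tight ?g ?f (pre ?f ?g (pre ?g ?f G))" by (intro tight_pre[OF cop' det(2) refl refl]) (simp add: tight_swap)
  then show "tight ?f ?g (pre ?f ?g G \<inter> pre ?g ?f G)" by (simp add: pre_pre tight_swap)
  show "finite (parts (pre ?g ?f G) G) \<and> card (parts (pre ?g ?f G) G) = nat \<bar>det L1\<bar>"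
    using card_parts_pre[OF cop det(1) refl refl G] by simp
  show "finite (parts (pre ?f ?g G) G) \<and> card (parts (pre ?f ?g G) G) = nat \<bar>det L2\<bar>"
    using card_parts_pre[OF cop' det(2) refl refl G'] by simp
qed (use det in \<open>simp_all add: mv_diff inj_int_mult_of_det\<close>)

text \<open>With l : (1-l) equal to the ratio of the d-th roots, the entropy constant splits into
  the leading constant of the theorem and the normalising powers in \<open>bm\<close>.\<close>

lemma bm_const_weighted:
  fixes x y :: real and d :: nat
  assumes xy: "0 < x" "0 < y" and d: "0 < d"
  defines "\<alpha> \<equiv> x powr (1 / real d)" and "\<beta> \<equiv> y powr (1 / real d)"
  defines "l \<equiv> \<alpha> / (\<alpha> + \<beta>)"
  shows "bm_const l ^ d = (\<alpha> + \<beta>) ^ d * (x powr (- l) * y powr (- (1 - l)))"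
proof -
  have ab: "0 < \<alpha>" "0 < \<beta>" using xy by (auto simp: \<alpha>_def \<beta>_def)
  define m where "m = 1 - l"
  have m: "m = \<beta> / (\<alpha> + \<beta>)" using ab by (simp add: m_def l_def field_simps)
  have lm: "l + m = 1" by (simp add: m_def)
  have "bm_const l = l powr (- l) * m powr (- m)" by (simp add: bm_const_def m_def)
  also have "\<dots> = (\<alpha> / (\<alpha> + \<beta>)) powr (- l) * (\<beta> / (\<alpha> + \<beta>)) powr (- m)" by (simp only: m[symmetric]) (simp add: l_def)
  also have "\<dots> = \<alpha> powr (- l) * \<beta> powr (- m) * ((\<alpha> + \<beta>) powr l * (\<alpha> + \<beta>) powr m)"
    using ab by (simp add: powr_divide powr_minus divide_simps)
  also have "(\<alpha> + \<beta>) powr l * (\<alpha> + \<beta>) powr m = \<alpha> + \<beta>" using ab by (simp add: lm flip: powr_add)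
  finally have "bm_const l ^ d = (\<alpha> powr (- l)) ^ d * (\<beta> powr (- m)) ^ d * (\<alpha> + \<beta>) ^ d" by (simp add: power_mult_distrib)
  moreover have "(\<alpha> powr (- l)) ^ d = x powr (- l)" "(\<beta> powr (- m)) ^ d = y powr (- m)"
    unfolding \<alpha>_def \<beta>_def using d xy by (simp_all add: powr_powr powr_power)
  ultimately show ?thesis by (simp add: m_def mult_ac)
qed

theorem regular_case:
  fixes a b :: int
  assumes ab: "0 < a" "0 < b"
  shows "\<exists>D \<sigma> :: real. D > 0 \<and> \<sigma> > 0 \<and> (\<forall>(L1 :: int^'n::finite^'n) (L2 :: int^'n^'n).
       irreducible_pair L1 L2 \<longrightarrow> coprime_pair L1 L2 \<longrightarrow> \<bar>det L1\<bar> = a \<longrightarrow> \<bar>det L2\<bar> = b \<longrightarrow>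
       (\<forall>A. finite A \<longrightarrow> (real_of_int a powr (1 / real CARD('n)) + real_of_int b powr (1 / real CARD('n))) ^ CARD('n) * real (card A)
            - D * real (card A) powr (1 - \<sigma>) \<le> real (card (lin_sumset L1 L2 A))))"
proof -
  define d where "d = CARD('n)"
  have d0: "0 < d" by (simp add: d_def)
  define \<alpha> where "\<alpha> = real_of_int a powr (1 / real d)"
  define \<beta> where "\<beta> = real_of_int b powr (1 / real d)"
  define K where "K = (\<alpha> + \<beta>) ^ d"
  define l where "l = \<alpha> / (\<alpha> + \<beta>)"
  have p: "1 \<le> \<alpha>" "0 < \<beta>" using ab by (auto simp: \<alpha>_def \<beta>_def intro!: ge_one_powr_ge_zero)
  have K: "1 \<le> K" unfolding K_def using p by (intro one_le_power) simp
  have l: "0 < l" "l < 1" using p by (auto simp: l_def)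
  have nab: "0 < nat a" "0 < nat b" "real (nat a) = real_of_int a" "real (nat b) = real_of_int b" using ab by auto
  have bmc: "bm_const l ^ d = K * (real (nat a) powr (- l) * real (nat b) powr (- (1 - l)))"
    unfolding nab K_def l_def \<alpha>_def \<beta>_def by (rule bm_const_weighted) (use ab d0 in auto)
  have C1: "1 \<le> K + 1" using K by simp
  obtain E0 \<kappa> where E: "0 \<le> E0" "0 < \<kappa>" and bm: "\<forall>(L1 :: int^'n::finite^'n) (L2 :: int^'n^'n) A V U.
    irreducible_pair L1 L2 \<longrightarrow> det L1 \<noteq> 0 \<longrightarrow> det L2 \<noteq> 0 \<longrightarrow> finite A \<longrightarrow>
    real (card (lsum ((*v) L1) ((*v) L2) A A)) \<le> (K + 1) * real (card A) \<longrightarrow> V \<subseteq> A \<longrightarrow> U \<subseteq> A \<longrightarrow> V \<noteq> {} \<longrightarrow> U \<noteq> {} \<longrightarrow>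
    bm_const l ^ CARD('n) * (real (card V) powr l * real (card U) powr (1 - l))
      \<le> real (card (lsum ((*v) L1) ((*v) L2) V U)) + E0 * real (card A) powr (- \<kappa>) * real (card A)"
    using exists_bm[OF C1 l] by blast
  \<comment> \<open>The size above which \<open>exists_minimal_tight\<close> applies with
    \<open>C\<close> = K + 1.\<close>
  define n0 where "n0 = (K + 1) powr (4 ^ CARD('n)) + 1"
  obtain D \<sigma> where D: "0 < D" "0 < \<sigma>" and ub: "\<forall>(f :: int^'n \<Rightarrow> int^'n) g \<T>. tight_pair f g \<T> (nat a) (nat b) \<longrightarrow>
     (\<forall>A. finite A \<longrightarrow> A \<noteq> {} \<longrightarrow> real (card (lsum f g A A)) \<le> (K + 1) * card A \<longrightarrow>
        tight_pair.bm f g (nat a) (nat b) K l (E0 * real (card A) powr (- \<kappa>)) A \<and>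
        (n0 \<le> real (card A) \<longrightarrow> (\<exists>G. \<T> G \<and> in_coset G A \<and> gen f g G A \<and> gen g f G A))) \<longrightarrow>
     (\<forall>A. finite A \<longrightarrow> K * real (card A) - D * real (card A) powr (1 - \<sigma>) \<le> real (card (lsum f g A A)))"
    using uniform_bound[OF nab(1,2) K l E(2,1), of n0, where 'g="int^'n"] by blast
  have "K * real (card A) - D * real (card A) powr (1 - \<sigma>) \<le> real (card (lin_sumset L1 L2 A))"
    if irr: "irreducible_pair L1 L2" and cop: "coprime_pair L1 L2" and dets: "\<bar>det L1\<bar> = a" "\<bar>det L2\<bar> = b" and fA: "finite A"
    for L1 L2 :: "int^'n^'n" and A
  proof -
    let ?f = "(*v) L1" and ?g = "(*v) L2"
    have det: "det L1 \<noteq> 0" "det L2 \<noteq> 0" using dets ab by auto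
    have tp: "tight_pair ?f ?g (tight ?f ?g) (nat a) (nat b)" using tight_pair_int[OF cop det] by (simp add: dets)
    have "tight_pair.bm ?f ?g (nat a) (nat b) K l (E0 * real (card A) powr (- \<kappa>)) A"
      if A: "finite A" "real (card (lsum ?f ?g A A)) \<le> (K + 1) * card A" for A
      unfolding tight_pair.bm_def[OF tp] bmc[symmetric] d_def using bm irr det A by blast
    moreover have "\<exists>G. tight ?f ?g G \<and> in_coset G A \<and> gen ?f ?g G A \<and> gen ?g ?f G A"
      if A: "finite A" "A \<noteq> {}" "real (card (lsum ?f ?g A A)) \<le> (K + 1) * card A" "n0 \<le> real (card A)" for A
    proof -
      have "(K + 1) powr (4 ^ CARD('n)) < card A" using A(4) by (simp add: n0_def)
      then obtain G where G: "tight ?f ?g G" "in_coset G A" "\<And>M. tight ?f ?g M \<Longrightarrow> M \<subseteq> G \<Longrightarrow> in_coset M A \<Longrightarrow> M = G"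
        using exists_minimal_tight[OF irr cop det(1) A(1,2), of "K + 1"] A(3) K by (auto simp: lin_sumset_lsum)
      have "gen ?f ?g G A" unfolding gen_def
      proof (intro allI impI)
        fix M assume M: "subgrp M \<and> pre ?g ?f G \<subseteq> M \<and> M \<subseteq> G \<and> in_coset M A"
        then have "tight ?f ?g M" by (intro tight_between[OF cop det(1) refl refl G(1)]) auto
        then show "M = G" using G(3) M by blast
      qed
      moreover have "gen ?g ?f G A" unfolding gen_def
      proof (intro allI impI)
        fix M assume M: "subgrp M \<and> pre ?f ?g G \<subseteq> M \<and> M \<subseteq> G \<and> in_coset M A"
        have tg: "tight ?g ?f G" using G(1) tight_swap[of ?f ?g G] by blast
        have "tight ?g ?f M" using tight_between[OF coprime_pair_sym[OF cop] det(2) refl refl tg, of M] M by blast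
        then show "M = G" using G(3) M tight_swap[of ?f ?g M] by blast
      qed
      ultimately show ?thesis using G by blast
    qed
    ultimately show ?thesis using ub[rule_format, OF tp _ fA] by (simp add: lin_sumset_lsum)
  qed
  then show ?thesis using D unfolding K_def \<alpha>_def \<beta>_def d_def by blast
qed

section \<open>One singular matrix: splitting by columns only\<close>

text \<open>Equal sums give g (y - y') = f (x' - x), so y and y' lie in one column. Splitting the
  second summand alone separates the sums, and this survives when \<open>g\<close> is
  singular.\<close>

lemma card_lsum_columns:
  fixes f g :: "'g::ab_group_add \<Rightarrow> 'g"
  assumes fd: "\<And>x y. f (x - y) = f x - f y" and gd: "\<And>x y. g (x - y) = g x - g y" and G: "subgrp G"
    and A: "in_coset G A" "finite A"
  shows "card (lsum f g A A) = (\<Sum>Q\<in>parts (pre g f G) A. card (lsum f g A Q))"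
proof -
  let ?T = "pre g f G"
  have sT: "subgrp ?T" by (rule subgrp_pre[OF gd fd G])
  have "lsum f g A A = (\<Union>Q\<in>parts ?T A. lsum f g A Q)"
    using Union_parts[OF sT, of A] unfolding lsum_def by blast
  moreover have "card (\<Union>Q\<in>parts ?T A. lsum f g A Q) = (\<Sum>Q\<in>parts ?T A. card (lsum f g A Q))"
  proof (rule card_UN_disjoint)
    show "finite (parts ?T A)" using A(2) by (rule finite_parts)
    show "\<forall>Q\<in>parts ?T A. finite (lsum f g A Q)" using A(2) parts_finite[OF A(2)] by (blast intro: finite_lsum)
    show "\<forall>Q\<in>parts ?T A. \<forall>Q'\<in>parts ?T A. Q \<noteq> Q' \<longrightarrow> lsum f g A Q \<inter> lsum f g A Q' = {}"
    proof (intro ballI impI, rule ccontr)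
      fix Q Q' assume Q: "Q \<in> parts ?T A" "Q' \<in> parts ?T A" "Q \<noteq> Q'" and "lsum f g A Q \<inter> lsum f g A Q' \<noteq> {}"
      then obtain z where "z \<in> lsum f g A Q" "z \<in> lsum f g A Q'" by blast
      then obtain x y x' y' where h: "x \<in> A" "y \<in> Q" "x' \<in> A" "y' \<in> Q'" "f x + g y = f x' + g y'"
        by (auto elim!: lsumE)
      have yA: "y \<in> A" "y' \<in> A" using h parts_subset[OF Q(1)] parts_subset[OF Q(2)] by auto
      have "g (y - y') = f (x' - x)" unfolding fd gd using h(5) by (simp add: algebra_simps)
      moreover have "x' - x \<in> G" "y - y' \<in> G" using A(1) h yA by (auto simp: in_coset_def)
      ultimately have T: "y - y' \<in> ?T" by (auto simp: pre_def)
      obtain q q' where q: "q \<in> A" "Q = part ?T A q" "q' \<in> A" "Q' = part ?T A q'" using Q(1,2) by (auto simp: parts_def)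
      have "Q = part ?T A y" "Q' = part ?T A y'"
        using h(2,4) part_eqI[OF sT, of y q A] part_eqI[OF sT, of y' q' A] unfolding q by (auto simp: part_def)
      then show False using part_eqI[OF sT T, of A] Q(3) by simp
    qed
  qed
  ultimately show ?thesis by simp
qed

text \<open>Each occupied column contributes at least one translate of f A. If all \<open>a\<close>
  columns are occupied this is already the claim, since the leading constant is \<open>a\<close>
  when the other determinant is 0.\<close>

lemma full_columns_bound:
  fixes f g :: "'g::ab_group_add \<Rightarrow> 'g"
  assumes fd: "\<And>x y. f (x - y) = f x - f y" and gd: "\<And>x y. g (x - y) = g x - g y" and finj: "inj f" and G: "subgrp G"
    and A: "in_coset G A" "finite A"
  shows "card (parts (pre g f G) A) * card A \<le> card (lsum f g A A)"
proof -
  have sT: "subgrp (pre g f G)" by (rule subgrp_pre[OF gd fd G])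
  have "card (parts (pre g f G) A) * card A = (\<Sum>Q\<in>parts (pre g f G) A. card A)" by simp
  also have "\<dots> \<le> (\<Sum>Q\<in>parts (pre g f G) A. card (lsum f g A Q))"
    using card_lsum_ge_left[OF finj A(2)] parts_finite[OF A(2)] parts_nonempty[OF sT] by (intro sum_mono) metis
  finally show ?thesis unfolding card_lsum_columns[OF fd gd G A] .
qed

text \<open>One-sided counterpart of \<open>full_columns\<close>. Shifting the classes of g Q modulo
  f T by f of a difference of \<open>A\<close> produces no new class, since a new one would add a
  whole column of \<open>A\<close> to the sums with \<open>Q\<close>, against \<open>near\<close>.
  Invariance extends to f G by generation, and g T is contained in f G, so \<open>Q\<close> meets
  all cosets of T2(T).\<close>

lemma column_full:
  fixes f g :: "'g::ab_group_add \<Rightarrow> 'g"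
  assumes fd: "\<And>x y. f (x - y) = f x - f y" and gd: "\<And>x y. g (x - y) = g x - g y" and finj: "inj f" and G: "subgrp G"
    and A: "in_coset G A" "finite A" and gen: "gen f g G A" and Q: "Q \<in> parts (pre g f G) A"
    and near: "\<And>P. P \<in> parts (pre g f G) A \<Longrightarrow> card (lsum f g A Q) < card (lsum f g Q Q) + card P"
  shows "card (parts (pre g f (pre g f G)) Q) = card (parts (pre g f (pre g f G)) (pre g f G))"
proof -
  define T where "T = pre g f G"
  have sT: "subgrp T" unfolding T_def by (rule subgrp_pre[OF gd fd G])
  have sTT: "subgrp (pre g f T)" by (rule subgrp_pre[OF gd fd sT])
  have sfT: "subgrp (f ` T)" using sT fd by (intro subgrp_image) auto
  have fQ: "finite Q" and QA: "Q \<subseteq> A" using parts_finite[OF A(2) Q] parts_subset[OF Q] by auto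
  have Qc: "in_coset T Q" unfolding T_def by (rule parts_in_coset[OF sT[unfolded T_def] Q])
  obtain q where q: "q \<in> Q" using parts_nonempty[OF sT[unfolded T_def] Q] by blast
  have f0: "f 0 = 0" using fd[of 0 0] by simp
  define cls where "cls y = {w. w - g y \<in> f ` T}" for y
  define \<Gamma> where "\<Gamma> = cls ` Q"
  \<comment> \<open>Classes are kept as sets and shifts act on them by composition, so the shifts
    that preserve \<Gamma> form a subgroup; finiteness of \<Gamma> upgrades inclusion to
    equality.\<close>
  define sh where "sh v S = (\<lambda>w. w + v) ` S" for v :: 'g and S
  have sh_sh: "sh u (sh v S) = sh (v + u) S" for u v S by (auto simp: sh_def image_image add.assoc)
  have sh0: "sh 0 S = S" for S by (simp add: sh_def)
  have sh_inj: "inj_on (sh v) X" for v X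
    by (rule inj_on_inverseI[of X "sh (- v)"]) (simp add: sh_sh sh0)
  have sh_cls: "sh v (cls y) = cls y'" if "g y' - g y - v \<in> f ` T" for v y y'
  proof -
    have "w \<in> sh v (cls y) \<longleftrightarrow> w - v - g y \<in> f ` T" for w
    proof
      assume "w \<in> sh v (cls y)"
      then obtain w' where "w = w' + v" "w' - g y \<in> f ` T" by (auto simp: sh_def cls_def)
      then show "w - v - g y \<in> f ` T" by simp
    next
      assume "w - v - g y \<in> f ` T"
      then have "w - v \<in> cls y" by (simp add: cls_def)
      then have "(w - v) + v \<in> sh v (cls y)" unfolding sh_def by (rule imageI)
      then show "w \<in> sh v (cls y)" by simp
    qed
    moreover have "w - v - g y \<in> f ` T \<longleftrightarrow> w - g y' \<in> f ` T" for w
    proof -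
      show ?thesis
      proof
        assume h: "w - v - g y \<in> f ` T"
        have "w - g y' = (w - v - g y) - (g y' - g y - v)" by (simp add: algebra_simps)
        then show "w - g y' \<in> f ` T" using subgrp_diff[OF sfT h that] by simp
      next
        assume h: "w - g y' \<in> f ` T"
        have eq: "w - v - g y = (w - g y') + (g y' - g y - v)" by (simp add: algebra_simps)
        show "w - v - g y \<in> f ` T" unfolding eq by (rule subgrp_add[OF sfT h that])
      qed
    qed
    ultimately show ?thesis by (auto simp: cls_def)
  qed
  define M where "M = {z \<in> G. sh (f z) ` \<Gamma> = \<Gamma>}"
  have key: "sh (f (x - q)) ` \<Gamma> = \<Gamma>" if x: "x \<in> A" for x
  proof (rule endo_inj_surj)
    show "finite \<Gamma>" using fQ by (simp add: \<Gamma>_def)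
    show "inj_on (sh (f (x - q))) \<Gamma>" by (rule sh_inj)
    show "sh (f (x - q)) ` \<Gamma> \<subseteq> \<Gamma>"
    proof
      fix S assume "S \<in> sh (f (x - q)) ` \<Gamma>"
      then obtain y where y: "y \<in> Q" "S = sh (f (x - q)) (cls y)" by (auto simp: \<Gamma>_def)
      define P where "P = part T A x"
      have P: "P \<in> parts T A" "finite P" "P \<subseteq> A" using x A(2) by (simp_all add: P_def part_in_parts part_subset finite_subset[OF part_subset])
      define W where "W = (\<lambda>p. f p + g y) ` P"
      have "W \<inter> lsum f g Q Q \<noteq> {}"
      proof
        assume dis: "W \<inter> lsum f g Q Q = {}"
        have cW: "card W = card P" unfolding W_def using finj by (intro card_image) (auto simp: inj_on_def dest: injD)
        have "W \<union> lsum f g Q Q \<subseteq> lsum f g A Q" using P(3) y(1) QA by (auto simp: W_def lsum_def)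
        then have "card (W \<union> lsum f g Q Q) \<le> card (lsum f g A Q)" using A(2) fQ by (intro card_mono finite_lsum)
        moreover have "card (W \<union> lsum f g Q Q) = card W + card (lsum f g Q Q)"
          using dis P(2) fQ by (intro card_Un_disjoint) (auto simp: W_def finite_lsum)
        ultimately show False using near[OF P(1)[unfolded T_def]] cW by simp
      qed
      then obtain p q1 q2 where h: "p \<in> P" "q1 \<in> Q" "q2 \<in> Q" "f q1 + g q2 = f p + g y" by (auto simp: W_def elim!: lsumE)
      have t: "p - x \<in> T" "q - q1 \<in> T" using h Qc q by (auto simp: P_def part_def in_coset_def)
      have "g q2 - g y - f (x - q) = f ((p - x) + (q - q1))"
      proof -
        have "f ((p - x) - (q1 - q)) = f p - f x - (f q1 - f q)" by (simp only: fd)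
        moreover have "(p - x) + (q - q1) = (p - x) - (q1 - q)" by simp
        ultimately have F: "f ((p - x) + (q - q1)) = f p - f x - (f q1 - f q)" by (simp only:)
        have gq: "g q2 = f p + g y - f q1" using h(4) by (metis add_diff_cancel_left')
        show ?thesis unfolding F gq fd by (simp add: algebra_simps)
      qed
      then have "g q2 - g y - f (x - q) \<in> f ` T" using subgrp_add[OF sT t] by simp
      then have "S = cls q2" unfolding y(2) by (rule sh_cls)
      then show "S \<in> \<Gamma>" using h(3) by (simp add: \<Gamma>_def)
    qed
  qed
  have diffM: "x - y \<in> M" if xy: "x \<in> M" "y \<in> M" for x y
  proof -
    have "sh (f (x - y)) ` \<Gamma> = sh (f (x - y)) ` (sh (f y) ` \<Gamma>)" using xy by (simp add: M_def)
    also have "\<dots> = sh (f x) ` \<Gamma>" by (simp add: image_image sh_sh fd)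
    finally show ?thesis using xy subgrp_diff[OF G] by (simp add: M_def)
  qed
  have sM: "subgrp M" unfolding subgrp_def using diffM by (auto simp: M_def subgrp_zero[OF G] f0 sh0)
  have TM: "T \<subseteq> M"
  proof
    fix z assume z: "z \<in> T"
    have "sh (f z) (cls y) = cls y" for y
    proof (rule sh_cls)
      show "g y - g y - f z \<in> f ` T" using subgrp_minus[OF sfT imageI[OF z]] by simp
    qed
    then show "z \<in> M" using z by (auto simp: M_def \<Gamma>_def T_def pre_def image_image)
  qed
  have cM: "in_coset M A"
  proof -
    have xM: "x - q \<in> M" if "x \<in> A" for x using key[OF that] A(1) that q QA by (auto simp: M_def in_coset_def)
    show ?thesis unfolding in_coset_def
    proof (intro ballI)
      fix x y assume "x \<in> A" "y \<in> A"
      then show "x - y \<in> M" using diffM[OF xM xM, of x y] by simp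
    qed
  qed
  have MG: "M = G" using gen sM TM cM unfolding gen_def T_def by (auto simp: M_def)
  show ?thesis unfolding T_def[symmetric]
  proof (rule card_parts_full[OF sTT Qc q])
    fix t assume t: "t \<in> T"
    then obtain z where z: "z \<in> G" "g t = f z" by (auto simp: T_def pre_def)
    have "z \<in> M" using z(1) MG by simp
    then have "sh (f z) ` \<Gamma> = \<Gamma>" by (simp add: M_def)
    moreover have "cls q \<in> \<Gamma>" using q by (simp add: \<Gamma>_def)
    ultimately have "sh (f z) (cls q) \<in> \<Gamma>" by blast
    then obtain x where x: "x \<in> Q" "sh (f z) (cls q) = cls x" by (auto simp: \<Gamma>_def)
    have "g x \<in> cls x" using subgrp_zero[OF sfT] by (simp add: cls_def)
    then have "g x - f z - g q \<in> f ` T" unfolding x(2)[symmetric] by (auto simp: sh_def cls_def)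
    moreover have "g x - f z - g q = g (x - (q + t))" using gd[of "x - q" t] by (simp add: gd z(2) algebra_simps)
    moreover have "x - (q + t) \<in> T"
    proof -
      have "x - q \<in> T" using Qc x(1) q by (simp add: in_coset_def)
      then have "(x - q) - t \<in> T" using t by (rule subgrp_diff[OF sT])
      then show ?thesis by (simp add: diff_diff_add)
    qed
    ultimately show "\<exists>x\<in>Q. x - (q + t) \<in> pre g f T" using x(1) by (auto simp: pre_def)
  qed
qed

text \<open>If some column is empty, three cases remain. A column with few points gains because its
  sums with \<open>A\<close> number at least |A|. A column whose sums with \<open>A\<close> exceed
  its own sums by n / (2a) gains that amount. Otherwise each column is full one level down and
  satisfies the bound without loss. The condition on \<sigma> makes n / (2a) pay for the increase of
  the loss under splitting.\<close>

lemma singular_step: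
  fixes f g :: "'g::ab_group_add \<Rightarrow> 'g" and a :: nat
  assumes fd: "\<And>x y. f (x - y) = f x - f y" and gd: "\<And>x y. g (x - y) = g x - g y" and finj: "inj f" and G: "subgrp G"
    and A: "in_coset G A" "finite A" "A \<noteq> {}" and gen: "gen f g G A" and a: "0 < a"
    and idx1: "finite (parts (pre g f G) G)" "card (parts (pre g f G) G) = a"
    and idx2: "card (parts (pre g f (pre g f G)) (pre g f G)) = a"
    and \<sigma>: "0 < \<sigma>" "\<sigma> < 1" "real a powr \<sigma> - 1 \<le> 1 / (2 * (real a)\<^sup>2)" and D: "0 \<le> D"
    and small: "D * real (card A) powr (1 - \<sigma>) \<le> real a * real (card A)"
    and IH: "\<And>C. C \<subset> A \<Longrightarrow> real a * real (card C) - D * real (card C) powr (1 - \<sigma>) \<le> real (card (lsum f g C C))"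
  shows "real a * real (card A) - D * real (card A) powr (1 - \<sigma>) \<le> real (card (lsum f g A A))"
proof -
  define T where "T = pre g f G"
  define Ps where "Ps = parts T A"
  define n where "n = real (card A)"
  define \<Lambda> where "\<Lambda> = D * n powr (1 - \<sigma>)"
  define s where "s X = real (card (lsum f g X X))" for X
  have sT: "subgrp T" unfolding T_def by (rule subgrp_pre[OF gd fd G])
  have fPs: "finite Ps" using A(2) by (simp add: Ps_def finite_parts)
  have n0: "0 < n" using A by (simp add: n_def card_gt_0_iff)
  have \<Lambda>0: "0 \<le> \<Lambda>" using D by (simp add: \<Lambda>_def)
  have Pp: "Q \<subseteq> A" "finite Q" "Q \<noteq> {}" "in_coset T Q" if "Q \<in> Ps" for Q
    using that parts_subset[of Q T A] parts_finite[OF A(2), of Q T] parts_nonempty[OF sT, of Q A] parts_in_coset[OF sT, of Q A] by (auto simp: Ps_def)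
  have cols: "s A = (\<Sum>Q\<in>Ps. real (card (lsum f g A Q)))"
    using card_lsum_columns[OF fd gd G A(1,2)] by (simp add: s_def Ps_def T_def)
  have sQ: "s Q \<le> real (card (lsum f g A Q))" if "Q \<in> Ps" for Q
    unfolding s_def using Pp[OF that] A(2) by (simp add: card_mono finite_lsum lsum_mono)
  have tot: "(\<Sum>Q\<in>Ps. real (card Q)) = n"
    using sum_card_parts[OF A(2) sT] by (simp add: n_def Ps_def flip: of_nat_sum)
  show ?thesis
  proof (cases "card Ps = a")
    case True
    have "a * card A \<le> card (lsum f g A A)" using full_columns_bound[OF fd gd finj G A(1,2)] True by (simp add: Ps_def T_def)
    then have "real (a * card A) \<le> real (card (lsum f g A A))" by (simp only: of_nat_le_iff)
    then show ?thesis using \<Lambda>0 by (simp add: \<Lambda>_def n_def)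
  next
    case False
    have cPs: "real (card Ps) \<le> real a" using card_parts_le[OF sT A(1)] idx1 by (simp add: Ps_def T_def)
    \<comment> \<open>If \<open>A\<close> were a single column, generation would force T2 = G, hence
      a = 1, and all columns would be occupied after all.\<close>
    have proper: "Q \<subset> A" if "Q \<in> Ps" for Q
    proof -
      have "Q \<noteq> A"
      proof
        assume eq: "Q = A"
        then have cA: "in_coset T A" using Pp[OF that] by simp
        then have "T = G" using gen sT unfolding gen_def T_def by (auto simp: pre_def)
        moreover have "part G G x = G" if "x \<in> G" for x using subgrp_diff[OF G _ that] by (auto simp: part_def)
        then have "parts G G = {G}" using subgrp_zero[OF G] by (auto simp: parts_def)
        ultimately have "a = 1" using idx1(2) by (simp add: T_def)
        moreover have "part T A x = A" if "x \<in> A" for x using cA that by (auto simp: part_def in_coset_def)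
        then have "Ps = {A}" using A(3) by (auto simp: Ps_def parts_def)
        ultimately show False using False by simp
      qed
      then show ?thesis using Pp(1)[OF that] by blast
    qed
    have loss: "(\<Sum>Q\<in>Ps. D * real (card Q) powr (1 - \<sigma>)) \<le> real a powr \<sigma> * \<Lambda>"
    proof -
      have "(\<Sum>Q\<in>Ps. real (card Q) powr (1 - \<sigma>)) \<le> real a powr \<sigma> * n powr (1 - \<sigma>)"
        using fPs Pp tot n0 cPs a \<sigma> by (intro powr_sum_le) (auto simp: card_gt_0_iff)
      from mult_left_mono[OF this D] show ?thesis by (simp add: \<Lambda>_def sum_distrib_left mult_ac)
    qed
    have lossn: "real a powr \<sigma> * \<Lambda> \<le> \<Lambda> + n / (2 * real a)"
    proof -
      have "(real a powr \<sigma> - 1) * \<Lambda> \<le> 1 / (2 * (real a)\<^sup>2) * (real a * n)"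
        using \<sigma>(3) small \<Lambda>0 by (intro mult_mono) (auto simp: \<Lambda>_def n_def)
      also have "\<dots> = n / (2 * real a)" using a by (simp add: power2_eq_square)
      finally show ?thesis by (simp add: algebra_simps)
    qed
    have gain: ?thesis if Q: "Q \<in> Ps" and h: "real a * real (card Q) - D * real (card Q) powr (1 - \<sigma>) + n / (2 * real a) \<le> real (card (lsum f g A Q))" for Q
    proof -
      have "real a * n - (\<Sum>Q\<in>Ps. D * real (card Q) powr (1 - \<sigma>)) + n / (2 * real a)
          = (\<Sum>Q\<in>Ps. real a * real (card Q) - D * real (card Q) powr (1 - \<sigma>)) + n / (2 * real a)"
        by (simp add: sum_subtractf tot flip: sum_distrib_left)
      also have "\<dots> = (real a * real (card Q) - D * real (card Q) powr (1 - \<sigma>) + n / (2 * real a))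
          + (\<Sum>Q\<in>Ps - {Q}. real a * real (card Q) - D * real (card Q) powr (1 - \<sigma>))"
        using sum.remove[OF fPs Q, of "\<lambda>Q. real a * real (card Q) - D * real (card Q) powr (1 - \<sigma>)"] by simp
      also have "\<dots> \<le> real (card (lsum f g A Q)) + (\<Sum>Q\<in>Ps - {Q}. real (card (lsum f g A Q)))"
      proof (intro add_mono sum_mono h)
        fix Q' assume "Q' \<in> Ps - {Q}"
        then show "real a * real (card Q') - D * real (card Q') powr (1 - \<sigma>) \<le> real (card (lsum f g A Q'))"
          using IH[OF proper, of Q'] sQ[of Q'] by (simp add: s_def)
      qed
      also have "\<dots> = s A" unfolding cols using sum.remove[OF fPs Q, of "\<lambda>Q. real (card (lsum f g A Q))"] by simp
      finally show ?thesis using loss lossn by (simp add: s_def n_def[symmetric] \<Lambda>_def)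
    qed
    consider (tiny) Q where "Q \<in> Ps" "2 * real a * real (card Q) \<le> n"
      | (extra) Q where "Q \<in> Ps" "s Q + n / (2 * real a) \<le> real (card (lsum f g A Q))"
      | (near) "\<And>Q. Q \<in> Ps \<Longrightarrow> n < 2 * real a * real (card Q)" "\<And>Q. Q \<in> Ps \<Longrightarrow> real (card (lsum f g A Q)) < s Q + n / (2 * real a)"
      by (meson not_le)
    then show ?thesis
    proof cases
      case tiny
      have "card A \<le> card (lsum f g A Q)" using Pp[OF tiny(1)] by (intro card_lsum_ge_left[OF finj A(2)]) auto
      then have "n \<le> real (card (lsum f g A Q))" by (simp add: n_def)
      moreover have "n / (2 * real a) \<le> n / 2" using n0 a by (intro divide_left_mono) auto
      moreover have "0 \<le> D * real (card Q) powr (1 - \<sigma>)" using D by simp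
      ultimately have "real a * real (card Q) - D * real (card Q) powr (1 - \<sigma>) + n / (2 * real a) \<le> real (card (lsum f g A Q))"
        using tiny(2) by linarith
      then show ?thesis by (rule gain[OF tiny(1)])
    next
      case extra
      then have "real a * real (card Q) - D * real (card Q) powr (1 - \<sigma>) + n / (2 * real a) \<le> real (card (lsum f g A Q))"
        using IH[OF proper[OF extra(1)]] by (simp add: s_def)
      then show ?thesis by (rule gain[OF extra(1)])
    next
      case near
      have "real a * real (card Q) \<le> real (card (lsum f g A Q))" if Q: "Q \<in> Ps" for Q
      proof -
        have "card (parts (pre g f T) Q) = card (parts (pre g f T) T)"
          unfolding T_def
        proof (rule column_full[OF fd gd finj G A(1,2) gen])
          show "Q \<in> parts (pre g f G) A" using Q by (simp add: Ps_def T_def)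
          fix P assume "P \<in> parts (pre g f G) A"
          then have "n < 2 * real a * real (card P)" by (intro near(1)) (simp add: Ps_def T_def)
          then have "n / (2 * real a) < real (card P)" using a by (simp add: field_simps)
          then have "real (card (lsum f g A Q)) < real (card (lsum f g Q Q) + card P)" using near(2)[OF Q] by (simp add: s_def)
          then show "card (lsum f g A Q) < card (lsum f g Q Q) + card P" by (simp only: of_nat_less_iff)
        qed
        then have "a * card Q \<le> card (lsum f g Q Q)"
          using full_columns_bound[OF fd gd finj sT Pp(4,2)[OF Q]] idx2 by (simp add: T_def)
        then have "real (a * card Q) \<le> real (card (lsum f g Q Q))" by (simp only: of_nat_le_iff)
        then show ?thesis using sQ[OF Q] by (simp add: s_def)
      qed
      then have "(\<Sum>Q\<in>Ps. real a * real (card Q)) \<le> s A" unfolding cols by (intro sum_mono)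
      then show ?thesis using \<Lambda>0 by (simp add: s_def n_def \<Lambda>_def tot flip: sum_distrib_left)
    qed
  qed
qed

theorem one_sided_case:
  fixes a :: int
  assumes a: "0 < a"
  shows "\<exists>D \<sigma> :: real. D > 0 \<and> \<sigma> > 0 \<and> (\<forall>(L1 :: int^'n::finite^'n) (L2 :: int^'n^'n).
       irreducible_pair L1 L2 \<longrightarrow> coprime_pair L1 L2 \<longrightarrow> \<bar>det L1\<bar> = a \<longrightarrow>
       (\<forall>A. finite A \<longrightarrow> real_of_int a * real (card A) - D * real (card A) powr (1 - \<sigma>) \<le> real (card (lin_sumset L1 L2 A))))"
proof -
  define k where "k = nat a"
  have k: "0 < k" "real k = real_of_int a" "1 \<le> real k" using a by (auto simp: k_def)
  have "0 < 1 / (2 * (real k)\<^sup>2)" using k by simp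
  then obtain \<tau> where \<tau>: "0 < \<tau>" "\<And>\<sigma>. 0 \<le> \<sigma> \<Longrightarrow> \<sigma> \<le> \<tau> \<Longrightarrow> real k powr \<sigma> - 1 \<le> 1 / (2 * (real k)\<^sup>2)"
    using exists_small_powr[OF k(3)] by blast
  define \<sigma> where "\<sigma> = min \<tau> (1 / 2)"
  have \<sigma>: "0 < \<sigma>" "\<sigma> < 1" "real k powr \<sigma> - 1 \<le> 1 / (2 * (real k)\<^sup>2)" using \<tau> by (auto simp: \<sigma>_def)
  \<comment> \<open>Above \<open>M\<close> a minimal tight lattice exists by
    \<open>exists_minimal_tight\<close>; the choice of \<open>D\<close> makes the bound trivial
    below \<open>M\<close>.\<close>
  define M where "M = real k powr (4 ^ CARD('n)) + 1"
  define D where "D = real k * M powr \<sigma> + 1"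
  have M: "1 \<le> M" by (simp add: M_def)
  have D: "0 < D" using k by (simp add: D_def add_nonneg_pos)
  have "real k * real (card A) - D * real (card A) powr (1 - \<sigma>) \<le> real (card (lsum ((*v) L1) ((*v) L2) A A))"
    if irr: "irreducible_pair L1 L2" and cop: "coprime_pair L1 L2" and det: "\<bar>det L1\<bar> = a" and fA: "finite A"
    for L1 L2 :: "int^'n^'n" and A
    using fA
  proof (induction "card A" arbitrary: A rule: less_induct)
    case (less A)
    let ?f = "(*v) L1" and ?g = "(*v) L2"
    note fA = \<open>finite A\<close>
    have det0: "det L1 \<noteq> 0" using det a by auto
    define n where "n = real (card A)"
    show ?case
    proof (rule ccontr)
      assume nF: "\<not> ?thesis"
      then have ne: "A \<noteq> {}" by auto
      have n1: "1 \<le> n" using ne fA by (simp add: n_def Suc_le_eq card_gt_0_iff)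
      have e: "n powr (1 - \<sigma>) = n powr (- \<sigma>) * n" using n1 powr_add[of n "- \<sigma>" 1] by simp
      have lt: "real (card (lsum ?f ?g A A)) < real k * n - D * n powr (1 - \<sigma>)" using nF by (simp add: n_def)
      have L0: "0 \<le> D * n powr (1 - \<sigma>)" using D by simp
      have small: "D * n powr (1 - \<sigma>) \<le> real k * n" using lt by linarith
      then have "(D * n powr (- \<sigma>)) * n \<le> real k * n" by (simp add: e mult.assoc)
      then have "D * n powr (- \<sigma>) \<le> (real k - 1) + 1" using n1 by (simp add: mult_le_cancel_right)
      then have "M \<le> n" by (intro large_of_small_power[of M \<sigma> "real k - 1" n D]) (use M \<sigma> k n1 in \<open>auto simp: D_def\<close>)
      then have big: "real k powr (4 ^ CARD('n)) < card A" by (simp add: M_def n_def)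
      have "real (card (lin_sumset L1 L2 A)) \<le> real k * card A" using lt L0 by (simp add: lin_sumset_lsum n_def)
      then obtain G where G: "tight ?f ?g G" "in_coset G A" "\<And>M. tight ?f ?g M \<Longrightarrow> M \<subseteq> G \<Longrightarrow> in_coset M A \<Longrightarrow> M = G"
        using exists_minimal_tight[OF irr cop det0 fA ne, of "real k"] big k by auto
      have gen: "gen ?f ?g G A" unfolding gen_def
      proof (intro allI impI)
        fix M assume M: "subgrp M \<and> pre ?g ?f G \<subseteq> M \<and> M \<subseteq> G \<and> in_coset M A"
        then have "tight ?f ?g M" by (intro tight_between[OF cop det0 refl refl G(1)]) auto
        then show "M = G" using G(3) M by blast
      qed
      have T: "tight ?f ?g (pre ?g ?f G)" by (rule tight_pre[OF cop det0 refl refl G(1)])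
      have c1: "finite (parts (pre ?g ?f G) G)" "card (parts (pre ?g ?f G) G) = k"
        using card_parts_pre[OF cop det0 refl refl G(1)] det by (auto simp: k_def)
      have c2: "card (parts (pre ?g ?f (pre ?g ?f G)) (pre ?g ?f G)) = k"
        using card_parts_pre[OF cop det0 refl refl T] det by (auto simp: k_def)
      have sG: "subgrp G" using G(1) by (simp add: tight_def)
      have "real k * real (card A) - D * real (card A) powr (1 - \<sigma>) \<le> real (card (lsum ?f ?g A A))"
        by (rule singular_step[OF mv_diff mv_diff inj_int_mult_of_det[OF det0] sG G(2) fA ne gen k(1) c1 c2 \<sigma> less_imp_le[OF D]])
          (use small less.hyps psubset_card_mono[OF fA] fA finite_subset in \<open>auto simp: n_def\<close>)
      then show False using nF by simp
    qed
  qed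
  then show ?thesis using D \<sigma>(1) unfolding k(2) lin_sumset_lsum by blast
qed

section \<open>Case distinction on the signs of the two determinants\<close>

lemma powr_root_power: "0 < x \<Longrightarrow> 0 < d \<Longrightarrow> (x powr (1 / real d)) ^ d = x"
  by (subst powr_realpow[symmetric]) (auto simp: powr_powr)

lemma lin_sumset_commute: "lin_sumset L1 L2 A = lin_sumset L2 L1 A"
  unfolding lin_sumset_lsum by (rule lsum_swap)

theorem theorem1p3:
  fixes a b :: int
  shows "\<exists>D \<sigma> :: real. D > 0 \<and> \<sigma> > 0 \<and>
    (\<forall>(L1 :: int^'n::finite^'n) (L2 :: int^'n^'n).
       irreducible_pair L1 L2 \<longrightarrow> coprime_pair L1 L2 \<longrightarrow>
       \<bar>det L1\<bar> = a \<longrightarrow> \<bar>det L2\<bar> = b \<longrightarrow>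
       (\<forall>A :: (int^'n) set. finite A \<longrightarrow>
          real (card (lin_sumset L1 L2 A)) \<ge>
            (real_of_int \<bar>det L1\<bar> powr (1 / real CARD('n))
              + real_of_int \<bar>det L2\<bar> powr (1 / real CARD('n))) ^ CARD('n) * real (card A)
            - D * real (card A) powr (1 - \<sigma>)))"
proof -
  let ?P = "\<lambda>(D::real) (\<sigma>::real) (L1 :: int^'n^'n) (L2 :: int^'n^'n) A.
    (real_of_int \<bar>det L1\<bar> powr (1 / real CARD('n)) + real_of_int \<bar>det L2\<bar> powr (1 / real CARD('n))) ^ CARD('n) * real (card A)
      - D * real (card A) powr (1 - \<sigma>) \<le> real (card (lin_sumset L1 L2 A))"
  have "\<exists>D \<sigma>. D > 0 \<and> \<sigma> > 0 \<and> (\<forall>(L1 :: int^'n^'n) (L2 :: int^'n^'n) A. irreducible_pair L1 L2 \<longrightarrow> coprime_pair L1 L2 \<longrightarrow>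
    \<bar>det L1\<bar> = a \<longrightarrow> \<bar>det L2\<bar> = b \<longrightarrow> finite A \<longrightarrow> ?P D \<sigma> L1 L2 A)"
  proof -
    \<comment> \<open>\<open>a\<close> and \<open>b\<close> are arbitrary integers, and negative
      values leave nothing to prove. A zero determinant has root 0, so the leading constant is the
      other determinant, or 0 if both vanish.\<close>
    consider (both) "0 < a" "0 < b" | (left) "0 < a" "b = 0" | (right) "a = 0" "0 < b"
      | (zero) "a = 0" "b = 0" | (negative) "a < 0 \<or> b < 0" by linarith
    then show ?thesis
    proof cases
      case both
      obtain D \<sigma> where D: "D > 0" "\<sigma> > 0" and h: "\<forall>(L1 :: int^'n^'n) (L2 :: int^'n^'n).
       irreducible_pair L1 L2 \<longrightarrow> coprime_pair L1 L2 \<longrightarrow> \<bar>det L1\<bar> = a \<longrightarrow> \<bar>det L2\<bar> = b \<longrightarrow>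
       (\<forall>A. finite A \<longrightarrow> (real_of_int a powr (1 / real CARD('n)) + real_of_int b powr (1 / real CARD('n))) ^ CARD('n) * real (card A)
            - D * real (card A) powr (1 - \<sigma>) \<le> real (card (lin_sumset L1 L2 A)))"
        using regular_case[OF both, where 'n='n] by blast
      have "?P D \<sigma> L1 L2 A" if "irreducible_pair L1 L2" "coprime_pair L1 L2" "\<bar>det L1\<bar> = a" "\<bar>det L2\<bar> = b" "finite A" for L1 L2 A
        unfolding that(3,4) using h that by blast
      then show ?thesis using D by blast
    next
      case left
      obtain D \<sigma> where D: "D > 0" "\<sigma> > 0" and h: "\<forall>(L1 :: int^'n^'n) (L2 :: int^'n^'n).
       irreducible_pair L1 L2 \<longrightarrow> coprime_pair L1 L2 \<longrightarrow> \<bar>det L1\<bar> = a \<longrightarrow>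
       (\<forall>A. finite A \<longrightarrow> real_of_int a * real (card A) - D * real (card A) powr (1 - \<sigma>) \<le> real (card (lin_sumset L1 L2 A)))"
        using one_sided_case[OF left(1), where 'n='n] by blast
      have e: "(real_of_int a powr (1 / real CARD('n)) + real_of_int b powr (1 / real CARD('n))) ^ CARD('n) = real_of_int a"
        using powr_root_power[of "real_of_int a" "CARD('n)"] left by simp
      have "?P D \<sigma> L1 L2 A" if "irreducible_pair L1 L2" "coprime_pair L1 L2" "\<bar>det L1\<bar> = a" "\<bar>det L2\<bar> = b" "finite A" for L1 L2 A
        unfolding that(3,4) e using h that by blast
      then show ?thesis using D by blast
    next
      case right
      obtain D \<sigma> where D: "D > 0" "\<sigma> > 0" and h: "\<forall>(L1 :: int^'n^'n) (L2 :: int^'n^'n).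
       irreducible_pair L1 L2 \<longrightarrow> coprime_pair L1 L2 \<longrightarrow> \<bar>det L1\<bar> = b \<longrightarrow>
       (\<forall>A. finite A \<longrightarrow> real_of_int b * real (card A) - D * real (card A) powr (1 - \<sigma>) \<le> real (card (lin_sumset L1 L2 A)))"
        using one_sided_case[OF right(2), where 'n='n] by blast
      have e: "(real_of_int a powr (1 / real CARD('n)) + real_of_int b powr (1 / real CARD('n))) ^ CARD('n) = real_of_int b"
        using powr_root_power[of "real_of_int b" "CARD('n)"] right by simp
      have "?P D \<sigma> L1 L2 A" if "irreducible_pair L1 L2" "coprime_pair L1 L2" "\<bar>det L1\<bar> = a" "\<bar>det L2\<bar> = b" "finite A" for L1 L2 A
        unfolding that(3,4) e lin_sumset_commute[of L1 L2]
        using h irreducible_pair_sym[OF that(1)] coprime_pair_sym[OF that(2)] that(4,5) by blast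
      then show ?thesis using D by blast
    next
      case zero
      have "?P 1 1 L1 L2 A" if "\<bar>det L1\<bar> = a" "\<bar>det L2\<bar> = b" for L1 L2 A
        unfolding that using zero by (simp add: power_0_left)
      then show ?thesis using zero_less_one[where 'a=real] by blast
    next
      case negative
      then have "\<bar>det L1\<bar> \<noteq> a \<or> \<bar>det L2\<bar> \<noteq> b" for L1 L2 :: "int^'n^'n" by auto
      then show ?thesis by (intro exI[of _ 1]) auto
    qed
  qed
  then show ?thesis by blast
qed

end
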